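(* Let $k$ be a commutative ring, let $\mathcal M_k^{\mathrm f}$ be the monoidal category of finitely generated projective $k$-modules, $\mathcal C(\mathcal M_k^{\mathrm f})$ the monoidal category of coalgebras in $\mathcal M_k^{\mathrm f}$ and $\mathcal A(\mathcal M_k^{\mathrm f})$ the monoidal category of algebras in $\mathcal M_k^{\mathrm f}$. There is a biequivalence $${}_{\mathcal C(\mathcal M_k^{\mathrm f})}\mathrm{Cat}\longrightarrow {}^{\mathcal A(\mathcal M_k^{\mathrm f})}\mathrm{Cat}$$ from the 2-category of $\mathcal C(\mathcal M_k^{\mathrm f})$-categories to the 2-category of dual $\mathcal A(\mathcal M_k^{\mathrm f})$-categories.
   Context: Let $(\mathcal W,\otimes,k)$ be a monoidal category, treated as strict. **The 2-category ${}_{\mathcal W}\mathrm{Cat}$.** 0-cells ($\mathcal W$-categories): a class $X$, objects $A_{x,y}\in\mathcal W$ ($x,y\in X$), and morphisms $m_{x,y,z}:A_{x,y}\otimes A_{y,z}\to A_{x,z}$, $\eta_x:k\to A_{x,x}$ in $\mathcal W$ satisfying the usual associativity and unit conditions. 1-cells $f:A\to B$: a map $f$ between underlying classes $X\to Y$ and morphisms $f_{x,y}:A_{x,y}\to B_{f(x),f(y)}$ compatible with multiplications and units. 2-cells $\alpha:f\Rightarrow g$ (for $f,g:A\to B$): morphisms $\alpha_x:k\to B_{g(x),f(x)}$ in $\mathcal W$ such that $m_{g(x),g(y),f(y)}\circ(g_{x,y}\otimes\alpha_y)=m_{g(x),f(x),f(y)}\circ(\alpha_x\otimes f_{x,y})$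 for all $x,y\in X$. Compositions: $(g\circ f)_{x,y}=g_{f(x),f(y)}\circ f_{x,y}$; for $\alpha:f\Rightarrow g$, $\beta:g\Rightarrow h$ the vertical composition is $(\beta\circ\alpha)_x=m_{h(x),g(x),f(x)}\circ(\beta_x\otimes\alpha_x)$; for $\alpha:f\Rightarrow f'$ ($f,f':A\to B$) and $\beta:g\Rightarrow g'$ ($g,g':B\to C$) the horizontal composition $\alpha*\beta:g\circ f\Rightarrow g'\circ f'$ is $(\alpha*\beta)_x=m_{g'(f'(x)),g'(f(x)),g(f(x))}\circ\big((g'_{f'(x),f(x)}\circ\alpha_x)\otimes\beta_{f(x)}\big)$. **The 2-category ${}^{\mathcal W}\mathrm{Cat}$.** 0-cells (dual $\mathcal W$-categories): a class $X$, objects $C_{x,y}\in\mathcal W$, and morphisms $\Delta_{x,y,z}:C_{x,z}\to C_{x,y}\otimes C_{y,z}$, $\varepsilon_x:C_{x,x}\to k$ in $\mathcal W$ with $(\Delta_{x,y,z}\otimes\mathrm{id})\circ\Delta_{x,z,u}=(\mathrm{id}\otimes\Delta_{y,z,u})\circ\Delta_{x,y,u}$ and $(\varepsilon_x\otimes\mathrm{id})\circ\Delta_{x,x,y}=\mathrm{id}=(\mathrm{id}\otimes\varepsilon_y)\circ\Delta_{x,y,y}$. 1-cells $f:C\to D$: a map $f:X\to Y$ of underlying classes and morphisms $f_{x,y}:D_{f(x),f(y)}\to C_{x,y}$ with $(f_{x,y}\otimes f_{y,z})\circ\Delta_{f(x),f(y),f(z)}=\Delta_{x,y,z}\circ f_{x,z}$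 and $\varepsilon_{f(x)}=\varepsilon_x\circ f_{x,x}$. 2-cells $\alpha:f\Rightarrow g$: morphisms $\alpha_x:D_{f(x),g(x)}\to k$ with $(f_{x,y}\otimes\alpha_y)\circ\Delta_{f(x),f(y),g(y)}=(\alpha_x\otimes g_{x,y})\circ\Delta_{f(x),g(x),g(y)}$. Compositions: $(g\circ f)_{x,y}=f_{x,y}\circ g_{f(x),f(y)}$; vertical $(\beta\circ\alpha)_x=(\alpha_x\otimes\beta_x)\circ\Delta_{f(x),g(x),h(x)}$; horizontal, for $\alpha:f\Rightarrow f'$ and $\beta:g\Rightarrow g'$, $(\alpha*\beta)_x=\big(\beta_{f(x)}\otimes(\alpha_x\circ g'_{f(x),f'(x)})\big)\circ\Delta_{g(f(x)),g'(f(x)),g'(f'(x))}$. Here these are taken with $\mathcal W=\mathcal C(\mathcal M_k^{\mathrm f})$ (coalgebras and coalgebra morphisms, $\otimes=\otimes_k$) and $\mathcal W=\mathcal A(\mathcal M_k^{\mathrm f})$ (algebras and algebra morphisms), respectively. In particular, all structure maps of 0-, 1- and 2-cells are coalgebra, respectively algebra, morphisms. *)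

theory Defs
  imports "HOL-Algebra.Module" "HOL-Library.Multiset" "HOL-Library.FuncSet"
begin

section \<open>Categories and symmetric monoidal categories\<close>

record ('o, 'a) cat =
  Obj :: "'o set"
  Hom :: "'o \<Rightarrow> 'o \<Rightarrow> 'a set"
  Idn :: "'o \<Rightarrow> 'a"
  Comp :: "'a \<Rightarrow> 'a \<Rightarrow> 'a"  (infixr \<open>\<cdot>\<index>\<close> 55)

locale category =
  fixes C :: "('o, 'a, 'z) cat_scheme" (structure)
  assumes Idn_Hom: "A \<in> Obj C \<Longrightarrow> Idn C A \<in> Hom C A A"
    and Comp_Hom: "\<lbrakk>A \<in> Obj C; B \<in> Obj C; D \<in> Obj C; f \<in> Hom C A B; g \<in> Hom C B D\<rbrakk>
      \<Longrightarrow> g \<cdot> f \<in> Hom C A D"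
    and Comp_assoc: "\<lbrakk>A \<in> Obj C; B \<in> Obj C; D \<in> Obj C; E \<in> Obj C;
      f \<in> Hom C A B; g \<in> Hom C B D; h \<in> Hom C D E\<rbrakk> \<Longrightarrow> (h \<cdot> g) \<cdot> f = h \<cdot> (g \<cdot> f)"
    and Comp_Idn: "\<lbrakk>A \<in> Obj C; B \<in> Obj C; f \<in> Hom C A B\<rbrakk> \<Longrightarrow> f \<cdot> Idn C A = f"
    and Idn_Comp: "\<lbrakk>A \<in> Obj C; B \<in> Obj C; f \<in> Hom C A B\<rbrakk> \<Longrightarrow> Idn C B \<cdot> f = f"

definition iso_arrow :: "('o, 'a, 'z) cat_scheme \<Rightarrow> 'o \<Rightarrow> 'o \<Rightarrow> 'a \<Rightarrow> bool" where
  "iso_arrow C A B f \<longleftrightarrow> f \<in> Hom C A B \<and>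
     (\<exists>g \<in> Hom C B A. g \<cdot>\<^bsub>C\<^esub> f = Idn C A \<and> f \<cdot>\<^bsub>C\<^esub> g = Idn C B)"

definition cat_functor ::
  "('o, 'a, 'z) cat_scheme \<Rightarrow> ('p, 'b, 'w) cat_scheme \<Rightarrow> ('o \<Rightarrow> 'p) \<Rightarrow> ('a \<Rightarrow> 'b) \<Rightarrow> bool" where
  "cat_functor C D F0 F1 \<longleftrightarrow>
     (\<forall>A \<in> Obj C. F0 A \<in> Obj D) \<and>
     (\<forall>A \<in> Obj C. \<forall>B \<in> Obj C. \<forall>f \<in> Hom C A B. F1 f \<in> Hom D (F0 A) (F0 B)) \<and>
     (\<forall>A \<in> Obj C. F1 (Idn C A) = Idn D (F0 A)) \<and>
     (\<forall>A \<in> Obj C. \<forall>B \<in> Obj C. \<forall>E \<in> Obj C. \<forall>f \<in> Hom C A B. \<forall>g \<in> Hom C B E.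
        F1 (g \<cdot>\<^bsub>C\<^esub> f) = F1 g \<cdot>\<^bsub>D\<^esub> F1 f)"

definition natural_iso ::
  "('o, 'a, 'z) cat_scheme \<Rightarrow> ('p, 'b, 'w) cat_scheme \<Rightarrow> ('o \<Rightarrow> 'p) \<Rightarrow> ('a \<Rightarrow> 'b) \<Rightarrow>
   ('o \<Rightarrow> 'p) \<Rightarrow> ('a \<Rightarrow> 'b) \<Rightarrow> ('o \<Rightarrow> 'b) \<Rightarrow> bool" where
  "natural_iso C D F0 F1 G0 G1 \<tau> \<longleftrightarrow>
     (\<forall>A \<in> Obj C. iso_arrow D (F0 A) (G0 A) (\<tau> A)) \<and>
     (\<forall>A \<in> Obj C. \<forall>B \<in> Obj C. \<forall>f \<in> Hom C A B. G1 f \<cdot>\<^bsub>D\<^esub> \<tau> A = \<tau> B \<cdot>\<^bsub>D\<^esub> F1 f)"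

definition cat_equivalence ::
  "('o, 'a, 'z) cat_scheme \<Rightarrow> ('p, 'b, 'w) cat_scheme \<Rightarrow> ('o \<Rightarrow> 'p) \<Rightarrow> ('a \<Rightarrow> 'b) \<Rightarrow> bool" where
  "cat_equivalence C D F0 F1 \<longleftrightarrow> cat_functor C D F0 F1 \<and>
     (\<exists>G0 G1 \<sigma> \<tau>. cat_functor D C G0 G1 \<and>
        natural_iso C C (\<lambda>A. A) (\<lambda>f. f) (\<lambda>A. G0 (F0 A)) (\<lambda>f. G1 (F1 f)) \<sigma> \<and>
        natural_iso D D (\<lambda>B. F0 (G0 B)) (\<lambda>g. F1 (G1 g)) (\<lambda>B. B) (\<lambda>g. g) \<tau>)"

text \<open>
  The structural isomorphisms go
  \<open>Assoc A B C : (A \<boxtimes> B) \<boxtimes> C \<rightarrow> A \<boxtimes> (B \<boxtimes> C)\<close>, \<open>LUnit A : I \<boxtimes> A \<rightarrow> A\<close>, \<open>RUnit A : A \<boxtimes> I \<rightarrow> A\<close> and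
  \<open>Braid A B : A \<boxtimes> B \<rightarrow> B \<boxtimes> A\<close>. Formulas valid in a strict monoidal category are written below
  with these isomorphisms inserted.
\<close>

record ('o, 'a) mon_cat = "('o, 'a) cat" +
  Ten :: "'o \<Rightarrow> 'o \<Rightarrow> 'o"  (infixr \<open>\<boxtimes>\<index>\<close> 70)
  TenA :: "'a \<Rightarrow> 'a \<Rightarrow> 'a"  (infixr \<open>\<star>\<index>\<close> 70)
  Unit :: 'o
  Assoc :: "'o \<Rightarrow> 'o \<Rightarrow> 'o \<Rightarrow> 'a"
  AssocInv :: "'o \<Rightarrow> 'o \<Rightarrow> 'o \<Rightarrow> 'a"
  LUnit :: "'o \<Rightarrow> 'a"
  LUnitInv :: "'o \<Rightarrow> 'a"
  RUnit :: "'o \<Rightarrow> 'a"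
  RUnitInv :: "'o \<Rightarrow> 'a"

record ('o, 'a) sym_mon_cat = "('o, 'a) mon_cat" +
  Braid :: "'o \<Rightarrow> 'o \<Rightarrow> 'a"


section \<open>Coalgebras and algebras in a symmetric monoidal category\<close>

record ('o, 'a) coalg =
  cobj :: 'o
  comul :: 'a
  counit :: 'a

record ('o, 'a) alg =
  aobj :: 'o
  amul :: 'a
  aunit :: 'a

context
  fixes V :: "('o, 'a) sym_mon_cat" (structure)
begin

text \<open>The middle-four interchange \<open>(A \<boxtimes> B) \<boxtimes> (C \<boxtimes> D) \<rightarrow> (A \<boxtimes> C) \<boxtimes> (B \<boxtimes> D)\<close>.\<close>

definition mid4 :: "'o \<Rightarrow> 'o \<Rightarrow> 'o \<Rightarrow> 'o \<Rightarrow> 'a" where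
  "mid4 A B C D =
     AssocInv V A C (B \<boxtimes> D) \<cdot> (Idn V A \<star> Assoc V C B D)
       \<cdot> (Idn V A \<star> (Braid V B C \<star> Idn V D))
       \<cdot> (Idn V A \<star> AssocInv V B C D) \<cdot> Assoc V A B (C \<boxtimes> D)"

definition is_coalg :: "('o, 'a) coalg \<Rightarrow> bool" where
  "is_coalg C \<longleftrightarrow> (let c = cobj C; \<Delta> = comul C; \<epsilon> = counit C in
     c \<in> Obj V \<and> \<Delta> \<in> Hom V c (c \<boxtimes> c) \<and> \<epsilon> \<in> Hom V c (Unit V) \<and>
     Assoc V c c c \<cdot> (\<Delta> \<star> Idn V c) \<cdot> \<Delta> = (Idn V c \<star> \<Delta>) \<cdot> \<Delta> \<and>
     LUnit V c \<cdot> (\<epsilon> \<star> Idn V c) \<cdot> \<Delta> = Idn V c \<and>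
     RUnit V c \<cdot> (Idn V c \<star> \<epsilon>) \<cdot> \<Delta> = Idn V c)"

definition coalgebras :: "(('o, 'a) coalg, 'a) mon_cat" where
  "coalgebras = \<lparr>
     Obj = {C. is_coalg C},
     Hom = (\<lambda>C D. {f \<in> Hom V (cobj C) (cobj D).
              comul D \<cdot> f = (f \<star> f) \<cdot> comul C \<and> counit D \<cdot> f = counit C}),
     Idn = (\<lambda>C. Idn V (cobj C)),
     Comp = Comp V,
     Ten = (\<lambda>C D. \<lparr>cobj = cobj C \<boxtimes> cobj D,
              comul = mid4 (cobj C) (cobj C) (cobj D) (cobj D) \<cdot> (comul C \<star> comul D),
              counit = LUnit V (Unit V) \<cdot> (counit C \<star> counit D)\<rparr>),
     TenA = TenA V,
     Unit = \<lparr>cobj = Unit V, comul = LUnitInv V (Unit V), counit = Idn V (Unit V)\<rparr>,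
     Assoc = (\<lambda>C D E. Assoc V (cobj C) (cobj D) (cobj E)),
     AssocInv = (\<lambda>C D E. AssocInv V (cobj C) (cobj D) (cobj E)),
     LUnit = (\<lambda>C. LUnit V (cobj C)),
     LUnitInv = (\<lambda>C. LUnitInv V (cobj C)),
     RUnit = (\<lambda>C. RUnit V (cobj C)),
     RUnitInv = (\<lambda>C. RUnitInv V (cobj C))\<rparr>"

definition is_alg :: "('o, 'a) alg \<Rightarrow> bool" where
  "is_alg A \<longleftrightarrow> (let a = aobj A; \<mu> = amul A; \<eta> = aunit A in
     a \<in> Obj V \<and> \<mu> \<in> Hom V (a \<boxtimes> a) a \<and> \<eta> \<in> Hom V (Unit V) a \<and>
     \<mu> \<cdot> (\<mu> \<star> Idn V a) = \<mu> \<cdot> (Idn V a \<star> \<mu>) \<cdot> Assoc V a a a \<and>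
     \<mu> \<cdot> (\<eta> \<star> Idn V a) = LUnit V a \<and>
     \<mu> \<cdot> (Idn V a \<star> \<eta>) = RUnit V a)"

definition algebras :: "(('o, 'a) alg, 'a) mon_cat" where
  "algebras = \<lparr>
     Obj = {A. is_alg A},
     Hom = (\<lambda>A B. {f \<in> Hom V (aobj A) (aobj B).
              f \<cdot> amul A = amul B \<cdot> (f \<star> f) \<and> f \<cdot> aunit A = aunit B}),
     Idn = (\<lambda>A. Idn V (aobj A)),
     Comp = Comp V,
     Ten = (\<lambda>A B. \<lparr>aobj = aobj A \<boxtimes> aobj B,
              amul = (amul A \<star> amul B) \<cdot> mid4 (aobj A) (aobj B) (aobj A) (aobj B),
              aunit = (aunit A \<star> aunit B) \<cdot> LUnitInv V (Unit V)\<rparr>),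
     TenA = TenA V,
     Unit = \<lparr>aobj = Unit V, amul = LUnit V (Unit V), aunit = Idn V (Unit V)\<rparr>,
     Assoc = (\<lambda>A B C. Assoc V (aobj A) (aobj B) (aobj C)),
     AssocInv = (\<lambda>A B C. AssocInv V (aobj A) (aobj B) (aobj C)),
     LUnit = (\<lambda>A. LUnit V (aobj A)),
     LUnitInv = (\<lambda>A. LUnitInv V (aobj A)),
     RUnit = (\<lambda>A. RUnit V (aobj A)),
     RUnitInv = (\<lambda>A. RUnitInv V (aobj A))\<rparr>"

end


section \<open>2-categories, pseudofunctors, biequivalences\<close>

text \<open>
  1-cells and 2-cells are supposed to determine their source and target, so that the compositions
  need no further arguments. \<open>Comp1 B g f\<close> is \<open>g \<circ> f\<close> and \<open>VComp B \<beta> \<alpha>\<close> is \<open>\<beta> \<circ> \<alpha>\<close>, but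
  horizontal composition is in diagrammatic order:
  \<open>HComp B \<alpha> \<beta> : g \<circ> f \<Rightarrow> g' \<circ> f'\<close> for \<open>\<alpha> : f \<Rightarrow> f'\<close> and \<open>\<beta> : g \<Rightarrow> g'\<close>.
\<close>

record ('o, 'm, 't) two_cat =
  Cell0 :: "'o set"
  Cell1 :: "'o \<Rightarrow> 'o \<Rightarrow> 'm set"
  Cell2 :: "'m \<Rightarrow> 'm \<Rightarrow> 't set"
  Id1 :: "'o \<Rightarrow> 'm"
  Comp1 :: "'m \<Rightarrow> 'm \<Rightarrow> 'm"
  Id2 :: "'m \<Rightarrow> 't"
  VComp :: "'t \<Rightarrow> 't \<Rightarrow> 't"
  HComp :: "'t \<Rightarrow> 't \<Rightarrow> 't"

definition HomCat :: "('o, 'm, 't) two_cat \<Rightarrow> 'o \<Rightarrow> 'o \<Rightarrow> ('m, 't) cat" where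
  "HomCat B X Y = \<lparr>Obj = Cell1 B X Y, Hom = Cell2 B, Idn = Id2 B, Comp = VComp B\<rparr>"

locale two_category =
  fixes B :: "('o, 'm, 't) two_cat"
  assumes HomCat_category: "\<lbrakk>X \<in> Cell0 B; Y \<in> Cell0 B\<rbrakk> \<Longrightarrow> category (HomCat B X Y)"
    and Id1_cell: "X \<in> Cell0 B \<Longrightarrow> Id1 B X \<in> Cell1 B X X"
    and Comp1_cell: "\<lbrakk>X \<in> Cell0 B; Y \<in> Cell0 B; Z \<in> Cell0 B; f \<in> Cell1 B X Y; g \<in> Cell1 B Y Z\<rbrakk>
      \<Longrightarrow> Comp1 B g f \<in> Cell1 B X Z"
    and Comp1_assoc: "\<lbrakk>X \<in> Cell0 B; Y \<in> Cell0 B; Z \<in> Cell0 B; U \<in> Cell0 B;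
      f \<in> Cell1 B X Y; g \<in> Cell1 B Y Z; h \<in> Cell1 B Z U\<rbrakk>
      \<Longrightarrow> Comp1 B (Comp1 B h g) f = Comp1 B h (Comp1 B g f)"
    and Comp1_Id1: "\<lbrakk>X \<in> Cell0 B; Y \<in> Cell0 B; f \<in> Cell1 B X Y\<rbrakk> \<Longrightarrow> Comp1 B f (Id1 B X) = f"
    and Id1_Comp1: "\<lbrakk>X \<in> Cell0 B; Y \<in> Cell0 B; f \<in> Cell1 B X Y\<rbrakk> \<Longrightarrow> Comp1 B (Id1 B Y) f = f"
    and HComp_cell: "\<lbrakk>X \<in> Cell0 B; Y \<in> Cell0 B; Z \<in> Cell0 B;
      f \<in> Cell1 B X Y; f' \<in> Cell1 B X Y; g \<in> Cell1 B Y Z; g' \<in> Cell1 B Y Z;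
      \<alpha> \<in> Cell2 B f f'; \<beta> \<in> Cell2 B g g'\<rbrakk>
      \<Longrightarrow> HComp B \<alpha> \<beta> \<in> Cell2 B (Comp1 B g f) (Comp1 B g' f')"
    and HComp_assoc: "\<lbrakk>X \<in> Cell0 B; Y \<in> Cell0 B; Z \<in> Cell0 B; U \<in> Cell0 B;
      f \<in> Cell1 B X Y; f' \<in> Cell1 B X Y; g \<in> Cell1 B Y Z; g' \<in> Cell1 B Y Z;
      h \<in> Cell1 B Z U; h' \<in> Cell1 B Z U;
      \<alpha> \<in> Cell2 B f f'; \<beta> \<in> Cell2 B g g'; \<gamma> \<in> Cell2 B h h'\<rbrakk>
      \<Longrightarrow> HComp B (HComp B \<alpha> \<beta>) \<gamma> = HComp B \<alpha> (HComp B \<beta> \<gamma>)"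
    and HComp_Id1_left: "\<lbrakk>X \<in> Cell0 B; Y \<in> Cell0 B; f \<in> Cell1 B X Y; f' \<in> Cell1 B X Y;
      \<alpha> \<in> Cell2 B f f'\<rbrakk> \<Longrightarrow> HComp B (Id2 B (Id1 B X)) \<alpha> = \<alpha>"
    and HComp_Id1_right: "\<lbrakk>X \<in> Cell0 B; Y \<in> Cell0 B; f \<in> Cell1 B X Y; f' \<in> Cell1 B X Y;
      \<alpha> \<in> Cell2 B f f'\<rbrakk> \<Longrightarrow> HComp B \<alpha> (Id2 B (Id1 B Y)) = \<alpha>"
    and HComp_Id2: "\<lbrakk>X \<in> Cell0 B; Y \<in> Cell0 B; Z \<in> Cell0 B; f \<in> Cell1 B X Y; g \<in> Cell1 B Y Z\<rbrakk>
      \<Longrightarrow> HComp B (Id2 B f) (Id2 B g) = Id2 B (Comp1 B g f)"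
    and interchange: "\<lbrakk>X \<in> Cell0 B; Y \<in> Cell0 B; Z \<in> Cell0 B;
      f \<in> Cell1 B X Y; f' \<in> Cell1 B X Y; f'' \<in> Cell1 B X Y;
      g \<in> Cell1 B Y Z; g' \<in> Cell1 B Y Z; g'' \<in> Cell1 B Y Z;
      \<alpha> \<in> Cell2 B f f'; \<alpha>' \<in> Cell2 B f' f''; \<beta> \<in> Cell2 B g g'; \<beta>' \<in> Cell2 B g' g''\<rbrakk>
      \<Longrightarrow> HComp B (VComp B \<alpha>' \<alpha>) (VComp B \<beta>' \<beta>) = VComp B (HComp B \<alpha>' \<beta>') (HComp B \<alpha> \<beta>)"

definition equivalent_0cells :: "('o, 'm, 't) two_cat \<Rightarrow> 'o \<Rightarrow> 'o \<Rightarrow> bool" where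
  "equivalent_0cells B X Y \<longleftrightarrow>
     (\<exists>f \<in> Cell1 B X Y. \<exists>g \<in> Cell1 B Y X. \<exists>\<sigma> \<tau>.
        iso_arrow (HomCat B X X) (Id1 B X) (Comp1 B g f) \<sigma> \<and>
        iso_arrow (HomCat B Y Y) (Comp1 B f g) (Id1 B Y) \<tau>)"

text \<open>
  \<open>PUnit F X : Id1 (F X) \<Rightarrow> F (Id1 X)\<close> and \<open>PComp F g f : F g \<circ> F f \<Rightarrow> F (g \<circ> f)\<close> are the
  coherence 2-cells of a pseudofunctor.
\<close>

record ('o, 'm, 't, 'p, 'n, 's) pseudofun =
  PF0 :: "'o \<Rightarrow> 'p"
  PF1 :: "'m \<Rightarrow> 'n"
  PF2 :: "'t \<Rightarrow> 's"
  PUnit :: "'o \<Rightarrow> 's"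
  PComp :: "'m \<Rightarrow> 'm \<Rightarrow> 's"

locale pseudofunctor = S: two_category B + T: two_category D
  for B :: "('o, 'm, 't) two_cat" and D :: "('p, 'n, 's) two_cat" +
  fixes F :: "('o, 'm, 't, 'p, 'n, 's) pseudofun"
  assumes PF0_cell: "X \<in> Cell0 B \<Longrightarrow> PF0 F X \<in> Cell0 D"
    and PF_functor: "\<lbrakk>X \<in> Cell0 B; Y \<in> Cell0 B\<rbrakk>
      \<Longrightarrow> cat_functor (HomCat B X Y) (HomCat D (PF0 F X) (PF0 F Y)) (PF1 F) (PF2 F)"
    and PUnit_iso: "X \<in> Cell0 B
      \<Longrightarrow> iso_arrow (HomCat D (PF0 F X) (PF0 F X)) (Id1 D (PF0 F X)) (PF1 F (Id1 B X)) (PUnit F X)"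
    and PComp_iso: "\<lbrakk>X \<in> Cell0 B; Y \<in> Cell0 B; Z \<in> Cell0 B; f \<in> Cell1 B X Y; g \<in> Cell1 B Y Z\<rbrakk>
      \<Longrightarrow> iso_arrow (HomCat D (PF0 F X) (PF0 F Z))
            (Comp1 D (PF1 F g) (PF1 F f)) (PF1 F (Comp1 B g f)) (PComp F g f)"
    and PComp_natural: "\<lbrakk>X \<in> Cell0 B; Y \<in> Cell0 B; Z \<in> Cell0 B;
      f \<in> Cell1 B X Y; f' \<in> Cell1 B X Y; g \<in> Cell1 B Y Z; g' \<in> Cell1 B Y Z;
      \<alpha> \<in> Cell2 B f f'; \<beta> \<in> Cell2 B g g'\<rbrakk>
      \<Longrightarrow> VComp D (PF2 F (HComp B \<alpha> \<beta>)) (PComp F g f)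
        = VComp D (PComp F g' f') (HComp D (PF2 F \<alpha>) (PF2 F \<beta>))"
    and PComp_assoc: "\<lbrakk>X \<in> Cell0 B; Y \<in> Cell0 B; Z \<in> Cell0 B; U \<in> Cell0 B;
      f \<in> Cell1 B X Y; g \<in> Cell1 B Y Z; h \<in> Cell1 B Z U\<rbrakk>
      \<Longrightarrow> VComp D (PComp F (Comp1 B h g) f) (HComp D (Id2 D (PF1 F f)) (PComp F h g))
        = VComp D (PComp F h (Comp1 B g f)) (HComp D (PComp F g f) (Id2 D (PF1 F h)))"
    and PUnit_right: "\<lbrakk>X \<in> Cell0 B; Y \<in> Cell0 B; f \<in> Cell1 B X Y\<rbrakk>
      \<Longrightarrow> VComp D (PComp F f (Id1 B X)) (HComp D (PUnit F X) (Id2 D (PF1 F f)))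
        = Id2 D (PF1 F f)"
    and PUnit_left: "\<lbrakk>X \<in> Cell0 B; Y \<in> Cell0 B; f \<in> Cell1 B X Y\<rbrakk>
      \<Longrightarrow> VComp D (PComp F (Id1 B Y) f) (HComp D (Id2 D (PF1 F f)) (PUnit F Y))
        = Id2 D (PF1 F f)"

text \<open>
  A biequivalence (in the sense of Street) is a pseudofunctor which induces equivalences of
  hom-categories and hits every 0-cell up to equivalence.
\<close>

locale biequivalence = pseudofunctor +
  assumes local_equivalence: "\<lbrakk>X \<in> Cell0 B; Y \<in> Cell0 B\<rbrakk>
      \<Longrightarrow> cat_equivalence (HomCat B X Y) (HomCat D (PF0 F X) (PF0 F Y)) (PF1 F) (PF2 F)"
    and biessentially_surjective: "Z \<in> Cell0 D
      \<Longrightarrow> \<exists>X \<in> Cell0 B. equivalent_0cells D (PF0 F X) Z"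


section \<open>The 2-categories of \<open>W\<close>-categories and of dual \<open>W\<close>-categories\<close>

text \<open>
  Underlying classes are subsets of a type \<open>'x\<close>. All families are extensional functions on
  their index sets, so that equality of 1-cells and of 2-cells is equality of the families.
  The index \<open>(x, y)\<close> of \<open>whom\<close> stands for \<open>A\<^sub>x\<^sub>,\<^sub>y\<close>, and \<open>(x, y, z)\<close> for that of \<open>m\<^sub>x\<^sub>,\<^sub>y\<^sub>,\<^sub>z\<close>.
\<close>

record ('x, 'o, 'a) wcat =
  wpts :: "'x set"
  whom :: "'x \<times> 'x \<Rightarrow> 'o"
  wmul :: "'x \<times> 'x \<times> 'x \<Rightarrow> 'a"
  wunit :: "'x \<Rightarrow> 'a"

record ('x, 'o, 'a) dual_wcat =
  dpts :: "'x set"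
  dhom :: "'x \<times> 'x \<Rightarrow> 'o"
  dcomul :: "'x \<times> 'x \<times> 'x \<Rightarrow> 'a"
  dcounit :: "'x \<Rightarrow> 'a"

record ('c, 'x, 'a) one_cell =
  dom1 :: 'c
  cod1 :: 'c
  pmap :: "'x \<Rightarrow> 'x"
  amap :: "'x \<times> 'x \<Rightarrow> 'a"

record ('c, 'x, 'a) two_cell =
  dom2 :: "('c, 'x, 'a) one_cell"
  cod2 :: "('c, 'x, 'a) one_cell"
  comp2 :: "'x \<Rightarrow> 'a"

context
  fixes W :: "('o, 'a, 'z) mon_cat_scheme" (structure)
begin

definition is_wcat :: "('x, 'o, 'a) wcat \<Rightarrow> bool" where
  "is_wcat A \<longleftrightarrow> (let X = wpts A; H = whom A; m = wmul A; \<eta> = wunit A in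
     H \<in> X \<times> X \<rightarrow>\<^sub>E Obj W \<and>
     m \<in> PiE (X \<times> X \<times> X) (\<lambda>(x, y, z). Hom W (H (x, y) \<boxtimes> H (y, z)) (H (x, z))) \<and>
     \<eta> \<in> PiE X (\<lambda>x. Hom W (Unit W) (H (x, x))) \<and>
     (\<forall>x \<in> X. \<forall>y \<in> X. \<forall>z \<in> X. \<forall>u \<in> X.
        m (x, z, u) \<cdot> (m (x, y, z) \<star> Idn W (H (z, u)))
        = m (x, y, u) \<cdot> (Idn W (H (x, y)) \<star> m (y, z, u))
            \<cdot> Assoc W (H (x, y)) (H (y, z)) (H (z, u))) \<and>
     (\<forall>x \<in> X. \<forall>y \<in> X.
        m (x, x, y) \<cdot> (\<eta> x \<star> Idn W (H (x, y))) = LUnit W (H (x, y)) \<and>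
        m (x, y, y) \<cdot> (Idn W (H (x, y)) \<star> \<eta> y) = RUnit W (H (x, y))))"

definition wfunctors ::
  "('x, 'o, 'a) wcat \<Rightarrow> ('x, 'o, 'a) wcat \<Rightarrow> (('x, 'o, 'a) wcat, 'x, 'a) one_cell set" where
  "wfunctors A B = {F. dom1 F = A \<and> cod1 F = B \<and> (let X = wpts A; f = pmap F; \<phi> = amap F in
     f \<in> X \<rightarrow>\<^sub>E wpts B \<and>
     \<phi> \<in> PiE (X \<times> X) (\<lambda>(x, y). Hom W (whom A (x, y)) (whom B (f x, f y))) \<and>
     (\<forall>x \<in> X. \<forall>y \<in> X. \<forall>z \<in> X.
        wmul B (f x, f y, f z) \<cdot> (\<phi> (x, y) \<star> \<phi> (y, z)) = \<phi> (x, z) \<cdot> wmul A (x, y, z)) \<and>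
     (\<forall>x \<in> X. \<phi> (x, x) \<cdot> wunit A x = wunit B (f x)))}"

definition wtransf ::
  "(('x, 'o, 'a) wcat, 'x, 'a) one_cell \<Rightarrow> (('x, 'o, 'a) wcat, 'x, 'a) one_cell \<Rightarrow>
   (('x, 'o, 'a) wcat, 'x, 'a) two_cell set" where
  "wtransf F G = {T. dom2 T = F \<and> cod2 T = G \<and>
     (let A = dom1 F; B = cod1 F; X = wpts A; f = pmap F; g = pmap G; \<alpha> = comp2 T in
     \<alpha> \<in> PiE X (\<lambda>x. Hom W (Unit W) (whom B (g x, f x))) \<and>
     (\<forall>x \<in> X. \<forall>y \<in> X.
        wmul B (g x, g y, f y) \<cdot> (amap G (x, y) \<star> \<alpha> y) \<cdot> RUnitInv W (whom A (x, y))
        = wmul B (g x, f x, f y) \<cdot> (\<alpha> x \<star> amap F (x, y)) \<cdot> LUnitInv W (whom A (x, y))))}"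

definition wcomp :: "(('x, 'o, 'a) wcat, 'x, 'a) one_cell \<Rightarrow> (('x, 'o, 'a) wcat, 'x, 'a) one_cell \<Rightarrow>
   (('x, 'o, 'a) wcat, 'x, 'a) one_cell" where
  "wcomp G F = (let X = wpts (dom1 F); f = pmap F in
     \<lparr>dom1 = dom1 F, cod1 = cod1 G,
      pmap = compose X (pmap G) f,
      amap = restrict (\<lambda>(x, y). amap G (f x, f y) \<cdot> amap F (x, y)) (X \<times> X)\<rparr>)"

definition W_Cat :: "'x itself \<Rightarrow>
  (('x, 'o, 'a) wcat, (('x, 'o, 'a) wcat, 'x, 'a) one_cell,
   (('x, 'o, 'a) wcat, 'x, 'a) two_cell) two_cat" where
  "W_Cat _ = \<lparr>
     Cell0 = {A. is_wcat A},
     Cell1 = wfunctors,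
     Cell2 = wtransf,
     Id1 = (\<lambda>A. \<lparr>dom1 = A, cod1 = A, pmap = (\<lambda>x \<in> wpts A. x),
              amap = (\<lambda>p \<in> wpts A \<times> wpts A. Idn W (whom A p))\<rparr>),
     Comp1 = wcomp,
     Id2 = (\<lambda>F. \<lparr>dom2 = F, cod2 = F,
              comp2 = (\<lambda>x \<in> wpts (dom1 F). wunit (cod1 F) (pmap F x))\<rparr>),
     VComp = (\<lambda>\<beta> \<alpha>. let F = dom2 \<alpha>; f = pmap F; g = pmap (cod2 \<alpha>); h = pmap (cod2 \<beta>) in
              \<lparr>dom2 = F, cod2 = cod2 \<beta>,
               comp2 = (\<lambda>x \<in> wpts (dom1 F).
                 wmul (cod1 F) (h x, g x, f x) \<cdot> (comp2 \<beta> x \<star> comp2 \<alpha> x)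
                   \<cdot> LUnitInv W (Unit W))\<rparr>),
     HComp = (\<lambda>\<alpha> \<beta>. let F = dom2 \<alpha>; F' = cod2 \<alpha>; G = dom2 \<beta>; G' = cod2 \<beta>;
                 f = pmap F; f' = pmap F'; g = pmap G; g' = pmap G' in
              \<lparr>dom2 = wcomp G F, cod2 = wcomp G' F',
               comp2 = (\<lambda>x \<in> wpts (dom1 F).
                 wmul (cod1 G) (g' (f' x), g' (f x), g (f x))
                   \<cdot> ((amap G' (f' x, f x) \<cdot> comp2 \<alpha> x) \<star> comp2 \<beta> (f x))
                   \<cdot> LUnitInv W (Unit W))\<rparr>)\<rparr>"

definition is_dual_wcat :: "('x, 'o, 'a) dual_wcat \<Rightarrow> bool" where
  "is_dual_wcat C \<longleftrightarrow> (let X = dpts C; H = dhom C; \<Delta> = dcomul C; \<epsilon> = dcounit C in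
     H \<in> X \<times> X \<rightarrow>\<^sub>E Obj W \<and>
     \<Delta> \<in> PiE (X \<times> X \<times> X) (\<lambda>(x, y, z). Hom W (H (x, z)) (H (x, y) \<boxtimes> H (y, z))) \<and>
     \<epsilon> \<in> PiE X (\<lambda>x. Hom W (H (x, x)) (Unit W)) \<and>
     (\<forall>x \<in> X. \<forall>y \<in> X. \<forall>z \<in> X. \<forall>u \<in> X.
        Assoc W (H (x, y)) (H (y, z)) (H (z, u))
            \<cdot> (\<Delta> (x, y, z) \<star> Idn W (H (z, u))) \<cdot> \<Delta> (x, z, u)
        = (Idn W (H (x, y)) \<star> \<Delta> (y, z, u)) \<cdot> \<Delta> (x, y, u)) \<and>
     (\<forall>x \<in> X. \<forall>y \<in> X.
        LUnit W (H (x, y)) \<cdot> (\<epsilon> x \<star> Idn W (H (x, y))) \<cdot> \<Delta> (x, x, y) = Idn W (H (x, y)) \<and>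
        RUnit W (H (x, y)) \<cdot> (Idn W (H (x, y)) \<star> \<epsilon> y) \<cdot> \<Delta> (x, y, y) = Idn W (H (x, y))))"

definition dual_wfunctors :: "('x, 'o, 'a) dual_wcat \<Rightarrow> ('x, 'o, 'a) dual_wcat \<Rightarrow>
   (('x, 'o, 'a) dual_wcat, 'x, 'a) one_cell set" where
  "dual_wfunctors C D = {F. dom1 F = C \<and> cod1 F = D \<and>
     (let X = dpts C; f = pmap F; \<phi> = amap F in
     f \<in> X \<rightarrow>\<^sub>E dpts D \<and>
     \<phi> \<in> PiE (X \<times> X) (\<lambda>(x, y). Hom W (dhom D (f x, f y)) (dhom C (x, y))) \<and>
     (\<forall>x \<in> X. \<forall>y \<in> X. \<forall>z \<in> X.
        (\<phi> (x, y) \<star> \<phi> (y, z)) \<cdot> dcomul D (f x, f y, f z) = dcomul C (x, y, z) \<cdot> \<phi> (x, z)) \<and>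
     (\<forall>x \<in> X. dcounit D (f x) = dcounit C x \<cdot> \<phi> (x, x)))}"

definition dual_wtransf :: "(('x, 'o, 'a) dual_wcat, 'x, 'a) one_cell \<Rightarrow>
   (('x, 'o, 'a) dual_wcat, 'x, 'a) one_cell \<Rightarrow>
   (('x, 'o, 'a) dual_wcat, 'x, 'a) two_cell set" where
  "dual_wtransf F G = {T. dom2 T = F \<and> cod2 T = G \<and>
     (let C = dom1 F; D = cod1 F; X = dpts C; f = pmap F; g = pmap G; \<alpha> = comp2 T in
     \<alpha> \<in> PiE X (\<lambda>x. Hom W (dhom D (f x, g x)) (Unit W)) \<and>
     (\<forall>x \<in> X. \<forall>y \<in> X.
        RUnit W (dhom C (x, y)) \<cdot> (amap F (x, y) \<star> \<alpha> y) \<cdot> dcomul D (f x, f y, g y)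
        = LUnit W (dhom C (x, y)) \<cdot> (\<alpha> x \<star> amap G (x, y)) \<cdot> dcomul D (f x, g x, g y)))}"

definition dual_wcomp :: "(('x, 'o, 'a) dual_wcat, 'x, 'a) one_cell \<Rightarrow>
   (('x, 'o, 'a) dual_wcat, 'x, 'a) one_cell \<Rightarrow> (('x, 'o, 'a) dual_wcat, 'x, 'a) one_cell" where
  "dual_wcomp G F = (let X = dpts (dom1 F); f = pmap F in
     \<lparr>dom1 = dom1 F, cod1 = cod1 G,
      pmap = compose X (pmap G) f,
      amap = restrict (\<lambda>(x, y). amap F (x, y) \<cdot> amap G (f x, f y)) (X \<times> X)\<rparr>)"

definition Dual_W_Cat :: "'x itself \<Rightarrow>
  (('x, 'o, 'a) dual_wcat, (('x, 'o, 'a) dual_wcat, 'x, 'a) one_cell,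
   (('x, 'o, 'a) dual_wcat, 'x, 'a) two_cell) two_cat" where
  "Dual_W_Cat _ = \<lparr>
     Cell0 = {C. is_dual_wcat C},
     Cell1 = dual_wfunctors,
     Cell2 = dual_wtransf,
     Id1 = (\<lambda>C. \<lparr>dom1 = C, cod1 = C, pmap = (\<lambda>x \<in> dpts C. x),
              amap = (\<lambda>p \<in> dpts C \<times> dpts C. Idn W (dhom C p))\<rparr>),
     Comp1 = dual_wcomp,
     Id2 = (\<lambda>F. \<lparr>dom2 = F, cod2 = F,
              comp2 = (\<lambda>x \<in> dpts (dom1 F). dcounit (cod1 F) (pmap F x))\<rparr>),
     VComp = (\<lambda>\<beta> \<alpha>. let F = dom2 \<alpha>; f = pmap F; g = pmap (cod2 \<alpha>); h = pmap (cod2 \<beta>) in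
              \<lparr>dom2 = F, cod2 = cod2 \<beta>,
               comp2 = (\<lambda>x \<in> dpts (dom1 F).
                 LUnit W (Unit W) \<cdot> (comp2 \<alpha> x \<star> comp2 \<beta> x)
                   \<cdot> dcomul (cod1 F) (f x, g x, h x))\<rparr>),
     HComp = (\<lambda>\<alpha> \<beta>. let F = dom2 \<alpha>; F' = cod2 \<alpha>; G = dom2 \<beta>; G' = cod2 \<beta>;
                 f = pmap F; f' = pmap F'; g = pmap G; g' = pmap G' in
              \<lparr>dom2 = dual_wcomp G F, cod2 = dual_wcomp G' F',
               comp2 = (\<lambda>x \<in> dpts (dom1 F).
                 LUnit W (Unit W)
                   \<cdot> (comp2 \<beta> (f x) \<star> (comp2 \<alpha> x \<cdot> amap G' (f x, f' x)))
                   \<cdot> dcomul (cod1 G) (g (f x), g' (f x), g' (f' x)))\<rparr>)\<rparr>"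

end


section \<open>Finitely generated projective modules\<close>

definition mod_homs ::
  "('r, 'e) ring_scheme \<Rightarrow> ('r, 'u) module \<Rightarrow> ('r, 'u) module \<Rightarrow> ('u \<Rightarrow> 'u) set" where
  "mod_homs R M N = {h \<in> carrier M \<rightarrow>\<^sub>E carrier N.
     (\<forall>x \<in> carrier M. \<forall>y \<in> carrier M. h (x \<oplus>\<^bsub>M\<^esub> y) = h x \<oplus>\<^bsub>N\<^esub> h y) \<and>
     (\<forall>r \<in> carrier R. \<forall>x \<in> carrier M. h (r \<odot>\<^bsub>M\<^esub> x) = r \<odot>\<^bsub>N\<^esub> h x)}"

definition finitely_generated :: "('r, 'e) ring_scheme \<Rightarrow> ('r, 'u) module \<Rightarrow> bool" where
  "finitely_generated R M \<longleftrightarrow> (\<exists>S. finite S \<and> S \<subseteq> carrier M \<and>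
     (\<forall>x \<in> carrier M. \<exists>a \<in> S \<rightarrow> carrier R. x = (\<Oplus>\<^bsub>M\<^esub>s \<in> S. a s \<odot>\<^bsub>M\<^esub> s)))"

text \<open>
  The lifting property is tested against the modules with carrier in the type \<open>'u\<close>. In the
  universes used below, this type contains a copy of every finitely generated free module.
\<close>

definition projective :: "('r, 'e) ring_scheme \<Rightarrow> ('r, 'u) module \<Rightarrow> bool" where
  "projective R M \<longleftrightarrow> (\<forall>(N :: ('r, 'u) module) (L :: ('r, 'u) module) p f.
     module R N \<longrightarrow> module R L \<longrightarrow> p \<in> mod_homs R N L \<longrightarrow> p ` carrier N = carrier L \<longrightarrow>
     f \<in> mod_homs R M L \<longrightarrow> (\<exists>h \<in> mod_homs R M N. \<forall>x \<in> carrier M. p (h x) = f x))"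

record ('r, 'u) mod_arrow =
  mdom :: "('r, 'u) module"
  mcod :: "('r, 'u) module"
  mfun :: "'u \<Rightarrow> 'u"

text \<open>
  The tensor product is presented by generators and relations: the finite formal sums
  \<open>m\<^sub>1 \<otimes> n\<^sub>1 + \<dots> + m\<^sub>k \<otimes> n\<^sub>k\<close>, as multisets of pairs, modulo the congruence generated by
  bilinearity. The relation \<open>m \<otimes> 0 = 0\<close> follows from the ones given.
\<close>

inductive tensor_step :: "('r, 'e) ring_scheme \<Rightarrow> ('r, 'u) module \<Rightarrow> ('r, 'u) module \<Rightarrow>
    ('u \<times> 'u) multiset \<Rightarrow> ('u \<times> 'u) multiset \<Rightarrow> bool"
  for R M N where
    add_left: "\<lbrakk>m \<in> carrier M; m' \<in> carrier M; n \<in> carrier N\<rbrakk> \<Longrightarrow>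
      tensor_step R M N (add_mset (m \<oplus>\<^bsub>M\<^esub> m', n) s) (add_mset (m, n) (add_mset (m', n) s))"
  | add_right: "\<lbrakk>m \<in> carrier M; n \<in> carrier N; n' \<in> carrier N\<rbrakk> \<Longrightarrow>
      tensor_step R M N (add_mset (m, n \<oplus>\<^bsub>N\<^esub> n') s) (add_mset (m, n) (add_mset (m, n') s))"
  | balanced: "\<lbrakk>r \<in> carrier R; m \<in> carrier M; n \<in> carrier N\<rbrakk> \<Longrightarrow>
      tensor_step R M N (add_mset (r \<odot>\<^bsub>M\<^esub> m, n) s) (add_mset (m, r \<odot>\<^bsub>N\<^esub> n) s)"
  | zero_left: "n \<in> carrier N \<Longrightarrow> tensor_step R M N (add_mset (\<zero>\<^bsub>M\<^esub>, n) s) s"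

text \<open>
  A universe for modules is a type \<open>'u\<close> with injections \<open>sc\<close> of the scalars and \<open>fs\<close> of the
  finite formal sums of pairs of its elements. They serve to realise \<open>k\<close> and tensor products as
  modules with carrier in \<open>'u\<close>: a congruence class of formal sums is represented by the code of
  a chosen member of it.
\<close>

context
  fixes R :: "('r, 'e) ring_scheme"
    and sc :: "'r \<Rightarrow> 'u"
    and fs :: "('u \<times> 'u) multiset \<Rightarrow> 'u"
begin

definition scalar_module :: "('r, 'u) module" where
  "scalar_module = \<lparr>carrier = sc ` carrier R, monoid.mult = undefined, one = undefined,
     zero = sc \<zero>\<^bsub>R\<^esub>, add = (\<lambda>u v. sc (inv_into UNIV sc u \<oplus>\<^bsub>R\<^esub> inv_into UNIV sc v)),
     smult = (\<lambda>r u. sc (r \<otimes>\<^bsub>R\<^esub> inv_into UNIV sc u))\<rparr>"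

definition tensor_class ::
  "('r, 'u) module \<Rightarrow> ('r, 'u) module \<Rightarrow> ('u \<times> 'u) multiset \<Rightarrow> 'u" where
  "tensor_class M N s = fs (SOME t. equivclp (tensor_step R M N) s t)"

definition pure_tensor :: "('r, 'u) module \<Rightarrow> ('r, 'u) module \<Rightarrow> 'u \<Rightarrow> 'u \<Rightarrow> 'u" where
  "pure_tensor M N m n = tensor_class M N {#(m, n)#}"

definition tensor_module :: "('r, 'u) module \<Rightarrow> ('r, 'u) module \<Rightarrow> ('r, 'u) module" where
  "tensor_module M N = \<lparr>
     carrier = tensor_class M N ` {s. set_mset s \<subseteq> carrier M \<times> carrier N},
     monoid.mult = undefined, one = undefined,
     zero = tensor_class M N {#},
     add = (\<lambda>u v. tensor_class M N (inv_into UNIV fs u + inv_into UNIV fs v)),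
     smult = (\<lambda>r u. tensor_class M N (image_mset (\<lambda>(m, n). (r \<odot>\<^bsub>M\<^esub> m, n)) (inv_into UNIV fs u)))\<rparr>"

text \<open>
  The symmetric monoidal category of finitely generated projective modules. Tensor products of
  arrows and the structural isomorphisms are the linear maps with the given values on pure tensors.
  (The fields \<open>mult\<close> and \<open>one\<close>, which HOL-Algebra's module records inherit from ring records,
  carry no meaning for modules.)
\<close>

definition fgp_modules :: "(('r, 'u) module, ('r, 'u) mod_arrow) sym_mon_cat" where
  "fgp_modules = (let T = tensor_module; t = pure_tensor; K = scalar_module in \<lparr>
     Obj = {M. module R M \<and> finitely_generated R M \<and> projective R M},
     Hom = (\<lambda>M N. {f. mdom f = M \<and> mcod f = N \<and> mfun f \<in> mod_homs R M N}),
     Idn = (\<lambda>M. \<lparr>mdom = M, mcod = M, mfun = (\<lambda>x \<in> carrier M. x)\<rparr>),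
     Comp = (\<lambda>g f. \<lparr>mdom = mdom f, mcod = mcod g,
              mfun = compose (carrier (mdom f)) (mfun g) (mfun f)\<rparr>),
     Ten = T,
     TenA = (\<lambda>f g. let M = mdom f; M' = mcod f; N = mdom g; N' = mcod g in
       \<lparr>mdom = T M N, mcod = T M' N',
        mfun = (THE h. h \<in> mod_homs R (T M N) (T M' N') \<and>
          (\<forall>m \<in> carrier M. \<forall>n \<in> carrier N. h (t M N m n) = t M' N' (mfun f m) (mfun g n)))\<rparr>),
     Unit = K,
     Assoc = (\<lambda>M N P. \<lparr>mdom = T (T M N) P, mcod = T M (T N P),
        mfun = (THE h. h \<in> mod_homs R (T (T M N) P) (T M (T N P)) \<and>
          (\<forall>m \<in> carrier M. \<forall>n \<in> carrier N. \<forall>p \<in> carrier P.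
             h (t (T M N) P (t M N m n) p) = t M (T N P) m (t N P n p)))\<rparr>),
     AssocInv = (\<lambda>M N P. \<lparr>mdom = T M (T N P), mcod = T (T M N) P,
        mfun = (THE h. h \<in> mod_homs R (T M (T N P)) (T (T M N) P) \<and>
          (\<forall>m \<in> carrier M. \<forall>n \<in> carrier N. \<forall>p \<in> carrier P.
             h (t M (T N P) m (t N P n p)) = t (T M N) P (t M N m n) p))\<rparr>),
     LUnit = (\<lambda>M. \<lparr>mdom = T K M, mcod = M,
        mfun = (THE h. h \<in> mod_homs R (T K M) M \<and>
          (\<forall>r \<in> carrier R. \<forall>m \<in> carrier M. h (t K M (sc r) m) = r \<odot>\<^bsub>M\<^esub> m))\<rparr>),
     LUnitInv = (\<lambda>M. \<lparr>mdom = M, mcod = T K M,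
        mfun = (\<lambda>m \<in> carrier M. t K M (sc \<one>\<^bsub>R\<^esub>) m)\<rparr>),
     RUnit = (\<lambda>M. \<lparr>mdom = T M K, mcod = M,
        mfun = (THE h. h \<in> mod_homs R (T M K) M \<and>
          (\<forall>r \<in> carrier R. \<forall>m \<in> carrier M. h (t M K m (sc r)) = r \<odot>\<^bsub>M\<^esub> m))\<rparr>),
     RUnitInv = (\<lambda>M. \<lparr>mdom = M, mcod = T M K,
        mfun = (\<lambda>m \<in> carrier M. t M K m (sc \<one>\<^bsub>R\<^esub>))\<rparr>),
     Braid = (\<lambda>M N. \<lparr>mdom = T M N, mcod = T N M,
        mfun = (THE h. h \<in> mod_homs R (T M N) (T N M) \<and>
          (\<forall>m \<in> carrier M. \<forall>n \<in> carrier N. h (t M N m n) = t N M n m))\<rparr>)\<rparr>)"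

end

end

theory Submission imports Defs begin

text \<open>
  Let \<open>V\<close> be the category of finitely generated projective modules and \<open>oprev V\<close> the same category
  with arrows and tensor products reversed. A module \<open>M\<close> has a finite dual basis, so \<open>M \<mapsto> M\<^sup>*\<close>
  is an equivalence from \<open>V\<close> to \<open>oprev V\<close>, and it is strong symmetric monoidal by the isomorphisms
  \<open>N\<^sup>* \<otimes> M\<^sup>* \<rightarrow> (M \<otimes> N)\<^sup>*\<close>. Hence it induces an equivalence from the coalgebras in \<open>V\<close> to those in
  \<open>oprev V\<close>. Applied to the hom-objects of enriched categories, this is a strict 2-functor which is
  bijective on 1-cells and on 2-cells; it is essentially surjective since category structures can
  be transported along isomorphisms of the hom-coalgebras.

  Coalgebras in \<open>oprev V\<close> are algebras in \<open>V\<close>, and a category enriched in them is a dual category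
  after exchanging \<open>A\<^sub>x\<^sub>,\<^sub>y\<close> and \<open>A\<^sub>y\<^sub>,\<^sub>x\<close>, which compensates for the reversal of the tensor product.
  This gives an isomorphism onto the 2-category of dual categories, and the composite 2-functor
  is the biequivalence.
\<close>

section \<open>Strict 2-functors that are local isomorphisms\<close>

text \<open>The exchange of indices is forced by the 2-cells. A 2-cell
  \<open>f \<Rightarrow> g\<close> has components from the unit into the hom at
  \<open>(g x, f x)\<close>, a dual one has components from the hom at \<open>(f x, g x)\<close>
  into the unit; dualising without the exchange would reverse the 2-cells. With it, the factors of a
  multiplication come out in opposite order, which is the order in
  \<open>dual N \<otimes> dual M \<rightarrow> dual (M \<otimes> N)\<close>; so the braiding is used
  only inside the middle-four interchange. Two obstacles shape the rest. The monoidal category is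
  not strict. General coherence is avoided: only a few equations are recorded, chosen so that one
  development of enriched categories serves both \<open>V\<close> and \<open>oprev V\<close>, and a
  tensor product of coalgebras is treated as typed data. Secondly, all modules have their carriers
  in the type \<open>'u\<close>. Free modules and duals must be coded there by formal sums, so a
  given module is in general only isomorphic to a dual, and 0-cells are reached up to equivalence.
  The axioms of the dual 2-category are not checked directly but carried over along a bijection of
  cells.\<close>

text \<open>
  The target is not assumed to be a 2-category, so that 2-category structures can be transported.
\<close>

locale local_iso =
  fixes B :: "('o, 'm, 't) two_cat" and D :: "('p, 'n, 's) two_cat"
    and P0 :: "'o \<Rightarrow> 'p" and P1 :: "'m \<Rightarrow> 'n" and P2 :: "'t \<Rightarrow> 's"
  assumes cell0: "X \<in> Cell0 B \<Longrightarrow> P0 X \<in> Cell0 D"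
    and bij1: "\<lbrakk>X \<in> Cell0 B; Y \<in> Cell0 B\<rbrakk> \<Longrightarrow> bij_betw P1 (Cell1 B X Y) (Cell1 D (P0 X) (P0 Y))"
    and image2: "\<lbrakk>X \<in> Cell0 B; Y \<in> Cell0 B; f \<in> Cell1 B X Y; g \<in> Cell1 B X Y\<rbrakk> \<Longrightarrow>
      P2 ` Cell2 B f g = Cell2 D (P1 f) (P1 g)"
    and inj2: "\<lbrakk>X \<in> Cell0 B; Y \<in> Cell0 B\<rbrakk> \<Longrightarrow>
      inj_on P2 (\<Union>f \<in> Cell1 B X Y. \<Union>g \<in> Cell1 B X Y. Cell2 B f g)"
    and Id1: "X \<in> Cell0 B \<Longrightarrow> P1 (Id1 B X) = Id1 D (P0 X)"
    and Comp1: "\<lbrakk>X \<in> Cell0 B; Y \<in> Cell0 B; Z \<in> Cell0 B; f \<in> Cell1 B X Y; g \<in> Cell1 B Y Z\<rbrakk> \<Longrightarrow>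
      P1 (Comp1 B g f) = Comp1 D (P1 g) (P1 f)"
    and Id2: "\<lbrakk>X \<in> Cell0 B; Y \<in> Cell0 B; f \<in> Cell1 B X Y\<rbrakk> \<Longrightarrow> P2 (Id2 B f) = Id2 D (P1 f)"
    and VComp: "\<lbrakk>X \<in> Cell0 B; Y \<in> Cell0 B; f \<in> Cell1 B X Y; g \<in> Cell1 B X Y; h \<in> Cell1 B X Y;
      \<alpha> \<in> Cell2 B f g; \<beta> \<in> Cell2 B g h\<rbrakk> \<Longrightarrow> P2 (VComp B \<beta> \<alpha>) = VComp D (P2 \<beta>) (P2 \<alpha>)"
    and HComp: "\<lbrakk>X \<in> Cell0 B; Y \<in> Cell0 B; Z \<in> Cell0 B;
      f \<in> Cell1 B X Y; f' \<in> Cell1 B X Y; g \<in> Cell1 B Y Z; g' \<in> Cell1 B Y Z;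
      \<alpha> \<in> Cell2 B f f'; \<beta> \<in> Cell2 B g g'\<rbrakk> \<Longrightarrow> P2 (HComp B \<alpha> \<beta>) = HComp D (P2 \<alpha>) (P2 \<beta>)"
begin

lemma cell1: "\<lbrakk>X \<in> Cell0 B; Y \<in> Cell0 B; f \<in> Cell1 B X Y\<rbrakk> \<Longrightarrow> P1 f \<in> Cell1 D (P0 X) (P0 Y)"
  by (rule bij_betw_apply[OF bij1])

lemma cell2: "\<lbrakk>X \<in> Cell0 B; Y \<in> Cell0 B; f \<in> Cell1 B X Y; g \<in> Cell1 B X Y; \<alpha> \<in> Cell2 B f g\<rbrakk> \<Longrightarrow>
    P2 \<alpha> \<in> Cell2 D (P1 f) (P1 g)"
  by (subst image2[of X Y f g, symmetric]) simp_all

lemma lift1: "\<lbrakk>X \<in> Cell0 B; Y \<in> Cell0 B; h \<in> Cell1 D (P0 X) (P0 Y)\<rbrakk> \<Longrightarrow> \<exists>f \<in> Cell1 B X Y. h = P1 f"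
  using bij_betw_imp_surj_on[OF bij1[of X Y]] by blast

lemma lift2: "\<lbrakk>X \<in> Cell0 B; Y \<in> Cell0 B; f \<in> Cell1 B X Y; g \<in> Cell1 B X Y;
    \<gamma> \<in> Cell2 D (P1 f) (P1 g)\<rbrakk> \<Longrightarrow> \<exists>\<alpha> \<in> Cell2 B f g. \<gamma> = P2 \<alpha>"
  using image2[of X Y f g] by blast

text \<open>Cited by position below: 1 to 8 are the locale assumptions other than
  \<open>inj2\<close>, in their order; 9 and 10 push 1-cells and 2-cells forward, 11 and 12 lift
  them back, and 13 is injectivity on 2-cells.\<close>

lemmas cells = cell0 bij1 image2 Id1 Comp1 Id2 VComp HComp cell1 cell2 lift1 lift2 inj2

end

section \<open>Vertical composition, read off from the hom-categories\<close>

context two_category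
begin

lemma Id2_cell: "\<lbrakk>X \<in> Cell0 B; Y \<in> Cell0 B; f \<in> Cell1 B X Y\<rbrakk> \<Longrightarrow> Id2 B f \<in> Cell2 B f f"
  using category.Idn_Hom[OF HomCat_category, of X Y f] by (simp add: HomCat_def)

lemma VComp_cell: "\<lbrakk>X \<in> Cell0 B; Y \<in> Cell0 B; f \<in> Cell1 B X Y; g \<in> Cell1 B X Y; h \<in> Cell1 B X Y;
    \<alpha> \<in> Cell2 B f g; \<beta> \<in> Cell2 B g h\<rbrakk> \<Longrightarrow> VComp B \<beta> \<alpha> \<in> Cell2 B f h"
  using category.Comp_Hom[OF HomCat_category, of X Y f g h \<alpha> \<beta>] by (simp add: HomCat_def)

lemma VComp_assoc: "\<lbrakk>X \<in> Cell0 B; Y \<in> Cell0 B; f \<in> Cell1 B X Y; g \<in> Cell1 B X Y;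
    h \<in> Cell1 B X Y; k \<in> Cell1 B X Y; \<alpha> \<in> Cell2 B f g; \<beta> \<in> Cell2 B g h; \<gamma> \<in> Cell2 B h k\<rbrakk> \<Longrightarrow>
    VComp B (VComp B \<gamma> \<beta>) \<alpha> = VComp B \<gamma> (VComp B \<beta> \<alpha>)"
  using category.Comp_assoc[OF HomCat_category, of X Y f g h k \<alpha> \<beta> \<gamma>] by (simp add: HomCat_def)

lemma VComp_Id2: "\<lbrakk>X \<in> Cell0 B; Y \<in> Cell0 B; f \<in> Cell1 B X Y; g \<in> Cell1 B X Y; \<alpha> \<in> Cell2 B f g\<rbrakk>
    \<Longrightarrow> VComp B \<alpha> (Id2 B f) = \<alpha>"
  using category.Comp_Idn[OF HomCat_category, of X Y f g \<alpha>] by (simp add: HomCat_def)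

lemma Id2_VComp: "\<lbrakk>X \<in> Cell0 B; Y \<in> Cell0 B; f \<in> Cell1 B X Y; g \<in> Cell1 B X Y; \<alpha> \<in> Cell2 B f g\<rbrakk>
    \<Longrightarrow> VComp B (Id2 B g) \<alpha> = \<alpha>"
  using category.Idn_Comp[OF HomCat_category, of X Y f g \<alpha>] by (simp add: HomCat_def)

lemma iso_Id2:
  assumes "X \<in> Cell0 B" "Y \<in> Cell0 B" "f \<in> Cell1 B X Y"
  shows "iso_arrow (HomCat B X Y) f f (Id2 B f)"
  using assms Id2_cell[OF assms] VComp_Id2[OF assms assms(3)]
  by (auto simp: iso_arrow_def HomCat_def)

end

text \<open>All cells of \<open>D\<close> lift to \<open>B\<close>: 0-cells by \<open>surj\<close>,
  1-cells and 2-cells because \<open>P1\<close> and \<open>P2\<close> are onto the cells between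
  images. The operations of \<open>D\<close> on such cells are images of operations of
  \<open>B\<close>, so each axiom of \<open>D\<close> is the image of the same axiom of
  \<open>B\<close>.\<close>

lemma two_category_transport:
  assumes B: "two_category B" and F: "local_iso B D P0 P1 P2" and surj: "Cell0 D \<subseteq> P0 ` Cell0 B"
  shows "two_category D"
proof -
  interpret B: two_category B by (rule B)
  note L = local_iso.cells[OF F]
  note lift0 = subsetD[OF surj]
  show ?thesis
  proof (rule two_category.intro)
    fix X' Y' assume z: "X' \<in> Cell0 D" "Y' \<in> Cell0 D"
    obtain X where [simp]: "X \<in> Cell0 B" "X' = P0 X" using lift0[of X'] z by auto
    obtain Y where [simp]: "Y \<in> Cell0 B" "Y' = P0 Y" using lift0[of Y'] z by auto
    show "category (HomCat D X' Y')"
    proof (rule category.intro, unfold HomCat_def, simp_all)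
      fix f assume a: "f \<in> Cell1 D (P0 X) (P0 Y)"
      obtain f' where [simp]: "f' \<in> Cell1 B X Y" "f = P1 f'" using L(11)[of X Y f] a by auto
      show "Id2 D f \<in> Cell2 D f f"
        using L(6)[of X Y f'] L(10)[of X Y f' f' "Id2 B f'"] B.Id2_cell[of X Y f'] by simp
    next
      fix f g h \<alpha> \<beta> assume a: "f \<in> Cell1 D (P0 X) (P0 Y)" "g \<in> Cell1 D (P0 X) (P0 Y)" "h \<in> Cell1 D (P0 X) (P0 Y)"
      obtain f' where [simp]: "f' \<in> Cell1 B X Y" "f = P1 f'" using L(11)[of X Y f] a by auto
      obtain g' where [simp]: "g' \<in> Cell1 B X Y" "g = P1 g'" using L(11)[of X Y g] a by auto
      obtain h' where [simp]: "h' \<in> Cell1 B X Y" "h = P1 h'" using L(11)[of X Y h] a by auto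
      assume b: "\<alpha> \<in> Cell2 D f g" "\<beta> \<in> Cell2 D g h"
      obtain \<alpha>' where [simp]: "\<alpha>' \<in> Cell2 B f' g'" "\<alpha> = P2 \<alpha>'" using L(12)[of X Y f' g' \<alpha>] b by auto
      obtain \<beta>' where [simp]: "\<beta>' \<in> Cell2 B g' h'" "\<beta> = P2 \<beta>'" using L(12)[of X Y g' h' \<beta>] b by auto
      show "VComp D \<beta> \<alpha> \<in> Cell2 D f h"
        using B.VComp_cell[of X Y f' g' h' \<alpha>' \<beta>'] L(7)[of X Y f' g' h' \<alpha>' \<beta>'] L(10)[of X Y f' h' "VComp B \<beta>' \<alpha>'"] by simp
    next
      fix f g h k \<alpha> \<beta> \<gamma> assume a: "f \<in> Cell1 D (P0 X) (P0 Y)" "g \<in> Cell1 D (P0 X) (P0 Y)"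
        "h \<in> Cell1 D (P0 X) (P0 Y)" "k \<in> Cell1 D (P0 X) (P0 Y)"
      obtain f' where [simp]: "f' \<in> Cell1 B X Y" "f = P1 f'" using L(11)[of X Y f] a by auto
      obtain g' where [simp]: "g' \<in> Cell1 B X Y" "g = P1 g'" using L(11)[of X Y g] a by auto
      obtain h' where [simp]: "h' \<in> Cell1 B X Y" "h = P1 h'" using L(11)[of X Y h] a by auto
      obtain k' where [simp]: "k' \<in> Cell1 B X Y" "k = P1 k'" using L(11)[of X Y k] a by auto
      assume b: "\<alpha> \<in> Cell2 D f g" "\<beta> \<in> Cell2 D g h" "\<gamma> \<in> Cell2 D h k"
      obtain \<alpha>' where [simp]: "\<alpha>' \<in> Cell2 B f' g'" "\<alpha> = P2 \<alpha>'" using L(12)[of X Y f' g' \<alpha>] b by auto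
      obtain \<beta>' where [simp]: "\<beta>' \<in> Cell2 B g' h'" "\<beta> = P2 \<beta>'" using L(12)[of X Y g' h' \<beta>] b by auto
      obtain \<gamma>' where [simp]: "\<gamma>' \<in> Cell2 B h' k'" "\<gamma> = P2 \<gamma>'" using L(12)[of X Y h' k' \<gamma>] b by auto
      have 3[simp]: "VComp B \<beta>' \<alpha>' \<in> Cell2 B f' h'" "VComp B \<gamma>' \<beta>' \<in> Cell2 B g' k'"
        using B.VComp_cell[of X Y f' g' h' \<alpha>' \<beta>'] B.VComp_cell[of X Y g' h' k' \<beta>' \<gamma>'] by simp_all
      show "VComp D (VComp D \<gamma> \<beta>) \<alpha> = VComp D \<gamma> (VComp D \<beta> \<alpha>)"
        using B.VComp_assoc[of X Y f' g' h' k' \<alpha>' \<beta>' \<gamma>']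
          L(7)[of X Y f' g' h' \<alpha>' \<beta>'] L(7)[of X Y g' h' k' \<beta>' \<gamma>']
          L(7)[of X Y f' h' k' "VComp B \<beta>' \<alpha>'" \<gamma>'] L(7)[of X Y f' g' k' \<alpha>' "VComp B \<gamma>' \<beta>'"] by simp
    next
      fix f g \<alpha> assume a: "f \<in> Cell1 D (P0 X) (P0 Y)" "g \<in> Cell1 D (P0 X) (P0 Y)"
      obtain f' where [simp]: "f' \<in> Cell1 B X Y" "f = P1 f'" using L(11)[of X Y f] a by auto
      obtain g' where [simp]: "g' \<in> Cell1 B X Y" "g = P1 g'" using L(11)[of X Y g] a by auto
      assume b: "\<alpha> \<in> Cell2 D f g"
      obtain \<alpha>' where [simp]: "\<alpha>' \<in> Cell2 B f' g'" "\<alpha> = P2 \<alpha>'" using L(12)[of X Y f' g' \<alpha>] b by auto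
      show "VComp D \<alpha> (Id2 D f) = \<alpha>"
        using B.VComp_Id2[of X Y f' g' \<alpha>'] L(7)[of X Y f' f' g' "Id2 B f'" \<alpha>']
          L(6)[of X Y f'] B.Id2_cell[of X Y f'] by simp
      show "VComp D (Id2 D g) \<alpha> = \<alpha>"
        using B.Id2_VComp[of X Y f' g' \<alpha>'] L(7)[of X Y f' g' g' \<alpha>' "Id2 B g'"]
          L(6)[of X Y g'] B.Id2_cell[of X Y g'] by simp
    qed
  next
    fix X' assume z: "X' \<in> Cell0 D"
    obtain X where [simp]: "X \<in> Cell0 B" "X' = P0 X" using lift0[of X'] z by auto
    show "Id1 D X' \<in> Cell1 D X' X'" using B.Id1_cell[of X] L(4)[of X] L(9)[of X X "Id1 B X"] by simp
  next
    fix X' Y' Z' f g assume z: "X' \<in> Cell0 D" "Y' \<in> Cell0 D" "Z' \<in> Cell0 D"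
      and a: "f \<in> Cell1 D X' Y'" "g \<in> Cell1 D Y' Z'"
    obtain X where [simp]: "X \<in> Cell0 B" "X' = P0 X" using lift0[of X'] z by auto
    obtain Y where [simp]: "Y \<in> Cell0 B" "Y' = P0 Y" using lift0[of Y'] z by auto
    obtain Z where [simp]: "Z \<in> Cell0 B" "Z' = P0 Z" using lift0[of Z'] z by auto
    obtain f' where [simp]: "f' \<in> Cell1 B X Y" "f = P1 f'" using L(11)[of X Y f] a by auto
    obtain g' where [simp]: "g' \<in> Cell1 B Y Z" "g = P1 g'" using L(11)[of Y Z g] a by auto
    show "Comp1 D g f \<in> Cell1 D X' Z'"
      using L(5)[of X Y Z f' g'] B.Comp1_cell[of X Y Z f' g'] L(9)[of X Z "Comp1 B g' f'"] by simp
  next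
    fix X' Y' Z' U' f g h assume z: "X' \<in> Cell0 D" "Y' \<in> Cell0 D" "Z' \<in> Cell0 D" "U' \<in> Cell0 D"
      and a: "f \<in> Cell1 D X' Y'" "g \<in> Cell1 D Y' Z'" "h \<in> Cell1 D Z' U'"
    obtain X where [simp]: "X \<in> Cell0 B" "X' = P0 X" using lift0[of X'] z by auto
    obtain Y where [simp]: "Y \<in> Cell0 B" "Y' = P0 Y" using lift0[of Y'] z by auto
    obtain Z where [simp]: "Z \<in> Cell0 B" "Z' = P0 Z" using lift0[of Z'] z by auto
    obtain U where [simp]: "U \<in> Cell0 B" "U' = P0 U" using lift0[of U'] z by auto
    obtain f' where [simp]: "f' \<in> Cell1 B X Y" "f = P1 f'" using L(11)[of X Y f] a by auto
    obtain g' where [simp]: "g' \<in> Cell1 B Y Z" "g = P1 g'" using L(11)[of Y Z g] a by auto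
    obtain h' where [simp]: "h' \<in> Cell1 B Z U" "h = P1 h'" using L(11)[of Z U h] a by auto
    show "Comp1 D (Comp1 D h g) f = Comp1 D h (Comp1 D g f)"
      using L(5)[of X Y Z f' g'] L(5)[of Y Z U g' h'] B.Comp1_cell[of X Y Z f' g'] B.Comp1_cell[of Y Z U g' h']
       L(5)[of X Z U "Comp1 B g' f'" h'] L(5)[of X Y U f' "Comp1 B h' g'"] B.Comp1_assoc[of X Y Z U f' g' h'] by simp
  next
    fix X' Y' f assume z: "X' \<in> Cell0 D" "Y' \<in> Cell0 D" and a: "f \<in> Cell1 D X' Y'"
    obtain X where [simp]: "X \<in> Cell0 B" "X' = P0 X" using lift0[of X'] z by auto
    obtain Y where [simp]: "Y \<in> Cell0 B" "Y' = P0 Y" using lift0[of Y'] z by auto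
    obtain f' where [simp]: "f' \<in> Cell1 B X Y" "f = P1 f'" using L(11)[of X Y f] a by auto
    show "Comp1 D f (Id1 D X') = f" "Comp1 D (Id1 D Y') f = f"
      using L(5)[of X X Y "Id1 B X" f'] L(5)[of X Y Y f' "Id1 B Y"] B.Id1_cell[of X] B.Id1_cell[of Y]
        L(4)[of X] L(4)[of Y] B.Comp1_Id1[of X Y f']
        B.Id1_Comp1[of X Y f'] by simp_all
  next
    fix X' Y' Z' f f' g g' \<alpha> \<beta> assume z: "X' \<in> Cell0 D" "Y' \<in> Cell0 D" "Z' \<in> Cell0 D"
      and a: "f \<in> Cell1 D X' Y'" "f' \<in> Cell1 D X' Y'" "g \<in> Cell1 D Y' Z'" "g' \<in> Cell1 D Y' Z'"
        "\<alpha> \<in> Cell2 D f f'" "\<beta> \<in> Cell2 D g g'"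
    obtain X where [simp]: "X \<in> Cell0 B" "X' = P0 X" using lift0[of X'] z by auto
    obtain Y where [simp]: "Y \<in> Cell0 B" "Y' = P0 Y" using lift0[of Y'] z by auto
    obtain Z where [simp]: "Z \<in> Cell0 B" "Z' = P0 Z" using lift0[of Z'] z by auto
    obtain F where [simp]: "F \<in> Cell1 B X Y" "f = P1 F" using L(11)[of X Y f] a by auto
    obtain F' where [simp]: "F' \<in> Cell1 B X Y" "f' = P1 F'" using L(11)[of X Y f'] a by auto
    obtain G where [simp]: "G \<in> Cell1 B Y Z" "g = P1 G" using L(11)[of Y Z g] a by auto
    obtain G' where [simp]: "G' \<in> Cell1 B Y Z" "g' = P1 G'" using L(11)[of Y Z g'] a by auto
    obtain \<alpha>' where [simp]: "\<alpha>' \<in> Cell2 B F F'" "\<alpha> = P2 \<alpha>'" using L(12)[of X Y F F' \<alpha>] a by auto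
    obtain \<beta>' where [simp]: "\<beta>' \<in> Cell2 B G G'" "\<beta> = P2 \<beta>'" using L(12)[of Y Z G G' \<beta>] a by auto
    show "HComp D \<alpha> \<beta> \<in> Cell2 D (Comp1 D g f) (Comp1 D g' f')"
      using B.HComp_cell[of X Y Z F F' G G' \<alpha>' \<beta>'] L(8)[of X Y Z F F' G G' \<alpha>' \<beta>']
       L(10)[of X Z "Comp1 B G F" "Comp1 B G' F'" "HComp B \<alpha>' \<beta>'"] L(5)[of X Y Z F G] L(5)[of X Y Z F' G']
       B.Comp1_cell[of X Y Z F G] B.Comp1_cell[of X Y Z F' G'] by simp
  next
    fix X' Y' Z' U' f f' g g' h h' \<alpha> \<beta> \<gamma> assume z: "X' \<in> Cell0 D" "Y' \<in> Cell0 D" "Z' \<in> Cell0 D" "U' \<in> Cell0 D"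
      and a: "f \<in> Cell1 D X' Y'" "f' \<in> Cell1 D X' Y'" "g \<in> Cell1 D Y' Z'" "g' \<in> Cell1 D Y' Z'"
        "h \<in> Cell1 D Z' U'" "h' \<in> Cell1 D Z' U'"
        "\<alpha> \<in> Cell2 D f f'" "\<beta> \<in> Cell2 D g g'" "\<gamma> \<in> Cell2 D h h'"
    obtain X where [simp]: "X \<in> Cell0 B" "X' = P0 X" using lift0[of X'] z by auto
    obtain Y where [simp]: "Y \<in> Cell0 B" "Y' = P0 Y" using lift0[of Y'] z by auto
    obtain Z where [simp]: "Z \<in> Cell0 B" "Z' = P0 Z" using lift0[of Z'] z by auto
    obtain U where [simp]: "U \<in> Cell0 B" "U' = P0 U" using lift0[of U'] z by auto
    obtain F where [simp]: "F \<in> Cell1 B X Y" "f = P1 F" using L(11)[of X Y f] a by auto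
    obtain F' where [simp]: "F' \<in> Cell1 B X Y" "f' = P1 F'" using L(11)[of X Y f'] a by auto
    obtain G where [simp]: "G \<in> Cell1 B Y Z" "g = P1 G" using L(11)[of Y Z g] a by auto
    obtain G' where [simp]: "G' \<in> Cell1 B Y Z" "g' = P1 G'" using L(11)[of Y Z g'] a by auto
    obtain H where [simp]: "H \<in> Cell1 B Z U" "h = P1 H" using L(11)[of Z U h] a by auto
    obtain H' where [simp]: "H' \<in> Cell1 B Z U" "h' = P1 H'" using L(11)[of Z U h'] a by auto
    obtain \<alpha>' where [simp]: "\<alpha>' \<in> Cell2 B F F'" "\<alpha> = P2 \<alpha>'" using L(12)[of X Y F F' \<alpha>] a by auto
    obtain \<beta>' where [simp]: "\<beta>' \<in> Cell2 B G G'" "\<beta> = P2 \<beta>'" using L(12)[of Y Z G G' \<beta>] a by auto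
    obtain \<gamma>' where [simp]: "\<gamma>' \<in> Cell2 B H H'" "\<gamma> = P2 \<gamma>'" using L(12)[of Z U H H' \<gamma>] a by auto
    have [simp]: "Comp1 B G F \<in> Cell1 B X Z" "Comp1 B G' F' \<in> Cell1 B X Z"
      "Comp1 B H G \<in> Cell1 B Y U" "Comp1 B H' G' \<in> Cell1 B Y U"
      by (rule B.Comp1_cell[where Y=Y] B.Comp1_cell[where Y=Z]; simp; fail)+
    show "HComp D (HComp D \<alpha> \<beta>) \<gamma> = HComp D \<alpha> (HComp D \<beta> \<gamma>)"
      using B.HComp_assoc[of X Y Z U F F' G G' H H' \<alpha>' \<beta>' \<gamma>'] L(8)[of X Y Z F F' G G' \<alpha>' \<beta>']
        L(8)[of Y Z U G G' H H' \<beta>' \<gamma>'] B.HComp_cell[of X Y Z F F' G G' \<alpha>' \<beta>']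
        B.HComp_cell[of Y Z U G G' H H' \<beta>' \<gamma>']
        L(8)[of X Z U "Comp1 B G F" "Comp1 B G' F'" H H' "HComp B \<alpha>' \<beta>'" \<gamma>']
        L(8)[of X Y U F F' "Comp1 B H G" "Comp1 B H' G'" \<alpha>' "HComp B \<beta>' \<gamma>'"] by simp
  next
    fix X' Y' f f' \<alpha> assume z: "X' \<in> Cell0 D" "Y' \<in> Cell0 D"
      and a: "f \<in> Cell1 D X' Y'" "f' \<in> Cell1 D X' Y'" "\<alpha> \<in> Cell2 D f f'"
    obtain X where [simp]: "X \<in> Cell0 B" "X' = P0 X" using lift0[of X'] z by auto
    obtain Y where [simp]: "Y \<in> Cell0 B" "Y' = P0 Y" using lift0[of Y'] z by auto
    obtain F where [simp]: "F \<in> Cell1 B X Y" "f = P1 F" using L(11)[of X Y f] a by auto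
    obtain F' where [simp]: "F' \<in> Cell1 B X Y" "f' = P1 F'" using L(11)[of X Y f'] a by auto
    obtain \<alpha>' where [simp]: "\<alpha>' \<in> Cell2 B F F'" "\<alpha> = P2 \<alpha>'" using L(12)[of X Y F F' \<alpha>] a by auto
    note [simp] = B.Id1_cell B.Id2_cell[OF _ _ B.Id1_cell] L(4)[symmetric] L(6)[OF _ _ B.Id1_cell, symmetric]
    show "HComp D (Id2 D (Id1 D X')) \<alpha> = \<alpha>" "HComp D \<alpha> (Id2 D (Id1 D Y')) = \<alpha>"
      using L(8)[of X X Y "Id1 B X" "Id1 B X" F F' "Id2 B (Id1 B X)" \<alpha>']
        L(8)[of X Y Y F F' "Id1 B Y" "Id1 B Y" \<alpha>' "Id2 B (Id1 B Y)"] B.HComp_Id1_left[of X Y F F' \<alpha>']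
        B.HComp_Id1_right[of X Y F F' \<alpha>'] by simp_all
  next
    fix X' Y' Z' f g assume z: "X' \<in> Cell0 D" "Y' \<in> Cell0 D" "Z' \<in> Cell0 D"
      and a: "f \<in> Cell1 D X' Y'" "g \<in> Cell1 D Y' Z'"
    obtain X where [simp]: "X \<in> Cell0 B" "X' = P0 X" using lift0[of X'] z by auto
    obtain Y where [simp]: "Y \<in> Cell0 B" "Y' = P0 Y" using lift0[of Y'] z by auto
    obtain Z where [simp]: "Z \<in> Cell0 B" "Z' = P0 Z" using lift0[of Z'] z by auto
    obtain f' where [simp]: "f' \<in> Cell1 B X Y" "f = P1 f'" using L(11)[of X Y f] a by auto
    obtain g' where [simp]: "g' \<in> Cell1 B Y Z" "g = P1 g'" using L(11)[of Y Z g] a by auto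
    show "HComp D (Id2 D f) (Id2 D g) = Id2 D (Comp1 D g f)"
      using L(5)[of X Y Z f' g'] B.Comp1_cell[of X Y Z f' g'] L(6)[of X Y f'] L(6)[of Y Z g']
        L(8)[of X Y Z f' f' g' g' "Id2 B f'" "Id2 B g'"] B.Id2_cell[of X Y f'] B.Id2_cell[of Y Z g']
        B.HComp_Id2[of X Y Z f' g'] L(6)[of X Z "Comp1 B g' f'"] by simp
  next
    fix X' Y' Z' f f' f'' g g' g'' \<alpha> \<alpha>' \<beta> \<beta>' assume z: "X' \<in> Cell0 D" "Y' \<in> Cell0 D" "Z' \<in> Cell0 D"
      and a: "f \<in> Cell1 D X' Y'" "f' \<in> Cell1 D X' Y'" "f'' \<in> Cell1 D X' Y'" "g \<in> Cell1 D Y' Z'" "g' \<in> Cell1 D Y' Z'" "g'' \<in> Cell1 D Y' Z'"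
        "\<alpha> \<in> Cell2 D f f'" "\<alpha>' \<in> Cell2 D f' f''" "\<beta> \<in> Cell2 D g g'" "\<beta>' \<in> Cell2 D g' g''"
    obtain X where [simp]: "X \<in> Cell0 B" "X' = P0 X" using lift0[of X'] z by auto
    obtain Y where [simp]: "Y \<in> Cell0 B" "Y' = P0 Y" using lift0[of Y'] z by auto
    obtain Z where [simp]: "Z \<in> Cell0 B" "Z' = P0 Z" using lift0[of Z'] z by auto
    obtain F where [simp]: "F \<in> Cell1 B X Y" "f = P1 F" using L(11)[of X Y f] a by auto
    obtain F' where [simp]: "F' \<in> Cell1 B X Y" "f' = P1 F'" using L(11)[of X Y f'] a by auto
    obtain F'' where [simp]: "F'' \<in> Cell1 B X Y" "f'' = P1 F''" using L(11)[of X Y f''] a by auto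
    obtain G where [simp]: "G \<in> Cell1 B Y Z" "g = P1 G" using L(11)[of Y Z g] a by auto
    obtain G' where [simp]: "G' \<in> Cell1 B Y Z" "g' = P1 G'" using L(11)[of Y Z g'] a by auto
    obtain G'' where [simp]: "G'' \<in> Cell1 B Y Z" "g'' = P1 G''" using L(11)[of Y Z g''] a by auto
    obtain a where [simp]: "a \<in> Cell2 B F F'" "\<alpha> = P2 a" using L(12)[of X Y F F' \<alpha>] a by auto
    obtain b where [simp]: "b \<in> Cell2 B G G'" "\<beta> = P2 b" using L(12)[of Y Z G G' \<beta>] a by auto
    obtain a' where [simp]: "a' \<in> Cell2 B F' F''" "\<alpha>' = P2 a'" using L(12)[of X Y F' F'' \<alpha>'] a by auto
    obtain b' where [simp]: "b' \<in> Cell2 B G' G''" "\<beta>' = P2 b'" using L(12)[of Y Z G' G'' \<beta>'] a by auto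
    have [simp]: "Comp1 B G F \<in> Cell1 B X Z" "Comp1 B G' F' \<in> Cell1 B X Z" "Comp1 B G'' F'' \<in> Cell1 B X Z"
      by (rule B.Comp1_cell[where Y=Y]; simp; fail)+
    note V = B.VComp_cell[of X Y F F' F'' a a'] B.VComp_cell[of Y Z G G' G'' b b']
    note H = B.HComp_cell[of X Y Z F F' G G' a b] B.HComp_cell[of X Y Z F' F'' G' G'' a' b']
    show "HComp D (VComp D \<alpha>' \<alpha>) (VComp D \<beta>' \<beta>) = VComp D (HComp D \<alpha>' \<beta>') (HComp D \<alpha> \<beta>)"
      using B.interchange[of X Y Z F F' F'' G G' G'' a a' b b'] V H
        L(7)[of X Y F F' F'' a a'] L(7)[of Y Z G G' G'' b b']
        L(8)[of X Y Z F F' G G' a b] L(8)[of X Y Z F' F'' G' G'' a' b']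
        L(8)[of X Y Z F F'' G G'' "VComp B a' a" "VComp B b' b"]
        L(7)[of X Z "Comp1 B G F" "Comp1 B G' F'" "Comp1 B G'' F''" "HComp B a b" "HComp B a' b'"]
      by simp
  qed
qed

section \<open>Composition of local isomorphisms, and what they preserve\<close>

lemma local_iso_comp:
  assumes F: "local_iso B D P0 P1 P2" and G: "local_iso D E Q0 Q1 Q2"
  shows "local_iso B E (Q0 \<circ> P0) (Q1 \<circ> P1) (Q2 \<circ> P2)"
proof -
  note L = local_iso.cells[OF F] and M = local_iso.cells[OF G]
  have 1: "\<lbrakk>X \<in> Cell0 B; Y \<in> Cell0 B\<rbrakk> \<Longrightarrow> bij_betw (Q1 \<circ> P1) (Cell1 B X Y) (Cell1 E (Q0 (P0 X)) (Q0 (P0 Y)))"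
    for X Y by (rule bij_betw_trans[OF L(2) M(2)]) (simp_all add: L(1))
  have 2: "\<lbrakk>X \<in> Cell0 B; Y \<in> Cell0 B; f \<in> Cell1 B X Y; g \<in> Cell1 B X Y\<rbrakk> \<Longrightarrow>
      (Q2 \<circ> P2) ` Cell2 B f g = Cell2 E (Q1 (P1 f)) (Q1 (P1 g))" for X Y f g
    using L(3)[of X Y f g] M(3)[of "P0 X" "P0 Y" "P1 f" "P1 g"] unfolding image_comp[symmetric] by (simp add: L(1,9))
  \<comment> \<open>Injectivity is required across all hom-sets between \<open>X\<close> and
    \<open>Y\<close> at once, so the image under \<open>P2\<close> has to be placed inside the
    corresponding union for \<open>D\<close>.\<close>
  have inj: "inj_on (Q2 \<circ> P2) (\<Union>f \<in> Cell1 B X Y. \<Union>g \<in> Cell1 B X Y. Cell2 B f g)"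
    if X: "X \<in> Cell0 B" "Y \<in> Cell0 B" for X Y
  proof (rule comp_inj_on[OF L(13)[OF X]])
    show "inj_on Q2 (P2 ` (\<Union>f \<in> Cell1 B X Y. \<Union>g \<in> Cell1 B X Y. Cell2 B f g))"
    proof (rule inj_on_subset[OF M(13)[OF L(1)[OF X(1)] L(1)[OF X(2)]]], rule subsetI)
      fix \<gamma> assume "\<gamma> \<in> P2 ` (\<Union>f \<in> Cell1 B X Y. \<Union>g \<in> Cell1 B X Y. Cell2 B f g)"
      then obtain f g \<alpha> where a: "f \<in> Cell1 B X Y" "g \<in> Cell1 B X Y" "\<alpha> \<in> Cell2 B f g" "\<gamma> = P2 \<alpha>" by blast
      show "\<gamma> \<in> (\<Union>f \<in> Cell1 D (P0 X) (P0 Y). \<Union>g \<in> Cell1 D (P0 X) (P0 Y). Cell2 D f g)"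
        using L(9)[OF X a(1)] L(9)[OF X a(2)] L(10)[OF X a(1-3)] a(4) by blast
    qed
  qed
  have 3: "\<lbrakk>X \<in> Cell0 B; Y \<in> Cell0 B; Z \<in> Cell0 B; f \<in> Cell1 B X Y; g \<in> Cell1 B Y Z\<rbrakk> \<Longrightarrow>
      Q1 (P1 (Comp1 B g f)) = Comp1 E (Q1 (P1 g)) (Q1 (P1 f))" for X Y Z f g
    using L(5)[of X Y Z f g] M(5)[of "P0 X" "P0 Y" "P0 Z" "P1 f" "P1 g"] by (simp add: L(1,9))
  have 4: "\<lbrakk>X \<in> Cell0 B; Y \<in> Cell0 B; f \<in> Cell1 B X Y\<rbrakk> \<Longrightarrow>
      Q2 (P2 (Id2 B f)) = Id2 E (Q1 (P1 f))" for X Y f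
    using L(6)[of X Y f] M(6)[of "P0 X" "P0 Y" "P1 f"] by (simp add: L(1,9))
  have 5: "\<lbrakk>X \<in> Cell0 B; Y \<in> Cell0 B; f \<in> Cell1 B X Y; g \<in> Cell1 B X Y; h \<in> Cell1 B X Y;
      \<alpha> \<in> Cell2 B f g; \<beta> \<in> Cell2 B g h\<rbrakk> \<Longrightarrow>
      Q2 (P2 (VComp B \<beta> \<alpha>)) = VComp E (Q2 (P2 \<beta>)) (Q2 (P2 \<alpha>))" for X Y f g h \<alpha> \<beta>
    using L(7)[of X Y f g h \<alpha> \<beta>] M(7)[of "P0 X" "P0 Y" "P1 f" "P1 g" "P1 h" "P2 \<alpha>" "P2 \<beta>"]
      L(10)[of X Y f g \<alpha>] L(10)[of X Y g h \<beta>] by (simp add: L(1,9))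
  have 6: "\<lbrakk>X \<in> Cell0 B; Y \<in> Cell0 B; Z \<in> Cell0 B;
      f \<in> Cell1 B X Y; f' \<in> Cell1 B X Y; g \<in> Cell1 B Y Z; g' \<in> Cell1 B Y Z;
      \<alpha> \<in> Cell2 B f f'; \<beta> \<in> Cell2 B g g'\<rbrakk> \<Longrightarrow>
      Q2 (P2 (HComp B \<alpha> \<beta>)) = HComp E (Q2 (P2 \<alpha>)) (Q2 (P2 \<beta>))" for X Y Z f f' g g' \<alpha> \<beta>
    using L(8)[of X Y Z f f' g g' \<alpha> \<beta>]
      M(8)[of "P0 X" "P0 Y" "P0 Z" "P1 f" "P1 f'" "P1 g" "P1 g'" "P2 \<alpha>" "P2 \<beta>"]
      L(10)[of X Y f f' \<alpha>] L(10)[of Y Z g g' \<beta>] by (simp add: L(1,9))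
  show ?thesis
    apply (unfold_locales, unfold o_apply)
    subgoal by (rule M(1)[OF L(1)])
    subgoal for X Y using 1[of X Y] by (simp add: o_def)
    subgoal for X Y f g using 2[of X Y f g] by (simp add: o_def)
    subgoal for X Y using inj[of X Y] by (simp add: o_def)
    subgoal by (simp add: L(1,4) M(4))
    subgoal for X Y Z f g by (rule 3[of X Y Z])
    subgoal for X Y f by (rule 4[of X Y])
    subgoal for X Y f g h \<alpha> \<beta> by (rule 5[of X Y f g h])
    subgoal for X Y Z f f' g g' \<alpha> \<beta> by (rule 6[of X Y Z f f' g g'])
    done
qed

lemma local_iso_iso_arrow:
  assumes B: "two_category B" and F: "local_iso B D P0 P1 P2"
    and X: "X \<in> Cell0 B" "Y \<in> Cell0 B" "f \<in> Cell1 B X Y" "g \<in> Cell1 B X Y"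
    and i: "iso_arrow (HomCat B X Y) f g \<sigma>"
  shows "iso_arrow (HomCat D (P0 X) (P0 Y)) (P1 f) (P1 g) (P2 \<sigma>)"
proof -
  interpret B: two_category B by (rule B)
  note L = local_iso.cells[OF F]
  obtain \<tau> where t: "\<sigma> \<in> Cell2 B f g" "\<tau> \<in> Cell2 B g f" "VComp B \<tau> \<sigma> = Id2 B f" "VComp B \<sigma> \<tau> = Id2 B g"
    using i by (auto simp: iso_arrow_def HomCat_def)
  have "VComp D (P2 \<tau>) (P2 \<sigma>) = Id2 D (P1 f)" "VComp D (P2 \<sigma>) (P2 \<tau>) = Id2 D (P1 g)"
    using L(7)[OF X(1,2,3,4,3) t(1,2)] L(7)[OF X(1,2,4,3,4) t(2,1)] L(6)[OF X(1,2)] X t by simp_all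
  moreover have "P2 \<sigma> \<in> Cell2 D (P1 f) (P1 g)" "P2 \<tau> \<in> Cell2 D (P1 g) (P1 f)"
    using L(10)[OF X t(1)] L(10)[OF X(1,2,4,3) t(2)] by blast+
  ultimately show ?thesis by (auto simp: iso_arrow_def HomCat_def)
qed

text \<open>Strictness on identities and composites gives the images of the two invertible 2-cells
  the right sources and targets.\<close>

lemma local_iso_equivalent:
  assumes B: "two_category B" and F: "local_iso B D P0 P1 P2"
    and X: "X \<in> Cell0 B" "Y \<in> Cell0 B" and e: "equivalent_0cells B X Y"
  shows "equivalent_0cells D (P0 X) (P0 Y)"
proof -
  interpret B: two_category B by (rule B)
  note L = local_iso.cells[OF F]
  obtain f g \<sigma> \<tau> where f: "f \<in> Cell1 B X Y" and g: "g \<in> Cell1 B Y X"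
    and s: "iso_arrow (HomCat B X X) (Id1 B X) (Comp1 B g f) \<sigma>"
    and t: "iso_arrow (HomCat B Y Y) (Comp1 B f g) (Id1 B Y) \<tau>"
    using e unfolding equivalent_0cells_def by blast
  have "iso_arrow (HomCat D (P0 X) (P0 X)) (P1 (Id1 B X)) (P1 (Comp1 B g f)) (P2 \<sigma>)"
    by (rule local_iso_iso_arrow[OF B F _ _ _ _ s]) (rule X B.Id1_cell[OF X(1)] B.Comp1_cell[OF X(1,2,1) f g])+
  moreover have "iso_arrow (HomCat D (P0 Y) (P0 Y)) (P1 (Comp1 B f g)) (P1 (Id1 B Y)) (P2 \<tau>)"
    by (rule local_iso_iso_arrow[OF B F _ _ _ _ t]) (rule X B.Id1_cell[OF X(2)] B.Comp1_cell[OF X(2,1,2) g f])+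
  ultimately show ?thesis unfolding equivalent_0cells_def
    using L(9)[OF X f] L(9)[OF X(2,1) g]
    unfolding L(4)[OF X(1)] L(4)[OF X(2)] L(5)[OF X(1,2,1) f g] L(5)[OF X(2,1,2) g f] by blast
qed

text \<open>A strict 2-functor is a pseudofunctor with identity coherence cells, so the coherence
  laws reduce to identity laws in \<open>D\<close>. The local quasi-inverses are the inverse
  bijections, and the natural isomorphisms consist of identities.\<close>

lemma local_iso_biequivalence:
  assumes B: "two_category B" and D: "two_category D" and F: "local_iso B D P0 P1 P2"
    and ess: "\<And>Z. Z \<in> Cell0 D \<Longrightarrow> \<exists>X \<in> Cell0 B. equivalent_0cells D (P0 X) Z"
  shows "biequivalence B D \<lparr>PF0 = P0, PF1 = P1, PF2 = P2, PUnit = (\<lambda>X. Id2 D (Id1 D (P0 X))),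
    PComp = (\<lambda>g f. Id2 D (Comp1 D (P1 g) (P1 f)))\<rparr>"
proof -
  interpret B: two_category B by (rule B)
  interpret D: two_category D by (rule D)
  note L = local_iso.cells[OF F]
  have cf: "cat_functor (HomCat B X Y) (HomCat D (P0 X) (P0 Y)) P1 P2"
    if X: "X \<in> Cell0 B" "Y \<in> Cell0 B" for X Y
    unfolding cat_functor_def HomCat_def using L(9)[OF X] L(10)[OF X] L(6)[OF X] L(7)[OF X] by simp
  show ?thesis
  proof (unfold_locales, simp_all)
    fix X assume X: "X \<in> Cell0 B" then show "P0 X \<in> Cell0 D" by (rule L)
    then show "iso_arrow (HomCat D (P0 X) (P0 X)) (Id1 D (P0 X)) (P1 (Id1 B X)) (Id2 D (Id1 D (P0 X)))"
      using D.iso_Id2[OF _ _ D.Id1_cell] L(4)[OF X] by simp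
  next
    fix X Y assume X: "X \<in> Cell0 B" "Y \<in> Cell0 B"
    show "cat_functor (HomCat B X Y) (HomCat D (P0 X) (P0 Y)) P1 P2" by (rule cf[OF X])
  next
    fix X Y Z f g assume X: "X \<in> Cell0 B" "Y \<in> Cell0 B" "Z \<in> Cell0 B" "f \<in> Cell1 B X Y" "g \<in> Cell1 B Y Z"
    show "iso_arrow (HomCat D (P0 X) (P0 Z)) (Comp1 D (P1 g) (P1 f)) (P1 (Comp1 B g f)) (Id2 D (Comp1 D (P1 g) (P1 f)))"
      unfolding L(5)[OF X] by (intro D.iso_Id2 D.Comp1_cell[of _ "P0 Y"] L(1) L(9) X)
  next
    fix X Y Z f f' g g' \<alpha> \<beta> assume X: "X \<in> Cell0 B" "Y \<in> Cell0 B" "Z \<in> Cell0 B"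
      "f \<in> Cell1 B X Y" "f' \<in> Cell1 B X Y" "g \<in> Cell1 B Y Z" "g' \<in> Cell1 B Y Z"
      "\<alpha> \<in> Cell2 B f f'" "\<beta> \<in> Cell2 B g g'"
    have 1: "HComp D (P2 \<alpha>) (P2 \<beta>) \<in> Cell2 D (Comp1 D (P1 g) (P1 f)) (Comp1 D (P1 g') (P1 f'))"
      by (intro D.HComp_cell[of "P0 X" "P0 Y" "P0 Z"] L(1) L(9) X L(10)[OF X(1,2,4,5,8)] L(10)[OF X(2,3,6,7,9)])
    have 2: "Comp1 D (P1 g) (P1 f) \<in> Cell1 D (P0 X) (P0 Z)" "Comp1 D (P1 g') (P1 f') \<in> Cell1 D (P0 X) (P0 Z)"
      by (intro D.Comp1_cell[of _ "P0 Y"] L(1) L(9) X)+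
    show "VComp D (P2 (HComp B \<alpha> \<beta>)) (Id2 D (Comp1 D (P1 g) (P1 f))) =
       VComp D (Id2 D (Comp1 D (P1 g') (P1 f'))) (HComp D (P2 \<alpha>) (P2 \<beta>))"
      unfolding L(8)[OF X] using D.VComp_Id2[OF L(1)[OF X(1)] L(1)[OF X(3)] 2 1] D.Id2_VComp[OF L(1)[OF X(1)] L(1)[OF X(3)] 2 1] by simp
  next
    fix X Y Z U f g h assume X: "X \<in> Cell0 B" "Y \<in> Cell0 B" "Z \<in> Cell0 B" "U \<in> Cell0 B"
      "f \<in> Cell1 B X Y" "g \<in> Cell1 B Y Z" "h \<in> Cell1 B Z U"
    note Y = L(9)[OF X(1,2,5)] L(9)[OF X(2,3,6)] L(9)[OF X(3,4,7)]
    note 0 = L(1)[OF X(1)] L(1)[OF X(2)] L(1)[OF X(3)] L(1)[OF X(4)]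
    show "VComp D (Id2 D (Comp1 D (P1 (Comp1 B h g)) (P1 f))) (HComp D (Id2 D (P1 f)) (Id2 D (Comp1 D (P1 h) (P1 g))))
      = VComp D (Id2 D (Comp1 D (P1 h) (P1 (Comp1 B g f)))) (HComp D (Id2 D (Comp1 D (P1 g) (P1 f))) (Id2 D (P1 h)))"
      unfolding L(5)[OF X(1,2,3,5,6)] L(5)[OF X(2,3,4,6,7)]
      using D.HComp_Id2[OF 0(1,2,4) Y(1) D.Comp1_cell[OF 0(2,3,4) Y(2,3)]]
        D.HComp_Id2[OF 0(1,3,4) D.Comp1_cell[OF 0(1,2,3) Y(1,2)] Y(3)] D.Comp1_assoc[OF 0 Y] by simp
  next
    fix X Y f assume X: "X \<in> Cell0 B" "Y \<in> Cell0 B" "f \<in> Cell1 B X Y"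
    note Y = L(9)[OF X(1,2,3)] and 0 = L(1)[OF X(1)] L(1)[OF X(2)]
    note I = D.Id2_VComp[OF 0 Y Y D.Id2_cell[OF 0 Y]]
    show "VComp D (Id2 D (Comp1 D (P1 f) (P1 (Id1 B X)))) (HComp D (Id2 D (Id1 D (P0 X))) (Id2 D (P1 f))) = Id2 D (P1 f)"
      "VComp D (Id2 D (Comp1 D (P1 (Id1 B Y)) (P1 f))) (HComp D (Id2 D (P1 f)) (Id2 D (Id1 D (P0 Y)))) = Id2 D (P1 f)"
      unfolding L(4)[OF X(1)] L(4)[OF X(2)] D.Comp1_Id1[OF 0 Y] D.Id1_Comp1[OF 0 Y]
        D.HComp_Id1_left[OF 0 Y Y D.Id2_cell[OF 0 Y]] D.HComp_Id1_right[OF 0 Y Y D.Id2_cell[OF 0 Y]]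
      by (rule I)+
  next
    fix X Y assume X: "X \<in> Cell0 B" "Y \<in> Cell0 B"
    note 0 = L(1)[OF X(1)] L(1)[OF X(2)]
    define G1 where "G1 = inv_into (Cell1 B X Y) P1"
    have b1: "G1 f \<in> Cell1 B X Y" "P1 (G1 f) = f" if "f \<in> Cell1 D (P0 X) (P0 Y)" for f
      using bij_betw_inv_into_right[OF L(2)[OF X] that] that bij_betwE[OF bij_betw_inv_into[OF L(2)[OF X]]]
      by (auto simp: G1_def)
    have b1': "G1 (P1 f) = f" if "f \<in> Cell1 B X Y" for f
      using bij_betw_inv_into_left[OF L(2)[OF X] that] by (simp add: G1_def)
    \<comment> \<open>A quasi-inverse is one function on all 2-cells, whatever their source and
      target. Inverting \<open>P2\<close> on the union of the hom-sets is what \<open>inj2\<close>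
      is for.\<close>
    define G2 where "G2 = inv_into (\<Union>f \<in> Cell1 B X Y. \<Union>g \<in> Cell1 B X Y. Cell2 B f g) P2"
    have b2: "G2 (P2 \<alpha>) = \<alpha>" if "f \<in> Cell1 B X Y" "g \<in> Cell1 B X Y" "\<alpha> \<in> Cell2 B f g" for f g \<alpha>
      unfolding G2_def by (rule inv_into_f_f[OF L(13)[OF X]]) (use that in blast)
    \<comment> \<open>The inverse taken on the whole union lies in the right hom-set: a preimage
      with the right source and target exists by \<open>lift2\<close>, and by \<open>b2\<close> it
      is the one that \<open>G2\<close> returns.\<close>
    have b3: "G2 \<gamma> \<in> Cell2 B (G1 f) (G1 g) \<and> P2 (G2 \<gamma>) = \<gamma>"
      if a: "f \<in> Cell1 D (P0 X) (P0 Y)" "g \<in> Cell1 D (P0 X) (P0 Y)" "\<gamma> \<in> Cell2 D f g" for f g \<gamma>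
    proof -
      obtain \<alpha> where "\<alpha> \<in> Cell2 B (G1 f) (G1 g)" "\<gamma> = P2 \<alpha>"
        using L(12)[OF X b1(1)[OF a(1)] b1(1)[OF a(2)], of \<gamma>] b1(2) a by auto
      then show ?thesis using b2[OF b1(1)[OF a(1)] b1(1)[OF a(2)]] by simp
    qed
    have cg: "cat_functor (HomCat D (P0 X) (P0 Y)) (HomCat B X Y) G1 G2"
      unfolding cat_functor_def HomCat_def
    proof (simp, intro conjI ballI)
      fix f assume a: "f \<in> Cell1 D (P0 X) (P0 Y)"
      show "G1 f \<in> Cell1 B X Y" by (rule b1[OF a])
      show "G2 (Id2 D f) = Id2 B (G1 f)"
        using L(6)[OF X b1(1)[OF a]] b1(2)[OF a] b2[OF b1(1)[OF a] b1(1)[OF a] B.Id2_cell[OF X b1(1)[OF a]]] by simp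
    next
      fix f g \<gamma> assume "f \<in> Cell1 D (P0 X) (P0 Y)" "g \<in> Cell1 D (P0 X) (P0 Y)" "\<gamma> \<in> Cell2 D f g"
      then show "G2 \<gamma> \<in> Cell2 B (G1 f) (G1 g)" using b3 by blast
    next
      fix f g h \<gamma> \<delta> assume a: "f \<in> Cell1 D (P0 X) (P0 Y)" "g \<in> Cell1 D (P0 X) (P0 Y)"
        "h \<in> Cell1 D (P0 X) (P0 Y)" "\<gamma> \<in> Cell2 D f g" "\<delta> \<in> Cell2 D g h"
      note c = b1(1)[OF a(1)] b1(1)[OF a(2)] b1(1)[OF a(3)]
      note d = b3[OF a(1,2,4), THEN conjunct1] b3[OF a(2,3,5), THEN conjunct1]
      have "VComp D \<delta> \<gamma> = P2 (VComp B (G2 \<delta>) (G2 \<gamma>))"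
        using L(7)[OF X c d] b3[OF a(1,2,4)] b3[OF a(2,3,5)] by simp
      then show "G2 (VComp D \<delta> \<gamma>) = VComp B (G2 \<delta>) (G2 \<gamma>)"
        using b2[OF c(1,3) B.VComp_cell[OF X c d]] by simp
    qed
    have "natural_iso (HomCat B X Y) (HomCat B X Y) (\<lambda>f. f) (\<lambda>\<alpha>. \<alpha>) (\<lambda>f. G1 (P1 f)) (\<lambda>\<alpha>. G2 (P2 \<alpha>)) (Id2 B)"
      using b1' b2 B.VComp_Id2[OF X] B.Id2_VComp[OF X] B.iso_Id2[OF X]
      by (simp add: natural_iso_def) (simp add: HomCat_def)
    moreover have "natural_iso (HomCat D (P0 X) (P0 Y)) (HomCat D (P0 X) (P0 Y))
        (\<lambda>f. P1 (G1 f)) (\<lambda>\<alpha>. P2 (G2 \<alpha>)) (\<lambda>f. f) (\<lambda>\<alpha>. \<alpha>) (Id2 D)"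
      using b1(2) b3 D.VComp_Id2[OF 0] D.Id2_VComp[OF 0] D.iso_Id2[OF 0]
      by (simp add: natural_iso_def) (simp add: HomCat_def)
    ultimately show "cat_equivalence (HomCat B X Y) (HomCat D (P0 X) (P0 Y)) P1 P2"
      unfolding cat_equivalence_def using cf[OF X] cg by blast
  next
    fix Z assume "Z \<in> Cell0 D" then show "\<exists>X \<in> Cell0 B. equivalent_0cells D (P0 X) Z" by (rule ess)
  qed
qed

section \<open>Symmetric monoidal categories\<close>

text \<open>
  Consequences of the axioms of a symmetric monoidal category which are stable under the passage
  to opposite arrows and reversed tensor products; the pentagon and the hexagon are not needed.
\<close>

locale symmon = category V for V :: "('o, 'a) sym_mon_cat" (structure) +
  fixes dm cd :: "'a \<Rightarrow> 'o"
  assumes Hom_dm_cd: "f \<in> Hom V A B \<Longrightarrow> dm f = A \<and> cd f = B"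
    and Unit_Obj [simp]: "Unit V \<in> Obj V"
    and Ten_Obj [simp]: "\<lbrakk>A \<in> Obj V; B \<in> Obj V\<rbrakk> \<Longrightarrow> A \<boxtimes> B \<in> Obj V"
    and TenA_Hom: "\<lbrakk>A \<in> Obj V; A' \<in> Obj V; B \<in> Obj V; B' \<in> Obj V; f \<in> Hom V A A'; g \<in> Hom V B B'\<rbrakk>
      \<Longrightarrow> f \<star> g \<in> Hom V (A \<boxtimes> B) (A' \<boxtimes> B')"
    and TenA_Comp: "\<lbrakk>A \<in> Obj V; A' \<in> Obj V; A'' \<in> Obj V; B \<in> Obj V; B' \<in> Obj V; B'' \<in> Obj V;
      f \<in> Hom V A A'; f' \<in> Hom V A' A''; g \<in> Hom V B B'; g' \<in> Hom V B' B''\<rbrakk>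
      \<Longrightarrow> (f' \<star> g') \<cdot> (f \<star> g) = (f' \<cdot> f) \<star> (g' \<cdot> g)"
    and TenA_Idn: "\<lbrakk>A \<in> Obj V; B \<in> Obj V\<rbrakk> \<Longrightarrow> Idn V A \<star> Idn V B = Idn V (A \<boxtimes> B)"
    and Assoc_Hom: "\<lbrakk>A \<in> Obj V; B \<in> Obj V; C \<in> Obj V\<rbrakk>
      \<Longrightarrow> Assoc V A B C \<in> Hom V ((A \<boxtimes> B) \<boxtimes> C) (A \<boxtimes> (B \<boxtimes> C))"
    and Assoc_nat: "\<lbrakk>A \<in> Obj V; A' \<in> Obj V; B \<in> Obj V; B' \<in> Obj V; C \<in> Obj V; C' \<in> Obj V;
      f \<in> Hom V A A'; g \<in> Hom V B B'; h \<in> Hom V C C'\<rbrakk>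
      \<Longrightarrow> Assoc V A' B' C' \<cdot> ((f \<star> g) \<star> h) = (f \<star> (g \<star> h)) \<cdot> Assoc V A B C"
    and LUnit_Hom: "A \<in> Obj V \<Longrightarrow> LUnit V A \<in> Hom V (Unit V \<boxtimes> A) A"
    and LUnitInv_Hom: "A \<in> Obj V \<Longrightarrow> LUnitInv V A \<in> Hom V A (Unit V \<boxtimes> A)"
    and LUnit_LUnitInv: "A \<in> Obj V \<Longrightarrow> LUnit V A \<cdot> LUnitInv V A = Idn V A"
    and LUnitInv_LUnit: "A \<in> Obj V \<Longrightarrow> LUnitInv V A \<cdot> LUnit V A = Idn V (Unit V \<boxtimes> A)"
    and LUnit_nat: "\<lbrakk>A \<in> Obj V; B \<in> Obj V; f \<in> Hom V A B\<rbrakk>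
      \<Longrightarrow> LUnit V B \<cdot> (Idn V (Unit V) \<star> f) = f \<cdot> LUnit V A"
    and RUnit_Hom: "A \<in> Obj V \<Longrightarrow> RUnit V A \<in> Hom V (A \<boxtimes> Unit V) A"
    and RUnitInv_Hom: "A \<in> Obj V \<Longrightarrow> RUnitInv V A \<in> Hom V A (A \<boxtimes> Unit V)"
    and RUnit_RUnitInv: "A \<in> Obj V \<Longrightarrow> RUnit V A \<cdot> RUnitInv V A = Idn V A"
    and RUnitInv_RUnit: "A \<in> Obj V \<Longrightarrow> RUnitInv V A \<cdot> RUnit V A = Idn V (A \<boxtimes> Unit V)"
    and RUnit_nat: "\<lbrakk>A \<in> Obj V; B \<in> Obj V; f \<in> Hom V A B\<rbrakk>
      \<Longrightarrow> RUnit V B \<cdot> (f \<star> Idn V (Unit V)) = f \<cdot> RUnit V A"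
    and RUnitInv_Unit: "RUnitInv V (Unit V) = LUnitInv V (Unit V)"
    and Assoc_Unit_left: "A \<in> Obj V \<Longrightarrow>
      Assoc V (Unit V) (Unit V) A \<cdot> (LUnitInv V (Unit V) \<star> Idn V A) = Idn V (Unit V) \<star> LUnitInv V A"
    and Assoc_Unit_outer: "A \<in> Obj V \<Longrightarrow>
      Assoc V (Unit V) A (Unit V) \<cdot> (LUnitInv V A \<star> Idn V (Unit V)) \<cdot> RUnitInv V A
      = (Idn V (Unit V) \<star> RUnitInv V A) \<cdot> LUnitInv V A"
    and Assoc_Unit_right: "A \<in> Obj V \<Longrightarrow>
      Assoc V A (Unit V) (Unit V) \<cdot> (RUnitInv V A \<star> Idn V (Unit V)) = Idn V A \<star> LUnitInv V (Unit V)"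
    and mid4_Hom: "\<lbrakk>A \<in> Obj V; B \<in> Obj V; C \<in> Obj V; D \<in> Obj V\<rbrakk>
      \<Longrightarrow> mid4 V A B C D \<in> Hom V ((A \<boxtimes> B) \<boxtimes> (C \<boxtimes> D)) ((A \<boxtimes> C) \<boxtimes> (B \<boxtimes> D))"
    and mid4_nat: "\<lbrakk>A \<in> Obj V; A' \<in> Obj V; B \<in> Obj V; B' \<in> Obj V; C \<in> Obj V; C' \<in> Obj V;
      D \<in> Obj V; D' \<in> Obj V; f \<in> Hom V A A'; g \<in> Hom V B B'; h \<in> Hom V C C'; k \<in> Hom V D D'\<rbrakk>
      \<Longrightarrow> mid4 V A' B' C' D' \<cdot> ((f \<star> g) \<star> (h \<star> k)) = ((f \<star> h) \<star> (g \<star> k)) \<cdot> mid4 V A B C D"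
    and mid4_Unit: "mid4 V (Unit V) (Unit V) (Unit V) (Unit V)
      = Idn V ((Unit V \<boxtimes> Unit V) \<boxtimes> (Unit V \<boxtimes> Unit V))"
begin

text \<open>Membership in \<open>Hom V A B\<close> has to be matched against guessed objects. A
  unary predicate together with the functions \<open>dm\<close> and \<open>cd\<close> lets the
  simplifier compute all typings instead.\<close>

definition ar :: "'a \<Rightarrow> bool" where
  "ar f \<longleftrightarrow> dm f \<in> Obj V \<and> cd f \<in> Obj V \<and> f \<in> Hom V (dm f) (cd f)"

lemma Hom_iff: "\<lbrakk>A \<in> Obj V; B \<in> Obj V\<rbrakk> \<Longrightarrow> f \<in> Hom V A B \<longleftrightarrow> ar f \<and> dm f = A \<and> cd f = B"
  using Hom_dm_cd[of f A B] by (auto simp: ar_def)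

lemma ar_Hom: "ar f \<Longrightarrow> f \<in> Hom V (dm f) (cd f)"
  by (simp add: ar_def)

lemma ar_Obj [simp]: "ar f \<Longrightarrow> dm f \<in> Obj V" "ar f \<Longrightarrow> cd f \<in> Obj V"
  by (auto simp: ar_def)

lemma ar_basic [simp]:
  "A \<in> Obj V \<Longrightarrow> ar (Idn V A)" "A \<in> Obj V \<Longrightarrow> dm (Idn V A) = A" "A \<in> Obj V \<Longrightarrow> cd (Idn V A) = A"
  "A \<in> Obj V \<Longrightarrow> ar (LUnit V A)" "A \<in> Obj V \<Longrightarrow> dm (LUnit V A) = Unit V \<boxtimes> A"
  "A \<in> Obj V \<Longrightarrow> cd (LUnit V A) = A"
  "A \<in> Obj V \<Longrightarrow> ar (LUnitInv V A)" "A \<in> Obj V \<Longrightarrow> dm (LUnitInv V A) = A"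
  "A \<in> Obj V \<Longrightarrow> cd (LUnitInv V A) = Unit V \<boxtimes> A"
  "A \<in> Obj V \<Longrightarrow> ar (RUnit V A)" "A \<in> Obj V \<Longrightarrow> dm (RUnit V A) = A \<boxtimes> Unit V"
  "A \<in> Obj V \<Longrightarrow> cd (RUnit V A) = A"
  "A \<in> Obj V \<Longrightarrow> ar (RUnitInv V A)" "A \<in> Obj V \<Longrightarrow> dm (RUnitInv V A) = A"
  "A \<in> Obj V \<Longrightarrow> cd (RUnitInv V A) = A \<boxtimes> Unit V"
  using Idn_Hom[of A] LUnit_Hom[of A] LUnitInv_Hom[of A] RUnit_Hom[of A] RUnitInv_Hom[of A]
  by (auto simp: Hom_iff)

lemma ar_Assoc [simp]:
  assumes "A \<in> Obj V" "B \<in> Obj V" "C \<in> Obj V"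
  shows "ar (Assoc V A B C)" "dm (Assoc V A B C) = (A \<boxtimes> B) \<boxtimes> C" "cd (Assoc V A B C) = A \<boxtimes> (B \<boxtimes> C)"
  using Assoc_Hom[OF assms] assms by (auto simp: Hom_iff)

lemma ar_mid4 [simp]:
  assumes "A \<in> Obj V" "B \<in> Obj V" "C \<in> Obj V" "D \<in> Obj V"
  shows "ar (mid4 V A B C D)" "dm (mid4 V A B C D) = (A \<boxtimes> B) \<boxtimes> (C \<boxtimes> D)"
    "cd (mid4 V A B C D) = (A \<boxtimes> C) \<boxtimes> (B \<boxtimes> D)"
  using mid4_Hom[OF assms] assms by (auto simp: Hom_iff)

lemma ar_Comp [simp]:
  assumes "ar f" "ar g" "dm g = cd f"
  shows "ar (g \<cdot> f)" "dm (g \<cdot> f) = dm f" "cd (g \<cdot> f) = cd g"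
  using Comp_Hom[of "dm f" "cd f" "cd g" f g] assms Hom_iff by (auto simp: ar_Hom)

lemma ar_TenA [simp]:
  assumes "ar f" "ar g"
  shows "ar (f \<star> g)" "dm (f \<star> g) = dm f \<boxtimes> dm g" "cd (f \<star> g) = cd f \<boxtimes> cd g"
  using TenA_Hom[of "dm f" "cd f" "dm g" "cd g" f g] assms Hom_iff by (auto simp: ar_Hom)

lemma comp_assoc [simp]:
  "\<lbrakk>ar f; ar g; ar h; dm g = cd f; dm h = cd g\<rbrakk> \<Longrightarrow> (h \<cdot> g) \<cdot> f = h \<cdot> (g \<cdot> f)"
  using Comp_assoc[of "dm f" "cd f" "cd g" "cd h" f g h] by (simp add: Hom_iff)

lemma comp_Idn [simp]: "\<lbrakk>ar f; dm f = A\<rbrakk> \<Longrightarrow> f \<cdot> Idn V A = f"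
  and Idn_comp [simp]: "\<lbrakk>ar f; cd f = A\<rbrakk> \<Longrightarrow> Idn V A \<cdot> f = f"
  using Comp_Idn[of "dm f" "cd f" f] Idn_Comp[of "dm f" "cd f" f] by (auto simp: Hom_iff)

lemma ten_comp [simp]:
  "\<lbrakk>ar f; ar f'; ar g; ar g'; dm f' = cd f; dm g' = cd g\<rbrakk> \<Longrightarrow>
    (f' \<star> g') \<cdot> (f \<star> g) = (f' \<cdot> f) \<star> (g' \<cdot> g)"
  using TenA_Comp[of "dm f" "cd f" "cd f'" "dm g" "cd g" "cd g'" f f' g g'] by (simp add: Hom_iff)

lemma ten_comp' [simp]:
  "\<lbrakk>ar f; ar f'; ar g; ar g'; dm f' = cd f; dm g' = cd g; ar z; cd z = dm f \<boxtimes> dm g\<rbrakk> \<Longrightarrow>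
    (f' \<star> g') \<cdot> ((f \<star> g) \<cdot> z) = ((f' \<cdot> f) \<star> (g' \<cdot> g)) \<cdot> z"
  by (subst comp_assoc[symmetric]) simp_all

lemma ten_Idn [simp]: "\<lbrakk>A \<in> Obj V; B \<in> Obj V\<rbrakk> \<Longrightarrow> Idn V A \<star> Idn V B = Idn V (A \<boxtimes> B)"
  by (rule TenA_Idn)

text \<open>For rewriting in the middle of a composite associated to the right.\<close>

lemma extend2: "\<lbrakk>g \<cdot> f = k; ar f; ar g; dm g = cd f; ar z; cd z = dm f\<rbrakk> \<Longrightarrow> g \<cdot> (f \<cdot> z) = k \<cdot> z"
  by (auto simp flip: comp_assoc)

text \<open>Composites are kept associated to the right, and tensor products of arrows are merged by
  \<open>ten_comp\<close>. So a redex may be followed by a further arrow, may have one merged into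
  its first factor, or both; the four forms cover these cases.\<close>

lemma assoc_nat [simp]:
  assumes "ar f" "ar g" "ar h" "cd f = A" "cd g = B" "cd h = C"
  shows "Assoc V A B C \<cdot> ((f \<star> g) \<star> h) = (f \<star> (g \<star> h)) \<cdot> Assoc V (dm f) (dm g) (dm h)"
    "\<lbrakk>ar z; cd z = (dm f \<boxtimes> dm g) \<boxtimes> dm h\<rbrakk> \<Longrightarrow>
      Assoc V A B C \<cdot> (((f \<star> g) \<star> h) \<cdot> z) = (f \<star> (g \<star> h)) \<cdot> (Assoc V (dm f) (dm g) (dm h) \<cdot> z)"
    "\<lbrakk>ar z; cd z = dm f \<boxtimes> dm g\<rbrakk> \<Longrightarrow>
      Assoc V A B C \<cdot> (((f \<star> g) \<cdot> z) \<star> h)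
      = (f \<star> (g \<star> h)) \<cdot> (Assoc V (dm f) (dm g) (dm h) \<cdot> (z \<star> Idn V (dm h)))"
    "\<lbrakk>ar z; cd z = dm f \<boxtimes> dm g; ar w; cd w = dm z \<boxtimes> dm h\<rbrakk> \<Longrightarrow>
      Assoc V A B C \<cdot> ((((f \<star> g) \<cdot> z) \<star> h) \<cdot> w)
      = (f \<star> (g \<star> h)) \<cdot> (Assoc V (dm f) (dm g) (dm h) \<cdot> ((z \<star> Idn V (dm h)) \<cdot> w))"
proof -
  show 1: "Assoc V A B C \<cdot> ((f \<star> g) \<star> h) = (f \<star> (g \<star> h)) \<cdot> Assoc V (dm f) (dm g) (dm h)"
    using Assoc_nat[of "dm f" A "dm g" B "dm h" C f g h] assms by (auto simp: Hom_iff)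
  note a = assms(1-3) assms(4-6)[symmetric]
  show 2: "Assoc V A B C \<cdot> (((f \<star> g) \<star> h) \<cdot> z) = (f \<star> (g \<star> h)) \<cdot> (Assoc V (dm f) (dm g) (dm h) \<cdot> z)"
    if "ar z" "cd z = (dm f \<boxtimes> dm g) \<boxtimes> dm h" for z
    using extend2[OF 1, of z] that a by simp
  show "Assoc V A B C \<cdot> (((f \<star> g) \<cdot> z) \<star> h)
      = (f \<star> (g \<star> h)) \<cdot> (Assoc V (dm f) (dm g) (dm h) \<cdot> (z \<star> Idn V (dm h)))"
    if "ar z" "cd z = dm f \<boxtimes> dm g"
    using 2[of "z \<star> Idn V (dm h)"] that a by simp
  show "Assoc V A B C \<cdot> ((((f \<star> g) \<cdot> z) \<star> h) \<cdot> w)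
      = (f \<star> (g \<star> h)) \<cdot> (Assoc V (dm f) (dm g) (dm h) \<cdot> ((z \<star> Idn V (dm h)) \<cdot> w))"
    if "ar z" "cd z = dm f \<boxtimes> dm g" "ar w" "cd w = dm z \<boxtimes> dm h"
    using 2[of "(z \<star> Idn V (dm h)) \<cdot> w"] that a by simp
qed

lemma LUnit_inverse [simp]:
  assumes "A \<in> Obj V"
  shows "LUnit V A \<cdot> LUnitInv V A = Idn V A"
    "\<lbrakk>ar z; cd z = A\<rbrakk> \<Longrightarrow> LUnit V A \<cdot> (LUnitInv V A \<cdot> z) = z"
    "LUnitInv V A \<cdot> LUnit V A = Idn V (Unit V \<boxtimes> A)"
    "\<lbrakk>ar z; cd z = Unit V \<boxtimes> A\<rbrakk> \<Longrightarrow> LUnitInv V A \<cdot> (LUnit V A \<cdot> z) = z"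
  subgoal by (rule LUnit_LUnitInv[OF assms])
  subgoal using extend2[OF LUnit_LUnitInv[OF assms], of z] assms by simp
  subgoal by (rule LUnitInv_LUnit[OF assms])
  subgoal using extend2[OF LUnitInv_LUnit[OF assms], of z] assms by simp
  done

lemma RUnit_inverse [simp]:
  assumes "A \<in> Obj V"
  shows "RUnit V A \<cdot> RUnitInv V A = Idn V A"
    "\<lbrakk>ar z; cd z = A\<rbrakk> \<Longrightarrow> RUnit V A \<cdot> (RUnitInv V A \<cdot> z) = z"
    "RUnitInv V A \<cdot> RUnit V A = Idn V (A \<boxtimes> Unit V)"
    "\<lbrakk>ar z; cd z = A \<boxtimes> Unit V\<rbrakk> \<Longrightarrow> RUnitInv V A \<cdot> (RUnit V A \<cdot> z) = z"
  subgoal by (rule RUnit_RUnitInv[OF assms])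
  subgoal using extend2[OF RUnit_RUnitInv[OF assms], of z] assms by simp
  subgoal by (rule RUnitInv_RUnit[OF assms])
  subgoal using extend2[OF RUnitInv_RUnit[OF assms], of z] assms by simp
  done

lemma LUnit_ten: "\<lbrakk>ar f; cd f = B\<rbrakk> \<Longrightarrow> LUnit V B \<cdot> (Idn V (Unit V) \<star> f) = f \<cdot> LUnit V (dm f)"
  using LUnit_nat[of "dm f" "cd f" f] by (auto simp: ar_Hom)

lemma RUnit_ten: "\<lbrakk>ar f; cd f = B\<rbrakk> \<Longrightarrow> RUnit V B \<cdot> (f \<star> Idn V (Unit V)) = f \<cdot> RUnit V (dm f)"
  using RUnit_nat[of "dm f" "cd f" f] by (auto simp: ar_Hom)

text \<open>Naturality of the inverse, by conjugating that of \<open>LUnit\<close>. As rewrite rules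
  these equations move inverse unit isomorphisms to the right end of a composite, which is where
  they stand in \<open>lact\<close> and \<open>ract\<close>.\<close>

lemma LUnitInv_comp [simp]:
  assumes "ar f" "cd f = B"
  shows "LUnitInv V B \<cdot> f = (Idn V (Unit V) \<star> f) \<cdot> LUnitInv V (dm f)"
    "\<lbrakk>ar z; cd z = dm f\<rbrakk> \<Longrightarrow> LUnitInv V B \<cdot> (f \<cdot> z) = (Idn V (Unit V) \<star> f) \<cdot> (LUnitInv V (dm f) \<cdot> z)"
proof -
  have "B \<in> Obj V" using assms by auto
  have "f = LUnit V B \<cdot> ((Idn V (Unit V) \<star> f) \<cdot> LUnitInv V (dm f))"
    using extend2[OF LUnit_ten[OF assms], of "LUnitInv V (dm f)"] assms by auto
  then show *: "LUnitInv V B \<cdot> f = (Idn V (Unit V) \<star> f) \<cdot> LUnitInv V (dm f)"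
    using LUnit_inverse(4)[of B "(Idn V (Unit V) \<star> f) \<cdot> LUnitInv V (dm f)"] assms \<open>B \<in> Obj V\<close> by auto
  show "LUnitInv V B \<cdot> (f \<cdot> z) = (Idn V (Unit V) \<star> f) \<cdot> (LUnitInv V (dm f) \<cdot> z)" if "ar z" "cd z = dm f"
    using extend2[OF *, of z] that assms \<open>B \<in> Obj V\<close> by simp
qed

lemma RUnitInv_comp [simp]:
  assumes "ar f" "cd f = B"
  shows "RUnitInv V B \<cdot> f = (f \<star> Idn V (Unit V)) \<cdot> RUnitInv V (dm f)"
    "\<lbrakk>ar z; cd z = dm f\<rbrakk> \<Longrightarrow> RUnitInv V B \<cdot> (f \<cdot> z) = (f \<star> Idn V (Unit V)) \<cdot> (RUnitInv V (dm f) \<cdot> z)"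
proof -
  have "B \<in> Obj V" using assms by auto
  have "f = RUnit V B \<cdot> ((f \<star> Idn V (Unit V)) \<cdot> RUnitInv V (dm f))"
    using extend2[OF RUnit_ten[OF assms], of "RUnitInv V (dm f)"] assms by auto
  then show *: "RUnitInv V B \<cdot> f = (f \<star> Idn V (Unit V)) \<cdot> RUnitInv V (dm f)"
    using RUnit_inverse(4)[of B "(f \<star> Idn V (Unit V)) \<cdot> RUnitInv V (dm f)"] assms \<open>B \<in> Obj V\<close> by auto
  show "RUnitInv V B \<cdot> (f \<cdot> z) = (f \<star> Idn V (Unit V)) \<cdot> (RUnitInv V (dm f) \<cdot> z)" if "ar z" "cd z = dm f"
    using extend2[OF *, of z] that assms \<open>B \<in> Obj V\<close> by simp
qed

lemma assoc_unit [simp]: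
  assumes "A \<in> Obj V" "ar z"
  shows "cd z = Unit V \<boxtimes> A \<Longrightarrow>
      Assoc V (Unit V) (Unit V) A \<cdot> ((LUnitInv V (Unit V) \<star> Idn V A) \<cdot> z)
      = (Idn V (Unit V) \<star> LUnitInv V A) \<cdot> z"
    "Assoc V (Unit V) A (Unit V) \<cdot> ((LUnitInv V A \<star> Idn V (Unit V)) \<cdot> RUnitInv V A)
      = (Idn V (Unit V) \<star> RUnitInv V A) \<cdot> LUnitInv V A"
    "cd z = A \<boxtimes> Unit V \<Longrightarrow>
      Assoc V A (Unit V) (Unit V) \<cdot> ((RUnitInv V A \<star> Idn V (Unit V)) \<cdot> z)
      = (Idn V A \<star> LUnitInv V (Unit V)) \<cdot> z"
  using extend2[OF Assoc_Unit_left, of A z] extend2[OF Assoc_Unit_right, of A z] assms Assoc_Unit_outer[of A]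
  by auto

lemma mid4_comp [simp]:
  assumes "ar f" "ar g" "ar h" "ar k" "cd f = A" "cd g = B" "cd h = C" "cd k = D"
  shows "mid4 V A B C D \<cdot> ((f \<star> g) \<star> (h \<star> k))
      = ((f \<star> h) \<star> (g \<star> k)) \<cdot> mid4 V (dm f) (dm g) (dm h) (dm k)"
    "\<lbrakk>ar z; cd z = (dm f \<boxtimes> dm g) \<boxtimes> (dm h \<boxtimes> dm k)\<rbrakk> \<Longrightarrow>
      mid4 V A B C D \<cdot> (((f \<star> g) \<star> (h \<star> k)) \<cdot> z)
      = ((f \<star> h) \<star> (g \<star> k)) \<cdot> (mid4 V (dm f) (dm g) (dm h) (dm k) \<cdot> z)"
proof -
  show 1: "mid4 V A B C D \<cdot> ((f \<star> g) \<star> (h \<star> k))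
      = ((f \<star> h) \<star> (g \<star> k)) \<cdot> mid4 V (dm f) (dm g) (dm h) (dm k)"
    using mid4_nat[of "dm f" A "dm g" B "dm h" C "dm k" D f g h k] assms by (auto simp: Hom_iff)
  show "mid4 V A B C D \<cdot> (((f \<star> g) \<star> (h \<star> k)) \<cdot> z)
      = ((f \<star> h) \<star> (g \<star> k)) \<cdot> (mid4 V (dm f) (dm g) (dm h) (dm k) \<cdot> z)"
    if "ar z" "cd z = (dm f \<boxtimes> dm g) \<boxtimes> (dm h \<boxtimes> dm k)"
    using extend2[OF 1, of z] that assms by auto
qed

section \<open>Multiplication by elements\<close>

text \<open>An arrow \<open>a\<close> from the unit object is regarded as an element, by which arrows are multiplied along \<open>m\<close>.
  The naturality conditions and the compositions of 2-cells are such products.\<close>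

definition lact :: "'o \<Rightarrow> 'a \<Rightarrow> 'a \<Rightarrow> 'a \<Rightarrow> 'a" where
  "lact P m a f = m \<cdot> (a \<star> f) \<cdot> LUnitInv V P"

definition ract :: "'o \<Rightarrow> 'a \<Rightarrow> 'a \<Rightarrow> 'a \<Rightarrow> 'a" where
  "ract P m f a = m \<cdot> (f \<star> a) \<cdot> RUnitInv V P"

lemma ar_act [simp]:
  assumes "ar m" "ar a" "ar f" "dm a = Unit V" "dm f = P"
  shows "dm m = cd a \<boxtimes> cd f \<Longrightarrow> ar (lact P m a f)" "dm m = cd a \<boxtimes> cd f \<Longrightarrow> dm (lact P m a f) = P"
    "dm m = cd a \<boxtimes> cd f \<Longrightarrow> cd (lact P m a f) = cd m"
    "dm m = cd f \<boxtimes> cd a \<Longrightarrow> ar (ract P m f a)" "dm m = cd f \<boxtimes> cd a \<Longrightarrow> dm (ract P m f a) = P"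
    "dm m = cd f \<boxtimes> cd a \<Longrightarrow> cd (ract P m f a) = cd m"
  using assms(1-4) assms(5)[symmetric] by (auto simp: lact_def ract_def)

text \<open>For two elements the left and the right action are the same product, because the two
  inverse unit isomorphisms agree at the unit object.\<close>

lemma lact_Unit_eq_ract: "lact (Unit V) m a b = ract (Unit V) m a b"
  by (simp add: lact_def ract_def RUnitInv_Unit)

text \<open>\<open>law\<close> is an instance of associativity in an enriched category, for three
  consecutive hom-objects \<open>P\<close>, \<open>Q\<close>, \<open>S\<close>; \<open>m1\<close> to
  \<open>m4\<close> are the four multiplications that occur in it.\<close>

context
  fixes m1 m2 m3 m4 P Q S
  assumes m: "ar m1" "ar m2" "ar m3" "ar m4" "P \<in> Obj V" "Q \<in> Obj V" "S \<in> Obj V"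
    "dm m4 = P \<boxtimes> Q" "dm m3 = cd m4 \<boxtimes> S" "dm m2 = Q \<boxtimes> S" "dm m1 = P \<boxtimes> cd m2"
    and law: "m3 \<cdot> (m4 \<star> Idn V S) = m1 \<cdot> (Idn V P \<star> m2) \<cdot> Assoc V P Q S"
begin

lemma law_extend:
  assumes "ar z" "cd z = (P \<boxtimes> Q) \<boxtimes> S"
  shows "m3 \<cdot> ((m4 \<star> Idn V S) \<cdot> z) = m1 \<cdot> ((Idn V P \<star> m2) \<cdot> (Assoc V P Q S \<cdot> z))"
  using extend2[OF law, of z] assms m by simp

text \<open>The three lemmas treat a product of two elements and one arrow. The arrow stands last
  here, in the middle in \<open>ract_lact\<close> and first in \<open>ract_ract\<close>; each
  position uses the equation of \<open>assoc_unit\<close> that belongs to it.\<close>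

lemma lact_lact:
  assumes "ar a" "ar b" "ar f" "dm a = Unit V" "dm b = Unit V" "cd a = P" "cd b = Q" "cd f = S" "dm f = X"
  shows "lact X m1 a (lact X m2 b f) = lact X m3 (lact (Unit V) m4 a b) f"
  using law_extend[of "((a \<star> b) \<star> f) \<cdot> ((LUnitInv V (Unit V) \<star> Idn V X) \<cdot> LUnitInv V X)"] m assms
  by (auto simp: lact_def)

lemma ract_lact:
  assumes "ar a" "ar b" "ar f" "dm a = Unit V" "dm b = Unit V" "cd a = P" "cd f = Q" "cd b = S" "dm f = X"
  shows "ract X m3 (lact X m4 a f) b = lact X m1 a (ract X m2 f b)"
  using law_extend[of "((a \<star> f) \<star> b) \<cdot> ((LUnitInv V X \<star> Idn V (Unit V)) \<cdot> RUnitInv V X)"] m assms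
  by (auto simp: lact_def ract_def)

lemma ract_ract:
  assumes "ar a" "ar b" "ar f" "dm a = Unit V" "dm b = Unit V" "cd f = P" "cd a = Q" "cd b = S" "dm f = X"
  shows "ract X m3 (ract X m4 f a) b = ract X m1 f (lact (Unit V) m2 a b)"
  using law_extend[of "((f \<star> a) \<star> b) \<cdot> ((RUnitInv V X \<star> Idn V (Unit V)) \<cdot> RUnitInv V X)"] m assms
  by (auto simp: lact_def ract_def)

end

lemma lact_unit:
  assumes "ar m" "ar e" "ar f" "dm e = Unit V" "dm m = cd e \<boxtimes> S" "cd f = S" "dm f = X"
    and "m \<cdot> (e \<star> Idn V S) = LUnit V S"
  shows "lact X m e f = f"
proof -
  have "m \<cdot> ((e \<star> Idn V S) \<cdot> ((Idn V (Unit V) \<star> f) \<cdot> LUnitInv V X)) = LUnit V S \<cdot> ((Idn V (Unit V) \<star> f) \<cdot> LUnitInv V X)"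
    by (rule extend2) (use assms in auto)
  then show ?thesis using assms LUnit_ten[of f S]
    using extend2[OF LUnit_ten[of f S], of "LUnitInv V X"] by (auto simp: lact_def)
qed

lemma ract_unit:
  assumes "ar m" "ar e" "ar f" "dm e = Unit V" "dm m = S \<boxtimes> cd e" "cd f = S" "dm f = X"
    and "m \<cdot> (Idn V S \<star> e) = RUnit V S"
  shows "ract X m f e = f"
proof -
  have "m \<cdot> ((Idn V S \<star> e) \<cdot> ((f \<star> Idn V (Unit V)) \<cdot> RUnitInv V X)) = RUnit V S \<cdot> ((f \<star> Idn V (Unit V)) \<cdot> RUnitInv V X)"
    by (rule extend2) (use assms in auto)
  then show ?thesis using assms RUnit_ten[of f S]
    using extend2[OF RUnit_ten[of f S], of "RUnitInv V X"] by (auto simp: ract_def)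
qed

text \<open>\<open>law\<close> is multiplicativity of an enriched functor with components
  \<open>f\<close>, \<open>g\<close>, \<open>h\<close>; functors therefore preserve products with
  elements.\<close>

lemma comp_lact:
  assumes "ar m" "ar m'" "ar f" "ar g" "ar h" "ar a" "ar b" "dm m = dm g \<boxtimes> dm h" "cd m = dm f"
    "dm m' = cd g \<boxtimes> cd h" "dm a = Unit V" "cd a = dm g" "cd b = dm h" "dm b = X"
    and law: "m' \<cdot> (g \<star> h) = f \<cdot> m"
  shows "f \<cdot> lact X m a b = lact X m' (g \<cdot> a) (h \<cdot> b)"
  using extend2[OF law, of "(a \<star> b) \<cdot> LUnitInv V X"] assms by (auto simp: lact_def)

lemma comp_ract:
  assumes "ar m" "ar m'" "ar f" "ar g" "ar h" "ar a" "ar b" "dm m = dm g \<boxtimes> dm h" "cd m = dm f"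
    "dm m' = cd g \<boxtimes> cd h" "dm b = Unit V" "cd a = dm g" "cd b = dm h" "dm a = X"
    and law: "m' \<cdot> (g \<star> h) = f \<cdot> m"
  shows "f \<cdot> ract X m a b = ract X m' (g \<cdot> a) (h \<cdot> b)"
  using extend2[OF law, of "(a \<star> b) \<cdot> RUnitInv V X"] assms by (auto simp: ract_def)

lemma lact_comp:
  assumes "ar m" "ar a" "ar f" "ar u" "dm m = cd a \<boxtimes> cd f" "dm a = Unit V" "dm f = P" "cd u = P" "dm u = X"
  shows "lact P m a f \<cdot> u = lact X m a (f \<cdot> u)"
  using assms by (auto simp: lact_def)

lemma ract_comp:
  assumes "ar m" "ar a" "ar f" "ar u" "dm m = cd f \<boxtimes> cd a" "dm a = Unit V" "dm f = P" "cd u = P" "dm u = X"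
  shows "ract P m f a \<cdot> u = ract X m (f \<cdot> u) a"
  using assms by (auto simp: ract_def)

end

section \<open>Categories enriched in coalgebras\<close>

lemma coalgebras_sel [simp]:
  "Obj (coalgebras V) = {C. is_coalg V C}"
  "Idn (coalgebras V) = (\<lambda>C. Idn V (cobj C))"
  "Comp (coalgebras V) = Comp V"
  "Ten (coalgebras V) = (\<lambda>C D. \<lparr>cobj = cobj C \<boxtimes>\<^bsub>V\<^esub> cobj D,
     comul = mid4 V (cobj C) (cobj C) (cobj D) (cobj D) \<cdot>\<^bsub>V\<^esub> (comul C \<star>\<^bsub>V\<^esub> comul D),
     counit = LUnit V (Unit V) \<cdot>\<^bsub>V\<^esub> (counit C \<star>\<^bsub>V\<^esub> counit D)\<rparr>)"
  "TenA (coalgebras V) = TenA V"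
  "Unit (coalgebras V) = \<lparr>cobj = Unit V, comul = LUnitInv V (Unit V), counit = Idn V (Unit V)\<rparr>"
  "Assoc (coalgebras V) = (\<lambda>C D E. Assoc V (cobj C) (cobj D) (cobj E))"
  "LUnit (coalgebras V) = (\<lambda>C. LUnit V (cobj C))"
  "LUnitInv (coalgebras V) = (\<lambda>C. LUnitInv V (cobj C))"
  "RUnit (coalgebras V) = (\<lambda>C. RUnit V (cobj C))"
  "RUnitInv (coalgebras V) = (\<lambda>C. RUnitInv V (cobj C))"
  by (simp_all add: coalgebras_def)

lemma Hom_coalgebras: "f \<in> Hom (coalgebras V) C D \<longleftrightarrow> f \<in> Hom V (cobj C) (cobj D) \<and>
    comul D \<cdot>\<^bsub>V\<^esub> f = (f \<star>\<^bsub>V\<^esub> f) \<cdot>\<^bsub>V\<^esub> comul C \<and> counit D \<cdot>\<^bsub>V\<^esub> f = counit C"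
  by (simp add: coalgebras_def)

context symmon
begin

abbreviation K :: "(('o, 'a) coalg, 'a) mon_cat" where "K \<equiv> coalgebras V"

text \<open>Only the typing of the structure maps. A hom-set of \<open>coalgebras V\<close> refers
  to its source and target through these maps alone, so a tensor product of coalgebras can serve as
  a source without a proof that it satisfies the axioms, which would call for more
  coherence.\<close>

definition precoalg :: "('o, 'a) coalg \<Rightarrow> bool" where
  "precoalg C \<longleftrightarrow> cobj C \<in> Obj V \<and> ar (comul C) \<and> dm (comul C) = cobj C \<and>
     cd (comul C) = cobj C \<boxtimes> cobj C \<and> ar (counit C) \<and> dm (counit C) = cobj C \<and> cd (counit C) = Unit V"

lemma precoalgD [simp]:
  assumes "precoalg C"
  shows "cobj C \<in> Obj V" "ar (comul C)" "dm (comul C) = cobj C" "cd (comul C) = cobj C \<boxtimes> cobj C"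
    "ar (counit C)" "dm (counit C) = cobj C" "cd (counit C) = Unit V"
  using assms by (auto simp: precoalg_def)

lemma coalg_precoalg: "is_coalg V C \<Longrightarrow> precoalg C"
  unfolding is_coalg_def Let_def precoalg_def by (auto simp: Hom_iff)

lemma precoalg_Unit [simp]: "precoalg (Unit K)"
  by (simp add: precoalg_def)

lemma precoalg_Ten [simp]: "\<lbrakk>precoalg C; precoalg D\<rbrakk> \<Longrightarrow> precoalg (Ten K C D)"
  unfolding precoalg_def[of "Ten K C D"] by simp

declare precoalg_Unit [simplified, simp] precoalg_Ten [simplified, simp]

lemma K_HomD:
  assumes "f \<in> Hom K C D" "precoalg C" "precoalg D"
  shows "ar f" "dm f = cobj C" "cd f = cobj D"
  using assms by (auto simp: Hom_coalgebras Hom_iff)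

lemma K_Hom_iff: "\<lbrakk>precoalg C; precoalg D\<rbrakk> \<Longrightarrow> f \<in> Hom K C D \<longleftrightarrow> ar f \<and> dm f = cobj C \<and> cd f = cobj D \<and>
    comul D \<cdot> f = (f \<star> f) \<cdot> comul C \<and> counit D \<cdot> f = counit C"
  by (auto simp: Hom_coalgebras Hom_iff)

lemma K_Idn: "precoalg C \<Longrightarrow> Idn V (cobj C) \<in> Hom K C C"
  by (simp add: K_Hom_iff)

lemma K_Comp:
  assumes "f \<in> Hom K C D" "g \<in> Hom K D E" "precoalg C" "precoalg D" "precoalg E"
  shows "g \<cdot> f \<in> Hom K C E"
proof -
  have f: "comul D \<cdot> f = (f \<star> f) \<cdot> comul C" "counit D \<cdot> f = counit C"
    and g: "comul E \<cdot> g = (g \<star> g) \<cdot> comul D" "counit E \<cdot> g = counit D"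
    using assms by (auto simp: Hom_coalgebras)
  note [simp] = K_HomD[OF assms(1,3,4)] K_HomD[OF assms(2,4,5)] assms(3-5)
  show ?thesis using extend2[OF g(1), of f] extend2[OF g(2), of f] f by (simp add: K_Hom_iff)
qed

lemma K_Ten:
  assumes "f \<in> Hom K C C'" "g \<in> Hom K D D'" "precoalg C" "precoalg C'" "precoalg D" "precoalg D'"
  shows "f \<star> g \<in> Hom K (Ten K C D) (Ten K C' D')"
proof -
  have f: "comul C' \<cdot> f = (f \<star> f) \<cdot> comul C" "counit C' \<cdot> f = counit C"
    and g: "comul D' \<cdot> g = (g \<star> g) \<cdot> comul D" "counit D' \<cdot> g = counit D"
    using assms by (auto simp: Hom_coalgebras)
  note [simp] = K_HomD[OF assms(1,3,4)] K_HomD[OF assms(2,5,6)] assms(3-6)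
  have "mid4 V (cobj C') (cobj C') (cobj D') (cobj D') \<cdot> (((f \<star> f) \<star> (g \<star> g)) \<cdot> (comul C \<star> comul D))
     = ((f \<star> g) \<star> (f \<star> g)) \<cdot> (mid4 V (cobj C) (cobj C) (cobj D) (cobj D) \<cdot> (comul C \<star> comul D))"
    by (subst mid4_comp(2)) simp_all
  then show ?thesis using f g
    by (subst K_Hom_iff) simp_all
qed

text \<open>The comultiplication law compares two maps from the unit object to its fourfold tensor
  power; they agree because \<open>mid4\<close> is the identity there.\<close>

lemma K_LUnitInv: "LUnitInv V (Unit V) \<in> Hom K (Unit K) (Ten K (Unit K) (Unit K))"
  using precoalg_Ten[OF precoalg_Unit precoalg_Unit]
  by (subst K_Hom_iff) (simp_all add: mid4_Unit)

text \<open>Elements in \<open>coalgebras V\<close> are the abstract form of grouplike elements, and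
  their product is a composite of coalgebra morphisms. This types both compositions of
  2-cells.\<close>

lemma K_lact:
  assumes "a \<in> Hom K (Unit K) C" "b \<in> Hom K (Unit K) D" "m \<in> Hom K (Ten K C D) E"
    "precoalg C" "precoalg D" "precoalg E"
  shows "lact (Unit V) m a b \<in> Hom K (Unit K) E"
proof -
  have "a \<star> b \<in> Hom K (Ten K (Unit K) (Unit K)) (Ten K C D)"
    by (rule K_Ten) (use assms precoalg_Unit in \<open>simp_all del: coalgebras_sel\<close>)
  then have "(a \<star> b) \<cdot> LUnitInv V (Unit V) \<in> Hom K (Unit K) (Ten K C D)"
    by (rule K_Comp[OF K_LUnitInv]) (use assms precoalg_Unit precoalg_Ten in \<open>simp_all del: coalgebras_sel\<close>)
  then show ?thesis unfolding lact_def
    by (rule K_Comp[OF _ assms(3)]) (use assms precoalg_Unit precoalg_Ten in \<open>simp_all del: coalgebras_sel\<close>)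
qed

section \<open>The data of enriched categories, functors and transformations\<close>

lemma wcatD:
  assumes A: "is_wcat K A"
  shows wcat_ext: "whom A \<in> extensional (wpts A \<times> wpts A)"
      "wmul A \<in> extensional (wpts A \<times> wpts A \<times> wpts A)" "wunit A \<in> extensional (wpts A)"
    and wcat_coalg: "\<lbrakk>x \<in> wpts A; y \<in> wpts A\<rbrakk> \<Longrightarrow> is_coalg V (whom A (x, y))"
    and wcat_mul: "\<lbrakk>x \<in> wpts A; y \<in> wpts A; z \<in> wpts A\<rbrakk> \<Longrightarrow>
      wmul A (x, y, z) \<in> Hom K (Ten K (whom A (x, y)) (whom A (y, z))) (whom A (x, z))"
    and wcat_unit: "x \<in> wpts A \<Longrightarrow> wunit A x \<in> Hom K (Unit K) (whom A (x, x))"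
    and wcat_assoc: "\<lbrakk>x \<in> wpts A; y \<in> wpts A; z \<in> wpts A; u \<in> wpts A\<rbrakk> \<Longrightarrow>
      wmul A (x, z, u) \<cdot> (wmul A (x, y, z) \<star> Idn V (cobj (whom A (z, u))))
        = wmul A (x, y, u) \<cdot> (Idn V (cobj (whom A (x, y))) \<star> wmul A (y, z, u))
            \<cdot> Assoc V (cobj (whom A (x, y))) (cobj (whom A (y, z))) (cobj (whom A (z, u)))"
    and wcat_lunit: "\<lbrakk>x \<in> wpts A; y \<in> wpts A\<rbrakk> \<Longrightarrow>
      wmul A (x, x, y) \<cdot> (wunit A x \<star> Idn V (cobj (whom A (x, y)))) = LUnit V (cobj (whom A (x, y)))"
    and wcat_runit: "\<lbrakk>x \<in> wpts A; y \<in> wpts A\<rbrakk> \<Longrightarrow>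
      wmul A (x, y, y) \<cdot> (Idn V (cobj (whom A (x, y))) \<star> wunit A y) = RUnit V (cobj (whom A (x, y)))"
proof -
  note * = A[unfolded is_wcat_def Let_def]
  show "whom A \<in> extensional (wpts A \<times> wpts A)" "wmul A \<in> extensional (wpts A \<times> wpts A \<times> wpts A)"
    "wunit A \<in> extensional (wpts A)" using * by (auto simp: PiE_def)
  show "\<lbrakk>x \<in> wpts A; y \<in> wpts A\<rbrakk> \<Longrightarrow> is_coalg V (whom A (x, y))"
    using *[THEN conjunct1] by (auto simp: PiE_iff)
  show "\<lbrakk>x \<in> wpts A; y \<in> wpts A; z \<in> wpts A\<rbrakk> \<Longrightarrow>
      wmul A (x, y, z) \<in> Hom K (Ten K (whom A (x, y)) (whom A (y, z))) (whom A (x, z))"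
    using *[THEN conjunct2, THEN conjunct1] by (auto simp: PiE_iff)
  show "x \<in> wpts A \<Longrightarrow> wunit A x \<in> Hom K (Unit K) (whom A (x, x))"
    using *[THEN conjunct2, THEN conjunct2, THEN conjunct1] by (auto simp: PiE_iff)
qed (use A[unfolded is_wcat_def Let_def] in \<open>simp_all\<close>)

lemma wcat_ar [simp]:
  assumes A: "is_wcat K A"
  shows "\<lbrakk>x \<in> wpts A; y \<in> wpts A\<rbrakk> \<Longrightarrow> precoalg (whom A (x, y))"
    "\<lbrakk>x \<in> wpts A; y \<in> wpts A; z \<in> wpts A\<rbrakk> \<Longrightarrow> ar (wmul A (x, y, z))"
    "\<lbrakk>x \<in> wpts A; y \<in> wpts A; z \<in> wpts A\<rbrakk> \<Longrightarrow>
      dm (wmul A (x, y, z)) = cobj (whom A (x, y)) \<boxtimes> cobj (whom A (y, z))"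
    "\<lbrakk>x \<in> wpts A; y \<in> wpts A; z \<in> wpts A\<rbrakk> \<Longrightarrow> cd (wmul A (x, y, z)) = cobj (whom A (x, z))"
    "x \<in> wpts A \<Longrightarrow> ar (wunit A x)" "x \<in> wpts A \<Longrightarrow> dm (wunit A x) = Unit V"
    "x \<in> wpts A \<Longrightarrow> cd (wunit A x) = cobj (whom A (x, x))"
proof -
  show p: "precoalg (whom A (x, y))" if "x \<in> wpts A" "y \<in> wpts A" for x y
    using coalg_precoalg[OF wcat_coalg[OF A that]] .
  show "ar (wmul A (x, y, z))" "dm (wmul A (x, y, z)) = cobj (whom A (x, y)) \<boxtimes> cobj (whom A (y, z))"
    "cd (wmul A (x, y, z)) = cobj (whom A (x, z))" if "x \<in> wpts A" "y \<in> wpts A" "z \<in> wpts A"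
    using K_HomD[OF wcat_mul[OF A that]] p that by simp_all
  show "ar (wunit A x)" "dm (wunit A x) = Unit V" "cd (wunit A x) = cobj (whom A (x, x))" if "x \<in> wpts A"
    using K_HomD[OF wcat_unit[OF A that]] p that by simp_all
qed

lemma w_lact_lact:
  "\<lbrakk>is_wcat K A; x \<in> wpts A; y \<in> wpts A; z \<in> wpts A; u \<in> wpts A; ar a; ar b; ar f; dm a = Unit V; dm b = Unit V;
    cd a = cobj (whom A (x, y)); cd b = cobj (whom A (y, z)); cd f = cobj (whom A (z, u)); dm f = P\<rbrakk> \<Longrightarrow>
    lact P (wmul A (x, z, u)) (lact (Unit V) (wmul A (x, y, z)) a b) f
    = lact P (wmul A (x, y, u)) a (lact P (wmul A (y, z, u)) b f)"
  by (rule lact_lact[OF _ _ _ _ _ _ _ _ _ _ _ wcat_assoc, symmetric]) simp_all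

lemma w_ract_lact:
  "\<lbrakk>is_wcat K A; x \<in> wpts A; y \<in> wpts A; z \<in> wpts A; u \<in> wpts A; ar a; ar b; ar f; dm a = Unit V; dm b = Unit V;
    cd a = cobj (whom A (x, y)); cd f = cobj (whom A (y, z)); cd b = cobj (whom A (z, u)); dm f = P\<rbrakk> \<Longrightarrow>
    ract P (wmul A (x, z, u)) (lact P (wmul A (x, y, z)) a f) b
    = lact P (wmul A (x, y, u)) a (ract P (wmul A (y, z, u)) f b)"
  by (rule ract_lact[OF _ _ _ _ _ _ _ _ _ _ _ wcat_assoc]) simp_all

lemma w_ract_ract:
  "\<lbrakk>is_wcat K A; x \<in> wpts A; y \<in> wpts A; z \<in> wpts A; u \<in> wpts A; ar a; ar b; ar f; dm a = Unit V; dm b = Unit V;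
    cd f = cobj (whom A (x, y)); cd a = cobj (whom A (y, z)); cd b = cobj (whom A (z, u)); dm f = P\<rbrakk> \<Longrightarrow>
    ract P (wmul A (x, y, u)) f (lact (Unit V) (wmul A (y, z, u)) a b)
    = ract P (wmul A (x, z, u)) (ract P (wmul A (x, y, z)) f a) b"
  by (rule ract_ract[OF _ _ _ _ _ _ _ _ _ _ _ wcat_assoc, symmetric]) simp_all

lemma w_lact_unit:
  "\<lbrakk>is_wcat K A; x \<in> wpts A; y \<in> wpts A; ar f; cd f = cobj (whom A (x, y)); dm f = P\<rbrakk> \<Longrightarrow>
    lact P (wmul A (x, x, y)) (wunit A x) f = f"
  by (rule lact_unit[OF _ _ _ _ _ _ _ wcat_lunit]) simp_all

lemma w_ract_unit:
  "\<lbrakk>is_wcat K A; x \<in> wpts A; y \<in> wpts A; ar f; cd f = cobj (whom A (x, y)); dm f = P\<rbrakk> \<Longrightarrow>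
    ract P (wmul A (x, y, y)) f (wunit A y) = f"
  by (rule ract_unit[OF _ _ _ _ _ _ _ wcat_runit]) simp_all

lemma wfunD:
  assumes F: "F \<in> wfunctors K A B"
  shows wfun_dom_cod: "dom1 F = A" "cod1 F = B"
    and wfun_ext: "pmap F \<in> extensional (wpts A)" "amap F \<in> extensional (wpts A \<times> wpts A)"
    and wfun_pt: "x \<in> wpts A \<Longrightarrow> pmap F x \<in> wpts B"
    and wfun_Hom: "\<lbrakk>x \<in> wpts A; y \<in> wpts A\<rbrakk> \<Longrightarrow>
      amap F (x, y) \<in> Hom K (whom A (x, y)) (whom B (pmap F x, pmap F y))"
    and wfun_mul: "\<lbrakk>x \<in> wpts A; y \<in> wpts A; z \<in> wpts A\<rbrakk> \<Longrightarrow>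
      wmul B (pmap F x, pmap F y, pmap F z) \<cdot> (amap F (x, y) \<star> amap F (y, z)) = amap F (x, z) \<cdot> wmul A (x, y, z)"
    and wfun_unit: "x \<in> wpts A \<Longrightarrow> amap F (x, x) \<cdot> wunit A x = wunit B (pmap F x)"
  using F unfolding wfunctors_def Let_def by (auto simp: PiE_iff)

lemma wfunctorsI:
  assumes "dom1 F = A" "cod1 F = B" "pmap F \<in> extensional (wpts A)" "amap F \<in> extensional (wpts A \<times> wpts A)"
    and "\<And>x. x \<in> wpts A \<Longrightarrow> pmap F x \<in> wpts B"
    and "\<And>x y. \<lbrakk>x \<in> wpts A; y \<in> wpts A\<rbrakk> \<Longrightarrow>
      amap F (x, y) \<in> Hom K (whom A (x, y)) (whom B (pmap F x, pmap F y))"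
    and "\<And>x y z. \<lbrakk>x \<in> wpts A; y \<in> wpts A; z \<in> wpts A\<rbrakk> \<Longrightarrow>
      wmul B (pmap F x, pmap F y, pmap F z) \<cdot> (amap F (x, y) \<star> amap F (y, z)) = amap F (x, z) \<cdot> wmul A (x, y, z)"
    and "\<And>x. x \<in> wpts A \<Longrightarrow> amap F (x, x) \<cdot> wunit A x = wunit B (pmap F x)"
  shows "F \<in> wfunctors K A B"
  using assms unfolding wfunctors_def Let_def by (auto simp: PiE_iff)

text \<open>An arrow component of a 1-cell determines neither source nor target of the 1-cell,
  so these facts are stated in terms of \<open>dom1\<close> and \<open>cod1\<close>.\<close>

definition wf1 :: "(('x, ('o, 'a) coalg, 'a) wcat, 'x, 'a) one_cell \<Rightarrow> bool" where
  "wf1 F \<longleftrightarrow> is_wcat K (dom1 F) \<and> is_wcat K (cod1 F) \<and> F \<in> wfunctors K (dom1 F) (cod1 F)"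

lemma wf1_ar [simp]:
  assumes "wf1 F"
  shows "is_wcat K (dom1 F)" "is_wcat K (cod1 F)" "x \<in> wpts (dom1 F) \<Longrightarrow> pmap F x \<in> wpts (cod1 F)"
    "\<lbrakk>x \<in> wpts (dom1 F); y \<in> wpts (dom1 F)\<rbrakk> \<Longrightarrow> ar (amap F (x, y))"
    "\<lbrakk>x \<in> wpts (dom1 F); y \<in> wpts (dom1 F)\<rbrakk> \<Longrightarrow> dm (amap F (x, y)) = cobj (whom (dom1 F) (x, y))"
    "\<lbrakk>x \<in> wpts (dom1 F); y \<in> wpts (dom1 F)\<rbrakk> \<Longrightarrow>
      cd (amap F (x, y)) = cobj (whom (cod1 F) (pmap F x, pmap F y))"
proof -
  have F: "F \<in> wfunctors K (dom1 F) (cod1 F)" and [simp]: "is_wcat K (dom1 F)" "is_wcat K (cod1 F)"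
    using assms by (auto simp: wf1_def)
  show p: "pmap F x \<in> wpts (cod1 F)" if "x \<in> wpts (dom1 F)" for x using wfun_pt[OF F that] .
  show "ar (amap F (x, y))" "dm (amap F (x, y)) = cobj (whom (dom1 F) (x, y))"
    "cd (amap F (x, y)) = cobj (whom (cod1 F) (pmap F x, pmap F y))"
    if "x \<in> wpts (dom1 F)" "y \<in> wpts (dom1 F)"
    using K_HomD[OF wfun_Hom[OF F that]] that p by simp_all
  show "is_wcat K (dom1 F)" "is_wcat K (cod1 F)" by simp_all
qed

lemma wtransfD:
  assumes T: "T \<in> wtransf K F G"
  shows wtransf_dom_cod: "dom2 T = F" "cod2 T = G"
    and wtransf_ext: "comp2 T \<in> extensional (wpts (dom1 F))"
    and wtransf_Hom: "x \<in> wpts (dom1 F) \<Longrightarrow> comp2 T x \<in> Hom K (Unit K) (whom (cod1 F) (pmap G x, pmap F x))"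
    and wtransf_nat: "\<lbrakk>x \<in> wpts (dom1 F); y \<in> wpts (dom1 F)\<rbrakk> \<Longrightarrow>
      ract (cobj (whom (dom1 F) (x, y))) (wmul (cod1 F) (pmap G x, pmap G y, pmap F y)) (amap G (x, y)) (comp2 T y)
      = lact (cobj (whom (dom1 F) (x, y))) (wmul (cod1 F) (pmap G x, pmap F x, pmap F y)) (comp2 T x) (amap F (x, y))"
  using T unfolding wtransf_def Let_def lact_def ract_def by (auto simp: PiE_iff)

lemma wtransfI:
  assumes "dom2 T = F" "cod2 T = G" "comp2 T \<in> extensional (wpts (dom1 F))"
    "\<And>x. x \<in> wpts (dom1 F) \<Longrightarrow> comp2 T x \<in> Hom K (Unit K) (whom (cod1 F) (pmap G x, pmap F x))"
    "\<And>x y. \<lbrakk>x \<in> wpts (dom1 F); y \<in> wpts (dom1 F)\<rbrakk> \<Longrightarrow>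
      ract (cobj (whom (dom1 F) (x, y))) (wmul (cod1 F) (pmap G x, pmap G y, pmap F y)) (amap G (x, y)) (comp2 T y)
      = lact (cobj (whom (dom1 F) (x, y))) (wmul (cod1 F) (pmap G x, pmap F x, pmap F y)) (comp2 T x) (amap F (x, y))"
  shows "T \<in> wtransf K F G"
  using assms unfolding wtransf_def Let_def lact_def ract_def by (auto simp: PiE_iff)

definition wf2 :: "(('x, ('o, 'a) coalg, 'a) wcat, 'x, 'a) two_cell \<Rightarrow> bool" where
  "wf2 T \<longleftrightarrow> wf1 (dom2 T) \<and> wf1 (cod2 T) \<and> dom1 (cod2 T) = dom1 (dom2 T) \<and>
     cod1 (cod2 T) = cod1 (dom2 T) \<and> T \<in> wtransf K (dom2 T) (cod2 T)"

lemma wf2_ar [simp]: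
  assumes "wf2 T"
  shows "wf1 (dom2 T)" "wf1 (cod2 T)" "dom1 (cod2 T) = dom1 (dom2 T)" "cod1 (cod2 T) = cod1 (dom2 T)"
    "x \<in> wpts (dom1 (dom2 T)) \<Longrightarrow> pmap (cod2 T) x \<in> wpts (cod1 (dom2 T))"
    "x \<in> wpts (dom1 (dom2 T)) \<Longrightarrow> ar (comp2 T x)"
    "x \<in> wpts (dom1 (dom2 T)) \<Longrightarrow> dm (comp2 T x) = Unit V"
    "x \<in> wpts (dom1 (dom2 T)) \<Longrightarrow>
      cd (comp2 T x) = cobj (whom (cod1 (dom2 T)) (pmap (cod2 T) x, pmap (dom2 T) x))"
proof -
  have T: "T \<in> wtransf K (dom2 T) (cod2 T)" using assms by (auto simp: wf2_def)
  show [simp]: "wf1 (dom2 T)" "wf1 (cod2 T)" and e[simp]: "dom1 (cod2 T) = dom1 (dom2 T)" "cod1 (cod2 T) = cod1 (dom2 T)"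
    using assms by (auto simp: wf2_def)
  show p: "pmap (cod2 T) x \<in> wpts (cod1 (dom2 T))" if "x \<in> wpts (dom1 (dom2 T))" for x
    using wf1_ar(3)[of "cod2 T" x] that by simp
  show "ar (comp2 T x)" "dm (comp2 T x) = Unit V"
    "cd (comp2 T x) = cobj (whom (cod1 (dom2 T)) (pmap (cod2 T) x, pmap (dom2 T) x))"
    if "x \<in> wpts (dom1 (dom2 T))"
    using K_HomD[OF wtransf_Hom[OF T that]] p that by simp_all
qed

lemma W_Cat_sel:
  "Cell0 (W_Cat K t) = {A. is_wcat K A}"
  "Cell1 (W_Cat K t) = wfunctors K"
  "Cell2 (W_Cat K t) = wtransf K"
  "Id1 (W_Cat K t) = (\<lambda>A. \<lparr>dom1 = A, cod1 = A, pmap = (\<lambda>x \<in> wpts A. x),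
     amap = (\<lambda>p \<in> wpts A \<times> wpts A. Idn V (cobj (whom A p)))\<rparr>)"
  "Comp1 (W_Cat K t) = wcomp K"
  "Id2 (W_Cat K t) = (\<lambda>F. \<lparr>dom2 = F, cod2 = F, comp2 = (\<lambda>x \<in> wpts (dom1 F). wunit (cod1 F) (pmap F x))\<rparr>)"
  "VComp (W_Cat K t) = (\<lambda>\<beta> \<alpha>. \<lparr>dom2 = dom2 \<alpha>, cod2 = cod2 \<beta>,
     comp2 = (\<lambda>x \<in> wpts (dom1 (dom2 \<alpha>)). lact (Unit V)
       (wmul (cod1 (dom2 \<alpha>)) (pmap (cod2 \<beta>) x, pmap (cod2 \<alpha>) x, pmap (dom2 \<alpha>) x)) (comp2 \<beta> x) (comp2 \<alpha> x))\<rparr>)"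
  "HComp (W_Cat K t) = (\<lambda>\<alpha> \<beta>. \<lparr>dom2 = wcomp K (dom2 \<beta>) (dom2 \<alpha>), cod2 = wcomp K (cod2 \<beta>) (cod2 \<alpha>),
     comp2 = (\<lambda>x \<in> wpts (dom1 (dom2 \<alpha>)). lact (Unit V)
       (wmul (cod1 (dom2 \<beta>)) (pmap (cod2 \<beta>) (pmap (cod2 \<alpha>) x), pmap (cod2 \<beta>) (pmap (dom2 \<alpha>) x),
          pmap (dom2 \<beta>) (pmap (dom2 \<alpha>) x)))
       (amap (cod2 \<beta>) (pmap (cod2 \<alpha>) x, pmap (dom2 \<alpha>) x) \<cdot> comp2 \<alpha> x) (comp2 \<beta> (pmap (dom2 \<alpha>) x)))\<rparr>)"
  by (simp_all add: W_Cat_def lact_def Let_def)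

lemma wf1I: "\<lbrakk>is_wcat K A; is_wcat K B; F \<in> wfunctors K A B\<rbrakk> \<Longrightarrow> wf1 F"
  using wfun_dom_cod[of F A B] by (auto simp: wf1_def)

lemma wcomp_sel [simp]:
  "dom1 (wcomp K G F) = dom1 F" "cod1 (wcomp K G F) = cod1 G"
  "x \<in> wpts (dom1 F) \<Longrightarrow> pmap (wcomp K G F) x = pmap G (pmap F x)"
  "\<lbrakk>x \<in> wpts (dom1 F); y \<in> wpts (dom1 F)\<rbrakk> \<Longrightarrow>
    amap (wcomp K G F) (x, y) = amap G (pmap F x, pmap F y) \<cdot> amap F (x, y)"
  by (simp_all add: wcomp_def Let_def compose_def)

lemma wcomp_ext: "pmap (wcomp K G F) \<in> extensional (wpts (dom1 F))"
  "amap (wcomp K G F) \<in> extensional (wpts (dom1 F) \<times> wpts (dom1 F))"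
  by (simp_all add: wcomp_def Let_def compose_def)

lemma wcomp_cell:
  assumes A: "is_wcat K A" and B: "is_wcat K B" and C: "is_wcat K C"
    and F: "F \<in> wfunctors K A B" and G: "G \<in> wfunctors K B C"
  shows "wcomp K G F \<in> wfunctors K A C"
proof -
  note [simp] = A B C wfun_dom_cod[OF F] wfun_dom_cod[OF G]
    wf1_ar[OF wf1I[OF A B F], simplified wfun_dom_cod[OF F]]
    wf1_ar[OF wf1I[OF B C G], simplified wfun_dom_cod[OF G]]
  show ?thesis
  proof (rule wfunctorsI)
    show "amap (wcomp K G F) (x, y) \<in> Hom K (whom A (x, y)) (whom C (pmap (wcomp K G F) x, pmap (wcomp K G F) y))"
      if "x \<in> wpts A" "y \<in> wpts A" for x y
      using K_Comp[OF wfun_Hom[OF F that] wfun_Hom[OF G]] that by simp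
    show "wmul C (pmap (wcomp K G F) x, pmap (wcomp K G F) y, pmap (wcomp K G F) z) \<cdot>
       (amap (wcomp K G F) (x, y) \<star> amap (wcomp K G F) (y, z)) = amap (wcomp K G F) (x, z) \<cdot> wmul A (x, y, z)"
      if "x \<in> wpts A" "y \<in> wpts A" "z \<in> wpts A" for x y z
      using extend2[OF wfun_mul[OF G, of "pmap F x" "pmap F y" "pmap F z"], of "amap F (x, y) \<star> amap F (y, z)"]
        wfun_mul[OF F that] that by simp
    show "amap (wcomp K G F) (x, x) \<cdot> wunit A x = wunit C (pmap (wcomp K G F) x)" if "x \<in> wpts A" for x
      using wfun_unit[OF F that] wfun_unit[OF G, of "pmap F x"] that by simp
  qed (use wcomp_ext[of G F] in simp_all)
qed

lemma wfun_eqI: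
  assumes "F \<in> wfunctors K A B" "G \<in> wfunctors K A B"
    and "\<And>x. x \<in> wpts A \<Longrightarrow> pmap F x = pmap G x"
    and "\<And>x y. \<lbrakk>x \<in> wpts A; y \<in> wpts A\<rbrakk> \<Longrightarrow> amap F (x, y) = amap G (x, y)"
  shows "F = G"
proof (rule one_cell.equality)
  note F = wfunD[OF assms(1)] and G = wfunD[OF assms(2)]
  show "dom1 F = dom1 G" "cod1 F = cod1 G" using F G by simp_all
  show "pmap F = pmap G" by (rule extensionalityI[OF F(3) G(3)]) (rule assms(3))
  show "amap F = amap G" by (rule extensionalityI[OF F(4) G(4)]) (use assms(4) in auto)
qed simp

lemma wtransf_eqI:
  assumes "S \<in> wtransf K F G" "T \<in> wtransf K F G"
    and "\<And>x. x \<in> wpts (dom1 F) \<Longrightarrow> comp2 S x = comp2 T x"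
  shows "S = T"
proof (rule two_cell.equality)
  note F = wtransfD[OF assms(1)] and G = wtransfD[OF assms(2)]
  show "dom2 S = dom2 T" "cod2 S = cod2 T" using F G by simp_all
  show "comp2 S = comp2 T" by (rule extensionalityI[OF F(3) G(3)]) (rule assms(3))
qed simp

section \<open>The 2-category of categories enriched in coalgebras\<close>

context
  fixes t :: "'x itself"
begin

abbreviation W :: "(('x, ('o, 'a) coalg, 'a) wcat, (('x, ('o, 'a) coalg, 'a) wcat, 'x, 'a) one_cell,
   (('x, ('o, 'a) coalg, 'a) wcat, 'x, 'a) two_cell) two_cat" where "W \<equiv> W_Cat K t"

lemma W_Id1: "is_wcat K A \<Longrightarrow> Id1 W A \<in> wfunctors K A A"
  by (rule wfunctorsI) (auto simp: W_Cat_sel intro!: K_Idn)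

lemma Id1_sel [simp]: "dom1 (Id1 W A) = A" "cod1 (Id1 W A) = A"
  "x \<in> wpts A \<Longrightarrow> pmap (Id1 W A) x = x"
  "\<lbrakk>x \<in> wpts A; y \<in> wpts A\<rbrakk> \<Longrightarrow> amap (Id1 W A) (x, y) = Idn V (cobj (whom A (x, y)))"
  by (simp_all add: W_Cat_sel)

lemma wf2I:
  assumes "is_wcat K A" "is_wcat K B" "F \<in> wfunctors K A B" "G \<in> wfunctors K A B" "\<alpha> \<in> wtransf K F G"
  shows "wf2 \<alpha>"
  using wf1I[OF assms(1,2,3)] wf1I[OF assms(1,2,4)] wtransf_dom_cod[OF assms(5)] wfun_dom_cod[OF assms(3)]
    wfun_dom_cod[OF assms(4)] assms(5) unfolding wf2_def by simp

lemma W_Id2: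
  assumes A: "is_wcat K A" and B: "is_wcat K B" and F: "F \<in> wfunctors K A B"
  shows "Id2 W F \<in> wtransf K F F"
proof -
  note [simp] = A B wfun_dom_cod[OF F] wf1_ar[OF wf1I[OF A B F], simplified wfun_dom_cod[OF F]]
  show ?thesis
    by (rule wtransfI) (auto simp: W_Cat_sel w_lact_unit w_ract_unit intro!: wcat_unit[OF B, simplified])
qed

lemma VComp_sel [simp]:
  "dom2 (VComp W \<beta> \<alpha>) = dom2 \<alpha>" "cod2 (VComp W \<beta> \<alpha>) = cod2 \<beta>"
  "x \<in> wpts (dom1 (dom2 \<alpha>)) \<Longrightarrow> comp2 (VComp W \<beta> \<alpha>) x = lact (Unit V)
     (wmul (cod1 (dom2 \<alpha>)) (pmap (cod2 \<beta>) x, pmap (cod2 \<alpha>) x, pmap (dom2 \<alpha>) x)) (comp2 \<beta> x) (comp2 \<alpha> x)"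
  by (simp_all add: W_Cat_sel)

lemma HComp_sel [simp]:
  "dom2 (HComp W \<alpha> \<beta>) = wcomp K (dom2 \<beta>) (dom2 \<alpha>)" "cod2 (HComp W \<alpha> \<beta>) = wcomp K (cod2 \<beta>) (cod2 \<alpha>)"
  "x \<in> wpts (dom1 (dom2 \<alpha>)) \<Longrightarrow> comp2 (HComp W \<alpha> \<beta>) x = lact (Unit V)
       (wmul (cod1 (dom2 \<beta>)) (pmap (cod2 \<beta>) (pmap (cod2 \<alpha>) x), pmap (cod2 \<beta>) (pmap (dom2 \<alpha>) x),
          pmap (dom2 \<beta>) (pmap (dom2 \<alpha>) x)))
       (amap (cod2 \<beta>) (pmap (cod2 \<alpha>) x, pmap (dom2 \<alpha>) x) \<cdot> comp2 \<alpha> x) (comp2 \<beta> (pmap (dom2 \<alpha>) x))"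
  by (simp_all add: W_Cat_sel)

lemma Id2_sel [simp]: "dom2 (Id2 W F) = F" "cod2 (Id2 W F) = F"
  "x \<in> wpts (dom1 F) \<Longrightarrow> comp2 (Id2 W F) x = wunit (cod1 F) (pmap F x)"
  by (simp_all add: W_Cat_sel)

lemma VH_ext: "comp2 (VComp W \<beta> \<alpha>) \<in> extensional (wpts (dom1 (dom2 \<alpha>)))"
  "comp2 (HComp W \<alpha> \<beta>) \<in> extensional (wpts (dom1 (dom2 \<alpha>)))"
  by (simp_all add: W_Cat_sel)

lemma W_VComp:
  assumes A: "is_wcat K A" and B: "is_wcat K B"
    and F: "F \<in> wfunctors K A B" and G: "G \<in> wfunctors K A B" and H: "H \<in> wfunctors K A B"
    and \<alpha>: "\<alpha> \<in> wtransf K F G" and \<beta>: "\<beta> \<in> wtransf K G H"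
  shows "VComp W \<beta> \<alpha> \<in> wtransf K F H"
proof -
  note [simp] = A B wfun_dom_cod[OF F] wfun_dom_cod[OF G] wfun_dom_cod[OF H]
    wtransf_dom_cod[OF \<alpha>] wtransf_dom_cod[OF \<beta>]
    wf1_ar[OF wf1I[OF A B F], simplified wfun_dom_cod[OF F]]
    wf1_ar[OF wf1I[OF A B G], simplified wfun_dom_cod[OF G]]
    wf1_ar[OF wf1I[OF A B H], simplified wfun_dom_cod[OF H]]
    wf2_ar[OF wf2I[OF A B F G \<alpha>], simplified wfun_dom_cod[OF F] wtransf_dom_cod[OF \<alpha>]]
    wf2_ar[OF wf2I[OF A B G H \<beta>], simplified wfun_dom_cod[OF G] wtransf_dom_cod[OF \<beta>]]
  show ?thesis
  proof (rule wtransfI)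
    show "comp2 (VComp W \<beta> \<alpha>) x \<in> Hom K (Unit K) (whom (cod1 F) (pmap H x, pmap F x))"
      if "x \<in> wpts (dom1 F)" for x
      using K_lact[OF wtransf_Hom[OF \<beta>, of x, unfolded wfun_dom_cod[OF G]]
        wtransf_Hom[OF \<alpha>, of x, unfolded wfun_dom_cod[OF F]] wcat_mul[OF B]] that
      by (simp del: coalgebras_sel)
    show "ract (cobj (whom (dom1 F) (x, y))) (wmul (cod1 F) (pmap H x, pmap H y, pmap F y)) (amap H (x, y))
         (comp2 (VComp W \<beta> \<alpha>) y) =
       lact (cobj (whom (dom1 F) (x, y))) (wmul (cod1 F) (pmap H x, pmap F x, pmap F y)) (comp2 (VComp W \<beta> \<alpha>) x)
         (amap F (x, y))" if "x \<in> wpts (dom1 F)" "y \<in> wpts (dom1 F)" for x y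
      \<comment> \<open>With products written as juxtaposition: \<open>H (\<beta> \<alpha>) = (H
        \<beta>) \<alpha> = (\<beta> G) \<alpha> = \<beta> (G \<alpha>) = \<beta> (\<alpha> F) =
        (\<beta> \<alpha>) F\<close>.\<close>
      using that wtransf_nat[OF \<alpha>, of x y] wtransf_nat[OF \<beta>, of x y]
      by (simp add: w_ract_ract w_ract_lact w_lact_lact)
  qed (use VH_ext[of \<beta> \<alpha>] in simp_all)
qed

lemma W_HComp:
  assumes A: "is_wcat K A" and B: "is_wcat K B" and C: "is_wcat K C"
    and F: "F \<in> wfunctors K A B" and F': "F' \<in> wfunctors K A B"
    and G: "G \<in> wfunctors K B C" and G': "G' \<in> wfunctors K B C"
    and \<alpha>: "\<alpha> \<in> wtransf K F F'" and \<beta>: "\<beta> \<in> wtransf K G G'"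
  shows "HComp W \<alpha> \<beta> \<in> wtransf K (wcomp K G F) (wcomp K G' F')"
proof -
  note [simp] = A B C wfun_dom_cod[OF F] wfun_dom_cod[OF G] wfun_dom_cod[OF F'] wfun_dom_cod[OF G']
    wtransf_dom_cod[OF \<alpha>] wtransf_dom_cod[OF \<beta>]
    wf1_ar[OF wf1I[OF A B F], simplified wfun_dom_cod[OF F]]
    wf1_ar[OF wf1I[OF A B F'], simplified wfun_dom_cod[OF F']]
    wf1_ar[OF wf1I[OF B C G], simplified wfun_dom_cod[OF G]]
    wf1_ar[OF wf1I[OF B C G'], simplified wfun_dom_cod[OF G']]
    wf2_ar[OF wf2I[OF A B F F' \<alpha>], simplified wfun_dom_cod[OF F] wtransf_dom_cod[OF \<alpha>]]
    wf2_ar[OF wf2I[OF B C G G' \<beta>], simplified wfun_dom_cod[OF G] wtransf_dom_cod[OF \<beta>]]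
  show ?thesis
  proof (rule wtransfI)
    fix x assume "x \<in> wpts (dom1 (wcomp K G F))"
    then have x: "x \<in> wpts A" by simp
    have "amap G' (pmap F' x, pmap F x) \<cdot> comp2 \<alpha> x \<in> Hom K (Unit K) (whom C (pmap G' (pmap F' x), pmap G' (pmap F x)))"
      by (rule K_Comp[OF wtransf_Hom[OF \<alpha>, unfolded wfun_dom_cod[OF F]] wfun_Hom[OF G']]) (use x in \<open>simp_all add: wfun_pt[OF F]\<close>)
    from K_lact[OF this wtransf_Hom[OF \<beta>, of "pmap F x", unfolded wfun_dom_cod[OF G]] wcat_mul[OF C]] x
    show "comp2 (HComp W \<alpha> \<beta>) x \<in> Hom K (Unit K) (whom (cod1 (wcomp K G F)) (pmap (wcomp K G' F') x, pmap (wcomp K G F) x))"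
      by (simp del: coalgebras_sel)
    fix y assume "y \<in> wpts (dom1 (wcomp K G F))"
    then have y: "y \<in> wpts A" by simp
    let ?P = "cobj (whom A (x, y))"
    \<comment> \<open>The functor \<open>G'\<close> carries the naturality of
      \<open>\<alpha>\<close> over to \<open>C\<close>: \<open>1\<close> and \<open>2\<close>
      identify the images of its two sides with products of images.\<close>
    have 1: "ract ?P (wmul C (pmap G' (pmap F' x), pmap G' (pmap F' y), pmap G' (pmap F y)))
        (amap G' (pmap F' x, pmap F' y) \<cdot> amap F' (x, y)) (amap G' (pmap F' y, pmap F y) \<cdot> comp2 \<alpha> y)
      = amap G' (pmap F' x, pmap F y) \<cdot> ract ?P (wmul B (pmap F' x, pmap F' y, pmap F y)) (amap F' (x, y)) (comp2 \<alpha> y)"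
      by (rule comp_ract[symmetric], rule_tac [15] wfun_mul[OF G']) (use x y in simp_all)
    have 2: "amap G' (pmap F' x, pmap F y) \<cdot> lact ?P (wmul B (pmap F' x, pmap F x, pmap F y)) (comp2 \<alpha> x) (amap F (x, y))
      = lact ?P (wmul C (pmap G' (pmap F' x), pmap G' (pmap F x), pmap G' (pmap F y)))
          (amap G' (pmap F' x, pmap F x) \<cdot> comp2 \<alpha> x) (amap G' (pmap F x, pmap F y) \<cdot> amap F (x, y))"
      by (rule comp_lact, rule_tac [15] wfun_mul[OF G']) (use x y in simp_all)
    \<comment> \<open>Naturality of \<open>\<beta>\<close> at the image points \<open>F x\<close>
      and \<open>F y\<close>, precomposed with the component of \<open>F\<close>.\<close>
    have 3: "ract ?P (wmul C (pmap G' (pmap F x), pmap G' (pmap F y), pmap G (pmap F y)))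
         (amap G' (pmap F x, pmap F y) \<cdot> amap F (x, y)) (comp2 \<beta> (pmap F y))
      = lact ?P (wmul C (pmap G' (pmap F x), pmap G (pmap F x), pmap G (pmap F y))) (comp2 \<beta> (pmap F x))
         (amap G (pmap F x, pmap F y) \<cdot> amap F (x, y))"
    proof -
      have "ract ?P (wmul C (pmap G' (pmap F x), pmap G' (pmap F y), pmap G (pmap F y)))
         (amap G' (pmap F x, pmap F y) \<cdot> amap F (x, y)) (comp2 \<beta> (pmap F y))
        = ract (cobj (whom B (pmap F x, pmap F y))) (wmul C (pmap G' (pmap F x), pmap G' (pmap F y), pmap G (pmap F y)))
         (amap G' (pmap F x, pmap F y)) (comp2 \<beta> (pmap F y)) \<cdot> amap F (x, y)"
        by (rule ract_comp[symmetric]) (use x y in simp_all)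
      also have "\<dots> = lact (cobj (whom B (pmap F x, pmap F y))) (wmul C (pmap G' (pmap F x), pmap G (pmap F x), pmap G (pmap F y)))
         (comp2 \<beta> (pmap F x)) (amap G (pmap F x, pmap F y)) \<cdot> amap F (x, y)"
        using wtransf_nat[OF \<beta>, of "pmap F x" "pmap F y"] x y by simp
      also have "\<dots> = lact ?P (wmul C (pmap G' (pmap F x), pmap G (pmap F x), pmap G (pmap F y))) (comp2 \<beta> (pmap F x))
         (amap G (pmap F x, pmap F y) \<cdot> amap F (x, y))"
        by (rule lact_comp) (use x y in simp_all)
      finally show ?thesis .
    qed
    show "ract (cobj (whom (dom1 (wcomp K G F)) (x, y)))
        (wmul (cod1 (wcomp K G F)) (pmap (wcomp K G' F') x, pmap (wcomp K G' F') y, pmap (wcomp K G F) y))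
        (amap (wcomp K G' F') (x, y)) (comp2 (HComp W \<alpha> \<beta>) y)
      = lact (cobj (whom (dom1 (wcomp K G F)) (x, y)))
        (wmul (cod1 (wcomp K G F)) (pmap (wcomp K G' F') x, pmap (wcomp K G F) x, pmap (wcomp K G F) y))
        (comp2 (HComp W \<alpha> \<beta>) x) (amap (wcomp K G F) (x, y))"
      using x y wtransf_nat[OF \<alpha>, of x y] by (simp add: w_ract_ract 1 2 w_ract_lact w_lact_lact 3)
  qed (use VH_ext(2)[of \<alpha> \<beta>] in simp_all)
qed

text \<open>Naturality of \<open>\<beta>\<close> precomposed with an element. This instance
  interchanges \<open>\<beta>\<close> with a component of another 2-cell.\<close>

lemma W_nat_element:
  assumes B: "is_wcat K B" and C: "is_wcat K C" and G: "G \<in> wfunctors K B C" and G': "G' \<in> wfunctors K B C" and \<beta>: "\<beta> \<in> wtransf K G G'"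
    and x: "x \<in> wpts B" "y \<in> wpts B" and a: "ar a" "dm a = Unit V" "cd a = cobj (whom B (x, y))"
  shows "lact (Unit V) (wmul C (pmap G' x, pmap G' y, pmap G y)) (amap G' (x, y) \<cdot> a) (comp2 \<beta> y)
    = lact (Unit V) (wmul C (pmap G' x, pmap G x, pmap G y)) (comp2 \<beta> x) (amap G (x, y) \<cdot> a)"
proof -
  note [simp] = B C wfun_dom_cod[OF G] wfun_dom_cod[OF G'] wtransf_dom_cod[OF \<beta>]
    wf1_ar[OF wf1I[OF B C G], simplified wfun_dom_cod[OF G]]
    wf1_ar[OF wf1I[OF B C G'], simplified wfun_dom_cod[OF G']]
    wf2_ar[OF wf2I[OF B C G G' \<beta>], simplified wfun_dom_cod[OF G] wtransf_dom_cod[OF \<beta>]]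
  have "ract (Unit V) (wmul C (pmap G' x, pmap G' y, pmap G y)) (amap G' (x, y) \<cdot> a) (comp2 \<beta> y)
     = ract (cobj (whom B (x, y))) (wmul C (pmap G' x, pmap G' y, pmap G y)) (amap G' (x, y)) (comp2 \<beta> y) \<cdot> a"
    by (rule ract_comp[symmetric]) (use x a in simp_all)
  also have "\<dots> = lact (cobj (whom B (x, y))) (wmul C (pmap G' x, pmap G x, pmap G y)) (comp2 \<beta> x) (amap G (x, y)) \<cdot> a"
    using wtransf_nat[OF \<beta>, of x y] x by simp
  also have "\<dots> = lact (Unit V) (wmul C (pmap G' x, pmap G x, pmap G y)) (comp2 \<beta> x) (amap G (x, y) \<cdot> a)"
    by (rule lact_comp) (use x a in simp_all)
  finally show ?thesis by (simp add: lact_Unit_eq_ract)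
qed

text \<open>The laws for 2-cells are checked on components, where they are identities between
  products of elements: they follow from associativity and units of the enriched categories, from
  multiplicativity of functors and, for the interchange law, from naturality.\<close>

lemma two_category_W_Cat: "two_category W"
proof (rule two_category.intro)
  fix A B assume "A \<in> Cell0 W" "B \<in> Cell0 W"
  then have A: "is_wcat K A" and B: "is_wcat K B" by (simp_all add: W_Cat_sel)
  note [simp] = A B
  have Hs: "Obj (HomCat W A B) = wfunctors K A B" "Hom (HomCat W A B) = wtransf K"
    "Idn (HomCat W A B) = Id2 W" "Comp (HomCat W A B) = VComp W"
    by (simp_all add: HomCat_def W_Cat_sel(2,3))
  show "category (HomCat W A B)"
  proof (rule category.intro, unfold Hs)
    show "Id2 W F \<in> wtransf K F F" if "F \<in> wfunctors K A B" for F
      by (rule W_Id2[OF A B that])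
    show "VComp W \<beta> \<alpha> \<in> wtransf K F H" if "F \<in> wfunctors K A B" "G \<in> wfunctors K A B"
      "H \<in> wfunctors K A B" "\<alpha> \<in> wtransf K F G" "\<beta> \<in> wtransf K G H" for F G H \<alpha> \<beta>
      by (rule W_VComp[OF A B that])
    fix F G assume F: "F \<in> wfunctors K A B" and G: "G \<in> wfunctors K A B"
    fix \<alpha> assume \<alpha>: "\<alpha> \<in> wtransf K F G"
    note [simp] = wfun_dom_cod[OF F] wfun_dom_cod[OF G] wtransf_dom_cod[OF \<alpha>] wf1_ar[OF wf1I[OF A B F], simplified wfun_dom_cod[OF F]]
      wf1_ar[OF wf1I[OF A B G], simplified wfun_dom_cod[OF G]]
      wf2_ar[OF wf2I[OF A B F G \<alpha>], simplified wfun_dom_cod[OF F] wtransf_dom_cod[OF \<alpha>]]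
    show "VComp W \<alpha> (Id2 W F) = \<alpha>"
      by (rule wtransf_eqI[OF W_VComp[OF A B F F G W_Id2[OF A B F] \<alpha>] \<alpha>]) (simp add: lact_Unit_eq_ract w_ract_unit)
    show "VComp W (Id2 W G) \<alpha> = \<alpha>"
      by (rule wtransf_eqI[OF W_VComp[OF A B F G G \<alpha> W_Id2[OF A B G]] \<alpha>]) (simp add: w_lact_unit)
    fix H J \<beta> \<gamma> assume H: "H \<in> wfunctors K A B" and J: "J \<in> wfunctors K A B"
      and \<beta>: "\<beta> \<in> wtransf K G H" and \<gamma>: "\<gamma> \<in> wtransf K H J"
    note [simp] = wfun_dom_cod[OF H] wfun_dom_cod[OF J] wtransf_dom_cod[OF \<beta>] wtransf_dom_cod[OF \<gamma>]
      wf1_ar[OF wf1I[OF A B H], simplified wfun_dom_cod[OF H]] wf1_ar[OF wf1I[OF A B J], simplified wfun_dom_cod[OF J]]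
      wf2_ar[OF wf2I[OF A B G H \<beta>], simplified wfun_dom_cod[OF G] wtransf_dom_cod[OF \<beta>]]
      wf2_ar[OF wf2I[OF A B H J \<gamma>], simplified wfun_dom_cod[OF H] wtransf_dom_cod[OF \<gamma>]]
    show "VComp W (VComp W \<gamma> \<beta>) \<alpha> = VComp W \<gamma> (VComp W \<beta> \<alpha>)"
      by (rule wtransf_eqI[OF W_VComp[OF A B F G J \<alpha> W_VComp[OF A B G H J \<beta> \<gamma>]]
            W_VComp[OF A B F H J W_VComp[OF A B F G H \<alpha> \<beta>] \<gamma>]]) (simp add: w_lact_lact)
  qed
next
  fix A assume "A \<in> Cell0 W" then show "Id1 W A \<in> Cell1 W A A"
    using W_Id1[of A] by (simp add: W_Cat_sel(1,2))
next
  fix A B C F G assume "A \<in> Cell0 W" "B \<in> Cell0 W" "C \<in> Cell0 W" "F \<in> Cell1 W A B" "G \<in> Cell1 W B C"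
  then show "Comp1 W G F \<in> Cell1 W A C"
    using wcomp_cell[of A B C F G] by (simp add: W_Cat_sel(1,2,5))
next
  fix A B C D F G H assume "A \<in> Cell0 W" "B \<in> Cell0 W" "C \<in> Cell0 W" "D \<in> Cell0 W"
    "F \<in> Cell1 W A B" "G \<in> Cell1 W B C" "H \<in> Cell1 W C D"
  then have A: "is_wcat K A" and B: "is_wcat K B" and C: "is_wcat K C" and D: "is_wcat K D"
    and F: "F \<in> wfunctors K A B" and G: "G \<in> wfunctors K B C" and H: "H \<in> wfunctors K C D"
    by (simp_all add: W_Cat_sel(1,2))
  note [simp] = wfun_dom_cod[OF F] wfun_dom_cod[OF G] wfun_dom_cod[OF H]
    wf1_ar[OF wf1I[OF A B F], simplified wfun_dom_cod[OF F]] wf1_ar[OF wf1I[OF B C G], simplified wfun_dom_cod[OF G]]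
    wf1_ar[OF wf1I[OF C D H], simplified wfun_dom_cod[OF H]]
  show "Comp1 W (Comp1 W H G) F = Comp1 W H (Comp1 W G F)" unfolding W_Cat_sel(5)
    by (rule wfun_eqI[OF wcomp_cell[OF A B D F wcomp_cell[OF B C D G H]] wcomp_cell[OF A C D wcomp_cell[OF A B C F G] H]])
      simp_all
next
  fix A B F assume "A \<in> Cell0 W" "B \<in> Cell0 W" "F \<in> Cell1 W A B"
  then have A: "is_wcat K A" and B: "is_wcat K B" and F: "F \<in> wfunctors K A B" by (simp_all add: W_Cat_sel(1,2))
  note [simp] = wfun_dom_cod[OF F] wf1_ar[OF wf1I[OF A B F], simplified wfun_dom_cod[OF F]]
  show "Comp1 W F (Id1 W A) = F" unfolding W_Cat_sel(5)
    by (rule wfun_eqI[OF wcomp_cell[OF A A B W_Id1[OF A] F] F]) simp_all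
  show "Comp1 W (Id1 W B) F = F" unfolding W_Cat_sel(5)
    by (rule wfun_eqI[OF wcomp_cell[OF A B B F W_Id1[OF B]] F]) simp_all
next
  fix A B C F F' G G' \<alpha> \<beta> assume "A \<in> Cell0 W" "B \<in> Cell0 W" "C \<in> Cell0 W"
    "F \<in> Cell1 W A B" "F' \<in> Cell1 W A B" "G \<in> Cell1 W B C" "G' \<in> Cell1 W B C"
    "\<alpha> \<in> Cell2 W F F'" "\<beta> \<in> Cell2 W G G'"
  then show "HComp W \<alpha> \<beta> \<in> Cell2 W (Comp1 W G F) (Comp1 W G' F')"
    using W_HComp[of A B C F F' G G' \<alpha> \<beta>] by (simp add: W_Cat_sel(1-3,5))
next
  fix A B C D F F' G G' H H' \<alpha> \<beta> \<gamma> assume "A \<in> Cell0 W" "B \<in> Cell0 W" "C \<in> Cell0 W" "D \<in> Cell0 W"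
    "F \<in> Cell1 W A B" "F' \<in> Cell1 W A B" "G \<in> Cell1 W B C" "G' \<in> Cell1 W B C"
    "H \<in> Cell1 W C D" "H' \<in> Cell1 W C D" "\<alpha> \<in> Cell2 W F F'" "\<beta> \<in> Cell2 W G G'" "\<gamma> \<in> Cell2 W H H'"
  then have A: "is_wcat K A" and B: "is_wcat K B" and C: "is_wcat K C" and D: "is_wcat K D"
    and F: "F \<in> wfunctors K A B" and F': "F' \<in> wfunctors K A B" and G: "G \<in> wfunctors K B C" and G': "G' \<in> wfunctors K B C"
    and H: "H \<in> wfunctors K C D" and H': "H' \<in> wfunctors K C D"
    and \<alpha>: "\<alpha> \<in> wtransf K F F'" and \<beta>: "\<beta> \<in> wtransf K G G'" and \<gamma>: "\<gamma> \<in> wtransf K H H'"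
    by (simp_all add: W_Cat_sel(1-3))
  note [simp] = A B C D wfun_dom_cod[OF F] wfun_dom_cod[OF G] wfun_dom_cod[OF H]
    wfun_dom_cod[OF F'] wfun_dom_cod[OF G'] wfun_dom_cod[OF H']
    wtransf_dom_cod[OF \<alpha>] wtransf_dom_cod[OF \<beta>] wtransf_dom_cod[OF \<gamma>]
    wf1_ar[OF wf1I[OF A B F], simplified wfun_dom_cod[OF F]] wf1_ar[OF wf1I[OF B C G], simplified wfun_dom_cod[OF G]]
    wf1_ar[OF wf1I[OF C D H], simplified wfun_dom_cod[OF H]]
    wf1_ar[OF wf1I[OF A B F'], simplified wfun_dom_cod[OF F']] wf1_ar[OF wf1I[OF B C G'], simplified wfun_dom_cod[OF G']]
    wf1_ar[OF wf1I[OF C D H'], simplified wfun_dom_cod[OF H']]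
    wf2_ar[OF wf2I[OF A B F F' \<alpha>], simplified wfun_dom_cod[OF F] wtransf_dom_cod[OF \<alpha>]]
    wf2_ar[OF wf2I[OF B C G G' \<beta>], simplified wfun_dom_cod[OF G] wtransf_dom_cod[OF \<beta>]]
    wf2_ar[OF wf2I[OF C D H H' \<gamma>], simplified wfun_dom_cod[OF H] wtransf_dom_cod[OF \<gamma>]]
  note ab = W_HComp[OF A B C F F' G G' \<alpha> \<beta>] and bc = W_HComp[OF B C D G G' H H' \<beta> \<gamma>]
  have ab_c: "HComp W (HComp W \<alpha> \<beta>) \<gamma> \<in> wtransf K (wcomp K H (wcomp K G F)) (wcomp K H' (wcomp K G' F'))"
    by (rule W_HComp[OF A C D wcomp_cell[OF A B C F G] wcomp_cell[OF A B C F' G'] H H' ab \<gamma>])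
  have "HComp W \<alpha> (HComp W \<beta> \<gamma>) \<in> wtransf K (wcomp K (wcomp K H G) F) (wcomp K (wcomp K H' G') F')"
    by (rule W_HComp[OF A B D F F' wcomp_cell[OF B C D G H] wcomp_cell[OF B C D G' H'] \<alpha> bc])
  \<comment> \<open>A 2-cell stores its source and target, so the two bracketings of the composite
    1-cells must be identified before the components can be compared.\<close>
  moreover have "wcomp K (wcomp K H G) F = wcomp K H (wcomp K G F)"
    by (rule wfun_eqI[OF wcomp_cell[OF A B D F wcomp_cell[OF B C D G H]] wcomp_cell[OF A C D wcomp_cell[OF A B C F G] H]])
      simp_all
  moreover have "wcomp K (wcomp K H' G') F' = wcomp K H' (wcomp K G' F')"
    by (rule wfun_eqI[OF wcomp_cell[OF A B D F' wcomp_cell[OF B C D G' H']] wcomp_cell[OF A C D wcomp_cell[OF A B C F' G'] H']])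
      simp_all
  ultimately have a_bc: "HComp W \<alpha> (HComp W \<beta> \<gamma>) \<in> wtransf K (wcomp K H (wcomp K G F)) (wcomp K H' (wcomp K G' F'))"
    by simp
  show "HComp W (HComp W \<alpha> \<beta>) \<gamma> = HComp W \<alpha> (HComp W \<beta> \<gamma>)"
  proof (rule wtransf_eqI[OF ab_c a_bc])
    fix x assume "x \<in> wpts (dom1 (wcomp K H (wcomp K G F)))"
    then have x: "x \<in> wpts A" by simp
    have "amap H' (pmap G' (pmap F' x), pmap G (pmap F x)) \<cdot>
       lact (Unit V) (wmul C (pmap G' (pmap F' x), pmap G' (pmap F x), pmap G (pmap F x)))
         (amap G' (pmap F' x, pmap F x) \<cdot> comp2 \<alpha> x) (comp2 \<beta> (pmap F x))
     = lact (Unit V) (wmul D (pmap H' (pmap G' (pmap F' x)), pmap H' (pmap G' (pmap F x)), pmap H' (pmap G (pmap F x))))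
        (amap H' (pmap G' (pmap F' x), pmap G' (pmap F x)) \<cdot> (amap G' (pmap F' x, pmap F x) \<cdot> comp2 \<alpha> x))
        (amap H' (pmap G' (pmap F x), pmap G (pmap F x)) \<cdot> comp2 \<beta> (pmap F x))"
      by (rule comp_lact, rule_tac [15] wfun_mul[OF H']) (use x in simp_all)
    then show "comp2 (HComp W (HComp W \<alpha> \<beta>) \<gamma>) x = comp2 (HComp W \<alpha> (HComp W \<beta> \<gamma>)) x"
      using x by (simp add: w_lact_lact)
  qed
next
  fix A B F F' \<alpha> assume "A \<in> Cell0 W" "B \<in> Cell0 W" "F \<in> Cell1 W A B" "F' \<in> Cell1 W A B" "\<alpha> \<in> Cell2 W F F'"
  then have A: "is_wcat K A" and B: "is_wcat K B" and F: "F \<in> wfunctors K A B" and F': "F' \<in> wfunctors K A B"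
    and \<alpha>: "\<alpha> \<in> wtransf K F F'" by (simp_all add: W_Cat_sel(1-3))
  note [simp] = A B wfun_dom_cod[OF F] wfun_dom_cod[OF F'] wtransf_dom_cod[OF \<alpha>]
    wf1_ar[OF wf1I[OF A B F], simplified wfun_dom_cod[OF F]] wf1_ar[OF wf1I[OF A B F'], simplified wfun_dom_cod[OF F']]
    wf2_ar[OF wf2I[OF A B F F' \<alpha>], simplified wfun_dom_cod[OF F] wtransf_dom_cod[OF \<alpha>]]
  have e: "wcomp K F (Id1 W A) = F" "wcomp K F' (Id1 W A) = F'" "wcomp K (Id1 W B) F = F" "wcomp K (Id1 W B) F' = F'"
    by (rule wfun_eqI[OF wcomp_cell[OF A A B W_Id1[OF A] F] F] wfun_eqI[OF wcomp_cell[OF A A B W_Id1[OF A] F'] F']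
        wfun_eqI[OF wcomp_cell[OF A B B F W_Id1[OF B]] F] wfun_eqI[OF wcomp_cell[OF A B B F' W_Id1[OF B]] F']; simp; fail)+
  note l = W_HComp[OF A A B W_Id1[OF A] W_Id1[OF A] F F' W_Id2[OF A A W_Id1[OF A]] \<alpha>, unfolded e]
  note r = W_HComp[OF A B B F F' W_Id1[OF B] W_Id1[OF B] \<alpha> W_Id2[OF B B W_Id1[OF B]], unfolded e]
  show "HComp W (Id2 W (Id1 W A)) \<alpha> = \<alpha>"
    by (rule wtransf_eqI[OF l \<alpha>]) (use wfun_unit[OF F'] in \<open>simp add: w_lact_unit\<close>)
  show "HComp W \<alpha> (Id2 W (Id1 W B)) = \<alpha>"
    by (rule wtransf_eqI[OF r \<alpha>]) (simp add: lact_Unit_eq_ract w_ract_unit)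
next
  fix A B C F G assume "A \<in> Cell0 W" "B \<in> Cell0 W" "C \<in> Cell0 W" "F \<in> Cell1 W A B" "G \<in> Cell1 W B C"
  then have A: "is_wcat K A" and B: "is_wcat K B" and C: "is_wcat K C"
    and F: "F \<in> wfunctors K A B" and G: "G \<in> wfunctors K B C" by (simp_all add: W_Cat_sel(1,2))
  note [simp] = A B C wfun_dom_cod[OF F] wfun_dom_cod[OF G]
    wf1_ar[OF wf1I[OF A B F], simplified wfun_dom_cod[OF F]] wf1_ar[OF wf1I[OF B C G], simplified wfun_dom_cod[OF G]]
  show "HComp W (Id2 W F) (Id2 W G) = Id2 W (Comp1 W G F)" unfolding W_Cat_sel(5)
    by (rule wtransf_eqI[OF W_HComp[OF A B C F F G G W_Id2[OF A B F] W_Id2[OF B C G]] W_Id2[OF A C wcomp_cell[OF A B C F G]]])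
      (use wfun_unit[OF G] in \<open>simp add: w_lact_unit\<close>)
next
  fix A B C F F' F'' G G' G'' \<alpha> \<alpha>' \<beta> \<beta>' assume "A \<in> Cell0 W" "B \<in> Cell0 W" "C \<in> Cell0 W"
    "F \<in> Cell1 W A B" "F' \<in> Cell1 W A B" "F'' \<in> Cell1 W A B" "G \<in> Cell1 W B C" "G' \<in> Cell1 W B C" "G'' \<in> Cell1 W B C"
    "\<alpha> \<in> Cell2 W F F'" "\<alpha>' \<in> Cell2 W F' F''" "\<beta> \<in> Cell2 W G G'" "\<beta>' \<in> Cell2 W G' G''"
  then have A: "is_wcat K A" and B: "is_wcat K B" and C: "is_wcat K C"
    and F: "F \<in> wfunctors K A B" and F': "F' \<in> wfunctors K A B" and F'': "F'' \<in> wfunctors K A B"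
    and G: "G \<in> wfunctors K B C" and G': "G' \<in> wfunctors K B C" and G'': "G'' \<in> wfunctors K B C"
    and \<alpha>: "\<alpha> \<in> wtransf K F F'" and \<alpha>': "\<alpha>' \<in> wtransf K F' F''"
    and \<beta>: "\<beta> \<in> wtransf K G G'" and \<beta>': "\<beta>' \<in> wtransf K G' G''"
    by (simp_all add: W_Cat_sel(1-3))
  note [simp] = A B C wfun_dom_cod[OF F] wfun_dom_cod[OF F'] wfun_dom_cod[OF F'']
    wfun_dom_cod[OF G] wfun_dom_cod[OF G'] wfun_dom_cod[OF G'']
    wtransf_dom_cod[OF \<alpha>] wtransf_dom_cod[OF \<beta>] wtransf_dom_cod[OF \<alpha>'] wtransf_dom_cod[OF \<beta>']
    wf1_ar[OF wf1I[OF A B F], simplified wfun_dom_cod[OF F]] wf1_ar[OF wf1I[OF B C G], simplified wfun_dom_cod[OF G]]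
    wf1_ar[OF wf1I[OF A B F'], simplified wfun_dom_cod[OF F']] wf1_ar[OF wf1I[OF B C G'], simplified wfun_dom_cod[OF G']]
    wf1_ar[OF wf1I[OF A B F''], simplified wfun_dom_cod[OF F'']] wf1_ar[OF wf1I[OF B C G''], simplified wfun_dom_cod[OF G'']]
    wf2_ar[OF wf2I[OF A B F F' \<alpha>], simplified wfun_dom_cod[OF F] wtransf_dom_cod[OF \<alpha>]]
    wf2_ar[OF wf2I[OF B C G G' \<beta>], simplified wfun_dom_cod[OF G] wtransf_dom_cod[OF \<beta>]]
    wf2_ar[OF wf2I[OF A B F' F'' \<alpha>'], simplified wfun_dom_cod[OF F'] wtransf_dom_cod[OF \<alpha>']]
    wf2_ar[OF wf2I[OF B C G' G'' \<beta>'], simplified wfun_dom_cod[OF G'] wtransf_dom_cod[OF \<beta>']]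
  note aa = W_VComp[OF A B F F' F'' \<alpha> \<alpha>'] and bb = W_VComp[OF B C G G' G'' \<beta> \<beta>']
  note c = wcomp_cell[OF A B C F G] wcomp_cell[OF A B C F' G'] wcomp_cell[OF A B C F'' G'']
  show "HComp W (VComp W \<alpha>' \<alpha>) (VComp W \<beta>' \<beta>) = VComp W (HComp W \<alpha>' \<beta>') (HComp W \<alpha> \<beta>)"
  proof (rule wtransf_eqI[OF W_HComp[OF A B C F F'' G G'' aa bb]
        W_VComp[OF A C c W_HComp[OF A B C F F' G G' \<alpha> \<beta>] W_HComp[OF A B C F' F'' G' G'' \<alpha>' \<beta>']]])
    fix x assume "x \<in> wpts (dom1 (wcomp K G F))"
    then have x: "x \<in> wpts A" by simp
    let ?m = "\<lambda>p q r. wmul C (p, q, r)"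
    have 1: "amap G'' (pmap F'' x, pmap F x) \<cdot>
       lact (Unit V) (wmul B (pmap F'' x, pmap F' x, pmap F x)) (comp2 \<alpha>' x) (comp2 \<alpha> x)
     = lact (Unit V) (?m (pmap G'' (pmap F'' x)) (pmap G'' (pmap F' x)) (pmap G'' (pmap F x)))
        (amap G'' (pmap F'' x, pmap F' x) \<cdot> comp2 \<alpha>' x) (amap G'' (pmap F' x, pmap F x) \<cdot> comp2 \<alpha> x)"
      by (rule comp_lact, rule_tac [15] wfun_mul[OF G'']) (use x in simp_all)
    \<comment> \<open>The one use of naturality in the interchange law: \<open>\<beta>'\<close> is
      moved past the image of \<open>\<alpha>\<close>. What remains is associativity and the
      multiplicativity in \<open>1\<close>.\<close>
    have 2: "lact (Unit V) (?m (pmap G'' (pmap F' x)) (pmap G'' (pmap F x)) (pmap G' (pmap F x)))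
        (amap G'' (pmap F' x, pmap F x) \<cdot> comp2 \<alpha> x) (comp2 \<beta>' (pmap F x))
      = lact (Unit V) (?m (pmap G'' (pmap F' x)) (pmap G' (pmap F' x)) (pmap G' (pmap F x)))
        (comp2 \<beta>' (pmap F' x)) (amap G' (pmap F' x, pmap F x) \<cdot> comp2 \<alpha> x)"
      by (rule W_nat_element[OF B C G' G'' \<beta>']) (use x in simp_all)
    let ?a = "amap G'' (pmap F'' x, pmap F' x) \<cdot> comp2 \<alpha>' x" and ?b = "amap G'' (pmap F' x, pmap F x) \<cdot> comp2 \<alpha> x"
      and ?c = "amap G' (pmap F' x, pmap F x) \<cdot> comp2 \<alpha> x"
    let ?p = "pmap G'' (pmap F'' x)" and ?q = "pmap G'' (pmap F' x)" and ?r = "pmap G'' (pmap F x)"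
      and ?s = "pmap G' (pmap F x)" and ?t = "pmap G (pmap F x)" and ?u = "pmap G' (pmap F' x)"
    have "comp2 (HComp W (VComp W \<alpha>' \<alpha>) (VComp W \<beta>' \<beta>)) x
      = lact (Unit V) (?m ?p ?q ?t) ?a (lact (Unit V) (?m ?q ?r ?t) ?b
          (lact (Unit V) (?m ?r ?s ?t) (comp2 \<beta>' (pmap F x)) (comp2 \<beta> (pmap F x))))"
      using x by (simp add: 1 w_lact_lact)
    also have "lact (Unit V) (?m ?q ?r ?t) ?b (lact (Unit V) (?m ?r ?s ?t) (comp2 \<beta>' (pmap F x)) (comp2 \<beta> (pmap F x)))
      = lact (Unit V) (?m ?q ?s ?t) (lact (Unit V) (?m ?q ?r ?s) ?b (comp2 \<beta>' (pmap F x))) (comp2 \<beta> (pmap F x))"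
      using x by (simp add: w_lact_lact)
    also have "\<dots> = lact (Unit V) (?m ?q ?u ?t) (comp2 \<beta>' (pmap F' x)) (lact (Unit V) (?m ?u ?s ?t) ?c (comp2 \<beta> (pmap F x)))"
      unfolding 2 using x by (simp add: w_lact_lact)
    also have "lact (Unit V) (?m ?p ?q ?t) ?a \<dots> = comp2 (VComp W (HComp W \<alpha>' \<beta>') (HComp W \<alpha> \<beta>)) x"
      using x by (simp add: w_lact_lact)
    finally show "comp2 (HComp W (VComp W \<alpha>' \<alpha>) (VComp W \<beta>' \<beta>)) x = comp2 (VComp W (HComp W \<alpha>' \<beta>') (HComp W \<alpha> \<beta>)) x" .
  qed
qed

end

section \<open>Functoriality in the base category\<close>

lemma left_cancel:
  assumes "r \<cdot> s = Idn V (dm s)" "ar r" "ar s" "dm r = cd s" "ar f" "ar g" "cd f = dm s" "cd g = dm s"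
    and "s \<cdot> f = s \<cdot> g"
  shows "f = g"
proof -
  have "f = r \<cdot> (s \<cdot> f)" using extend2[OF assms(1), of f] assms(2-8) by simp
  also have "\<dots> = r \<cdot> (s \<cdot> g)" by (simp only: assms(9))
  also have "\<dots> = g" using extend2[OF assms(1), of g] assms(2-8) by simp
  finally show ?thesis .
qed

lemma right_cancel:
  assumes "s \<cdot> r = Idn V (cd s)" "ar r" "ar s" "dm s = cd r" "ar f" "ar g" "dm f = cd s" "dm g = cd s"
    and "f \<cdot> s = g \<cdot> s"
  shows "f = g"
proof -
  have "f = (f \<cdot> s) \<cdot> r" using assms(1-8) by simp
  also have "\<dots> = (g \<cdot> s) \<cdot> r" by (simp only: assms(9))
  also have "\<dots> = g" using assms(1-8) by simp
  finally show ?thesis .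
qed

lemma iso_arrow_iff:
  assumes "A \<in> Obj V" "B \<in> Obj V"
  shows "iso_arrow V A B f \<longleftrightarrow> ar f \<and> dm f = A \<and> cd f = B \<and>
    (\<exists>g. ar g \<and> dm g = B \<and> cd g = A \<and> g \<cdot> f = Idn V A \<and> f \<cdot> g = Idn V B)"
  unfolding iso_arrow_def using Hom_iff[OF assms] Hom_iff[OF assms(2,1)] by auto

text \<open>Compose the comultiplication law of \<open>f\<close> with \<open>g\<close> on the right
  and with \<open>g \<star> g\<close> on the left, and the counit law with \<open>g\<close> on the
  right.\<close>

lemma K_inverse:
  assumes f: "f \<in> Hom K C D" and C: "precoalg C" and D: "precoalg D"
    and g: "ar g" "dm g = cobj D" "cd g = cobj C" "g \<cdot> f = Idn V (cobj C)" "f \<cdot> g = Idn V (cobj D)"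
  shows "g \<in> Hom K D C"
proof -
  note [simp] = K_HomD[OF f C D] C D g(1-3)
  have h: "comul D \<cdot> f = (f \<star> f) \<cdot> comul C" "counit D \<cdot> f = counit C"
    using f by (auto simp: Hom_coalgebras)
  have "(g \<star> g) \<cdot> (comul D \<cdot> (f \<cdot> g)) = (g \<star> g) \<cdot> ((f \<star> f) \<cdot> (comul C \<cdot> g))"
    using extend2[OF h(1), of g] by simp
  then have "comul C \<cdot> g = (g \<star> g) \<cdot> comul D" using g(4,5) by simp
  moreover have "counit D \<cdot> (f \<cdot> g) = counit C \<cdot> g" using extend2[OF h(2), of g] by simp
  then have "counit C \<cdot> g = counit D" using g(5) by simp
  ultimately show ?thesis by (simp add: K_Hom_iff)
qed

text \<open>The structure of \<open>C\<close> is dictated by the wish that \<open>e\<close> be a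
  coalgebra morphism. Its axioms are those of \<open>Z\<close> conjugated by \<open>e\<close>, with
  the inverses carried through the structural isomorphisms by naturality.\<close>

lemma K_transport:
  assumes Z: "is_coalg V Z" and e: "ar e" "cd e = cobj Z" and e': "ar e'" "dm e' = cobj Z" "cd e' = dm e"
    and inv: "e' \<cdot> e = Idn V (dm e)" "e \<cdot> e' = Idn V (cobj Z)"
  defines "C \<equiv> \<lparr>cobj = dm e, comul = (e' \<star> e') \<cdot> comul Z \<cdot> e, counit = counit Z \<cdot> e\<rparr>"
  shows "is_coalg V C" "e \<in> Hom K C Z" "e' \<in> Hom K Z C"
proof -
  have pZ[simp]: "precoalg Z" by (rule coalg_precoalg[OF Z])
  note [simp] = e e' inv
  have ee'[simp]: "e \<cdot> (e' \<cdot> z) = z" if "ar z" "cd z = cobj Z" for z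
    using extend2[OF inv(2), of z] that by simp
  have e'e[simp]: "e' \<cdot> (e \<cdot> z) = z" if "ar z" "cd z = dm e" for z
    using extend2[OF inv(1), of z] that by simp
  have pC[simp]: "precoalg C" unfolding precoalg_def C_def by simp
  have 1: "Assoc V (cobj Z) (cobj Z) (cobj Z) \<cdot> ((comul Z \<star> Idn V (cobj Z)) \<cdot> comul Z) = (Idn V (cobj Z) \<star> comul Z) \<cdot> comul Z"
    and 2: "LUnit V (cobj Z) \<cdot> ((counit Z \<star> Idn V (cobj Z)) \<cdot> comul Z) = Idn V (cobj Z)"
    and 3: "RUnit V (cobj Z) \<cdot> ((Idn V (cobj Z) \<star> counit Z) \<cdot> comul Z) = Idn V (cobj Z)"
    using Z unfolding is_coalg_def Let_def by simp_all
  note x1 = extend2[OF 1, of e] and x2 = extend2[OF 2, of e] and x3 = extend2[OF 3, of e]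
  have "Assoc V (dm e) (dm e) (dm e) \<cdot> ((comul C \<star> Idn V (dm e)) \<cdot> comul C)
     = Assoc V (dm e) (dm e) (dm e) \<cdot> (((e' \<star> e') \<star> e') \<cdot> ((comul Z \<star> Idn V (cobj Z)) \<cdot> (comul Z \<cdot> e)))"
    by (simp add: C_def)
  also have "\<dots> = (e' \<star> (e' \<star> e')) \<cdot> (Assoc V (cobj Z) (cobj Z) (cobj Z) \<cdot> ((comul Z \<star> Idn V (cobj Z)) \<cdot> (comul Z \<cdot> e)))"
    by (subst assoc_nat(2)) simp_all
  also have "\<dots> = (Idn V (dm e) \<star> comul C) \<cdot> comul C"
    using x1 by (simp add: C_def)
  finally have c1: "Assoc V (dm e) (dm e) (dm e) \<cdot> ((comul C \<star> Idn V (dm e)) \<cdot> comul C) = (Idn V (dm e) \<star> comul C) \<cdot> comul C" .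
  have "LUnit V (dm e) \<cdot> ((counit C \<star> Idn V (dm e)) \<cdot> comul C)
     = LUnit V (dm e) \<cdot> ((Idn V (Unit V) \<star> e') \<cdot> ((counit Z \<star> Idn V (cobj Z)) \<cdot> (comul Z \<cdot> e)))"
    by (simp add: C_def)
  also have "\<dots> = e' \<cdot> (LUnit V (cobj Z) \<cdot> ((counit Z \<star> Idn V (cobj Z)) \<cdot> (comul Z \<cdot> e)))"
    using extend2[OF LUnit_ten[of e' "dm e"], of "(counit Z \<star> Idn V (cobj Z)) \<cdot> (comul Z \<cdot> e)"] by simp
  also have "\<dots> = Idn V (dm e)" using x2 by simp
  finally have c2: "LUnit V (dm e) \<cdot> ((counit C \<star> Idn V (dm e)) \<cdot> comul C) = Idn V (dm e)" .
  have "RUnit V (dm e) \<cdot> ((Idn V (dm e) \<star> counit C) \<cdot> comul C)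
     = RUnit V (dm e) \<cdot> ((e' \<star> Idn V (Unit V)) \<cdot> ((Idn V (cobj Z) \<star> counit Z) \<cdot> (comul Z \<cdot> e)))"
    by (simp add: C_def)
  also have "\<dots> = e' \<cdot> (RUnit V (cobj Z) \<cdot> ((Idn V (cobj Z) \<star> counit Z) \<cdot> (comul Z \<cdot> e)))"
    using extend2[OF RUnit_ten[of e' "dm e"], of "(Idn V (cobj Z) \<star> counit Z) \<cdot> (comul Z \<cdot> e)"] by simp
  also have "\<dots> = Idn V (dm e)" using x3 by simp
  finally have c3: "RUnit V (dm e) \<cdot> ((Idn V (dm e) \<star> counit C) \<cdot> comul C) = Idn V (dm e)" .
  have cC [simp]: "cobj C = dm e" by (simp add: C_def)
  then show "is_coalg V C" unfolding is_coalg_def Let_def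
    using c1 c2 c3 precoalgD[OF pC] by (simp add: Hom_iff)
  show 4: "e \<in> Hom K C Z" unfolding K_Hom_iff[OF pC pZ] by (simp add: C_def)
  show "e' \<in> Hom K Z C" by (rule K_inverse[OF 4]) simp_all
qed

end

text \<open>A strong monoidal equivalence, with \<open>\<nu>\<close>, \<open>\<kappa>\<close> and
  their inverses \<open>\<mu>\<close>, \<open>\<iota>\<close>. The former act on comultiplications
  and counits, the latter on multiplications and units of enriched categories. The symmetry occurs
  only in \<open>nu_mid4\<close>, because tensor products of coalgebras use the braiding only
  through \<open>mid4\<close>.\<close>

locale symfun = V: symmon V dm cd + V': symmon V' dm' cd'
  for V :: "('o, 'a) sym_mon_cat" (structure) and dm cd
    and V' :: "('p, 'b) sym_mon_cat" and dm' cd' +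
  fixes F0 :: "'o \<Rightarrow> 'p" and F1 :: "'a \<Rightarrow> 'b" and \<nu> \<mu> :: "'o \<Rightarrow> 'o \<Rightarrow> 'b" and \<kappa> \<iota> :: 'b
  assumes F0_Obj [simp]: "A \<in> Obj V \<Longrightarrow> F0 A \<in> Obj V'"
    and F1_bij: "\<lbrakk>A \<in> Obj V; B \<in> Obj V\<rbrakk> \<Longrightarrow> bij_betw F1 (Hom V A B) (Hom V' (F0 A) (F0 B))"
    and F1_Idn: "A \<in> Obj V \<Longrightarrow> F1 (Idn V A) = Idn V' (F0 A)"
    and F1_Comp: "\<lbrakk>A \<in> Obj V; B \<in> Obj V; C \<in> Obj V; f \<in> Hom V A B; g \<in> Hom V B C\<rbrakk>
      \<Longrightarrow> F1 (g \<cdot> f) = F1 g \<cdot>\<^bsub>V'\<^esub> F1 f"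
    and nu_Hom: "\<lbrakk>A \<in> Obj V; B \<in> Obj V\<rbrakk> \<Longrightarrow> \<nu> A B \<in> Hom V' (F0 (A \<boxtimes> B)) (F0 A \<boxtimes>\<^bsub>V'\<^esub> F0 B)"
    and mu_Hom: "\<lbrakk>A \<in> Obj V; B \<in> Obj V\<rbrakk> \<Longrightarrow> \<mu> A B \<in> Hom V' (F0 A \<boxtimes>\<^bsub>V'\<^esub> F0 B) (F0 (A \<boxtimes> B))"
    and nu_mu: "\<lbrakk>A \<in> Obj V; B \<in> Obj V\<rbrakk> \<Longrightarrow> \<nu> A B \<cdot>\<^bsub>V'\<^esub> \<mu> A B = Idn V' (F0 A \<boxtimes>\<^bsub>V'\<^esub> F0 B)"
    and mu_nu: "\<lbrakk>A \<in> Obj V; B \<in> Obj V\<rbrakk> \<Longrightarrow> \<mu> A B \<cdot>\<^bsub>V'\<^esub> \<nu> A B = Idn V' (F0 (A \<boxtimes> B))"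
    and nu_nat: "\<lbrakk>A \<in> Obj V; A' \<in> Obj V; B \<in> Obj V; B' \<in> Obj V; f \<in> Hom V A A'; g \<in> Hom V B B'\<rbrakk>
      \<Longrightarrow> \<nu> A' B' \<cdot>\<^bsub>V'\<^esub> F1 (f \<star> g) = (F1 f \<star>\<^bsub>V'\<^esub> F1 g) \<cdot>\<^bsub>V'\<^esub> \<nu> A B"
    and kappa_Hom: "\<kappa> \<in> Hom V' (F0 (Unit V)) (Unit V')"
    and iota_Hom: "\<iota> \<in> Hom V' (Unit V') (F0 (Unit V))"
    and kappa_iota: "\<kappa> \<cdot>\<^bsub>V'\<^esub> \<iota> = Idn V' (Unit V')"
    and iota_kappa: "\<iota> \<cdot>\<^bsub>V'\<^esub> \<kappa> = Idn V' (F0 (Unit V))"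
    and nu_assoc: "\<lbrakk>A \<in> Obj V; B \<in> Obj V; C \<in> Obj V\<rbrakk> \<Longrightarrow>
      Assoc V' (F0 A) (F0 B) (F0 C) \<cdot>\<^bsub>V'\<^esub> (\<nu> A B \<star>\<^bsub>V'\<^esub> Idn V' (F0 C)) \<cdot>\<^bsub>V'\<^esub> \<nu> (A \<boxtimes> B) C
      = (Idn V' (F0 A) \<star>\<^bsub>V'\<^esub> \<nu> B C) \<cdot>\<^bsub>V'\<^esub> \<nu> A (B \<boxtimes> C) \<cdot>\<^bsub>V'\<^esub> F1 (Assoc V A B C)"
    and nu_lunit: "A \<in> Obj V \<Longrightarrow>
      LUnit V' (F0 A) \<cdot>\<^bsub>V'\<^esub> (\<kappa> \<star>\<^bsub>V'\<^esub> Idn V' (F0 A)) \<cdot>\<^bsub>V'\<^esub> \<nu> (Unit V) A = F1 (LUnit V A)"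
    and nu_runit: "A \<in> Obj V \<Longrightarrow>
      RUnit V' (F0 A) \<cdot>\<^bsub>V'\<^esub> (Idn V' (F0 A) \<star>\<^bsub>V'\<^esub> \<kappa>) \<cdot>\<^bsub>V'\<^esub> \<nu> A (Unit V) = F1 (RUnit V A)"
    and nu_mid4: "\<lbrakk>A \<in> Obj V; B \<in> Obj V; C \<in> Obj V; D \<in> Obj V\<rbrakk> \<Longrightarrow>
      mid4 V' (F0 A) (F0 B) (F0 C) (F0 D) \<cdot>\<^bsub>V'\<^esub> (\<nu> A B \<star>\<^bsub>V'\<^esub> \<nu> C D) \<cdot>\<^bsub>V'\<^esub> \<nu> (A \<boxtimes> B) (C \<boxtimes> D)
      = (\<nu> A C \<star>\<^bsub>V'\<^esub> \<nu> B D) \<cdot>\<^bsub>V'\<^esub> \<nu> (A \<boxtimes> C) (B \<boxtimes> D) \<cdot>\<^bsub>V'\<^esub> F1 (mid4 V A B C D)"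
    and ess_surj: "Z \<in> Obj V' \<Longrightarrow> \<exists>A \<in> Obj V. \<exists>e. iso_arrow V' (F0 A) Z e"
begin

abbreviation comp' (infixr "\<bullet>" 55) where "g \<bullet> f \<equiv> g \<cdot>\<^bsub>V'\<^esub> f"
abbreviation ten' (infixr "\<diamond>" 70) where "f \<diamond> g \<equiv> f \<star>\<^bsub>V'\<^esub> g"

lemma F1_ar [simp]:
  assumes "V.ar f"
  shows "V'.ar (F1 f)" "dm' (F1 f) = F0 (dm f)" "cd' (F1 f) = F0 (cd f)"
  using bij_betw_apply[OF F1_bij V.ar_Hom[OF assms]] assms V'.Hom_iff[of "F0 (dm f)" "F0 (cd f)" "F1 f"]
  by auto

lemma F1_id [simp]: "A \<in> Obj V \<Longrightarrow> F1 (Idn V A) = Idn V' (F0 A)"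
  by (rule F1_Idn)

lemma F1_comp [simp]: "\<lbrakk>V.ar f; V.ar g; dm g = cd f\<rbrakk> \<Longrightarrow> F1 (g \<cdot> f) = F1 g \<bullet> F1 f"
  using F1_Comp[of "dm f" "cd f" "cd g" f g] by (simp add: V.Hom_iff)

lemma F1_inj: "\<lbrakk>F1 f = F1 g; V.ar f; V.ar g; dm f = dm g; cd f = cd g\<rbrakk> \<Longrightarrow> f = g"
  using bij_betw_imp_inj_on[OF F1_bij[of "dm f" "cd f"]] V.ar_Hom[of f] V.ar_Hom[of g] by (simp add: inj_on_eq_iff)

lemma F1_eq_iff: "\<lbrakk>V.ar f; V.ar g; dm f = dm g; cd f = cd g\<rbrakk> \<Longrightarrow> F1 f = F1 g \<longleftrightarrow> f = g"
  using F1_inj by blast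

lemma F1_full:
  assumes "V'.ar h" "dm' h = F0 A" "cd' h = F0 B" "A \<in> Obj V" "B \<in> Obj V"
  obtains f where "V.ar f" "dm f = A" "cd f = B" "F1 f = h"
proof -
  have "h \<in> F1 ` Hom V A B"
    using bij_betw_imp_surj_on[OF F1_bij[of A B]] V'.ar_Hom[OF assms(1)] assms by simp
  then show ?thesis using that V.Hom_iff[OF assms(4,5)] by auto
qed

lemma structure_ar [simp]:
  "\<lbrakk>A \<in> Obj V; B \<in> Obj V\<rbrakk> \<Longrightarrow> V'.ar (\<nu> A B)"
  "\<lbrakk>A \<in> Obj V; B \<in> Obj V\<rbrakk> \<Longrightarrow> dm' (\<nu> A B) = F0 (A \<boxtimes> B)"
  "\<lbrakk>A \<in> Obj V; B \<in> Obj V\<rbrakk> \<Longrightarrow> cd' (\<nu> A B) = F0 A \<boxtimes>\<^bsub>V'\<^esub> F0 B"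
  "\<lbrakk>A \<in> Obj V; B \<in> Obj V\<rbrakk> \<Longrightarrow> V'.ar (\<mu> A B)"
  "\<lbrakk>A \<in> Obj V; B \<in> Obj V\<rbrakk> \<Longrightarrow> dm' (\<mu> A B) = F0 A \<boxtimes>\<^bsub>V'\<^esub> F0 B"
  "\<lbrakk>A \<in> Obj V; B \<in> Obj V\<rbrakk> \<Longrightarrow> cd' (\<mu> A B) = F0 (A \<boxtimes> B)"
  "V'.ar \<kappa>" "dm' \<kappa> = F0 (Unit V)" "cd' \<kappa> = Unit V'" "V'.ar \<iota>" "dm' \<iota> = Unit V'" "cd' \<iota> = F0 (Unit V)"
  using nu_Hom[of A B] mu_Hom[of A B] kappa_Hom iota_Hom by (auto simp: V'.Hom_iff)

lemma structure_inverse [simp]: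
  "\<lbrakk>A \<in> Obj V; B \<in> Obj V\<rbrakk> \<Longrightarrow> \<nu> A B \<bullet> \<mu> A B = Idn V' (F0 A \<boxtimes>\<^bsub>V'\<^esub> F0 B)"
  "\<lbrakk>A \<in> Obj V; B \<in> Obj V; V'.ar z; cd' z = F0 A \<boxtimes>\<^bsub>V'\<^esub> F0 B\<rbrakk> \<Longrightarrow> \<nu> A B \<bullet> (\<mu> A B \<bullet> z) = z"
  "\<lbrakk>A \<in> Obj V; B \<in> Obj V\<rbrakk> \<Longrightarrow> \<mu> A B \<bullet> \<nu> A B = Idn V' (F0 (A \<boxtimes> B))"
  "\<lbrakk>A \<in> Obj V; B \<in> Obj V; V'.ar z; cd' z = F0 (A \<boxtimes> B)\<rbrakk> \<Longrightarrow> \<mu> A B \<bullet> (\<nu> A B \<bullet> z) = z"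
  "\<kappa> \<bullet> \<iota> = Idn V' (Unit V')" "\<lbrakk>V'.ar z; cd' z = Unit V'\<rbrakk> \<Longrightarrow> \<kappa> \<bullet> (\<iota> \<bullet> z) = z"
  "\<iota> \<bullet> \<kappa> = Idn V' (F0 (Unit V))" "\<lbrakk>V'.ar z; cd' z = F0 (Unit V)\<rbrakk> \<Longrightarrow> \<iota> \<bullet> (\<kappa> \<bullet> z) = z"
  subgoal by (rule nu_mu)
  subgoal using V'.extend2[OF nu_mu[of A B], of z] by simp
  subgoal by (rule mu_nu)
  subgoal using V'.extend2[OF mu_nu[of A B], of z] by simp
  subgoal by (rule kappa_iota)
  subgoal using V'.extend2[OF kappa_iota, of z] by simp
  subgoal by (rule iota_kappa)
  subgoal using V'.extend2[OF iota_kappa, of z] by simp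
  done

lemma nu_natural:
  "\<lbrakk>V.ar f; V.ar g; cd f = A; cd g = B\<rbrakk> \<Longrightarrow> \<nu> A B \<bullet> F1 (f \<star> g) = (F1 f \<diamond> F1 g) \<bullet> \<nu> (dm f) (dm g)"
  using nu_nat[of "dm f" "cd f" "dm g" "cd g" f g] by (auto simp: V.ar_Hom)

lemma nu_natural':
  assumes "V.ar f" "V.ar g" "cd f = A" "cd g = B" "V'.ar z" "cd' z = F0 (dm f \<boxtimes> dm g)"
  shows "(F1 f \<diamond> F1 g) \<bullet> (\<nu> (dm f) (dm g) \<bullet> z) = \<nu> A B \<bullet> (F1 (f \<star> g) \<bullet> z)"
  using V'.extend2[OF nu_natural[OF assms(1-4)], of z] assms by auto

lemma mu_natural:
  assumes "V.ar f" "V.ar g" "cd f = A" "cd g = B" "dm f = A'" "dm g = B'"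
  shows "\<mu> A B \<bullet> (F1 f \<diamond> F1 g) = F1 (f \<star> g) \<bullet> \<mu> A' B'"
proof (rule V'.left_cancel[of "\<mu> A B" "\<nu> A B"])
  have "\<nu> A B \<bullet> (F1 (f \<star> g) \<bullet> \<mu> A' B') = ((F1 f \<diamond> F1 g) \<bullet> \<nu> A' B') \<bullet> \<mu> A' B'"
    using V'.extend2[OF nu_natural[OF assms(1-4)], of "\<mu> A' B'"] assms by auto
  then show "\<nu> A B \<bullet> (\<mu> A B \<bullet> (F1 f \<diamond> F1 g)) = \<nu> A B \<bullet> (F1 (f \<star> g) \<bullet> \<mu> A' B')"
    using assms by auto
qed (use assms in auto)

lemma mu_natural':
  assumes "V.ar f" "V.ar g" "cd f = A" "cd g = B" "dm f = A'" "dm g = B'" "V'.ar z" "cd' z = F0 A' \<boxtimes>\<^bsub>V'\<^esub> F0 B'"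
  shows "\<mu> A B \<bullet> ((F1 f \<diamond> F1 g) \<bullet> z) = F1 (f \<star> g) \<bullet> (\<mu> A' B' \<bullet> z)"
  using V'.extend2[OF mu_natural[OF assms(1-6)], of z] assms by auto

definition F0c :: "('o, 'a) coalg \<Rightarrow> ('p, 'b) coalg" where
  "F0c C = \<lparr>cobj = F0 (cobj C), comul = \<nu> (cobj C) (cobj C) \<bullet> F1 (comul C), counit = \<kappa> \<bullet> F1 (counit C)\<rparr>"

lemma F0c_sel [simp]: "cobj (F0c C) = F0 (cobj C)" "comul (F0c C) = \<nu> (cobj C) (cobj C) \<bullet> F1 (comul C)"
  "counit (F0c C) = \<kappa> \<bullet> F1 (counit C)"
  by (simp_all add: F0c_def)

lemma F0c_precoalg [simp]: "V.precoalg C \<Longrightarrow> V'.precoalg (F0c C)"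
  unfolding V'.precoalg_def[of "F0c C"] by simp

text \<open>Both sides of coassociativity for \<open>F0c C\<close> are images under
  \<open>F1\<close> of the sides for \<open>C\<close>, followed by the invertible arrow
  \<open>?X\<close>; the counit laws are images outright. So faithfulness gives both directions, and
  the reflecting one is what \<open>coalg_ess_surj\<close> needs.\<close>

lemma F0c_coalg:
  assumes C: "V.precoalg C"
  shows "is_coalg V' (F0c C) \<longleftrightarrow> is_coalg V C"
proof -
  note [simp] = C
  let ?c = "cobj C" and ?d = "comul C" and ?e = "counit C"
  let ?X = "(Idn V' (F0 ?c) \<diamond> \<nu> ?c ?c) \<bullet> \<nu> ?c (?c \<boxtimes> ?c)"
  let ?l = "Assoc V ?c ?c ?c \<cdot> ((?d \<star> Idn V ?c) \<cdot> ?d)" and ?r = "(Idn V ?c \<star> ?d) \<cdot> ?d"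
  have "Assoc V' (F0 ?c) (F0 ?c) (F0 ?c) \<bullet> ((comul (F0c C) \<diamond> Idn V' (F0 ?c)) \<bullet> comul (F0c C))
    = Assoc V' (F0 ?c) (F0 ?c) (F0 ?c) \<bullet> ((\<nu> ?c ?c \<diamond> Idn V' (F0 ?c)) \<bullet>
        ((F1 ?d \<diamond> F1 (Idn V ?c)) \<bullet> (\<nu> ?c ?c \<bullet> F1 ?d)))" by simp
  also have "(F1 ?d \<diamond> F1 (Idn V ?c)) \<bullet> (\<nu> ?c ?c \<bullet> F1 ?d) = \<nu> (?c \<boxtimes> ?c) ?c \<bullet> (F1 (?d \<star> Idn V ?c) \<bullet> F1 ?d)"
    using nu_natural'[of ?d "Idn V ?c" "?c \<boxtimes> ?c" ?c "F1 ?d"] by simp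
  also have "Assoc V' (F0 ?c) (F0 ?c) (F0 ?c) \<bullet> ((\<nu> ?c ?c \<diamond> Idn V' (F0 ?c)) \<bullet> \<dots>) = ?X \<bullet> F1 ?l"
    using V'.extend2[OF nu_assoc[of ?c ?c ?c], of "F1 (?d \<star> Idn V ?c) \<bullet> F1 ?d"] by simp
  finally have l: "Assoc V' (F0 ?c) (F0 ?c) (F0 ?c) \<bullet> ((comul (F0c C) \<diamond> Idn V' (F0 ?c)) \<bullet> comul (F0c C)) = ?X \<bullet> F1 ?l" .
  have "(Idn V' (F0 ?c) \<diamond> comul (F0c C)) \<bullet> comul (F0c C)
    = (Idn V' (F0 ?c) \<diamond> \<nu> ?c ?c) \<bullet> ((F1 (Idn V ?c) \<diamond> F1 ?d) \<bullet> (\<nu> ?c ?c \<bullet> F1 ?d))" by simp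
  also have "(F1 (Idn V ?c) \<diamond> F1 ?d) \<bullet> (\<nu> ?c ?c \<bullet> F1 ?d) = \<nu> ?c (?c \<boxtimes> ?c) \<bullet> (F1 (Idn V ?c \<star> ?d) \<bullet> F1 ?d)"
    using nu_natural'[of "Idn V ?c" ?d ?c "?c \<boxtimes> ?c" "F1 ?d"] by simp
  finally have r: "(Idn V' (F0 ?c) \<diamond> comul (F0c C)) \<bullet> comul (F0c C) = ?X \<bullet> F1 ?r" by simp
  have 1: "?X \<bullet> F1 ?l = ?X \<bullet> F1 ?r \<longleftrightarrow> ?l = ?r"
  proof
    assume "?X \<bullet> F1 ?l = ?X \<bullet> F1 ?r"
    then have "F1 ?l = F1 ?r"
      by (rule V'.left_cancel[of "\<mu> ?c (?c \<boxtimes> ?c) \<bullet> (Idn V' (F0 ?c) \<diamond> \<mu> ?c ?c)" ?X, rotated -1]) simp_all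
    then show "?l = ?r" by (rule F1_inj) simp_all
  qed simp
  have "LUnit V' (F0 ?c) \<bullet> ((counit (F0c C) \<diamond> Idn V' (F0 ?c)) \<bullet> comul (F0c C))
    = LUnit V' (F0 ?c) \<bullet> ((\<kappa> \<diamond> Idn V' (F0 ?c)) \<bullet> ((F1 ?e \<diamond> F1 (Idn V ?c)) \<bullet> (\<nu> ?c ?c \<bullet> F1 ?d)))" by simp
  also have "(F1 ?e \<diamond> F1 (Idn V ?c)) \<bullet> (\<nu> ?c ?c \<bullet> F1 ?d) = \<nu> (Unit V) ?c \<bullet> (F1 (?e \<star> Idn V ?c) \<bullet> F1 ?d)"
    using nu_natural'[of ?e "Idn V ?c" "Unit V" ?c "F1 ?d"] by simp
  also have "LUnit V' (F0 ?c) \<bullet> ((\<kappa> \<diamond> Idn V' (F0 ?c)) \<bullet> \<dots>) = F1 (LUnit V ?c \<cdot> ((?e \<star> Idn V ?c) \<cdot> ?d))"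
    using V'.extend2[OF nu_lunit[of ?c], of "F1 (?e \<star> Idn V ?c) \<bullet> F1 ?d"] by simp
  finally have "LUnit V' (F0 ?c) \<bullet> ((counit (F0c C) \<diamond> Idn V' (F0 ?c)) \<bullet> comul (F0c C)) = Idn V' (F0 ?c)
    \<longleftrightarrow> F1 (LUnit V ?c \<cdot> ((?e \<star> Idn V ?c) \<cdot> ?d)) = F1 (Idn V ?c)" by simp
  also have "\<dots> \<longleftrightarrow> LUnit V ?c \<cdot> ((?e \<star> Idn V ?c) \<cdot> ?d) = Idn V ?c"
    by (rule F1_eq_iff) simp_all
  finally have 2: "LUnit V' (F0 ?c) \<bullet> ((counit (F0c C) \<diamond> Idn V' (F0 ?c)) \<bullet> comul (F0c C)) = Idn V' (F0 ?c)
    \<longleftrightarrow> LUnit V ?c \<cdot> ((?e \<star> Idn V ?c) \<cdot> ?d) = Idn V ?c" .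
  have "RUnit V' (F0 ?c) \<bullet> ((Idn V' (F0 ?c) \<diamond> counit (F0c C)) \<bullet> comul (F0c C))
    = RUnit V' (F0 ?c) \<bullet> ((Idn V' (F0 ?c) \<diamond> \<kappa>) \<bullet> ((F1 (Idn V ?c) \<diamond> F1 ?e) \<bullet> (\<nu> ?c ?c \<bullet> F1 ?d)))" by simp
  also have "(F1 (Idn V ?c) \<diamond> F1 ?e) \<bullet> (\<nu> ?c ?c \<bullet> F1 ?d) = \<nu> ?c (Unit V) \<bullet> (F1 (Idn V ?c \<star> ?e) \<bullet> F1 ?d)"
    using nu_natural'[of "Idn V ?c" ?e ?c "Unit V" "F1 ?d"] by simp
  also have "RUnit V' (F0 ?c) \<bullet> ((Idn V' (F0 ?c) \<diamond> \<kappa>) \<bullet> \<dots>) = F1 (RUnit V ?c \<cdot> ((Idn V ?c \<star> ?e) \<cdot> ?d))"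
    using V'.extend2[OF nu_runit[of ?c], of "F1 (Idn V ?c \<star> ?e) \<bullet> F1 ?d"] by simp
  finally have "RUnit V' (F0 ?c) \<bullet> ((Idn V' (F0 ?c) \<diamond> counit (F0c C)) \<bullet> comul (F0c C)) = Idn V' (F0 ?c)
    \<longleftrightarrow> F1 (RUnit V ?c \<cdot> ((Idn V ?c \<star> ?e) \<cdot> ?d)) = F1 (Idn V ?c)" by simp
  also have "\<dots> \<longleftrightarrow> RUnit V ?c \<cdot> ((Idn V ?c \<star> ?e) \<cdot> ?d) = Idn V ?c"
    by (rule F1_eq_iff) simp_all
  finally have 3: "RUnit V' (F0 ?c) \<bullet> ((Idn V' (F0 ?c) \<diamond> counit (F0c C)) \<bullet> comul (F0c C)) = Idn V' (F0 ?c)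
    \<longleftrightarrow> RUnit V ?c \<cdot> ((Idn V ?c \<star> ?e) \<cdot> ?d) = Idn V ?c" .
  show ?thesis unfolding is_coalg_def Let_def F0c_sel(1) l r 1 2 3 using V'.precoalgD[OF F0c_precoalg[OF C]]
    by (simp add: V.Hom_iff V'.Hom_iff del: F0c_sel(2,3))
qed

text \<open>The arrows \<open>\<nu>\<close> and \<open>\<kappa>\<close> added by \<open>F0c\<close>
  can be cancelled and \<open>F1\<close> is faithful, so the morphism equations hold in
  \<open>V'\<close> exactly when they hold in \<open>V\<close>.\<close>

lemma F1_K:
  assumes "V.precoalg C" "V.precoalg D" "V.ar f" "dm f = cobj C" "cd f = cobj D"
  shows "F1 f \<in> Hom V'.K (F0c C) (F0c D) \<longleftrightarrow> f \<in> Hom V.K C D"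
proof -
  note [simp] = assms
  let ?c = "cobj C" and ?d = "cobj D"
  have "(F1 f \<diamond> F1 f) \<bullet> (\<nu> ?c ?c \<bullet> F1 (comul C)) = \<nu> ?d ?d \<bullet> F1 ((f \<star> f) \<cdot> comul C)"
    using nu_natural'[of f f ?d ?d "F1 (comul C)"] by simp
  then have 1: "comul (F0c D) \<bullet> F1 f = (F1 f \<diamond> F1 f) \<bullet> comul (F0c C)
     \<longleftrightarrow> \<nu> ?d ?d \<bullet> F1 (comul D \<cdot> f) = \<nu> ?d ?d \<bullet> F1 ((f \<star> f) \<cdot> comul C)" by simp
  have 2: "\<nu> ?d ?d \<bullet> F1 (comul D \<cdot> f) = \<nu> ?d ?d \<bullet> F1 ((f \<star> f) \<cdot> comul C) \<longleftrightarrow> comul D \<cdot> f = (f \<star> f) \<cdot> comul C"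
  proof
    assume "\<nu> ?d ?d \<bullet> F1 (comul D \<cdot> f) = \<nu> ?d ?d \<bullet> F1 ((f \<star> f) \<cdot> comul C)"
    then have "F1 (comul D \<cdot> f) = F1 ((f \<star> f) \<cdot> comul C)"
      by (rule V'.left_cancel[of "\<mu> ?d ?d" "\<nu> ?d ?d", rotated -1]) simp_all
    then show "comul D \<cdot> f = (f \<star> f) \<cdot> comul C" by (rule F1_inj) simp_all
  qed simp
  have 3: "counit (F0c D) \<bullet> F1 f = counit (F0c C) \<longleftrightarrow> counit D \<cdot> f = counit C"
  proof
    assume "counit (F0c D) \<bullet> F1 f = counit (F0c C)"
    then have "\<kappa> \<bullet> F1 (counit D \<cdot> f) = \<kappa> \<bullet> F1 (counit C)" by simp
    then have "F1 (counit D \<cdot> f) = F1 (counit C)"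
      by (rule V'.left_cancel[of \<iota> \<kappa>, rotated -1]) simp_all
    then show "counit D \<cdot> f = counit C" by (rule F1_inj) simp_all
  next
    assume "counit D \<cdot> f = counit C"
    then have "F1 (counit D \<cdot> f) = F1 (counit C)" by simp
    then show "counit (F0c D) \<bullet> F1 f = counit (F0c C)" by simp
  qed
  show ?thesis using 1 2 3 V.K_Hom_iff[OF assms(1,2)] V'.K_Hom_iff[OF assms(1,2)[THEN F0c_precoalg]] by simp
qed

text \<open>The left unit law of \<open>\<nu>\<close> at the unit object, with the second
  \<open>\<kappa>\<close> moved through the unit isomorphism by naturality. It gives the
  comultiplication law in \<open>kappa_K\<close> and the counit law in \<open>nu_K\<close>.\<close>

lemma kappa_kappa: "LUnit V' (Unit V') \<bullet> ((\<kappa> \<diamond> \<kappa>) \<bullet> \<nu> (Unit V) (Unit V)) = \<kappa> \<bullet> F1 (LUnit V (Unit V))"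
proof -
  have "LUnit V' (Unit V') \<bullet> ((\<kappa> \<diamond> \<kappa>) \<bullet> \<nu> (Unit V) (Unit V))
    = LUnit V' (Unit V') \<bullet> ((Idn V' (Unit V') \<diamond> \<kappa>) \<bullet> ((\<kappa> \<diamond> Idn V' (F0 (Unit V))) \<bullet> \<nu> (Unit V) (Unit V)))" by simp
  also have "\<dots> = \<kappa> \<bullet> (LUnit V' (F0 (Unit V)) \<bullet> ((\<kappa> \<diamond> Idn V' (F0 (Unit V))) \<bullet> \<nu> (Unit V) (Unit V)))"
    using V'.extend2[OF V'.LUnit_ten[of \<kappa> "Unit V'"], of "(\<kappa> \<diamond> Idn V' (F0 (Unit V))) \<bullet> \<nu> (Unit V) (Unit V)"] by simp
  also have "\<dots> = \<kappa> \<bullet> F1 (LUnit V (Unit V))" by (simp add: nu_lunit)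
  finally show ?thesis .
qed

lemma kappa_K: "\<kappa> \<in> Hom V'.K (F0c (Unit V.K)) (Unit V'.K)"
proof -
  have [simp]: "F1 (LUnit V (Unit V)) \<bullet> F1 (LUnitInv V (Unit V)) = Idn V' (F0 (Unit V))"
    using F1_comp[of "LUnitInv V (Unit V)" "LUnit V (Unit V)"] by simp
  have "LUnit V' (Unit V') \<bullet> ((\<kappa> \<diamond> \<kappa>) \<bullet> (\<nu> (Unit V) (Unit V) \<bullet> F1 (LUnitInv V (Unit V)))) = \<kappa>"
    using V'.extend2[OF kappa_kappa, of "F1 (LUnitInv V (Unit V))"] by simp
  also have "\<dots> = LUnit V' (Unit V') \<bullet> (LUnitInv V' (Unit V') \<bullet> \<kappa>)"
    by (simp del: V'.LUnitInv_comp)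
  finally have "(\<kappa> \<diamond> \<kappa>) \<bullet> (\<nu> (Unit V) (Unit V) \<bullet> F1 (LUnitInv V (Unit V))) = LUnitInv V' (Unit V') \<bullet> \<kappa>"
    by (rule V'.left_cancel[of "LUnitInv V' (Unit V')", rotated -1]) (simp_all del: V'.LUnitInv_comp)
  then show ?thesis
    using F0c_precoalg[OF V.precoalg_Unit] by (subst V'.K_Hom_iff) simp_all
qed

lemma iota_K: "\<iota> \<in> Hom V'.K (Unit V'.K) (F0c (Unit V.K))"
  by (rule V'.K_inverse[OF kappa_K]) (use F0c_precoalg[OF V.precoalg_Unit] in simp_all)

lemma nu_K:
  assumes "V.precoalg C" "V.precoalg D"
  shows "\<nu> (cobj C) (cobj D) \<in> Hom V'.K (F0c (Ten V.K C D)) (Ten V'.K (F0c C) (F0c D))"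
proof -
  note [simp] = assms
  let ?c = "cobj C" and ?d = "cobj D"
  \<comment> \<open>The trailing identity gives the composite the shape expected by
    \<open>nu_natural'\<close>.\<close>
  have 1: "mid4 V' (F0 ?c) (F0 ?c) (F0 ?d) (F0 ?d) \<bullet>
      ((\<nu> ?c ?c \<diamond> \<nu> ?d ?d) \<bullet> ((F1 (comul C) \<diamond> F1 (comul D)) \<bullet> (\<nu> ?c ?d \<bullet> Idn V' (F0 (?c \<boxtimes> ?d)))))
     = (\<nu> ?c ?d \<diamond> \<nu> ?c ?d) \<bullet> (\<nu> (?c \<boxtimes> ?d) (?c \<boxtimes> ?d) \<bullet> F1 (mid4 V ?c ?c ?d ?d \<cdot> (comul C \<star> comul D)))"
    using nu_natural'[of "comul C" "comul D" "?c \<boxtimes> ?c" "?d \<boxtimes> ?d" "Idn V' (F0 (?c \<boxtimes> ?d))"]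
      V'.extend2[OF nu_mid4[of ?c ?c ?d ?d], of "F1 (comul C \<star> comul D)"] by simp
  have "LUnit V' (Unit V') \<bullet> ((\<kappa> \<diamond> \<kappa>) \<bullet> ((F1 (counit C) \<diamond> F1 (counit D)) \<bullet> (\<nu> ?c ?d \<bullet> Idn V' (F0 (?c \<boxtimes> ?d)))))
    = \<kappa> \<bullet> F1 (LUnit V (Unit V) \<cdot> (counit C \<star> counit D))"
    using nu_natural'[of "counit C" "counit D" "Unit V" "Unit V" "Idn V' (F0 (?c \<boxtimes> ?d))"]
      V'.extend2[OF kappa_kappa, of "F1 (counit C \<star> counit D)"] by simp
  with 1 show ?thesis
    using F0c_precoalg[OF V.precoalg_Ten[OF assms]] V'.precoalg_Ten[OF assms[THEN F0c_precoalg]]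
    by (subst V'.K_Hom_iff) simp_all
qed

lemma mu_K:
  assumes "V.precoalg C" "V.precoalg D"
  shows "\<mu> (cobj C) (cobj D) \<in> Hom V'.K (Ten V'.K (F0c C) (F0c D)) (F0c (Ten V.K C D))"
  by (rule V'.K_inverse[OF nu_K[OF assms]])
    (use F0c_precoalg[OF V.precoalg_Ten[OF assms]] V'.precoalg_Ten[OF assms[THEN F0c_precoalg]] assms in simp_all)

text \<open>The structure of \<open>Z\<close> is transported along an isomorphism from some
  \<open>F0 a\<close>, the transported maps are lifted to \<open>V\<close> by fullness, and the
  axioms are reflected by \<open>F0c_coalg\<close>.\<close>

lemma coalg_ess_surj:
  assumes Z: "is_coalg V' Z"
  shows "\<exists>C e e'. is_coalg V C \<and> e \<in> Hom V'.K (F0c C) Z \<and> e' \<in> Hom V'.K Z (F0c C) \<and>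
    e' \<bullet> e = Idn V' (F0 (cobj C)) \<and> e \<bullet> e' = Idn V' (cobj Z)"
proof -
  have pZ: "V'.precoalg Z" by (rule V'.coalg_precoalg[OF Z])
  note [simp] = pZ
  obtain a e where a[simp]: "a \<in> Obj V" and e: "iso_arrow V' (F0 a) (cobj Z) e"
    using ess_surj[of "cobj Z"] by auto
  then obtain e' where [simp]: "V'.ar e" "dm' e = F0 a" "cd' e = cobj Z" "V'.ar e'" "dm' e' = cobj Z" "cd' e' = F0 a"
    and inv[simp]: "e' \<bullet> e = Idn V' (F0 a)" "e \<bullet> e' = Idn V' (cobj Z)"
    by (auto simp: V'.iso_arrow_iff)
  \<comment> \<open>The factors \<open>\<mu>\<close> here and \<open>\<iota>\<close> for the counit
    cancel the \<open>\<nu>\<close> and \<open>\<kappa>\<close> that \<open>F0c\<close> adds, so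
    that \<open>F0c C\<close> is exactly the transported coalgebra.\<close>
  obtain d where d: "V.ar d" "dm d = a" "cd d = a \<boxtimes> a" "F1 d = \<mu> a a \<bullet> ((e' \<diamond> e') \<bullet> comul Z \<bullet> e)"
    by (rule F1_full[of "\<mu> a a \<bullet> ((e' \<diamond> e') \<bullet> comul Z \<bullet> e)" a "a \<boxtimes> a"]) simp_all
  obtain c where c: "V.ar c" "dm c = a" "cd c = Unit V" "F1 c = \<iota> \<bullet> (counit Z \<bullet> e)"
    by (rule F1_full[of "\<iota> \<bullet> (counit Z \<bullet> e)" a "Unit V"]) simp_all
  define C where "C = \<lparr>cobj = a, comul = d, counit = c\<rparr>"
  have F: "F0c C = \<lparr>cobj = dm' e, comul = (e' \<diamond> e') \<bullet> comul Z \<bullet> e, counit = counit Z \<bullet> e\<rparr>"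
    unfolding F0c_def by (simp add: C_def c d)
  have T: "is_coalg V' (F0c C)" "e \<in> Hom V'.K (F0c C) Z" "e' \<in> Hom V'.K Z (F0c C)"
    unfolding F by (rule V'.K_transport[OF Z]; simp)+
  have "V.precoalg C" unfolding V.precoalg_def C_def using c d by simp
  then have "is_coalg V C" using F0c_coalg T(1) by blast
  then show ?thesis using T(2,3) inv by (intro exI[of _ C] exI[of _ e] exI[of _ e']) (simp add: C_def)
qed

end

context symmon
begin

text \<open>An enriched category without its associativity and unit laws. \<open>Fw0\<close> can be
  applied to such data already, which lets the laws before and after be compared in both
  directions.\<close>

definition prewcat :: "('x, ('o, 'a) coalg, 'a) wcat \<Rightarrow> bool" where
  "prewcat A \<longleftrightarrow> whom A \<in> extensional (wpts A \<times> wpts A) \<and>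
     wmul A \<in> extensional (wpts A \<times> wpts A \<times> wpts A) \<and> wunit A \<in> extensional (wpts A) \<and>
     (\<forall>x \<in> wpts A. \<forall>y \<in> wpts A. is_coalg V (whom A (x, y))) \<and>
     (\<forall>x \<in> wpts A. \<forall>y \<in> wpts A. \<forall>z \<in> wpts A.
        wmul A (x, y, z) \<in> Hom K (Ten K (whom A (x, y)) (whom A (y, z))) (whom A (x, z))) \<and>
     (\<forall>x \<in> wpts A. wunit A x \<in> Hom K (Unit K) (whom A (x, x)))"

lemma wcat_iff: "is_wcat K A \<longleftrightarrow> prewcat A \<and>
    (\<forall>x \<in> wpts A. \<forall>y \<in> wpts A. \<forall>z \<in> wpts A. \<forall>u \<in> wpts A.
      wmul A (x, z, u) \<cdot> (wmul A (x, y, z) \<star> Idn V (cobj (whom A (z, u))))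
        = wmul A (x, y, u) \<cdot> (Idn V (cobj (whom A (x, y))) \<star> wmul A (y, z, u))
            \<cdot> Assoc V (cobj (whom A (x, y))) (cobj (whom A (y, z))) (cobj (whom A (z, u)))) \<and>
    (\<forall>x \<in> wpts A. \<forall>y \<in> wpts A.
      wmul A (x, x, y) \<cdot> (wunit A x \<star> Idn V (cobj (whom A (x, y)))) = LUnit V (cobj (whom A (x, y)))) \<and>
    (\<forall>x \<in> wpts A. \<forall>y \<in> wpts A.
      wmul A (x, y, y) \<cdot> (Idn V (cobj (whom A (x, y))) \<star> wunit A y) = RUnit V (cobj (whom A (x, y))))"
  (is "_ \<longleftrightarrow> _ \<and> ?laws")
proof (intro iffI conjI)
  assume A: "is_wcat K A"
  show "prewcat A" unfolding prewcat_def
    using wcat_ext[OF A] wcat_coalg[OF A] wcat_mul[OF A] wcat_unit[OF A] by simp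
qed (use wcat_assoc wcat_lunit wcat_runit in
  \<open>auto simp del: coalgebras_sel simp: prewcat_def is_wcat_def Let_def PiE_iff coalgebras_sel(1,2,3,5,7,8,10)\<close>)

lemma prewcat_ar [simp]:
  assumes A: "prewcat A"
  shows "\<lbrakk>x \<in> wpts A; y \<in> wpts A\<rbrakk> \<Longrightarrow> precoalg (whom A (x, y))"
    "\<lbrakk>x \<in> wpts A; y \<in> wpts A; z \<in> wpts A\<rbrakk> \<Longrightarrow> ar (wmul A (x, y, z))"
    "\<lbrakk>x \<in> wpts A; y \<in> wpts A; z \<in> wpts A\<rbrakk> \<Longrightarrow>
      dm (wmul A (x, y, z)) = cobj (whom A (x, y)) \<boxtimes> cobj (whom A (y, z))"
    "\<lbrakk>x \<in> wpts A; y \<in> wpts A; z \<in> wpts A\<rbrakk> \<Longrightarrow> cd (wmul A (x, y, z)) = cobj (whom A (x, z))"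
    "x \<in> wpts A \<Longrightarrow> ar (wunit A x)" "x \<in> wpts A \<Longrightarrow> dm (wunit A x) = Unit V"
    "x \<in> wpts A \<Longrightarrow> cd (wunit A x) = cobj (whom A (x, x))"
proof -
  show p: "precoalg (whom A (x, y))" if "x \<in> wpts A" "y \<in> wpts A" for x y
    using A that by (intro coalg_precoalg) (simp add: prewcat_def)
  show "ar (wmul A (x, y, z))" "dm (wmul A (x, y, z)) = cobj (whom A (x, y)) \<boxtimes> cobj (whom A (y, z))"
    "cd (wmul A (x, y, z)) = cobj (whom A (x, z))" if "x \<in> wpts A" "y \<in> wpts A" "z \<in> wpts A"
  proof -
    have "wmul A (x, y, z) \<in> Hom K (Ten K (whom A (x, y)) (whom A (y, z))) (whom A (x, z))"
      using A that by (simp add: prewcat_def)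
    from K_HomD[OF this] show "ar (wmul A (x, y, z))"
      "dm (wmul A (x, y, z)) = cobj (whom A (x, y)) \<boxtimes> cobj (whom A (y, z))"
      "cd (wmul A (x, y, z)) = cobj (whom A (x, z))" using p that by simp_all
  qed
  show "ar (wunit A x)" "dm (wunit A x) = Unit V" "cd (wunit A x) = cobj (whom A (x, x))" if "x \<in> wpts A"
  proof -
    have "wunit A x \<in> Hom K (Unit K) (whom A (x, x))" using A that by (simp add: prewcat_def)
    from K_HomD[OF this] show "ar (wunit A x)" "dm (wunit A x) = Unit V" "cd (wunit A x) = cobj (whom A (x, x))"
      using p that by simp_all
  qed
qed

text \<open>The structure of \<open>T\<close> is that of \<open>Z\<close> conjugated by
  \<open>e\<close>. Hence \<open>e\<close> and \<open>e'\<close>, with the identity on points, are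
  functors whose composites are identities; the equivalence is in fact an isomorphism.\<close>

lemma wcat_transport:
  assumes Z: "is_wcat K Z" and pts: "wpts T = wpts Z"
    and ext: "whom T \<in> extensional (wpts Z \<times> wpts Z)" "wmul T \<in> extensional (wpts Z \<times> wpts Z \<times> wpts Z)"
      "wunit T \<in> extensional (wpts Z)"
    and coalg: "\<And>x y. \<lbrakk>x \<in> wpts Z; y \<in> wpts Z\<rbrakk> \<Longrightarrow> is_coalg V (whom T (x, y))"
    and e: "\<And>x y. \<lbrakk>x \<in> wpts Z; y \<in> wpts Z\<rbrakk> \<Longrightarrow> e (x, y) \<in> Hom K (whom T (x, y)) (whom Z (x, y))"
    and e': "\<And>x y. \<lbrakk>x \<in> wpts Z; y \<in> wpts Z\<rbrakk> \<Longrightarrow> e' (x, y) \<in> Hom K (whom Z (x, y)) (whom T (x, y))"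
    and e'e: "\<And>x y. \<lbrakk>x \<in> wpts Z; y \<in> wpts Z\<rbrakk> \<Longrightarrow> e' (x, y) \<cdot> e (x, y) = Idn V (cobj (whom T (x, y)))"
    and ee': "\<And>x y. \<lbrakk>x \<in> wpts Z; y \<in> wpts Z\<rbrakk> \<Longrightarrow> e (x, y) \<cdot> e' (x, y) = Idn V (cobj (whom Z (x, y)))"
    and mul: "\<And>x y z. \<lbrakk>x \<in> wpts Z; y \<in> wpts Z; z \<in> wpts Z\<rbrakk> \<Longrightarrow>
      wmul T (x, y, z) = e' (x, z) \<cdot> wmul Z (x, y, z) \<cdot> (e (x, y) \<star> e (y, z))"
    and unit: "\<And>x. x \<in> wpts Z \<Longrightarrow> wunit T x = e' (x, x) \<cdot> wunit Z x"
  shows "is_wcat K T" "equivalent_0cells (W_Cat K t) T Z"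
proof -
  note [simp] = Z pts e'e ee'
  have pT[simp]: "precoalg (whom T (x, y))" if "x \<in> wpts Z" "y \<in> wpts Z" for x y
    by (rule coalg_precoalg[OF coalg[OF that]])
  have e_ar[simp]: "ar (e (x, y))" "dm (e (x, y)) = cobj (whom T (x, y))" "cd (e (x, y)) = cobj (whom Z (x, y))"
    "ar (e' (x, y))" "dm (e' (x, y)) = cobj (whom Z (x, y))" "cd (e' (x, y)) = cobj (whom T (x, y))"
    if "x \<in> wpts Z" "y \<in> wpts Z" for x y
    using K_HomD[OF e[OF that]] K_HomD[OF e'[OF that]] that by simp_all
  have e'e'[simp]: "e' (x, y) \<cdot> (e (x, y) \<cdot> z) = z" if "x \<in> wpts Z" "y \<in> wpts Z" "ar z" "cd z = cobj (whom T (x, y))" for x y z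
    using extend2[OF e'e[OF that(1,2)], of z] that by simp
  have ee''[simp]: "e (x, y) \<cdot> (e' (x, y) \<cdot> z) = z" if "x \<in> wpts Z" "y \<in> wpts Z" "ar z" "cd z = cobj (whom Z (x, y))" for x y z
    using extend2[OF ee'[OF that(1,2)], of z] that by simp
  have mulT: "wmul T (x, y, z) \<in> Hom K (Ten K (whom T (x, y)) (whom T (y, z))) (whom T (x, z))"
    if xyz: "x \<in> wpts Z" "y \<in> wpts Z" "z \<in> wpts Z" for x y z
  proof -
    have "e (x, y) \<star> e (y, z) \<in> Hom K (Ten K (whom T (x, y)) (whom T (y, z))) (Ten K (whom Z (x, y)) (whom Z (y, z)))"
      by (rule K_Ten[OF e e]) (use xyz in simp_all)
    then have "wmul Z (x, y, z) \<cdot> (e (x, y) \<star> e (y, z)) \<in> Hom K (Ten K (whom T (x, y)) (whom T (y, z))) (whom Z (x, z))"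
      by (rule K_Comp[OF _ wcat_mul[OF Z]]) (use xyz precoalg_Ten in \<open>simp_all del: coalgebras_sel\<close>)
    then show ?thesis unfolding mul[OF xyz]
      by (rule K_Comp[OF _ e']) (use xyz precoalg_Ten in \<open>simp_all del: coalgebras_sel\<close>)
  qed
  have unitT: "wunit T x \<in> Hom K (Unit K) (whom T (x, x))" if x: "x \<in> wpts Z" for x
    unfolding unit[OF x] by (rule K_Comp[OF wcat_unit[OF Z] e']) (use x precoalg_Unit in \<open>simp_all del: coalgebras_sel\<close>)
  have pre: "prewcat T" unfolding prewcat_def pts using ext coalg mulT unitT by blast
  show T: "is_wcat K T" unfolding wcat_iff pts
  proof (intro conjI ballI pre)
    fix x y assume x: "x \<in> wpts Z" and y: "y \<in> wpts Z"
    have "wmul T (x, x, y) \<cdot> (wunit T x \<star> Idn V (cobj (whom T (x, y))))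
      = e' (x, y) \<cdot> (wmul Z (x, x, y) \<cdot> ((wunit Z x \<star> Idn V (cobj (whom Z (x, y)))) \<cdot> (Idn V (Unit V) \<star> e (x, y))))"
      using x y by (simp add: mul unit)
    also have "\<dots> = e' (x, y) \<cdot> (LUnit V (cobj (whom Z (x, y))) \<cdot> (Idn V (Unit V) \<star> e (x, y)))"
      using extend2[OF wcat_lunit[OF Z x y], of "Idn V (Unit V) \<star> e (x, y)"] x y by simp
    also have "\<dots> = LUnit V (cobj (whom T (x, y)))" using x y LUnit_ten[of "e (x, y)"] by simp
    finally show "wmul T (x, x, y) \<cdot> (wunit T x \<star> Idn V (cobj (whom T (x, y)))) = LUnit V (cobj (whom T (x, y)))" .
    have "wmul T (x, y, y) \<cdot> (Idn V (cobj (whom T (x, y))) \<star> wunit T y)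
      = e' (x, y) \<cdot> (wmul Z (x, y, y) \<cdot> ((Idn V (cobj (whom Z (x, y))) \<star> wunit Z y) \<cdot> (e (x, y) \<star> Idn V (Unit V))))"
      using x y by (simp add: mul unit)
    also have "\<dots> = e' (x, y) \<cdot> (RUnit V (cobj (whom Z (x, y))) \<cdot> (e (x, y) \<star> Idn V (Unit V)))"
      using extend2[OF wcat_runit[OF Z x y], of "e (x, y) \<star> Idn V (Unit V)"] x y by simp
    also have "\<dots> = RUnit V (cobj (whom T (x, y)))" using x y RUnit_ten[of "e (x, y)"] by simp
    finally show "wmul T (x, y, y) \<cdot> (Idn V (cobj (whom T (x, y))) \<star> wunit T y) = RUnit V (cobj (whom T (x, y)))" .
    fix z u assume z: "z \<in> wpts Z" and u: "u \<in> wpts Z"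
    have "wmul T (x, z, u) \<cdot> (wmul T (x, y, z) \<star> Idn V (cobj (whom T (z, u))))
      = e' (x, u) \<cdot> (wmul Z (x, z, u) \<cdot> ((wmul Z (x, y, z) \<star> Idn V (cobj (whom Z (z, u)))) \<cdot> ((e (x, y) \<star> e (y, z)) \<star> e (z, u))))"
      using x y z u by (simp add: mul)
    also have "\<dots> = wmul T (x, y, u) \<cdot> (Idn V (cobj (whom T (x, y))) \<star> wmul T (y, z, u))
         \<cdot> Assoc V (cobj (whom T (x, y))) (cobj (whom T (y, z))) (cobj (whom T (z, u)))"
      using extend2[OF wcat_assoc[OF Z x y z u], of "(e (x, y) \<star> e (y, z)) \<star> e (z, u)"] x y z u by (simp add: mul)
    finally show "wmul T (x, z, u) \<cdot> (wmul T (x, y, z) \<star> Idn V (cobj (whom T (z, u)))) = \<dots>" .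
  qed
  define f where "f = \<lparr>dom1 = T, cod1 = Z, pmap = (\<lambda>x \<in> wpts Z. x), amap = restrict e (wpts Z \<times> wpts Z)\<rparr>"
  define g where "g = \<lparr>dom1 = Z, cod1 = T, pmap = (\<lambda>x \<in> wpts Z. x), amap = restrict e' (wpts Z \<times> wpts Z)\<rparr>"
  have f: "f \<in> wfunctors K T Z"
  proof (rule wfunctorsI)
    show "wmul Z (pmap f x, pmap f y, pmap f z) \<cdot> (amap f (x, y) \<star> amap f (y, z)) = amap f (x, z) \<cdot> wmul T (x, y, z)"
      if "x \<in> wpts T" "y \<in> wpts T" "z \<in> wpts T" for x y z using that by (simp add: f_def mul)
    show "amap f (x, x) \<cdot> wunit T x = wunit Z (pmap f x)" if "x \<in> wpts T" for x using that by (simp add: f_def unit)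
  qed (use e in \<open>simp_all add: f_def\<close>)
  have g: "g \<in> wfunctors K Z T"
  proof (rule wfunctorsI)
    show "wmul T (pmap g x, pmap g y, pmap g z) \<cdot> (amap g (x, y) \<star> amap g (y, z)) = amap g (x, z) \<cdot> wmul Z (x, y, z)"
      if "x \<in> wpts Z" "y \<in> wpts Z" "z \<in> wpts Z" for x y z using that by (simp add: g_def mul)
    show "amap g (x, x) \<cdot> wunit Z x = wunit T (pmap g x)" if "x \<in> wpts Z" for x using that by (simp add: g_def unit)
  qed (use e' in \<open>simp_all add: g_def\<close>)
  have "wcomp K g f = Id1 (W_Cat K t) T"
    by (rule wfun_eqI[OF wcomp_cell[OF T Z T f g] W_Id1[OF T]])
      (simp_all add: W_Cat_sel(4), simp_all add: f_def g_def wcomp_def Let_def compose_def)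
  moreover have "wcomp K f g = Id1 (W_Cat K t) Z"
    by (rule wfun_eqI[OF wcomp_cell[OF Z T Z g f] W_Id1[OF Z]])
      (simp_all add: W_Cat_sel(4), simp_all add: f_def g_def wcomp_def Let_def compose_def)
  moreover have "iso_arrow (HomCat (W_Cat K t) A A) (Id1 (W_Cat K t) A) (Id1 (W_Cat K t) A) (Id2 (W_Cat K t) (Id1 (W_Cat K t) A))"
    if "is_wcat K A" for A
    by (rule two_category.iso_Id2[OF two_category_W_Cat]) (use that W_Id1[OF that, of t] in \<open>simp_all add: W_Cat_sel(1,2)\<close>)
  ultimately show "equivalent_0cells (W_Cat K t) T Z"
    unfolding equivalent_0cells_def W_Cat_sel(2,5) using f g T Z by metis
qed

end

section \<open>Change of base along the monoidal equivalence\<close>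

context symfun
begin

text \<open>The law \<open>nu_assoc\<close>, multiplied on either side by the inverses of its outer
  factors.\<close>

lemma mu_assoc:
  assumes [simp]: "A \<in> Obj V" "B \<in> Obj V" "C \<in> Obj V"
  shows "\<mu> A (B \<boxtimes> C) \<bullet> ((Idn V' (F0 A) \<diamond> \<mu> B C) \<bullet> Assoc V' (F0 A) (F0 B) (F0 C))
    = F1 (Assoc V A B C) \<bullet> (\<mu> (A \<boxtimes> B) C \<bullet> (\<mu> A B \<diamond> Idn V' (F0 C)))"
proof -
  let ?N = "(\<nu> A B \<diamond> Idn V' (F0 C)) \<bullet> \<nu> (A \<boxtimes> B) C" and ?X = "\<mu> (A \<boxtimes> B) C \<bullet> (\<mu> A B \<diamond> Idn V' (F0 C))"
  let ?Y = "\<mu> A (B \<boxtimes> C) \<bullet> (Idn V' (F0 A) \<diamond> \<mu> B C)"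
  have "?Y \<bullet> (Assoc V' (F0 A) (F0 B) (F0 C) \<bullet> ?N) \<bullet> ?X = ?Y \<bullet> ((Idn V' (F0 A) \<diamond> \<nu> B C) \<bullet> \<nu> A (B \<boxtimes> C) \<bullet> F1 (Assoc V A B C)) \<bullet> ?X"
    by (simp only: nu_assoc[OF assms])
  then show ?thesis by simp
qed

lemma F_LUnit_inverse [simp]:
  assumes [simp]: "A \<in> Obj V"
  shows "F1 (LUnitInv V A) \<bullet> F1 (LUnit V A) = Idn V' (F0 (Unit V \<boxtimes> A))"
    "F1 (RUnitInv V A) \<bullet> F1 (RUnit V A) = Idn V' (F0 (A \<boxtimes> Unit V))"
  using F1_comp[of "LUnit V A" "LUnitInv V A"] F1_comp[of "RUnit V A" "RUnitInv V A"]
  by (simp_all del: V.LUnitInv_comp V.RUnitInv_comp)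

lemma mu_lunit:
  assumes [simp]: "A \<in> Obj V"
  shows "F1 (LUnit V A) \<bullet> (\<mu> (Unit V) A \<bullet> (\<iota> \<diamond> Idn V' (F0 A))) = LUnit V' (F0 A)"
    "F1 (RUnit V A) \<bullet> (\<mu> A (Unit V) \<bullet> (Idn V' (F0 A) \<diamond> \<iota>)) = RUnit V' (F0 A)"
  unfolding nu_lunit[OF assms, symmetric] nu_runit[OF assms, symmetric] by simp_all

lemma F_LUnitInv:
  assumes [simp]: "A \<in> Obj V"
  shows "F1 (LUnitInv V A) = \<mu> (Unit V) A \<bullet> ((\<iota> \<diamond> Idn V' (F0 A)) \<bullet> LUnitInv V' (F0 A))"
    "F1 (RUnitInv V A) = \<mu> A (Unit V) \<bullet> ((Idn V' (F0 A) \<diamond> \<iota>) \<bullet> RUnitInv V' (F0 A))"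
proof -
  have "F1 (LUnitInv V A) \<bullet> ((F1 (LUnit V A) \<bullet> (\<mu> (Unit V) A \<bullet> (\<iota> \<diamond> Idn V' (F0 A)))) \<bullet> LUnitInv V' (F0 A)) = F1 (LUnitInv V A)"
    by (simp add: mu_lunit)
  then show "F1 (LUnitInv V A) = \<mu> (Unit V) A \<bullet> ((\<iota> \<diamond> Idn V' (F0 A)) \<bullet> LUnitInv V' (F0 A))"
    using V'.extend2[OF F_LUnit_inverse(1)[OF assms], of "\<mu> (Unit V) A \<bullet> ((\<iota> \<diamond> Idn V' (F0 A)) \<bullet> LUnitInv V' (F0 A))"]
    by simp
  have "F1 (RUnitInv V A) \<bullet> ((F1 (RUnit V A) \<bullet> (\<mu> A (Unit V) \<bullet> (Idn V' (F0 A) \<diamond> \<iota>))) \<bullet> RUnitInv V' (F0 A)) = F1 (RUnitInv V A)"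
    by (simp add: mu_lunit)
  then show "F1 (RUnitInv V A) = \<mu> A (Unit V) \<bullet> ((Idn V' (F0 A) \<diamond> \<iota>) \<bullet> RUnitInv V' (F0 A))"
    using V'.extend2[OF F_LUnit_inverse(2)[OF assms], of "\<mu> A (Unit V) \<bullet> ((Idn V' (F0 A) \<diamond> \<iota>) \<bullet> RUnitInv V' (F0 A))"]
    by simp
qed

text \<open>An element \<open>a\<close> of \<open>X\<close> is carried to the element
  \<open>F1 a \<bullet> \<iota>\<close>, and \<open>\<mu>\<close> is absorbed into the
  multiplication. With these conventions products with elements are preserved, hence also naturality
  and the compositions of 2-cells.\<close>

lemma F_lact:
  assumes "V.ar m" "V.ar a" "V.ar f" "dm m = X \<boxtimes> Y" "cd a = X" "dm a = Unit V" "cd f = Y" "dm f = P"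
  shows "F1 (V.lact P m a f) = V'.lact (F0 P) (F1 m \<bullet> \<mu> X Y) (F1 a \<bullet> \<iota>) (F1 f)"
proof -
  have o: "X \<in> Obj V" "Y \<in> Obj V" "P \<in> Obj V" using assms by auto
  have "\<mu> X Y \<bullet> ((F1 a \<diamond> F1 f) \<bullet> ((\<iota> \<diamond> Idn V' (F0 P)) \<bullet> LUnitInv V' (F0 P)))
     = F1 (a \<star> f) \<bullet> F1 (LUnitInv V P)"
    using mu_natural'[of a f X Y "Unit V" P "(\<iota> \<diamond> Idn V' (F0 P)) \<bullet> LUnitInv V' (F0 P)"] assms(2-) o by (simp add: F_LUnitInv)
  then show ?thesis unfolding V.lact_def V'.lact_def using assms o by simp
qed

lemma F_ract:
  assumes "V.ar m" "V.ar a" "V.ar f" "dm m = Y \<boxtimes> X" "cd a = X" "dm a = Unit V" "cd f = Y" "dm f = P"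
  shows "F1 (V.ract P m f a) = V'.ract (F0 P) (F1 m \<bullet> \<mu> Y X) (F1 f) (F1 a \<bullet> \<iota>)"
proof -
  have o: "X \<in> Obj V" "Y \<in> Obj V" "P \<in> Obj V" using assms by auto
  have "\<mu> Y X \<bullet> ((F1 f \<diamond> F1 a) \<bullet> ((Idn V' (F0 P) \<diamond> \<iota>) \<bullet> RUnitInv V' (F0 P)))
     = F1 (f \<star> a) \<bullet> F1 (RUnitInv V P)"
    using mu_natural'[of f a Y X P "Unit V" "(Idn V' (F0 P) \<diamond> \<iota>) \<bullet> RUnitInv V' (F0 P)"] assms(2-) o by (simp add: F_LUnitInv)
  then show ?thesis unfolding V.ract_def V'.ract_def using assms o by simp
qed

text \<open>The change of enriching base along a monoidal functor. The points stay the same, so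
  bijectivity on cells concerns the components only.\<close>

definition Fw0 :: "('x, ('o, 'a) coalg, 'a) wcat \<Rightarrow> ('x, ('p, 'b) coalg, 'b) wcat" where
  "Fw0 A = \<lparr>wpts = wpts A, whom = (\<lambda>p \<in> wpts A \<times> wpts A. F0c (whom A p)),
     wmul = restrict (\<lambda>(x, y, z). F1 (wmul A (x, y, z)) \<bullet> \<mu> (cobj (whom A (x, y))) (cobj (whom A (y, z))))
       (wpts A \<times> wpts A \<times> wpts A),
     wunit = (\<lambda>x \<in> wpts A. F1 (wunit A x) \<bullet> \<iota>)\<rparr>"

lemma Fw0_sel [simp]:
  "wpts (Fw0 A) = wpts A"
  "\<lbrakk>x \<in> wpts A; y \<in> wpts A\<rbrakk> \<Longrightarrow> whom (Fw0 A) (x, y) = F0c (whom A (x, y))"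
  "\<lbrakk>x \<in> wpts A; y \<in> wpts A; z \<in> wpts A\<rbrakk> \<Longrightarrow>
    wmul (Fw0 A) (x, y, z) = F1 (wmul A (x, y, z)) \<bullet> \<mu> (cobj (whom A (x, y))) (cobj (whom A (y, z)))"
  "x \<in> wpts A \<Longrightarrow> wunit (Fw0 A) x = F1 (wunit A x) \<bullet> \<iota>"
  by (simp_all add: Fw0_def)

lemma Fw0_ext: "whom (Fw0 A) \<in> extensional (wpts A \<times> wpts A)"
  "wmul (Fw0 A) \<in> extensional (wpts A \<times> wpts A \<times> wpts A)" "wunit (Fw0 A) \<in> extensional (wpts A)"
  by (simp_all add: Fw0_def)

lemma Fw0_prewcat:
  assumes A: "V.prewcat A"
  shows "V'.prewcat (Fw0 A)"
  unfolding V'.prewcat_def Fw0_sel(1)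
proof (intro conjI ballI Fw0_ext)
  note [simp] = A
  fix x y assume x: "x \<in> wpts A" and y: "y \<in> wpts A"
  have "is_coalg V (whom A (x, y))" using x y A unfolding V.prewcat_def by blast
  then show "is_coalg V' (whom (Fw0 A) (x, y))" using x y F0c_coalg[of "whom A (x, y)"] by simp
  have "wunit A x \<in> Hom V.K (Unit V.K) (whom A (x, x))" using x A unfolding V.prewcat_def by blast
  then have "F1 (wunit A x) \<in> Hom V'.K (F0c (Unit V.K)) (F0c (whom A (x, x)))"
    by (rule iffD2[OF F1_K, rotated -1]) (use x in simp_all)
  then have "F1 (wunit A x) \<bullet> \<iota> \<in> Hom V'.K (Unit V'.K) (F0c (whom A (x, x)))"
    by (rule V'.K_Comp[OF iota_K]) (use x V'.precoalg_Unit F0c_precoalg[OF V.precoalg_Unit] in \<open>simp_all del: coalgebras_sel\<close>)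
  then show "wunit (Fw0 A) x \<in> Hom V'.K (Unit V'.K) (whom (Fw0 A) (x, x))" using x by (simp del: coalgebras_sel)
  fix z assume z: "z \<in> wpts A"
  have "wmul A (x, y, z) \<in> Hom V.K (Ten V.K (whom A (x, y)) (whom A (y, z))) (whom A (x, z))"
    using x y z A unfolding V.prewcat_def by blast
  then have "F1 (wmul A (x, y, z)) \<in> Hom V'.K (F0c (Ten V.K (whom A (x, y)) (whom A (y, z)))) (F0c (whom A (x, z)))"
    by (rule iffD2[OF F1_K, rotated -1]) (use x y z in simp_all)
  then have "F1 (wmul A (x, y, z)) \<bullet> \<mu> (cobj (whom A (x, y))) (cobj (whom A (y, z)))
      \<in> Hom V'.K (Ten V'.K (F0c (whom A (x, y))) (F0c (whom A (y, z)))) (F0c (whom A (x, z)))"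
    by (rule V'.K_Comp[OF mu_K, rotated 2]) (use x y z V'.precoalg_Ten F0c_precoalg[OF V.precoalg_Ten] in \<open>simp_all del: coalgebras_sel\<close>)
  then show "wmul (Fw0 A) (x, y, z) \<in> Hom V'.K (Ten V'.K (whom (Fw0 A) (x, y)) (whom (Fw0 A) (y, z))) (whom (Fw0 A) (x, z))"
    using x y z by (simp del: coalgebras_sel)
qed

text \<open>Each law for \<open>Fw0 A\<close> is the image of the law for \<open>A\<close>
  precomposed with an invertible arrow \<open>?X\<close>. Cancelling it and using faithfulness gives
  the equivalence; the reflecting direction serves \<open>Fw_ess_surj\<close>.\<close>

lemma Fw0_wcat:
  assumes A: "V.prewcat A"
  shows "is_wcat V'.K (Fw0 A) \<longleftrightarrow> is_wcat V.K A"
proof -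
  note [simp] = A
  let ?h = "\<lambda>x y. cobj (whom A (x, y))" and ?m = "\<lambda>x y z. wmul A (x, y, z)"
  have 1: "wmul (Fw0 A) (x, z, u) \<bullet> (wmul (Fw0 A) (x, y, z) \<diamond> Idn V' (cobj (whom (Fw0 A) (z, u))))
      = wmul (Fw0 A) (x, y, u) \<bullet> (Idn V' (cobj (whom (Fw0 A) (x, y))) \<diamond> wmul (Fw0 A) (y, z, u))
        \<bullet> Assoc V' (cobj (whom (Fw0 A) (x, y))) (cobj (whom (Fw0 A) (y, z))) (cobj (whom (Fw0 A) (z, u)))
    \<longleftrightarrow> ?m x z u \<cdot> (?m x y z \<star> Idn V (?h z u)) = ?m x y u \<cdot> (Idn V (?h x y) \<star> ?m y z u) \<cdot> Assoc V (?h x y) (?h y z) (?h z u)"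
    if xyzu[simp]: "x \<in> wpts A" "y \<in> wpts A" "z \<in> wpts A" "u \<in> wpts A" for x y z u
  proof -
    let ?X = "\<mu> (?h x y \<boxtimes> ?h y z) (?h z u) \<bullet> (\<mu> (?h x y) (?h y z) \<diamond> Idn V' (F0 (?h z u)))"
    let ?l = "?m x z u \<cdot> (?m x y z \<star> Idn V (?h z u))" and ?r = "?m x y u \<cdot> (Idn V (?h x y) \<star> ?m y z u) \<cdot> Assoc V (?h x y) (?h y z) (?h z u)"
    have l: "wmul (Fw0 A) (x, z, u) \<bullet> (wmul (Fw0 A) (x, y, z) \<diamond> Idn V' (cobj (whom (Fw0 A) (z, u)))) = F1 ?l \<bullet> ?X"
      using mu_natural'[OF _ _ refl refl refl refl, of "?m x y z" "Idn V (?h z u)" "\<mu> (?h x y) (?h y z) \<diamond> Idn V' (F0 (?h z u))"] by simp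
    have "\<mu> (?h x y) (?h y u) \<bullet> ((F1 (Idn V (?h x y)) \<diamond> F1 (?m y z u)) \<bullet> ((Idn V' (F0 (?h x y)) \<diamond> \<mu> (?h y z) (?h z u)) \<bullet>
         Assoc V' (F0 (?h x y)) (F0 (?h y z)) (F0 (?h z u))))
      = F1 (Idn V (?h x y) \<star> ?m y z u) \<bullet> (\<mu> (?h x y) (?h y z \<boxtimes> ?h z u) \<bullet> ((Idn V' (F0 (?h x y)) \<diamond> \<mu> (?h y z) (?h z u)) \<bullet>
         Assoc V' (F0 (?h x y)) (F0 (?h y z)) (F0 (?h z u))))"
      by (rule mu_natural') simp_all
    then have r: "wmul (Fw0 A) (x, y, u) \<bullet> (Idn V' (cobj (whom (Fw0 A) (x, y))) \<diamond> wmul (Fw0 A) (y, z, u))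
        \<bullet> Assoc V' (cobj (whom (Fw0 A) (x, y))) (cobj (whom (Fw0 A) (y, z))) (cobj (whom (Fw0 A) (z, u))) = F1 ?r \<bullet> ?X"
      by (simp add: mu_assoc)
    show ?thesis unfolding l r
    proof
      assume "F1 ?l \<bullet> ?X = F1 ?r \<bullet> ?X"
      then have "F1 ?l = F1 ?r"
        by (rule V'.right_cancel[of ?X "(\<nu> (?h x y) (?h y z) \<diamond> Idn V' (F0 (?h z u))) \<bullet> \<nu> (?h x y \<boxtimes> ?h y z) (?h z u)", rotated -1]) simp_all
      then show "?l = ?r" by (rule F1_inj) simp_all
    qed (simp only:)
  qed
  have 2: "wmul (Fw0 A) (x, x, y) \<bullet> (wunit (Fw0 A) x \<diamond> Idn V' (cobj (whom (Fw0 A) (x, y)))) = LUnit V' (cobj (whom (Fw0 A) (x, y)))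
    \<longleftrightarrow> ?m x x y \<cdot> (wunit A x \<star> Idn V (?h x y)) = LUnit V (?h x y)"
    if xy[simp]: "x \<in> wpts A" "y \<in> wpts A" for x y
  proof -
    let ?X = "\<mu> (Unit V) (?h x y) \<bullet> (\<iota> \<diamond> Idn V' (F0 (?h x y)))"
    let ?l = "?m x x y \<cdot> (wunit A x \<star> Idn V (?h x y))" and ?r = "LUnit V (?h x y)"
    have l: "wmul (Fw0 A) (x, x, y) \<bullet> (wunit (Fw0 A) x \<diamond> Idn V' (cobj (whom (Fw0 A) (x, y)))) = F1 ?l \<bullet> ?X"
      using mu_natural'[OF _ _ refl refl refl refl, of "wunit A x" "Idn V (?h x y)" "\<iota> \<diamond> Idn V' (F0 (?h x y))"] by simp
    have r: "LUnit V' (cobj (whom (Fw0 A) (x, y))) = F1 ?r \<bullet> ?X" by (simp add: mu_lunit)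
    show ?thesis unfolding l r
    proof
      assume "F1 ?l \<bullet> ?X = F1 ?r \<bullet> ?X"
      then have "F1 ?l = F1 ?r"
        by (rule V'.right_cancel[of ?X "(\<kappa> \<diamond> Idn V' (F0 (?h x y))) \<bullet> \<nu> (Unit V) (?h x y)", rotated -1]) simp_all
      then show "?l = ?r" by (rule F1_inj) simp_all
    qed (simp only:)
  qed
  have 3: "wmul (Fw0 A) (x, y, y) \<bullet> (Idn V' (cobj (whom (Fw0 A) (x, y))) \<diamond> wunit (Fw0 A) y) = RUnit V' (cobj (whom (Fw0 A) (x, y)))
    \<longleftrightarrow> ?m x y y \<cdot> (Idn V (?h x y) \<star> wunit A y) = RUnit V (?h x y)"
    if xy[simp]: "x \<in> wpts A" "y \<in> wpts A" for x y
  proof -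
    let ?X = "\<mu> (?h x y) (Unit V) \<bullet> (Idn V' (F0 (?h x y)) \<diamond> \<iota>)"
    let ?l = "?m x y y \<cdot> (Idn V (?h x y) \<star> wunit A y)" and ?r = "RUnit V (?h x y)"
    have l: "wmul (Fw0 A) (x, y, y) \<bullet> (Idn V' (cobj (whom (Fw0 A) (x, y))) \<diamond> wunit (Fw0 A) y) = F1 ?l \<bullet> ?X"
      using mu_natural'[OF _ _ refl refl refl refl, of "Idn V (?h x y)" "wunit A y" "Idn V' (F0 (?h x y)) \<diamond> \<iota>"] by simp
    have r: "RUnit V' (cobj (whom (Fw0 A) (x, y))) = F1 ?r \<bullet> ?X" by (simp add: mu_lunit)
    show ?thesis unfolding l r
    proof
      assume "F1 ?l \<bullet> ?X = F1 ?r \<bullet> ?X"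
      then have "F1 ?l = F1 ?r"
        by (rule V'.right_cancel[of ?X "(Idn V' (F0 (?h x y)) \<diamond> \<kappa>) \<bullet> \<nu> (?h x y) (Unit V)", rotated -1]) simp_all
      then show "?l = ?r" by (rule F1_inj) simp_all
    qed (simp only:)
  qed
  show ?thesis unfolding V'.wcat_iff V.wcat_iff Fw0_sel(1) using 1 2 3 Fw0_prewcat[OF A] A
    by (simp del: Fw0_sel V.comp_assoc V'.comp_assoc)
qed

definition Fw1 :: "(('x, ('o, 'a) coalg, 'a) wcat, 'x, 'a) one_cell \<Rightarrow> (('x, ('p, 'b) coalg, 'b) wcat, 'x, 'b) one_cell" where
  "Fw1 F = \<lparr>dom1 = Fw0 (dom1 F), cod1 = Fw0 (cod1 F), pmap = pmap F,
     amap = (\<lambda>p \<in> wpts (dom1 F) \<times> wpts (dom1 F). F1 (amap F p))\<rparr>"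

lemma Fw1_sel [simp]: "dom1 (Fw1 F) = Fw0 (dom1 F)" "cod1 (Fw1 F) = Fw0 (cod1 F)" "pmap (Fw1 F) = pmap F"
  "\<lbrakk>x \<in> wpts (dom1 F); y \<in> wpts (dom1 F)\<rbrakk> \<Longrightarrow> amap (Fw1 F) (x, y) = F1 (amap F (x, y))"
  by (simp_all add: Fw1_def)

text \<open>\<open>F\<close> is only assumed to be typed data. So the equivalence gives both the
  well-definedness of \<open>Fw1\<close> and, for data obtained by lifting arrows through
  \<open>F1\<close>, its surjectivity.\<close>

lemma Fw1_iff:
  assumes A: "is_wcat V.K A" and B: "is_wcat V.K B" and F: "dom1 F = A" "cod1 F = B"
    "pmap F \<in> extensional (wpts A)" "amap F \<in> extensional (wpts A \<times> wpts A)"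
    and pt: "\<And>x. x \<in> wpts A \<Longrightarrow> pmap F x \<in> wpts B"
    and ar: "\<And>x y. \<lbrakk>x \<in> wpts A; y \<in> wpts A\<rbrakk> \<Longrightarrow> V.ar (amap F (x, y)) \<and> dm (amap F (x, y)) = cobj (whom A (x, y)) \<and>
      cd (amap F (x, y)) = cobj (whom B (pmap F x, pmap F y))"
  shows "Fw1 F \<in> wfunctors V'.K (Fw0 A) (Fw0 B) \<longleftrightarrow> F \<in> wfunctors V.K A B"
proof -
  note [simp] = A B F pt
  have [simp]: "V.ar (amap F (x, y))" "dm (amap F (x, y)) = cobj (whom A (x, y))"
    "cd (amap F (x, y)) = cobj (whom B (pmap F x, pmap F y))" if "x \<in> wpts A" "y \<in> wpts A" for x y
    using ar[OF that] by auto
  have 1: "F1 (amap F (x, y)) \<in> Hom V'.K (F0c (whom A (x, y))) (F0c (whom B (pmap F x, pmap F y)))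
      \<longleftrightarrow> amap F (x, y) \<in> Hom V.K (whom A (x, y)) (whom B (pmap F x, pmap F y))"
    if "x \<in> wpts A" "y \<in> wpts A" for x y
    by (rule F1_K) (use that in simp_all)
  have 2: "wmul (Fw0 B) (pmap F x, pmap F y, pmap F z) \<bullet> (F1 (amap F (x, y)) \<diamond> F1 (amap F (y, z)))
      = F1 (amap F (x, z)) \<bullet> wmul (Fw0 A) (x, y, z)
    \<longleftrightarrow> wmul B (pmap F x, pmap F y, pmap F z) \<cdot> (amap F (x, y) \<star> amap F (y, z)) = amap F (x, z) \<cdot> wmul A (x, y, z)"
    if xyz: "x \<in> wpts A" "y \<in> wpts A" "z \<in> wpts A" for x y z
  proof -
    note [simp] = xyz
    let ?X = "\<mu> (cobj (whom A (x, y))) (cobj (whom A (y, z)))"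
    let ?l = "wmul B (pmap F x, pmap F y, pmap F z) \<cdot> (amap F (x, y) \<star> amap F (y, z))" and ?r = "amap F (x, z) \<cdot> wmul A (x, y, z)"
    have l: "wmul (Fw0 B) (pmap F x, pmap F y, pmap F z) \<bullet> (F1 (amap F (x, y)) \<diamond> F1 (amap F (y, z))) = F1 ?l \<bullet> ?X"
      using mu_natural[of "amap F (x, y)" "amap F (y, z)", OF _ _ refl refl refl refl] by simp
    have r: "F1 (amap F (x, z)) \<bullet> wmul (Fw0 A) (x, y, z) = F1 ?r \<bullet> ?X" by simp
    show ?thesis unfolding l r
    proof
      assume "F1 ?l \<bullet> ?X = F1 ?r \<bullet> ?X"
      then have "F1 ?l = F1 ?r"
        by (rule V'.right_cancel[of ?X "\<nu> (cobj (whom A (x, y))) (cobj (whom A (y, z)))", rotated -1]) simp_all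
      then show "?l = ?r" by (rule F1_inj) simp_all
    qed (simp only:)
  qed
  have 3: "F1 (amap F (x, x)) \<bullet> wunit (Fw0 A) x = wunit (Fw0 B) (pmap F x)
    \<longleftrightarrow> amap F (x, x) \<cdot> wunit A x = wunit B (pmap F x)"
    if x: "x \<in> wpts A" for x
  proof -
    note [simp] = x
    let ?l = "amap F (x, x) \<cdot> wunit A x" and ?r = "wunit B (pmap F x)"
    have l: "F1 (amap F (x, x)) \<bullet> wunit (Fw0 A) x = F1 ?l \<bullet> \<iota>" and r: "wunit (Fw0 B) (pmap F x) = F1 ?r \<bullet> \<iota>" by simp_all
    show ?thesis unfolding l r
    proof
      assume "F1 ?l \<bullet> \<iota> = F1 ?r \<bullet> \<iota>"
      then have "F1 ?l = F1 ?r" by (rule V'.right_cancel[of \<iota> \<kappa>, rotated -1]) simp_all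
      then show "?l = ?r" by (rule F1_inj) simp_all
    qed (simp only:)
  qed
  show ?thesis
  proof
    assume H: "Fw1 F \<in> wfunctors V'.K (Fw0 A) (Fw0 B)"
    show "F \<in> wfunctors V.K A B"
    proof (rule V.wfunctorsI)
      show "amap F (x, y) \<in> Hom V.K (whom A (x, y)) (whom B (pmap F x, pmap F y))"
        if "x \<in> wpts A" "y \<in> wpts A" for x y using V'.wfun_Hom[OF H, of x y] 1 that by simp
      show "wmul B (pmap F x, pmap F y, pmap F z) \<cdot> (amap F (x, y) \<star> amap F (y, z)) = amap F (x, z) \<cdot> wmul A (x, y, z)"
        if "x \<in> wpts A" "y \<in> wpts A" "z \<in> wpts A" for x y z using V'.wfun_mul[OF H, of x y z] 2 that by (simp del: Fw0_sel(3))
      show "amap F (x, x) \<cdot> wunit A x = wunit B (pmap F x)" if "x \<in> wpts A" for x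
        using V'.wfun_unit[OF H, of x] 3 that by (simp del: Fw0_sel(4))
    qed simp_all
  next
    assume H: "F \<in> wfunctors V.K A B"
    show "Fw1 F \<in> wfunctors V'.K (Fw0 A) (Fw0 B)"
    proof (rule V'.wfunctorsI)
      show "amap (Fw1 F) (x, y) \<in> Hom V'.K (whom (Fw0 A) (x, y)) (whom (Fw0 B) (pmap (Fw1 F) x, pmap (Fw1 F) y))"
        if "x \<in> wpts (Fw0 A)" "y \<in> wpts (Fw0 A)" for x y using V.wfun_Hom[OF H, of x y] 1 that by simp
      show "wmul (Fw0 B) (pmap (Fw1 F) x, pmap (Fw1 F) y, pmap (Fw1 F) z) \<bullet> (amap (Fw1 F) (x, y) \<diamond> amap (Fw1 F) (y, z))
         = amap (Fw1 F) (x, z) \<bullet> wmul (Fw0 A) (x, y, z)"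
        if "x \<in> wpts (Fw0 A)" "y \<in> wpts (Fw0 A)" "z \<in> wpts (Fw0 A)" for x y z
        using V.wfun_mul[OF H, of x y z] 2 that by (simp del: Fw0_sel(3))
      show "amap (Fw1 F) (x, x) \<bullet> wunit (Fw0 A) x = wunit (Fw0 B) (pmap (Fw1 F) x)" if "x \<in> wpts (Fw0 A)" for x
        using V.wfun_unit[OF H, of x] 3 that by (simp del: Fw0_sel(4))
      show "amap (Fw1 F) \<in> extensional (wpts (Fw0 A) \<times> wpts (Fw0 A))" by (simp add: Fw1_def)
    qed simp_all
  qed
qed

lemma Fw1_cell: "\<lbrakk>is_wcat V.K A; is_wcat V.K B; F \<in> wfunctors V.K A B\<rbrakk> \<Longrightarrow> Fw1 F \<in> wfunctors V'.K (Fw0 A) (Fw0 B)"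
  by (rule iffD2[OF Fw1_iff]) (simp_all add: V.wfunD V.K_HomD[OF V.wfun_Hom])

lemma Fw1_bij:
  assumes A: "is_wcat V.K A" and B: "is_wcat V.K B"
  shows "bij_betw Fw1 (wfunctors V.K A B) (wfunctors V'.K (Fw0 A) (Fw0 B))"
proof (rule bij_betwI')
  fix F G assume F: "F \<in> wfunctors V.K A B" and G: "G \<in> wfunctors V.K A B"
  show "Fw1 F = Fw1 G \<longleftrightarrow> F = G"
  proof
    assume e: "Fw1 F = Fw1 G"
    note [simp] = V.wfun_dom_cod[OF F] V.wfun_dom_cod[OF G] A B
      V.wf1_ar[OF V.wf1I[OF A B F], simplified V.wfun_dom_cod[OF F]]
      V.wf1_ar[OF V.wf1I[OF A B G], simplified V.wfun_dom_cod[OF G]]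
    have p: "pmap F = pmap G" using arg_cong[OF e, of pmap] by simp
    show "F = G"
    proof (rule V.wfun_eqI[OF F G])
      show "pmap F x = pmap G x" for x by (simp add: p)
      fix x y assume x[simp]: "x \<in> wpts A" and y[simp]: "y \<in> wpts A"
      have "F1 (amap F (x, y)) = F1 (amap G (x, y))" using arg_cong[OF e, of "\<lambda>F. amap F (x, y)"] by simp
      then show "amap F (x, y) = amap G (x, y)" by (rule F1_inj) (simp_all add: p)
    qed
  qed simp
next
  fix F assume "F \<in> wfunctors V.K A B" then show "Fw1 F \<in> wfunctors V'.K (Fw0 A) (Fw0 B)" by (rule Fw1_cell[OF A B])
next
  fix H assume H: "H \<in> wfunctors V'.K (Fw0 A) (Fw0 B)"
  have A': "is_wcat V'.K (Fw0 A)" and B': "is_wcat V'.K (Fw0 B)"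
    using A B Fw0_wcat[of A] Fw0_wcat[of B] V.wcat_iff by blast+
  note [simp] = A B A' B' V'.wfun_dom_cod[OF H] V'.wf1_ar[OF V'.wf1I[OF A' B' H], simplified V'.wfun_dom_cod[OF H]]
  have "\<forall>p \<in> wpts A \<times> wpts A. \<exists>f. V.ar f \<and> dm f = cobj (whom A p) \<and> cd f = cobj (whom B (pmap H (fst p), pmap H (snd p))) \<and>
     F1 f = amap H p"
  proof
    fix p assume "p \<in> wpts A \<times> wpts A"
    then obtain x y where p: "p = (x, y)" and [simp]: "x \<in> wpts A" "y \<in> wpts A" by auto
    have [simp]: "pmap H x \<in> wpts B" "pmap H y \<in> wpts B" using V'.wfun_pt[OF H, of x] V'.wfun_pt[OF H, of y] by simp_all
    obtain f where "V.ar f" "dm f = cobj (whom A (x, y))" "cd f = cobj (whom B (pmap H x, pmap H y))" "F1 f = amap H (x, y)"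
      by (rule F1_full[of "amap H (x, y)" "cobj (whom A (x, y))" "cobj (whom B (pmap H x, pmap H y))"]) simp_all
    then show "\<exists>f. V.ar f \<and> dm f = cobj (whom A p) \<and> cd f = cobj (whom B (pmap H (fst p), pmap H (snd p))) \<and>
     F1 f = amap H p" by (auto simp: p)
  qed
  from bchoice[OF this] obtain \<phi> where \<phi>: "\<And>x y. \<lbrakk>x \<in> wpts A; y \<in> wpts A\<rbrakk> \<Longrightarrow> V.ar (\<phi> (x, y)) \<and> dm (\<phi> (x, y)) = cobj (whom A (x, y)) \<and>
    cd (\<phi> (x, y)) = cobj (whom B (pmap H x, pmap H y)) \<and> F1 (\<phi> (x, y)) = amap H (x, y)" by auto
  define F where "F = \<lparr>dom1 = A, cod1 = B, pmap = pmap H, amap = restrict \<phi> (wpts A \<times> wpts A)\<rparr>"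
  have e: "H = Fw1 F"
  proof (rule one_cell.equality)
    show "amap H = amap (Fw1 F)"
      by (rule extensionalityI[of _ "wpts A \<times> wpts A"]) (use V'.wfun_ext[OF H] \<phi> in \<open>auto simp: Fw1_def F_def\<close>)
  qed (simp_all add: F_def)
  have F: "dom1 F = A" "cod1 F = B" "pmap F = pmap H"
    "\<And>x y. \<lbrakk>x \<in> wpts A; y \<in> wpts A\<rbrakk> \<Longrightarrow> amap F (x, y) = \<phi> (x, y)" "amap F \<in> extensional (wpts A \<times> wpts A)"
    by (simp_all add: F_def)
  have "Fw1 F \<in> wfunctors V'.K (Fw0 A) (Fw0 B)" using H by (simp only: e[symmetric])
  moreover have "pmap F \<in> extensional (wpts A)" "\<And>x. x \<in> wpts A \<Longrightarrow> pmap F x \<in> wpts B"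
    using V'.wfun_ext[OF H] V'.wfun_pt[OF H] by (simp_all add: F)
  ultimately have "F \<in> wfunctors V.K A B"
    by (intro iffD1[OF Fw1_iff[OF A B]]) (use F \<phi> in simp_all)
  then show "\<exists>F \<in> wfunctors V.K A B. H = Fw1 F" using e by blast
qed

definition Fw2 :: "(('x, ('o, 'a) coalg, 'a) wcat, 'x, 'a) two_cell \<Rightarrow> (('x, ('p, 'b) coalg, 'b) wcat, 'x, 'b) two_cell" where
  "Fw2 T = \<lparr>dom2 = Fw1 (dom2 T), cod2 = Fw1 (cod2 T), comp2 = (\<lambda>x \<in> wpts (dom1 (dom2 T)). F1 (comp2 T x) \<bullet> \<iota>)\<rparr>"

lemma Fw2_sel [simp]: "dom2 (Fw2 T) = Fw1 (dom2 T)" "cod2 (Fw2 T) = Fw1 (cod2 T)"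
  "x \<in> wpts (dom1 (dom2 T)) \<Longrightarrow> comp2 (Fw2 T) x = F1 (comp2 T x) \<bullet> \<iota>"
  by (simp_all add: Fw2_def)

lemma Fw2_iff:
  assumes A: "is_wcat V.K A" and B: "is_wcat V.K B" and F: "F \<in> wfunctors V.K A B" and G: "G \<in> wfunctors V.K A B"
    and T: "dom2 T = F" "cod2 T = G" "comp2 T \<in> extensional (wpts A)"
    and ar: "\<And>x. x \<in> wpts A \<Longrightarrow> V.ar (comp2 T x) \<and> dm (comp2 T x) = Unit V \<and>
      cd (comp2 T x) = cobj (whom B (pmap G x, pmap F x))"
  shows "Fw2 T \<in> wtransf V'.K (Fw1 F) (Fw1 G) \<longleftrightarrow> T \<in> wtransf V.K F G"
proof -
  note [simp] = A B T V.wfun_dom_cod[OF F] V.wfun_dom_cod[OF G]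
    V.wf1_ar[OF V.wf1I[OF A B F], simplified V.wfun_dom_cod[OF F]]
    V.wf1_ar[OF V.wf1I[OF A B G], simplified V.wfun_dom_cod[OF G]]
  have [simp]: "V.ar (comp2 T x)" "dm (comp2 T x) = Unit V" "cd (comp2 T x) = cobj (whom B (pmap G x, pmap F x))"
    if "x \<in> wpts A" for x using ar[OF that] by auto
  have 1: "F1 (comp2 T x) \<bullet> \<iota> \<in> Hom V'.K (Unit V'.K) (F0c (whom B (pmap G x, pmap F x)))
     \<longleftrightarrow> comp2 T x \<in> Hom V.K (Unit V.K) (whom B (pmap G x, pmap F x))" if x[simp]: "x \<in> wpts A" for x
  proof -
    note o = F0c_precoalg[OF V.precoalg_Unit] V'.precoalg_Unit
    have "F1 (comp2 T x) \<in> Hom V'.K (F0c (Unit V.K)) (F0c (whom B (pmap G x, pmap F x)))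
      \<longleftrightarrow> comp2 T x \<in> Hom V.K (Unit V.K) (whom B (pmap G x, pmap F x))"
      by (rule F1_K) (use V.precoalg_Unit in simp_all)
    moreover have "F1 (comp2 T x) \<bullet> \<iota> \<in> Hom V'.K (Unit V'.K) (F0c (whom B (pmap G x, pmap F x)))"
      if "F1 (comp2 T x) \<in> Hom V'.K (F0c (Unit V.K)) (F0c (whom B (pmap G x, pmap F x)))"
      by (rule V'.K_Comp[OF iota_K that]) (use o in \<open>simp_all del: coalgebras_sel\<close>)
    moreover have "F1 (comp2 T x) \<in> Hom V'.K (F0c (Unit V.K)) (F0c (whom B (pmap G x, pmap F x)))"
      if "F1 (comp2 T x) \<bullet> \<iota> \<in> Hom V'.K (Unit V'.K) (F0c (whom B (pmap G x, pmap F x)))"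
    proof -
      \<comment> \<open>Composing with the coalgebra morphism \<open>\<kappa>\<close> undoes the
        composition with its inverse \<open>\<iota>\<close>.\<close>
      have "(F1 (comp2 T x) \<bullet> \<iota>) \<bullet> \<kappa> \<in> Hom V'.K (F0c (Unit V.K)) (F0c (whom B (pmap G x, pmap F x)))"
        by (rule V'.K_Comp[OF kappa_K that]) (use o in \<open>simp_all del: coalgebras_sel\<close>)
      then show ?thesis by (simp del: coalgebras_sel)
    qed
    ultimately show ?thesis by blast
  qed
  have 2: "V'.ract (F0 (cobj (whom A (x, y)))) (wmul (Fw0 B) (pmap G x, pmap G y, pmap F y)) (F1 (amap G (x, y))) (F1 (comp2 T y) \<bullet> \<iota>)
      = V'.lact (F0 (cobj (whom A (x, y)))) (wmul (Fw0 B) (pmap G x, pmap F x, pmap F y)) (F1 (comp2 T x) \<bullet> \<iota>) (F1 (amap F (x, y)))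
    \<longleftrightarrow> V.ract (cobj (whom A (x, y))) (wmul B (pmap G x, pmap G y, pmap F y)) (amap G (x, y)) (comp2 T y)
      = V.lact (cobj (whom A (x, y))) (wmul B (pmap G x, pmap F x, pmap F y)) (comp2 T x) (amap F (x, y))"
    if xy[simp]: "x \<in> wpts A" "y \<in> wpts A" for x y
  proof -
    let ?l = "V.ract (cobj (whom A (x, y))) (wmul B (pmap G x, pmap G y, pmap F y)) (amap G (x, y)) (comp2 T y)"
    let ?r = "V.lact (cobj (whom A (x, y))) (wmul B (pmap G x, pmap F x, pmap F y)) (comp2 T x) (amap F (x, y))"
    have l: "V'.ract (F0 (cobj (whom A (x, y)))) (wmul (Fw0 B) (pmap G x, pmap G y, pmap F y)) (F1 (amap G (x, y))) (F1 (comp2 T y) \<bullet> \<iota>) = F1 ?l"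
      by (subst F_ract) simp_all
    have r: "V'.lact (F0 (cobj (whom A (x, y)))) (wmul (Fw0 B) (pmap G x, pmap F x, pmap F y)) (F1 (comp2 T x) \<bullet> \<iota>) (F1 (amap F (x, y))) = F1 ?r"
      by (subst F_lact) simp_all
    show ?thesis unfolding l r by (rule F1_eq_iff) simp_all
  qed
  show ?thesis
  proof
    assume H: "Fw2 T \<in> wtransf V'.K (Fw1 F) (Fw1 G)"
    show "T \<in> wtransf V.K F G"
    proof (rule V.wtransfI)
      show "comp2 T x \<in> Hom V.K (Unit V.K) (whom (cod1 F) (pmap G x, pmap F x))" if "x \<in> wpts (dom1 F)" for x
        using V'.wtransf_Hom[OF H, of x] 1 that by (simp del: coalgebras_sel)
      show "V.ract (cobj (whom (dom1 F) (x, y))) (wmul (cod1 F) (pmap G x, pmap G y, pmap F y)) (amap G (x, y)) (comp2 T y)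
        = V.lact (cobj (whom (dom1 F) (x, y))) (wmul (cod1 F) (pmap G x, pmap F x, pmap F y)) (comp2 T x) (amap F (x, y))"
        if "x \<in> wpts (dom1 F)" "y \<in> wpts (dom1 F)" for x y
        using V'.wtransf_nat[OF H, of x y] 2 that by (simp del: Fw0_sel(3))
    qed simp_all
  next
    assume H: "T \<in> wtransf V.K F G"
    show "Fw2 T \<in> wtransf V'.K (Fw1 F) (Fw1 G)"
    proof (rule V'.wtransfI)
      show "comp2 (Fw2 T) x \<in> Hom V'.K (Unit V'.K) (whom (cod1 (Fw1 F)) (pmap (Fw1 G) x, pmap (Fw1 F) x))" if "x \<in> wpts (dom1 (Fw1 F))" for x
        using V.wtransf_Hom[OF H, of x] 1 that by (simp del: coalgebras_sel)
      show "V'.ract (cobj (whom (dom1 (Fw1 F)) (x, y))) (wmul (cod1 (Fw1 F)) (pmap (Fw1 G) x, pmap (Fw1 G) y, pmap (Fw1 F) y)) (amap (Fw1 G) (x, y)) (comp2 (Fw2 T) y)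
        = V'.lact (cobj (whom (dom1 (Fw1 F)) (x, y))) (wmul (cod1 (Fw1 F)) (pmap (Fw1 G) x, pmap (Fw1 F) x, pmap (Fw1 F) y)) (comp2 (Fw2 T) x) (amap (Fw1 F) (x, y))"
        if "x \<in> wpts (dom1 (Fw1 F))" "y \<in> wpts (dom1 (Fw1 F))" for x y
        using V.wtransf_nat[OF H, of x y] 2 that by (simp del: Fw0_sel(3))
      show "comp2 (Fw2 T) \<in> extensional (wpts (dom1 (Fw1 F)))" by (simp add: Fw2_def)
    qed simp_all
  qed
qed

lemma Fw2_cell:
  assumes "is_wcat V.K A" "is_wcat V.K B" "F \<in> wfunctors V.K A B" "G \<in> wfunctors V.K A B" "T \<in> wtransf V.K F G"
  shows "Fw2 T \<in> wtransf V'.K (Fw1 F) (Fw1 G)"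
  by (rule iffD2[OF Fw2_iff[OF assms(1-4)] assms(5)])
    (use V.wtransfD[OF assms(5)] V.wf2_ar[OF V.wf2I[OF assms]] V.wfun_dom_cod[OF assms(3)] V.wfun_dom_cod[OF assms(4)] in simp_all)

lemma Fw2_image:
  assumes A: "is_wcat V.K A" and B: "is_wcat V.K B" and F: "F \<in> wfunctors V.K A B" and G: "G \<in> wfunctors V.K A B"
  shows "Fw2 ` wtransf V.K F G = wtransf V'.K (Fw1 F) (Fw1 G)"
proof (intro equalityI subsetI)
  fix S assume S: "S \<in> wtransf V'.K (Fw1 F) (Fw1 G)"
  have A': "is_wcat V'.K (Fw0 A)" and B': "is_wcat V'.K (Fw0 B)"
    using A B Fw0_wcat[of A] Fw0_wcat[of B] V.wcat_iff by blast+
  note F' = Fw1_cell[OF A B F] and G' = Fw1_cell[OF A B G]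
  note [simp] = A B V.wfun_dom_cod[OF F] V.wfun_dom_cod[OF G] V'.wtransf_dom_cod[OF S]
    V.wf1_ar[OF V.wf1I[OF A B F], simplified V.wfun_dom_cod[OF F]]
    V.wf1_ar[OF V.wf1I[OF A B G], simplified V.wfun_dom_cod[OF G]]
  note [simp] = V'.wf2_ar[OF V'.wf2I[OF A' B' F' G' S], simplified]
  \<comment> \<open>The component is composed with \<open>\<kappa>\<close> before it is lifted,
    because \<open>Fw2\<close> composes the image of the lift with \<open>\<iota>\<close>.\<close>
  have "\<forall>x \<in> wpts A. \<exists>a. V.ar a \<and> dm a = Unit V \<and> cd a = cobj (whom B (pmap G x, pmap F x)) \<and> F1 a = comp2 S x \<bullet> \<kappa>"
  proof
    fix x assume [simp]: "x \<in> wpts A"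
    obtain a where "V.ar a" "dm a = Unit V" "cd a = cobj (whom B (pmap G x, pmap F x))" "F1 a = comp2 S x \<bullet> \<kappa>"
      by (rule F1_full[of "comp2 S x \<bullet> \<kappa>" "Unit V" "cobj (whom B (pmap G x, pmap F x))"]) simp_all
    then show "\<exists>a. V.ar a \<and> dm a = Unit V \<and> cd a = cobj (whom B (pmap G x, pmap F x)) \<and> F1 a = comp2 S x \<bullet> \<kappa>" by blast
  qed
  from bchoice[OF this] obtain \<phi> where \<phi>: "\<And>x. x \<in> wpts A \<Longrightarrow> V.ar (\<phi> x) \<and> dm (\<phi> x) = Unit V \<and>
    cd (\<phi> x) = cobj (whom B (pmap G x, pmap F x)) \<and> F1 (\<phi> x) = comp2 S x \<bullet> \<kappa>" by auto
  define T where "T = \<lparr>dom2 = F, cod2 = G, comp2 = restrict \<phi> (wpts A)\<rparr>"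
  have e: "S = Fw2 T"
  proof (rule two_cell.equality)
    show "comp2 S = comp2 (Fw2 T)"
      by (rule extensionalityI[of _ "wpts A"]) (use V'.wtransf_ext[OF S] \<phi> in \<open>auto simp: Fw2_def T_def\<close>)
  qed (simp_all add: T_def)
  have T: "dom2 T = F" "cod2 T = G" "\<And>x. x \<in> wpts A \<Longrightarrow> comp2 T x = \<phi> x" "comp2 T \<in> extensional (wpts A)"
    by (simp_all add: T_def)
  have "Fw2 T \<in> wtransf V'.K (Fw1 F) (Fw1 G)" using S by (simp only: e[symmetric])
  then have "T \<in> wtransf V.K F G"
    by (intro iffD1[OF Fw2_iff[OF A B F G]]) (use T \<phi> in simp_all)
  then show "S \<in> Fw2 ` wtransf V.K F G" using e by blast
qed (use Fw2_cell[OF A B F G] in blast)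

text \<open>Injectivity of \<open>Fw1\<close> settles sources and targets first; then the components
  are compared by cancelling \<open>\<iota>\<close> and using faithfulness.\<close>

lemma Fw2_inj:
  assumes A: "is_wcat V.K A" and B: "is_wcat V.K B"
  shows "inj_on Fw2 (\<Union>F \<in> wfunctors V.K A B. \<Union>G \<in> wfunctors V.K A B. wtransf V.K F G)"
proof (rule inj_onI)
  fix S T assume S: "S \<in> (\<Union>F \<in> wfunctors V.K A B. \<Union>G \<in> wfunctors V.K A B. wtransf V.K F G)"
    and T: "T \<in> (\<Union>F \<in> wfunctors V.K A B. \<Union>G \<in> wfunctors V.K A B. wtransf V.K F G)" and e: "Fw2 S = Fw2 T"
  obtain F G where F: "F \<in> wfunctors V.K A B" and G: "G \<in> wfunctors V.K A B" and S: "S \<in> wtransf V.K F G" using S by blast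
  obtain F' G' where F': "F' \<in> wfunctors V.K A B" and G': "G' \<in> wfunctors V.K A B" and T: "T \<in> wtransf V.K F' G'" using T by blast
  note inj = bij_betw_imp_inj_on[OF Fw1_bij[OF A B]]
  have "F = F'" by (rule inj_onD[OF inj _ F F'])
    (use arg_cong[OF e, of dom2] V.wtransf_dom_cod[OF S] V.wtransf_dom_cod[OF T] in simp)
  moreover have "G = G'" by (rule inj_onD[OF inj _ G G'])
    (use arg_cong[OF e, of cod2] V.wtransf_dom_cod[OF S] V.wtransf_dom_cod[OF T] in simp)
  ultimately have T: "T \<in> wtransf V.K F G" using T by simp
  note [simp] = V.wfun_dom_cod[OF F] V.wtransf_dom_cod[OF S] V.wtransf_dom_cod[OF T]
    V.wf2_ar[OF V.wf2I[OF A B F G S], simplified V.wfun_dom_cod[OF F] V.wtransf_dom_cod[OF S]]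
    V.wf2_ar[OF V.wf2I[OF A B F G T], simplified V.wfun_dom_cod[OF F] V.wtransf_dom_cod[OF T]]
  show "S = T"
  proof (rule V.wtransf_eqI[OF S T])
    fix x assume "x \<in> wpts (dom1 F)"
    then have [simp]: "x \<in> wpts A" by simp
    have "F1 (comp2 S x) \<bullet> \<iota> = F1 (comp2 T x) \<bullet> \<iota>" using arg_cong[OF e, of "\<lambda>T. comp2 T x"] by simp
    then have "F1 (comp2 S x) = F1 (comp2 T x)" by (rule V'.right_cancel[of \<iota> \<kappa>, rotated -1]) simp_all
    then show "comp2 S x = comp2 T x" by (rule F1_inj) simp_all
  qed
qed

lemma Fw0_cell: "is_wcat V.K A \<Longrightarrow> is_wcat V'.K (Fw0 A)"
  using Fw0_wcat[of A] V.wcat_iff[of A] by blast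

text \<open>\<open>F_lact\<close> for a product of two elements, with the result turned into an
  element again by \<open>\<iota>\<close>. It is the form in which the two compositions of 2-cells
  need it.\<close>

lemma F_lact_iota:
  assumes "V.ar m" "V.ar a" "V.ar f" "dm m = X \<boxtimes> Y" "cd a = X" "dm a = Unit V" "cd f = Y" "dm f = Unit V"
  shows "F1 (V.lact (Unit V) m a f) \<bullet> \<iota> = V'.lact (Unit V') (F1 m \<bullet> \<mu> X Y) (F1 a \<bullet> \<iota>) (F1 f \<bullet> \<iota>)"
proof -
  have "X \<in> Obj V" "Y \<in> Obj V" using assms by auto
  then show ?thesis unfolding F_lact[OF assms] using assms by (intro V'.lact_comp) simp_all
qed

section \<open>The change of base as a local isomorphism, and its essential surjectivity\<close>

context
  fixes t :: "'x itself"
begin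

lemma Fw_local_iso: "local_iso (W_Cat V.K t) (W_Cat V'.K t) Fw0 Fw1 Fw2"
proof (rule local_iso.intro, unfold V.W_Cat_sel(1-3,5) V'.W_Cat_sel(1-3,5) mem_Collect_eq)
  show "is_wcat V.K A \<Longrightarrow> is_wcat V'.K (Fw0 A)" for A by (rule Fw0_cell)
  show "\<lbrakk>is_wcat V.K A; is_wcat V.K B\<rbrakk> \<Longrightarrow> bij_betw Fw1 (wfunctors V.K A B) (wfunctors V'.K (Fw0 A) (Fw0 B))" for A B
    by (rule Fw1_bij)
  show "\<lbrakk>is_wcat V.K A; is_wcat V.K B; F \<in> wfunctors V.K A B; G \<in> wfunctors V.K A B\<rbrakk> \<Longrightarrow>
      Fw2 ` wtransf V.K F G = wtransf V'.K (Fw1 F) (Fw1 G)" for A B F G by (rule Fw2_image)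
  show "\<lbrakk>is_wcat V.K A; is_wcat V.K B\<rbrakk> \<Longrightarrow>
      inj_on Fw2 (\<Union>F \<in> wfunctors V.K A B. \<Union>G \<in> wfunctors V.K A B. wtransf V.K F G)" for A B by (rule Fw2_inj)
next
  fix A :: "('x, ('o, 'a) coalg, 'a) wcat" assume A: "is_wcat V.K A"
  show "Fw1 (Id1 (W_Cat V.K t) A) = Id1 (W_Cat V'.K t) (Fw0 A)"
    by (rule V'.wfun_eqI[OF Fw1_cell[OF A A V.W_Id1[OF A]] V'.W_Id1[OF Fw0_cell[OF A]]]) (use A in simp_all)
next
  fix A B C :: "('x, ('o, 'a) coalg, 'a) wcat" and F G assume A: "is_wcat V.K A" and B: "is_wcat V.K B" and C: "is_wcat V.K C"
    and F: "F \<in> wfunctors V.K A B" and G: "G \<in> wfunctors V.K B C"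
  note [simp] = A B C V.wfun_dom_cod[OF F] V.wfun_dom_cod[OF G]
    V.wf1_ar[OF V.wf1I[OF A B F], simplified V.wfun_dom_cod[OF F]]
    V.wf1_ar[OF V.wf1I[OF B C G], simplified V.wfun_dom_cod[OF G]]
  show "Fw1 (wcomp V.K G F) = wcomp V'.K (Fw1 G) (Fw1 F)"
    by (rule V'.wfun_eqI[OF Fw1_cell[OF A C V.wcomp_cell[OF A B C F G]]
          V'.wcomp_cell[OF Fw0_cell[OF A] Fw0_cell[OF B] Fw0_cell[OF C] Fw1_cell[OF A B F] Fw1_cell[OF B C G]]]) simp_all
next
  fix A B :: "('x, ('o, 'a) coalg, 'a) wcat" and F assume A: "is_wcat V.K A" and B: "is_wcat V.K B" and F: "F \<in> wfunctors V.K A B"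
  note [simp] = A B V.wfun_dom_cod[OF F] V.wf1_ar[OF V.wf1I[OF A B F], simplified V.wfun_dom_cod[OF F]]
  show "Fw2 (Id2 (W_Cat V.K t) F) = Id2 (W_Cat V'.K t) (Fw1 F)"
    by (rule V'.wtransf_eqI[OF Fw2_cell[OF A B F F V.W_Id2[OF A B F]] V'.W_Id2[OF Fw0_cell[OF A] Fw0_cell[OF B] Fw1_cell[OF A B F]]])
      simp
next
  fix A B :: "('x, ('o, 'a) coalg, 'a) wcat" and F G H \<alpha> \<beta> assume A: "is_wcat V.K A" and B: "is_wcat V.K B" and F: "F \<in> wfunctors V.K A B"
    and G: "G \<in> wfunctors V.K A B" and H: "H \<in> wfunctors V.K A B" and \<alpha>: "\<alpha> \<in> wtransf V.K F G" and \<beta>: "\<beta> \<in> wtransf V.K G H"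
  note [simp] = A B V.wfun_dom_cod[OF F] V.wfun_dom_cod[OF G] V.wfun_dom_cod[OF H]
    V.wtransf_dom_cod[OF \<alpha>] V.wtransf_dom_cod[OF \<beta>]
    V.wf1_ar[OF V.wf1I[OF A B F], simplified V.wfun_dom_cod[OF F]]
    V.wf1_ar[OF V.wf1I[OF A B G], simplified V.wfun_dom_cod[OF G]]
    V.wf1_ar[OF V.wf1I[OF A B H], simplified V.wfun_dom_cod[OF H]]
    V.wf2_ar[OF V.wf2I[OF A B F G \<alpha>], simplified V.wfun_dom_cod[OF F] V.wtransf_dom_cod[OF \<alpha>]]
    V.wf2_ar[OF V.wf2I[OF A B G H \<beta>], simplified V.wfun_dom_cod[OF G] V.wtransf_dom_cod[OF \<beta>]]
  show "Fw2 (VComp (W_Cat V.K t) \<beta> \<alpha>) = VComp (W_Cat V'.K t) (Fw2 \<beta>) (Fw2 \<alpha>)"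
  proof (rule V'.wtransf_eqI[OF Fw2_cell[OF A B F H V.W_VComp[OF A B F G H \<alpha> \<beta>]]
        V'.W_VComp[OF Fw0_cell[OF A] Fw0_cell[OF B] Fw1_cell[OF A B F] Fw1_cell[OF A B G] Fw1_cell[OF A B H]
          Fw2_cell[OF A B F G \<alpha>] Fw2_cell[OF A B G H \<beta>]]])
    fix x assume "x \<in> wpts (dom1 (Fw1 F))"
    then have [simp]: "x \<in> wpts A" by simp
    show "comp2 (Fw2 (VComp (W_Cat V.K t) \<beta> \<alpha>)) x = comp2 (VComp (W_Cat V'.K t) (Fw2 \<beta>) (Fw2 \<alpha>)) x"
      by (simp, subst F_lact_iota) simp_all
  qed
next
  fix A B C :: "('x, ('o, 'a) coalg, 'a) wcat" and F F' G G' \<alpha> \<beta> assume A: "is_wcat V.K A" and B: "is_wcat V.K B" and C: "is_wcat V.K C"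
    and F: "F \<in> wfunctors V.K A B" and F': "F' \<in> wfunctors V.K A B"
    and G: "G \<in> wfunctors V.K B C" and G': "G' \<in> wfunctors V.K B C"
    and \<alpha>: "\<alpha> \<in> wtransf V.K F F'" and \<beta>: "\<beta> \<in> wtransf V.K G G'"
  note [simp] = A B C V.wfun_dom_cod[OF F] V.wfun_dom_cod[OF G] V.wfun_dom_cod[OF F'] V.wfun_dom_cod[OF G']
    V.wtransf_dom_cod[OF \<alpha>] V.wtransf_dom_cod[OF \<beta>]
    V.wf1_ar[OF V.wf1I[OF A B F], simplified V.wfun_dom_cod[OF F]]
    V.wf1_ar[OF V.wf1I[OF A B F'], simplified V.wfun_dom_cod[OF F']]
    V.wf1_ar[OF V.wf1I[OF B C G], simplified V.wfun_dom_cod[OF G]]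
    V.wf1_ar[OF V.wf1I[OF B C G'], simplified V.wfun_dom_cod[OF G']]
    V.wf2_ar[OF V.wf2I[OF A B F F' \<alpha>], simplified V.wfun_dom_cod[OF F] V.wtransf_dom_cod[OF \<alpha>]]
    V.wf2_ar[OF V.wf2I[OF B C G G' \<beta>], simplified V.wfun_dom_cod[OF G] V.wtransf_dom_cod[OF \<beta>]]
  have e: "Fw1 (wcomp V.K J H) = wcomp V'.K (Fw1 J) (Fw1 H)"
    if H: "H \<in> wfunctors V.K A B" and J: "J \<in> wfunctors V.K B C" for H J
  proof -
    note [simp] = V.wfun_dom_cod[OF H] V.wfun_dom_cod[OF J]
      V.wf1_ar[OF V.wf1I[OF A B H], simplified V.wfun_dom_cod[OF H]]
      V.wf1_ar[OF V.wf1I[OF B C J], simplified V.wfun_dom_cod[OF J]]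
    show ?thesis
      by (rule V'.wfun_eqI[OF Fw1_cell[OF A C V.wcomp_cell[OF A B C H J]]
          V'.wcomp_cell[OF Fw0_cell[OF A] Fw0_cell[OF B] Fw0_cell[OF C] Fw1_cell[OF A B H] Fw1_cell[OF B C J]]]) simp_all
  qed
  show "Fw2 (HComp (W_Cat V.K t) \<alpha> \<beta>) = HComp (W_Cat V'.K t) (Fw2 \<alpha>) (Fw2 \<beta>)"
  proof (rule V'.wtransf_eqI[OF Fw2_cell[OF A C V.wcomp_cell[OF A B C F G] V.wcomp_cell[OF A B C F' G']
          V.W_HComp[OF A B C F F' G G' \<alpha> \<beta>], unfolded e[OF F G] e[OF F' G']]
        V'.W_HComp[OF Fw0_cell[OF A] Fw0_cell[OF B] Fw0_cell[OF C] Fw1_cell[OF A B F] Fw1_cell[OF A B F']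
          Fw1_cell[OF B C G] Fw1_cell[OF B C G'] Fw2_cell[OF A B F F' \<alpha>] Fw2_cell[OF B C G G' \<beta>]]])
    fix x assume "x \<in> wpts (dom1 (wcomp V'.K (Fw1 G) (Fw1 F)))"
    then have [simp]: "x \<in> wpts A" by simp
    show "comp2 (Fw2 (HComp (W_Cat V.K t) \<alpha> \<beta>)) x = comp2 (HComp (W_Cat V'.K t) (Fw2 \<alpha>) (Fw2 \<beta>)) x"
      by (simp, subst F_lact_iota) simp_all
  qed
qed

text \<open>Every hom-coalgebra of \<open>Z\<close> is isomorphic to some \<open>F0c (D p)\<close>.
  Conjugating the structure of \<open>Z\<close> by these isomorphisms and lifting it by fullness
  yields data \<open>A\<close> for which \<open>Fw0 A\<close> is a transport of
  \<open>Z\<close>.\<close>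

lemma Fw_ess_surj:
  fixes Z :: "('x, ('p, 'b) coalg, 'b) wcat"
  assumes Z: "is_wcat V'.K Z"
  shows "\<exists>A. is_wcat V.K A \<and> equivalent_0cells (W_Cat V'.K t) (Fw0 A) Z"
proof -
  let ?X = "wpts Z"
  note [simp] = Z
  have "\<forall>p \<in> ?X \<times> ?X. \<exists>c. is_coalg V (fst c) \<and> fst (snd c) \<in> Hom V'.K (F0c (fst c)) (whom Z p) \<and>
     snd (snd c) \<in> Hom V'.K (whom Z p) (F0c (fst c)) \<and> snd (snd c) \<bullet> fst (snd c) = Idn V' (F0 (cobj (fst c))) \<and>
     fst (snd c) \<bullet> snd (snd c) = Idn V' (cobj (whom Z p))"
  proof
    fix p assume "p \<in> ?X \<times> ?X"
    then have "is_coalg V' (whom Z p)" using V'.wcat_coalg[OF Z] by (cases p) auto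
    from coalg_ess_surj[OF this] show "\<exists>c. is_coalg V (fst c) \<and> fst (snd c) \<in> Hom V'.K (F0c (fst c)) (whom Z p) \<and>
     snd (snd c) \<in> Hom V'.K (whom Z p) (F0c (fst c)) \<and> snd (snd c) \<bullet> fst (snd c) = Idn V' (F0 (cobj (fst c))) \<and>
     fst (snd c) \<bullet> snd (snd c) = Idn V' (cobj (whom Z p))" by simp
  qed
  from bchoice[OF this] obtain c where c: "\<forall>p \<in> ?X \<times> ?X. is_coalg V (fst (c p)) \<and> fst (snd (c p)) \<in> Hom V'.K (F0c (fst (c p))) (whom Z p) \<and>
     snd (snd (c p)) \<in> Hom V'.K (whom Z p) (F0c (fst (c p))) \<and> snd (snd (c p)) \<bullet> fst (snd (c p)) = Idn V' (F0 (cobj (fst (c p)))) \<and>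
     fst (snd (c p)) \<bullet> snd (snd (c p)) = Idn V' (cobj (whom Z p))" by (rule exE)
  define D where "D p = fst (c p)" for p
  define e where "e p = fst (snd (c p))" for p
  define e' where "e' p = snd (snd (c p))" for p
  have D: "is_coalg V (D (x, y))" and e: "e (x, y) \<in> Hom V'.K (F0c (D (x, y))) (whom Z (x, y))"
    and e': "e' (x, y) \<in> Hom V'.K (whom Z (x, y)) (F0c (D (x, y)))"
    and e'e: "e' (x, y) \<bullet> e (x, y) = Idn V' (F0 (cobj (D (x, y))))" and ee': "e (x, y) \<bullet> e' (x, y) = Idn V' (cobj (whom Z (x, y)))"
    if "x \<in> ?X" "y \<in> ?X" for x y
    using c[THEN bspec, of "(x, y)"] that by (auto simp: D_def e_def e'_def)
  note pD[simp] = V.coalg_precoalg[OF D]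
  have [simp]: "V'.ar (e (x, y))" "dm' (e (x, y)) = F0 (cobj (D (x, y)))" "cd' (e (x, y)) = cobj (whom Z (x, y))"
    "V'.ar (e' (x, y))" "dm' (e' (x, y)) = cobj (whom Z (x, y))" "cd' (e' (x, y)) = F0 (cobj (D (x, y)))"
    if "x \<in> ?X" "y \<in> ?X" for x y
    using V'.K_HomD[OF e[OF that]] V'.K_HomD[OF e'[OF that]] that by simp_all
  \<comment> \<open>The multiplication of \<open>Z\<close> transported to the coalgebras
    \<open>F0c (D p)\<close>. The factors \<open>\<nu>\<close> and, for units,
    \<open>\<kappa>\<close> appended below cancel against the \<open>\<mu>\<close> and
    \<open>\<iota>\<close> in \<open>Fw0\<close>.\<close>
  let ?M = "\<lambda>x y z. e' (x, z) \<bullet> wmul Z (x, y, z) \<bullet> (e (x, y) \<diamond> e (y, z))"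
  have "\<forall>p \<in> ?X \<times> ?X \<times> ?X. \<exists>m. case p of (x, y, z) \<Rightarrow> V.ar m \<and> dm m = cobj (D (x, y)) \<boxtimes> cobj (D (y, z)) \<and> cd m = cobj (D (x, z)) \<and>
     F1 m = ?M x y z \<bullet> \<nu> (cobj (D (x, y))) (cobj (D (y, z)))"
  proof
    fix p assume "p \<in> ?X \<times> ?X \<times> ?X"
    then obtain x y z where p: "p = (x, y, z)" and [simp]: "x \<in> ?X" "y \<in> ?X" "z \<in> ?X" by auto
    obtain m where "V.ar m" "dm m = cobj (D (x, y)) \<boxtimes> cobj (D (y, z))" "cd m = cobj (D (x, z))"
      "F1 m = ?M x y z \<bullet> \<nu> (cobj (D (x, y))) (cobj (D (y, z)))"
      by (rule F1_full[of "?M x y z \<bullet> \<nu> (cobj (D (x, y))) (cobj (D (y, z)))" "cobj (D (x, y)) \<boxtimes> cobj (D (y, z))" "cobj (D (x, z))"]) simp_all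
    then show "\<exists>m. case p of (x, y, z) \<Rightarrow> V.ar m \<and> dm m = cobj (D (x, y)) \<boxtimes> cobj (D (y, z)) \<and> cd m = cobj (D (x, z)) \<and>
     F1 m = ?M x y z \<bullet> \<nu> (cobj (D (x, y))) (cobj (D (y, z)))" by (auto simp: p)
  qed
  from bchoice[OF this] obtain m where m: "\<forall>p \<in> ?X \<times> ?X \<times> ?X. case p of (x, y, z) \<Rightarrow> V.ar (m p) \<and>
     dm (m p) = cobj (D (x, y)) \<boxtimes> cobj (D (y, z)) \<and> cd (m p) = cobj (D (x, z)) \<and>
     F1 (m p) = ?M x y z \<bullet> \<nu> (cobj (D (x, y))) (cobj (D (y, z)))" by (rule exE)
  have [simp]: "V.ar (m (x, y, z))" "dm (m (x, y, z)) = cobj (D (x, y)) \<boxtimes> cobj (D (y, z))"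
    "cd (m (x, y, z)) = cobj (D (x, z))" "F1 (m (x, y, z)) = ?M x y z \<bullet> \<nu> (cobj (D (x, y))) (cobj (D (y, z)))"
    if "x \<in> ?X" "y \<in> ?X" "z \<in> ?X" for x y z using m[THEN bspec, of "(x, y, z)"] that by simp_all
  have "\<forall>x \<in> ?X. \<exists>u. V.ar u \<and> dm u = Unit V \<and> cd u = cobj (D (x, x)) \<and> F1 u = e' (x, x) \<bullet> wunit Z x \<bullet> \<kappa>"
  proof
    fix x assume [simp]: "x \<in> ?X"
    obtain u where "V.ar u" "dm u = Unit V" "cd u = cobj (D (x, x))" "F1 u = e' (x, x) \<bullet> wunit Z x \<bullet> \<kappa>"
      by (rule F1_full[of "e' (x, x) \<bullet> wunit Z x \<bullet> \<kappa>" "Unit V" "cobj (D (x, x))"]) simp_all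
    then show "\<exists>u. V.ar u \<and> dm u = Unit V \<and> cd u = cobj (D (x, x)) \<and> F1 u = e' (x, x) \<bullet> wunit Z x \<bullet> \<kappa>" by blast
  qed
  from bchoice[OF this] obtain u where u: "\<forall>x \<in> ?X. V.ar (u x) \<and> dm (u x) = Unit V \<and> cd (u x) = cobj (D (x, x)) \<and>
    F1 (u x) = e' (x, x) \<bullet> wunit Z x \<bullet> \<kappa>" by (rule exE)
  have [simp]: "V.ar (u x)" "dm (u x) = Unit V" "cd (u x) = cobj (D (x, x))" "F1 (u x) = e' (x, x) \<bullet> wunit Z x \<bullet> \<kappa>"
    if "x \<in> ?X" for x using u[THEN bspec, OF that] by simp_all
  define A where "A = \<lparr>wpts = ?X, whom = restrict D (?X \<times> ?X), wmul = restrict m (?X \<times> ?X \<times> ?X), wunit = restrict u ?X\<rparr>"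
  have [simp]: "wpts A = ?X" "\<lbrakk>x \<in> ?X; y \<in> ?X\<rbrakk> \<Longrightarrow> whom A (x, y) = D (x, y)"
    "\<lbrakk>x \<in> ?X; y \<in> ?X; z \<in> ?X\<rbrakk> \<Longrightarrow> wmul A (x, y, z) = m (x, y, z)" "x \<in> ?X \<Longrightarrow> wunit A x = u x" for x y z
    by (simp_all add: A_def)
  \<comment> \<open>\<open>Fw0 A\<close> is recognised as a category before \<open>A\<close> itself:
    that the lifted maps are coalgebra morphisms is reflected from their images by
    \<open>F1_K\<close> afterwards.\<close>
  have T: "is_wcat V'.K (Fw0 A)" "equivalent_0cells (W_Cat V'.K t) (Fw0 A) Z"
    by (rule V'.wcat_transport[of Z "Fw0 A" e e']; use Fw0_ext[of A] e e' e'e ee' D F0c_coalg in simp)+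
  have "V.prewcat A" unfolding V.prewcat_def
  proof (intro conjI ballI)
    fix x y assume "x \<in> wpts A" "y \<in> wpts A"
    then have x[simp]: "x \<in> ?X" and y[simp]: "y \<in> ?X" by simp_all
    show "is_coalg V (whom A (x, y))" using D[of x y] by simp
    have "wunit (Fw0 A) x \<in> Hom V'.K (Unit V'.K) (whom (Fw0 A) (x, x))" by (rule V'.wcat_unit[OF T(1)]) simp
    then have "e' (x, x) \<bullet> wunit Z x \<in> Hom V'.K (Unit V'.K) (F0c (D (x, x)))" by (simp del: coalgebras_sel)
    then have "(e' (x, x) \<bullet> wunit Z x) \<bullet> \<kappa> \<in> Hom V'.K (F0c (Unit V.K)) (F0c (D (x, x)))"
      by (rule V'.K_Comp[OF kappa_K]) (use V'.precoalg_Unit F0c_precoalg[OF V.precoalg_Unit] in \<open>simp_all del: coalgebras_sel\<close>)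
    then have 1: "F1 (u x) \<in> Hom V'.K (F0c (Unit V.K)) (F0c (D (x, x)))" by (simp del: coalgebras_sel)
    have "u x \<in> Hom V.K (Unit V.K) (D (x, x))" by (rule iffD1[OF F1_K 1]) simp_all
    then show "wunit A x \<in> Hom V.K (Unit V.K) (whom A (x, x))" by (simp del: coalgebras_sel)
    fix z assume "z \<in> wpts A"
    then have z[simp]: "z \<in> ?X" by simp
    have "wmul (Fw0 A) (x, y, z) \<in> Hom V'.K (Ten V'.K (whom (Fw0 A) (x, y)) (whom (Fw0 A) (y, z))) (whom (Fw0 A) (x, z))"
      by (rule V'.wcat_mul[OF T(1)]) simp_all
    then have "?M x y z \<in> Hom V'.K (Ten V'.K (F0c (D (x, y))) (F0c (D (y, z)))) (F0c (D (x, z)))" by (simp del: coalgebras_sel)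
    then have "?M x y z \<bullet> \<nu> (cobj (D (x, y))) (cobj (D (y, z))) \<in> Hom V'.K (F0c (Ten V.K (D (x, y)) (D (y, z)))) (F0c (D (x, z)))"
      by (rule V'.K_Comp[OF nu_K, rotated 2]) (use V'.precoalg_Ten F0c_precoalg[OF V.precoalg_Ten] in \<open>simp_all del: coalgebras_sel\<close>)
    then have 1: "F1 (m (x, y, z)) \<in> Hom V'.K (F0c (Ten V.K (D (x, y)) (D (y, z)))) (F0c (D (x, z)))" by (simp del: coalgebras_sel)
    have "m (x, y, z) \<in> Hom V.K (Ten V.K (D (x, y)) (D (y, z))) (D (x, z))"
      by (rule iffD1[OF F1_K 1]) simp_all
    then show "wmul A (x, y, z) \<in> Hom V.K (Ten V.K (whom A (x, y)) (whom A (y, z))) (whom A (x, z))" by (simp del: coalgebras_sel)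
  qed (simp_all add: A_def)
  then have "is_wcat V.K A" using Fw0_wcat T(1) by blast
  then show ?thesis using T(2) by blast
qed

end

end

section \<open>Reversing arrows and tensor products\<close>

text \<open>The associator is reversed twice and so remains an associator, with the objects in
  opposite order; likewise the braiding keeps its direction. The unit isomorphisms change sides and
  are inverted.\<close>

definition oprev :: "('o, 'a) sym_mon_cat \<Rightarrow> ('o, 'a) sym_mon_cat" where
  "oprev V = \<lparr>Obj = Obj V, Hom = (\<lambda>A B. Hom V B A), Idn = Idn V, Comp = (\<lambda>g f. f \<cdot>\<^bsub>V\<^esub> g),
     Ten = (\<lambda>A B. B \<boxtimes>\<^bsub>V\<^esub> A), TenA = (\<lambda>f g. g \<star>\<^bsub>V\<^esub> f), Unit = Unit V,
     Assoc = (\<lambda>A B C. Assoc V C B A), AssocInv = (\<lambda>A B C. AssocInv V C B A),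
     LUnit = RUnitInv V, LUnitInv = RUnit V, RUnit = LUnitInv V, RUnitInv = LUnit V, Braid = Braid V\<rparr>"

lemma oprev_sel [simp]:
  "Obj (oprev V) = Obj V" "Hom (oprev V) A B = Hom V B A" "Idn (oprev V) = Idn V"
  "g \<cdot>\<^bsub>oprev V\<^esub> f = f \<cdot>\<^bsub>V\<^esub> g" "A \<boxtimes>\<^bsub>oprev V\<^esub> B = B \<boxtimes>\<^bsub>V\<^esub> A" "f \<star>\<^bsub>oprev V\<^esub> g = g \<star>\<^bsub>V\<^esub> f"
  "Unit (oprev V) = Unit V" "Assoc (oprev V) A B C = Assoc V C B A" "AssocInv (oprev V) A B C = AssocInv V C B A"
  "LUnit (oprev V) = RUnitInv V" "LUnitInv (oprev V) = RUnit V" "RUnit (oprev V) = LUnitInv V"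
  "RUnitInv (oprev V) = LUnit V" "Braid (oprev V) = Braid V"
  by (simp_all add: oprev_def)

definition alg_of :: "('o, 'a) coalg \<Rightarrow> ('o, 'a) alg" where
  "alg_of C = \<lparr>aobj = cobj C, amul = comul C, aunit = counit C\<rparr>"

definition coalg_of :: "('o, 'a) alg \<Rightarrow> ('o, 'a) coalg" where
  "coalg_of A = \<lparr>cobj = aobj A, comul = amul A, counit = aunit A\<rparr>"

lemma alg_of_sel [simp]: "aobj (alg_of C) = cobj C" "amul (alg_of C) = comul C" "aunit (alg_of C) = counit C"
  "alg_of (coalg_of A) = A" "coalg_of (alg_of C) = C" "cobj (coalg_of A) = aobj A"
  by (simp_all add: alg_of_def coalg_of_def)

lemma algebras_sel [simp]:
  "Obj (algebras V) = {A. is_alg V A}"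
  "Idn (algebras V) = (\<lambda>A. Idn V (aobj A))"
  "Comp (algebras V) = Comp V"
  "Ten (algebras V) = (\<lambda>A B. \<lparr>aobj = aobj A \<boxtimes>\<^bsub>V\<^esub> aobj B,
     amul = (amul A \<star>\<^bsub>V\<^esub> amul B) \<cdot>\<^bsub>V\<^esub> mid4 V (aobj A) (aobj B) (aobj A) (aobj B),
     aunit = (aunit A \<star>\<^bsub>V\<^esub> aunit B) \<cdot>\<^bsub>V\<^esub> LUnitInv V (Unit V)\<rparr>)"
  "TenA (algebras V) = TenA V"
  "Unit (algebras V) = \<lparr>aobj = Unit V, amul = LUnit V (Unit V), aunit = Idn V (Unit V)\<rparr>"
  "Assoc (algebras V) = (\<lambda>A B C. Assoc V (aobj A) (aobj B) (aobj C))"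
  "LUnit (algebras V) = (\<lambda>A. LUnit V (aobj A))"
  "RUnit (algebras V) = (\<lambda>A. RUnit V (aobj A))"
  by (simp_all add: algebras_def)

text \<open>The defining equations of both kinds of morphisms are the same, read once in
  \<open>V\<close> and once in \<open>oprev V\<close>; the direction is reversed.\<close>

lemma Hom_algebras: "Hom (algebras V) (alg_of D) (alg_of C) = Hom (coalgebras (oprev V)) C D"
  by (auto simp: algebras_def coalgebras_def)

text \<open>\<open>mid4\<close> is defined by one particular bracketing, which the reversal changes
  into another. That the two composites agree is a coherence statement; it is assumed here, and for
  modules it is verified on pure tensors.\<close>

locale oprev_symmon = symmon V dm cd for V :: "('o, 'a) sym_mon_cat" (structure) and dm cd +
  assumes mid4_oprev: "\<lbrakk>A \<in> Obj V; B \<in> Obj V; C \<in> Obj V; D \<in> Obj V\<rbrakk> \<Longrightarrow> mid4 (oprev V) A B C D = mid4 V D B C A"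
begin

lemma LUnit_Unit: "LUnit V (Unit V) = RUnit V (Unit V)"
proof -
  have "LUnit V (Unit V) = LUnit V (Unit V) \<cdot> (LUnitInv V (Unit V) \<cdot> RUnit V (Unit V))"
    using RUnit_inverse(3)[of "Unit V"] RUnitInv_Unit by (simp del: LUnitInv_comp RUnitInv_comp LUnit_inverse)
  then show ?thesis by (simp del: LUnitInv_comp)
qed

text \<open>All results on categories enriched in coalgebras become available for
  \<open>oprev V\<close>, with the prefix \<open>O\<close>. The unit coherence laws to be checked
  are those of \<open>V\<close> multiplied by unit isomorphisms that cancel the inverse
  ones.\<close>

sublocale O: symmon "oprev V" cd dm
proof (unfold_locales, simp_all only: oprev_sel)
  show "f \<in> Hom V B A \<Longrightarrow> cd f = A \<and> dm f = B" for f A B using Hom_dm_cd[of f B A] by simp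
  show "A \<in> Obj V \<Longrightarrow> Idn V A \<in> Hom V A A" for A by (rule Idn_Hom)
  show "Unit V \<in> Obj V" by simp
  show "\<lbrakk>A \<in> Obj V; B \<in> Obj V\<rbrakk> \<Longrightarrow> B \<boxtimes> A \<in> Obj V" for A B by simp
  show "\<lbrakk>A \<in> Obj V; B \<in> Obj V\<rbrakk> \<Longrightarrow> Idn V B \<star> Idn V A = Idn V (B \<boxtimes> A)" for A B by simp
  show "LUnit V (Unit V) = RUnit V (Unit V)" by (rule LUnit_Unit)
  show "mid4 (oprev V) (Unit V) (Unit V) (Unit V) (Unit V) = Idn V ((Unit V \<boxtimes> Unit V) \<boxtimes> Unit V \<boxtimes> Unit V)"
    by (simp add: mid4_oprev mid4_Unit)
next
  fix A assume A[simp]: "A \<in> Obj V"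
  have "((Idn V A \<star> RUnit V (Unit V)) \<cdot> Assoc V A (Unit V) (Unit V) \<cdot> (RUnitInv V A \<star> Idn V (Unit V))) \<cdot> (RUnit V A \<star> Idn V (Unit V))
     = RUnit V A \<star> Idn V (Unit V)"
    unfolding Assoc_Unit_right[OF A] by (simp flip: LUnit_Unit del: LUnitInv_comp RUnitInv_comp)
  then show "(Idn V A \<star> RUnit V (Unit V)) \<cdot> Assoc V A (Unit V) (Unit V) = RUnit V A \<star> Idn V (Unit V)"
    by (simp del: LUnitInv_comp RUnitInv_comp assoc_unit)
  have "((Idn V (Unit V) \<star> LUnit V A) \<cdot> Assoc V (Unit V) (Unit V) A \<cdot> (LUnitInv V (Unit V) \<star> Idn V A)) \<cdot> (RUnit V (Unit V) \<star> Idn V A)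
     = RUnit V (Unit V) \<star> Idn V A"
    unfolding Assoc_Unit_left[OF A] by (simp del: LUnitInv_comp RUnitInv_comp)
  then show "(Idn V (Unit V) \<star> LUnit V A) \<cdot> Assoc V (Unit V) (Unit V) A = RUnit V (Unit V) \<star> Idn V A"
    unfolding LUnit_Unit[symmetric] by (simp del: LUnitInv_comp RUnitInv_comp assoc_unit)
  show "(LUnit V A \<cdot> (Idn V (Unit V) \<star> RUnit V A)) \<cdot> Assoc V (Unit V) A (Unit V) = RUnit V A \<cdot> (LUnit V A \<star> Idn V (Unit V))"
  proof (rule right_cancel[of "(LUnitInv V A \<star> Idn V (Unit V)) \<cdot> RUnitInv V A" "RUnit V A \<cdot> (LUnit V A \<star> Idn V (Unit V))"])
    show "((LUnit V A \<cdot> (Idn V (Unit V) \<star> RUnit V A)) \<cdot> Assoc V (Unit V) A (Unit V)) \<cdot> ((LUnitInv V A \<star> Idn V (Unit V)) \<cdot> RUnitInv V A)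
      = (RUnit V A \<cdot> (LUnit V A \<star> Idn V (Unit V))) \<cdot> ((LUnitInv V A \<star> Idn V (Unit V)) \<cdot> RUnitInv V A)"
      using Assoc_Unit_outer[OF A] by (simp del: LUnitInv_comp RUnitInv_comp assoc_unit)
  qed (simp_all del: LUnitInv_comp RUnitInv_comp)
  show "RUnitInv V A \<cdot> RUnit V A = Idn V (A \<boxtimes> Unit V)" "LUnitInv V A \<cdot> LUnit V A = Idn V (Unit V \<boxtimes> A)"
    by (rule RUnitInv_RUnit[OF A], rule LUnitInv_LUnit[OF A])
next
  fix A B f assume "A \<in> Obj V" "B \<in> Obj V" "f \<in> Hom V B A"
  then show "(f \<star> Idn V (Unit V)) \<cdot> RUnitInv V B = RUnitInv V A \<cdot> f" "(Idn V (Unit V) \<star> f) \<cdot> LUnitInv V B = LUnitInv V A \<cdot> f"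
    "f \<cdot> Idn V B = f" "Idn V A \<cdot> f = f"
    by (auto simp: Hom_iff)
qed (simp_all add: Hom_iff mid4_oprev LUnit_ten RUnit_ten)

lemma O_ar [simp]: "O.ar = ar"
  by (rule ext, unfold O.ar_def ar_def oprev_sel) blast

abbreviation M :: "(('o, 'a) alg, 'a) mon_cat" where "M \<equiv> algebras V"

text \<open>The factors change places because \<open>oprev\<close> reverses tensor products. The
  multiplications agree by \<open>mid4_oprev\<close>, the units because both inverse unit
  isomorphisms agree at the unit object.\<close>

lemma alg_of_Ten: "\<lbrakk>O.precoalg C; O.precoalg D\<rbrakk> \<Longrightarrow> Ten M (alg_of D) (alg_of C) = alg_of (Ten O.K C D)"
  using O.precoalgD[of C] O.precoalgD[of D] by (simp add: alg_of_def mid4_oprev RUnitInv_Unit)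

lemma alg_of_Unit: "Unit M = alg_of (Unit O.K)"
  by (simp add: alg_of_def LUnit_Unit)

text \<open>Associativity is the same equation up to bracketing and the order of its sides. The unit
  laws differ in form: on the coalgebra side a unit isomorphism has been moved across the
  equation.\<close>

lemma is_alg_alg_of: "is_alg V (alg_of C) \<longleftrightarrow> is_coalg (oprev V) C"
proof (cases "O.precoalg C")
  case True
  note [simp] = O.precoalgD[OF True, simplified]
  let ?c = "cobj C" and ?m = "comul C" and ?e = "counit C"
  have 1: "LUnit (oprev V) ?c \<cdot>\<^bsub>oprev V\<^esub> (?e \<star>\<^bsub>oprev V\<^esub> Idn (oprev V) ?c) \<cdot>\<^bsub>oprev V\<^esub> ?m = Idn (oprev V) ?c
    \<longleftrightarrow> ?m \<cdot> (Idn V ?c \<star> ?e) = RUnit V ?c"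
  proof
    assume "LUnit (oprev V) ?c \<cdot>\<^bsub>oprev V\<^esub> (?e \<star>\<^bsub>oprev V\<^esub> Idn (oprev V) ?c) \<cdot>\<^bsub>oprev V\<^esub> ?m = Idn (oprev V) ?c"
    then have "(?m \<cdot> (Idn V ?c \<star> ?e)) \<cdot> RUnitInv V ?c = RUnit V ?c \<cdot> RUnitInv V ?c" by (simp del: RUnitInv_comp)
    then show "?m \<cdot> (Idn V ?c \<star> ?e) = RUnit V ?c"
      by (rule right_cancel[of "RUnitInv V ?c" "RUnit V ?c", rotated -1]) (simp_all del: RUnitInv_comp)
  next
    assume "?m \<cdot> (Idn V ?c \<star> ?e) = RUnit V ?c"
    then show "LUnit (oprev V) ?c \<cdot>\<^bsub>oprev V\<^esub> (?e \<star>\<^bsub>oprev V\<^esub> Idn (oprev V) ?c) \<cdot>\<^bsub>oprev V\<^esub> ?m = Idn (oprev V) ?c"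
      by (simp only: oprev_sel) simp
  qed
  have 2: "RUnit (oprev V) ?c \<cdot>\<^bsub>oprev V\<^esub> (Idn (oprev V) ?c \<star>\<^bsub>oprev V\<^esub> ?e) \<cdot>\<^bsub>oprev V\<^esub> ?m = Idn (oprev V) ?c
    \<longleftrightarrow> ?m \<cdot> (?e \<star> Idn V ?c) = LUnit V ?c"
  proof
    assume "RUnit (oprev V) ?c \<cdot>\<^bsub>oprev V\<^esub> (Idn (oprev V) ?c \<star>\<^bsub>oprev V\<^esub> ?e) \<cdot>\<^bsub>oprev V\<^esub> ?m = Idn (oprev V) ?c"
    then have "(?m \<cdot> (?e \<star> Idn V ?c)) \<cdot> LUnitInv V ?c = LUnit V ?c \<cdot> LUnitInv V ?c" by (simp del: LUnitInv_comp)
    then show "?m \<cdot> (?e \<star> Idn V ?c) = LUnit V ?c"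
      by (rule right_cancel[of "LUnitInv V ?c" "LUnit V ?c", rotated -1]) (simp_all del: LUnitInv_comp)
  next
    assume "?m \<cdot> (?e \<star> Idn V ?c) = LUnit V ?c"
    then show "RUnit (oprev V) ?c \<cdot>\<^bsub>oprev V\<^esub> (Idn (oprev V) ?c \<star>\<^bsub>oprev V\<^esub> ?e) \<cdot>\<^bsub>oprev V\<^esub> ?m = Idn (oprev V) ?c"
      by (simp only: oprev_sel) simp
  qed
  show ?thesis unfolding is_coalg_def is_alg_def Let_def 1 2 by (auto simp: Hom_iff)
next
  case False
  then have "\<not> is_coalg (oprev V) C" using O.coalg_precoalg by blast
  moreover have "\<not> is_alg V (alg_of C)"
    using False unfolding is_alg_def Let_def O.precoalg_def by (auto simp: Hom_iff)
  ultimately show ?thesis by blast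
qed

text \<open>In \<open>oprev V\<close> the multiplication at \<open>(z, y, x)\<close> is an arrow of
  \<open>V\<close> from the hom at \<open>(z, x)\<close> to the tensor product of the homs at
  \<open>(y, x)\<close> and \<open>(z, y)\<close>, in this order. Reading the index pairs backwards
  makes it a comultiplication at \<open>(x, y, z)\<close> without any braiding.\<close>

definition T0 :: "('x, ('o, 'a) coalg, 'a) wcat \<Rightarrow> ('x, ('o, 'a) alg, 'a) dual_wcat" where
  "T0 A = \<lparr>dpts = wpts A, dhom = restrict (\<lambda>(x, y). alg_of (whom A (y, x))) (wpts A \<times> wpts A),
     dcomul = restrict (\<lambda>(x, y, z). wmul A (z, y, x)) (wpts A \<times> wpts A \<times> wpts A), dcounit = wunit A\<rparr>"

lemma T0_sel [simp]: "dpts (T0 A) = wpts A"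
  "\<lbrakk>x \<in> wpts A; y \<in> wpts A\<rbrakk> \<Longrightarrow> dhom (T0 A) (x, y) = alg_of (whom A (y, x))"
  "\<lbrakk>x \<in> wpts A; y \<in> wpts A; z \<in> wpts A\<rbrakk> \<Longrightarrow> dcomul (T0 A) (x, y, z) = wmul A (z, y, x)"
  "dcounit (T0 A) = wunit A"
  by (simp_all add: T0_def)

definition predual :: "('x, ('o, 'a) alg, 'a) dual_wcat \<Rightarrow> bool" where
  "predual C \<longleftrightarrow> dhom C \<in> extensional (dpts C \<times> dpts C) \<and>
     dcomul C \<in> extensional (dpts C \<times> dpts C \<times> dpts C) \<and> dcounit C \<in> extensional (dpts C) \<and>
     (\<forall>x \<in> dpts C. \<forall>y \<in> dpts C. is_alg V (dhom C (x, y))) \<and>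
     (\<forall>x \<in> dpts C. \<forall>y \<in> dpts C. \<forall>z \<in> dpts C.
        dcomul C (x, y, z) \<in> Hom M (dhom C (x, z)) (Ten M (dhom C (x, y)) (dhom C (y, z)))) \<and>
     (\<forall>x \<in> dpts C. dcounit C x \<in> Hom M (dhom C (x, x)) (Unit M))"

lemma dual_wcat_iff: "is_dual_wcat M C \<longleftrightarrow> predual C \<and>
    (\<forall>x \<in> dpts C. \<forall>y \<in> dpts C. \<forall>z \<in> dpts C. \<forall>u \<in> dpts C.
      Assoc V (aobj (dhom C (x, y))) (aobj (dhom C (y, z))) (aobj (dhom C (z, u)))
        \<cdot> (dcomul C (x, y, z) \<star> Idn V (aobj (dhom C (z, u)))) \<cdot> dcomul C (x, z, u)
      = (Idn V (aobj (dhom C (x, y))) \<star> dcomul C (y, z, u)) \<cdot> dcomul C (x, y, u)) \<and>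
    (\<forall>x \<in> dpts C. \<forall>y \<in> dpts C.
      LUnit V (aobj (dhom C (x, y))) \<cdot> (dcounit C x \<star> Idn V (aobj (dhom C (x, y)))) \<cdot> dcomul C (x, x, y)
        = Idn V (aobj (dhom C (x, y)))) \<and>
    (\<forall>x \<in> dpts C. \<forall>y \<in> dpts C.
      RUnit V (aobj (dhom C (x, y))) \<cdot> (Idn V (aobj (dhom C (x, y))) \<star> dcounit C y) \<cdot> dcomul C (x, y, y)
        = Idn V (aobj (dhom C (x, y))))"
  (is "_ \<longleftrightarrow> _ \<and> ?l1 \<and> ?l2 \<and> ?l3")
proof -
  have "predual C \<longleftrightarrow> dhom C \<in> dpts C \<times> dpts C \<rightarrow>\<^sub>E Obj M \<and>
     dcomul C \<in> PiE (dpts C \<times> dpts C \<times> dpts C) (\<lambda>(x, y, z). Hom M (dhom C (x, z)) (Ten M (dhom C (x, y)) (dhom C (y, z)))) \<and>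
     dcounit C \<in> PiE (dpts C) (\<lambda>x. Hom M (dhom C (x, x)) (Unit M))"
    unfolding predual_def PiE_iff algebras_sel(1) by (auto simp del: algebras_sel)
  then show ?thesis unfolding is_dual_wcat_def Let_def algebras_sel(2,3,5,7,8,9) by blast
qed

text \<open>The laws correspond after renaming \<open>x\<close>, \<open>y\<close>, \<open>z\<close>,
  \<open>u\<close> to \<open>u\<close>, \<open>z\<close>, \<open>y\<close>, \<open>x\<close>; in the
  unit laws a unit isomorphism is moved across the equation. The form as an equivalence on
  extensional data also yields the surjectivity of \<open>T0\<close>.\<close>

lemma T0_wcat:
  assumes ext: "whom A \<in> extensional (wpts A \<times> wpts A)" "wmul A \<in> extensional (wpts A \<times> wpts A \<times> wpts A)"
    "wunit A \<in> extensional (wpts A)"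
  shows "is_dual_wcat M (T0 A) \<longleftrightarrow> is_wcat O.K A"
proof -
  have mul: "dcomul (T0 A) (x, y, z) \<in> Hom M (dhom (T0 A) (x, z)) (Ten M (dhom (T0 A) (x, y)) (dhom (T0 A) (y, z)))
      \<longleftrightarrow> wmul A (z, y, x) \<in> Hom O.K (Ten O.K (whom A (z, y)) (whom A (y, x))) (whom A (z, x))"
    if "x \<in> wpts A" "y \<in> wpts A" "z \<in> wpts A" "\<And>x y. \<lbrakk>x \<in> wpts A; y \<in> wpts A\<rbrakk> \<Longrightarrow> is_coalg (oprev V) (whom A (x, y))" for x y z
    using that alg_of_Ten[OF O.coalg_precoalg O.coalg_precoalg, of "whom A (z, y)" "whom A (y, x)"]
      Hom_algebras[of V "whom A (z, x)" "Ten O.K (whom A (z, y)) (whom A (y, x))"]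
    by (simp del: algebras_sel coalgebras_sel)
  have unit: "dcounit (T0 A) x \<in> Hom M (dhom (T0 A) (x, x)) (Unit M) \<longleftrightarrow> wunit A x \<in> Hom O.K (Unit O.K) (whom A (x, x))"
    if "x \<in> wpts A" for x
    using that Hom_algebras[of V "whom A (x, x)" "Unit O.K"] by (simp add: alg_of_Unit del: algebras_sel coalgebras_sel)
  have coalg: "(\<forall>x \<in> wpts A. \<forall>y \<in> wpts A. is_alg V (dhom (T0 A) (x, y))) \<longleftrightarrow> (\<forall>x \<in> wpts A. \<forall>y \<in> wpts A. is_coalg (oprev V) (whom A (x, y)))"
    by (auto simp: is_alg_alg_of)
  have pre: "predual (T0 A) \<longleftrightarrow> O.prewcat A"
  proof
    assume P: "predual (T0 A)"
    have c: "is_coalg (oprev V) (whom A (x, y))" if "x \<in> wpts A" "y \<in> wpts A" for x y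
      using P that unfolding predual_def T0_sel(1) coalg by blast
    show "O.prewcat A" unfolding O.prewcat_def
    proof (intro conjI ballI ext)
      fix x y assume x: "x \<in> wpts A" and y: "y \<in> wpts A"
      show "is_coalg (oprev V) (whom A (x, y))" by (rule c[OF x y])
      have "dcounit (T0 A) x \<in> Hom M (dhom (T0 A) (x, x)) (Unit M)"
        using P x unfolding predual_def T0_sel(1) by blast
      then show "wunit A x \<in> Hom O.K (Unit O.K) (whom A (x, x))" by (rule iffD1[OF unit[OF x]])
      fix z assume z: "z \<in> wpts A"
      have "dcomul (T0 A) (z, y, x) \<in> Hom M (dhom (T0 A) (z, x)) (Ten M (dhom (T0 A) (z, y)) (dhom (T0 A) (y, x)))"
        using P x y z unfolding predual_def T0_sel(1) by blast
      then show "wmul A (x, y, z) \<in> Hom O.K (Ten O.K (whom A (x, y)) (whom A (y, z))) (whom A (x, z))"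
        by (rule iffD1[OF mul[OF z y x], rotated -1]) (rule c)
    qed
  next
    assume P: "O.prewcat A"
    have c: "is_coalg (oprev V) (whom A (x, y))" if "x \<in> wpts A" "y \<in> wpts A" for x y
      using P that unfolding O.prewcat_def by blast
    show "predual (T0 A)" unfolding predual_def T0_sel(1)
    proof (intro conjI ballI)
      show "dhom (T0 A) \<in> extensional (wpts A \<times> wpts A)" "dcomul (T0 A) \<in> extensional (wpts A \<times> wpts A \<times> wpts A)"
        "dcounit (T0 A) \<in> extensional (wpts A)" using ext(3) by (simp_all add: T0_def)
      fix x y assume x: "x \<in> wpts A" and y: "y \<in> wpts A"
      show "is_alg V (dhom (T0 A) (x, y))" using c[OF y x] x y by (simp add: is_alg_alg_of)
      have "wunit A x \<in> Hom O.K (Unit O.K) (whom A (x, x))"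
        using P x unfolding O.prewcat_def by blast
      then show "dcounit (T0 A) x \<in> Hom M (dhom (T0 A) (x, x)) (Unit M)" by (rule iffD2[OF unit[OF x]])
      fix z assume z: "z \<in> wpts A"
      have "wmul A (z, y, x) \<in> Hom O.K (Ten O.K (whom A (z, y)) (whom A (y, x))) (whom A (z, x))"
        using P x y z unfolding O.prewcat_def by blast
      then show "dcomul (T0 A) (x, y, z) \<in> Hom M (dhom (T0 A) (x, z)) (Ten M (dhom (T0 A) (x, y)) (dhom (T0 A) (y, z)))"
        by (rule iffD2[OF mul[OF x y z], rotated -1]) (rule c)
    qed
  qed
  show ?thesis
  proof (cases "O.prewcat A")
    case True
    note [simp] = True O.prewcat_ar[OF True, simplified] O.precoalgD[OF O.prewcat_ar(1)[OF True], simplified]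
    let ?h = "\<lambda>x y. cobj (whom A (x, y))"
    have "(\<forall>x \<in> wpts A. \<forall>y \<in> wpts A. \<forall>z \<in> wpts A. \<forall>u \<in> wpts A.
        Assoc V (?h y x) (?h z y) (?h u z) \<cdot> (wmul A (z, y, x) \<star> Idn V (?h u z)) \<cdot> wmul A (u, z, x)
        = (Idn V (?h y x) \<star> wmul A (u, z, y)) \<cdot> wmul A (u, y, x))
      \<longleftrightarrow> (\<forall>x \<in> wpts A. \<forall>y \<in> wpts A. \<forall>z \<in> wpts A. \<forall>u \<in> wpts A.
        (Idn V (?h z u) \<star> wmul A (x, y, z)) \<cdot> wmul A (x, z, u)
        = (Assoc V (?h z u) (?h y z) (?h x y) \<cdot> (wmul A (y, z, u) \<star> Idn V (?h x y))) \<cdot> wmul A (x, y, u))"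
      by (auto simp del: T0_sel)
    moreover have "LUnit V (?h y x) \<cdot> (wunit A x \<star> Idn V (?h y x)) \<cdot> wmul A (y, x, x) = Idn V (?h y x)
      \<longleftrightarrow> (wunit A x \<star> Idn V (?h y x)) \<cdot> wmul A (y, x, x) = LUnitInv V (?h y x)"
      if [simp]: "x \<in> wpts A" "y \<in> wpts A" for x y
    proof
      assume "LUnit V (?h y x) \<cdot> (wunit A x \<star> Idn V (?h y x)) \<cdot> wmul A (y, x, x) = Idn V (?h y x)"
      then have "LUnit V (?h y x) \<cdot> ((wunit A x \<star> Idn V (?h y x)) \<cdot> wmul A (y, x, x)) = LUnit V (?h y x) \<cdot> LUnitInv V (?h y x)" by simp
      then show "(wunit A x \<star> Idn V (?h y x)) \<cdot> wmul A (y, x, x) = LUnitInv V (?h y x)"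
        by (rule left_cancel[of "LUnitInv V (?h y x)", rotated -1]) (simp_all del: LUnitInv_comp)
    qed simp
    moreover have "RUnit V (?h y x) \<cdot> (Idn V (?h y x) \<star> wunit A y) \<cdot> wmul A (y, y, x) = Idn V (?h y x)
      \<longleftrightarrow> (Idn V (?h y x) \<star> wunit A y) \<cdot> wmul A (y, y, x) = RUnitInv V (?h y x)"
      if [simp]: "x \<in> wpts A" "y \<in> wpts A" for x y
    proof
      assume "RUnit V (?h y x) \<cdot> (Idn V (?h y x) \<star> wunit A y) \<cdot> wmul A (y, y, x) = Idn V (?h y x)"
      then have "RUnit V (?h y x) \<cdot> ((Idn V (?h y x) \<star> wunit A y) \<cdot> wmul A (y, y, x)) = RUnit V (?h y x) \<cdot> RUnitInv V (?h y x)" by simp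
      then show "(Idn V (?h y x) \<star> wunit A y) \<cdot> wmul A (y, y, x) = RUnitInv V (?h y x)"
        by (rule left_cancel[of "RUnitInv V (?h y x)", rotated -1]) (simp_all del: RUnitInv_comp)
    qed simp
    ultimately show ?thesis unfolding dual_wcat_iff O.wcat_iff pre
      by (auto simp del: comp_assoc O.comp_assoc)
  next
    case False
    then show ?thesis using pre dual_wcat_iff[of "T0 A"] O.wcat_iff[of A] by blast
  qed
qed

lemma T0_inverse:
  assumes "dhom C \<in> extensional (dpts C \<times> dpts C)" "dcomul C \<in> extensional (dpts C \<times> dpts C \<times> dpts C)"
    "dcounit C \<in> extensional (dpts C)"
  shows "\<exists>A. T0 A = C \<and> whom A \<in> extensional (wpts A \<times> wpts A) \<and>
    wmul A \<in> extensional (wpts A \<times> wpts A \<times> wpts A) \<and> wunit A \<in> extensional (wpts A)"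
proof -
  define A where "A = \<lparr>wpts = dpts C, whom = restrict (\<lambda>(x, y). coalg_of (dhom C (y, x))) (dpts C \<times> dpts C),
     wmul = restrict (\<lambda>(x, y, z). dcomul C (z, y, x)) (dpts C \<times> dpts C \<times> dpts C), wunit = dcounit C\<rparr>"
  have "T0 A = C"
  proof (rule dual_wcat.equality)
    show "dhom (T0 A) = dhom C" by (rule extensionalityI[OF _ assms(1)]) (auto simp: T0_def A_def)
    show "dcomul (T0 A) = dcomul C" by (rule extensionalityI[OF _ assms(2)]) (auto simp: T0_def A_def)
  qed (simp_all add: A_def)
  then show ?thesis using assms by (intro exI[of _ A]) (simp add: A_def)
qed

lemma T0_surj:
  assumes "is_dual_wcat M C"
  shows "\<exists>A. is_wcat O.K A \<and> T0 A = C"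
proof -
  have "predual C" using assms dual_wcat_iff by blast
  then have e: "dhom C \<in> extensional (dpts C \<times> dpts C)" "dcomul C \<in> extensional (dpts C \<times> dpts C \<times> dpts C)"
    "dcounit C \<in> extensional (dpts C)" unfolding predual_def by blast+
  from T0_inverse[OF this] obtain A where "T0 A = C" "whom A \<in> extensional (wpts A \<times> wpts A)"
    "wmul A \<in> extensional (wpts A \<times> wpts A \<times> wpts A)" "wunit A \<in> extensional (wpts A)" by blast
  then show ?thesis using T0_wcat[of A] assms by auto
qed

definition T1 :: "(('x, ('o, 'a) coalg, 'a) wcat, 'x, 'a) one_cell \<Rightarrow> (('x, ('o, 'a) alg, 'a) dual_wcat, 'x, 'a) one_cell" where
  "T1 F = \<lparr>dom1 = T0 (dom1 F), cod1 = T0 (cod1 F), pmap = pmap F,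
     amap = restrict (\<lambda>(x, y). amap F (y, x)) (wpts (dom1 F) \<times> wpts (dom1 F))\<rparr>"

lemma T1_sel [simp]: "dom1 (T1 F) = T0 (dom1 F)" "cod1 (T1 F) = T0 (cod1 F)" "pmap (T1 F) = pmap F"
  "\<lbrakk>x \<in> wpts (dom1 F); y \<in> wpts (dom1 F)\<rbrakk> \<Longrightarrow> amap (T1 F) (x, y) = amap F (y, x)"
  by (simp_all add: T1_def)

lemma dual_wfunD:
  assumes F: "F \<in> dual_wfunctors M C D"
  shows "dom1 F = C" "cod1 F = D" "pmap F \<in> extensional (dpts C)" "amap F \<in> extensional (dpts C \<times> dpts C)"
    and "x \<in> dpts C \<Longrightarrow> pmap F x \<in> dpts D"
    and "\<lbrakk>x \<in> dpts C; y \<in> dpts C\<rbrakk> \<Longrightarrow> amap F (x, y) \<in> Hom M (dhom D (pmap F x, pmap F y)) (dhom C (x, y))"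
    and "\<lbrakk>x \<in> dpts C; y \<in> dpts C; z \<in> dpts C\<rbrakk> \<Longrightarrow>
      (amap F (x, y) \<star> amap F (y, z)) \<cdot> dcomul D (pmap F x, pmap F y, pmap F z) = dcomul C (x, y, z) \<cdot> amap F (x, z)"
    and "x \<in> dpts C \<Longrightarrow> dcounit D (pmap F x) = dcounit C x \<cdot> amap F (x, x)"
  using F unfolding dual_wfunctors_def Let_def by (auto simp: PiE_iff)

lemma dual_wfunI:
  assumes "dom1 F = C" "cod1 F = D" "pmap F \<in> extensional (dpts C)" "amap F \<in> extensional (dpts C \<times> dpts C)"
    and "\<And>x. x \<in> dpts C \<Longrightarrow> pmap F x \<in> dpts D"
    and "\<And>x y. \<lbrakk>x \<in> dpts C; y \<in> dpts C\<rbrakk> \<Longrightarrow> amap F (x, y) \<in> Hom M (dhom D (pmap F x, pmap F y)) (dhom C (x, y))"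
    and "\<And>x y z. \<lbrakk>x \<in> dpts C; y \<in> dpts C; z \<in> dpts C\<rbrakk> \<Longrightarrow>
      (amap F (x, y) \<star> amap F (y, z)) \<cdot> dcomul D (pmap F x, pmap F y, pmap F z) = dcomul C (x, y, z) \<cdot> amap F (x, z)"
    and "\<And>x. x \<in> dpts C \<Longrightarrow> dcounit D (pmap F x) = dcounit C x \<cdot> amap F (x, x)"
  shows "F \<in> dual_wfunctors M C D"
  using assms unfolding dual_wfunctors_def Let_def by (auto simp: PiE_iff)

lemma T1_wfun:
  assumes F: "dom1 F = A" "cod1 F = B" "pmap F \<in> extensional (wpts A)" "amap F \<in> extensional (wpts A \<times> wpts A)"
  shows "T1 F \<in> dual_wfunctors M (T0 A) (T0 B) \<longleftrightarrow> F \<in> wfunctors O.K A B"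
proof
  assume H: "T1 F \<in> dual_wfunctors M (T0 A) (T0 B)"
  note D = dual_wfunD[OF H, simplified F(1,2) T0_sel T1_sel]
  have pt[simp]: "x \<in> wpts A \<Longrightarrow> pmap F x \<in> wpts B" for x by (rule D)
  show "F \<in> wfunctors O.K A B"
  proof (rule O.wfunctorsI)
    show "amap F (x, y) \<in> Hom O.K (whom A (x, y)) (whom B (pmap F x, pmap F y))" if "x \<in> wpts A" "y \<in> wpts A" for x y
      using D(6)[of y x] that by (simp add: F Hom_algebras)
    show "wmul B (pmap F x, pmap F y, pmap F z) \<cdot>\<^bsub>oprev V\<^esub> (amap F (x, y) \<star>\<^bsub>oprev V\<^esub> amap F (y, z)) = amap F (x, z) \<cdot>\<^bsub>oprev V\<^esub> wmul A (x, y, z)"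
      if "x \<in> wpts A" "y \<in> wpts A" "z \<in> wpts A" for x y z
      using D(7)[of z y x] that by (simp add: F)
    show "amap F (x, x) \<cdot>\<^bsub>oprev V\<^esub> wunit A x = wunit B (pmap F x)" if "x \<in> wpts A" for x
      using D(8)[of x] that by (simp add: F)
  qed (use F in simp_all)
next
  assume H: "F \<in> wfunctors O.K A B"
  note D = O.wfunD[OF H]
  have [simp]: "x \<in> wpts A \<Longrightarrow> pmap F x \<in> wpts B" for x by (rule D)
  show "T1 F \<in> dual_wfunctors M (T0 A) (T0 B)"
  proof (rule dual_wfunI)
    show "amap (T1 F) (x, y) \<in> Hom M (dhom (T0 B) (pmap (T1 F) x, pmap (T1 F) y)) (dhom (T0 A) (x, y))"
      if "x \<in> dpts (T0 A)" "y \<in> dpts (T0 A)" for x y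
      using D(6)[of y x] that by (simp add: F Hom_algebras)
    show "(amap (T1 F) (x, y) \<star> amap (T1 F) (y, z)) \<cdot> dcomul (T0 B) (pmap (T1 F) x, pmap (T1 F) y, pmap (T1 F) z)
      = dcomul (T0 A) (x, y, z) \<cdot> amap (T1 F) (x, z)"
      if "x \<in> dpts (T0 A)" "y \<in> dpts (T0 A)" "z \<in> dpts (T0 A)" for x y z
      using D(7)[of z y x] that by (simp add: F)
    show "dcounit (T0 B) (pmap (T1 F) x) = dcounit (T0 A) x \<cdot> amap (T1 F) (x, x)" if "x \<in> dpts (T0 A)" for x
      using D(8)[of x] that by (simp add: F)
  qed (use F in \<open>simp_all add: T1_def\<close>)
qed

lemma T1_bij: "bij_betw T1 (wfunctors O.K A B) (dual_wfunctors M (T0 A) (T0 B))"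
proof (rule bij_betwI')
  fix F G assume F: "F \<in> wfunctors O.K A B" and G: "G \<in> wfunctors O.K A B"
  show "T1 F = T1 G \<longleftrightarrow> F = G"
  proof
    assume e: "T1 F = T1 G"
    note [simp] = O.wfun_dom_cod[OF F] O.wfun_dom_cod[OF G]
    show "F = G"
    proof (rule O.wfun_eqI[OF F G])
      show "pmap F x = pmap G x" for x using arg_cong[OF e, of pmap] by simp
      show "amap F (x, y) = amap G (x, y)" if "x \<in> wpts A" "y \<in> wpts A" for x y
        using arg_cong[OF e, of "\<lambda>F. amap F (y, x)"] that by simp
    qed
  qed simp
next
  fix F assume F: "F \<in> wfunctors O.K A B"
  show "T1 F \<in> dual_wfunctors M (T0 A) (T0 B)" by (rule iffD2[OF T1_wfun F]) (rule O.wfunD[OF F])+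
next
  fix H assume H: "H \<in> dual_wfunctors M (T0 A) (T0 B)"
  note D = dual_wfunD[OF H, simplified T0_sel]
  define F where "F = \<lparr>dom1 = A, cod1 = B, pmap = pmap H, amap = restrict (\<lambda>(x, y). amap H (y, x)) (wpts A \<times> wpts A)\<rparr>"
  have e: "T1 F = H"
  proof (rule one_cell.equality)
    show "amap (T1 F) = amap H" by (rule extensionalityI[OF _ D(4)]) (auto simp: T1_def F_def)
  qed (simp_all add: F_def D)
  have "F \<in> wfunctors O.K A B" by (rule iffD1[OF T1_wfun]) (use D H e in \<open>simp_all add: F_def\<close>)
  then show "\<exists>F \<in> wfunctors O.K A B. H = T1 F" using e by blast
qed

text \<open>The components stay as they are: the exchange of indices turns the hom at
  \<open>(g x, f x)\<close> into the one at \<open>(f x, g x)\<close>, and the reversal of arrows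
  makes an element a map to the unit object. So a 2-cell keeps its direction.\<close>

definition T2 :: "(('x, ('o, 'a) coalg, 'a) wcat, 'x, 'a) two_cell \<Rightarrow> (('x, ('o, 'a) alg, 'a) dual_wcat, 'x, 'a) two_cell" where
  "T2 S = \<lparr>dom2 = T1 (dom2 S), cod2 = T1 (cod2 S), comp2 = comp2 S\<rparr>"

lemma T2_sel [simp]: "dom2 (T2 S) = T1 (dom2 S)" "cod2 (T2 S) = T1 (cod2 S)" "comp2 (T2 S) = comp2 S"
  by (simp_all add: T2_def)

lemma T2_wtransf:
  assumes A: "is_wcat O.K A" and B: "is_wcat O.K B" and F: "F \<in> wfunctors O.K A B" and G: "G \<in> wfunctors O.K A B"
    and S: "dom2 S = F" "cod2 S = G"
  shows "T2 S \<in> dual_wtransf M (T1 F) (T1 G) \<longleftrightarrow> S \<in> wtransf O.K F G"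
proof -
  note [simp] = S O.wfun_dom_cod[OF F] O.wfun_dom_cod[OF G] A B
    O.wf1_ar[OF O.wf1I[OF A B F], simplified O.wfun_dom_cod[OF F] oprev_sel O_ar]
    O.wf1_ar[OF O.wf1I[OF A B G], simplified O.wfun_dom_cod[OF G] oprev_sel O_ar]
    O.wcat_ar[OF A, simplified oprev_sel O_ar] O.wcat_ar[OF B, simplified oprev_sel O_ar]
  have cA[simp]: "cobj (whom A (x, y)) \<in> Obj V" if "x \<in> wpts A" "y \<in> wpts A" for x y
    using O.precoalgD(1)[of "whom A (x, y)"] that by simp
  have cB[simp]: "cobj (whom B (x, y)) \<in> Obj V" if "x \<in> wpts B" "y \<in> wpts B" for x y
    using O.precoalgD(1)[of "whom B (x, y)"] that by simp
  have H: "comp2 S x \<in> Hom M (dhom (T0 B) (pmap F x, pmap G x)) (Unit M)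
    \<longleftrightarrow> comp2 S x \<in> Hom O.K (Unit O.K) (whom B (pmap G x, pmap F x))" if "x \<in> wpts A" for x
    using that Hom_algebras[of V "whom B (pmap G x, pmap F x)" "Unit O.K"] by (simp add: alg_of_Unit del: algebras_sel coalgebras_sel)
  \<comment> \<open>Naturality at \<open>(x, y)\<close> corresponds to dual naturality at
    \<open>(y, x)\<close>, since \<open>T1\<close> exchanges the indices of the components.\<close>
  have N: "RUnit V (aobj (dhom (T0 A) (y, x))) \<cdot> (amap (T1 F) (y, x) \<star> comp2 S x) \<cdot> dcomul (T0 B) (pmap F y, pmap F x, pmap G x)
      = LUnit V (aobj (dhom (T0 A) (y, x))) \<cdot> (comp2 S y \<star> amap (T1 G) (y, x)) \<cdot> dcomul (T0 B) (pmap F y, pmap G y, pmap G x)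
    \<longleftrightarrow> O.ract (cobj (whom A (x, y))) (wmul B (pmap G x, pmap G y, pmap F y)) (amap G (x, y)) (comp2 S y)
      = O.lact (cobj (whom A (x, y))) (wmul B (pmap G x, pmap F x, pmap F y)) (comp2 S x) (amap F (x, y))"
    if xy[simp]: "x \<in> wpts A" "y \<in> wpts A" and S': "\<And>x. x \<in> wpts A \<Longrightarrow> comp2 S x \<in> Hom O.K (Unit O.K) (whom B (pmap G x, pmap F x))" for x y
  proof -
    have [simp]: "ar (comp2 S x)" "cd (comp2 S x) = Unit V" "dm (comp2 S x) = cobj (whom B (pmap G x, pmap F x))" if "x \<in> wpts A" for x
      using O.K_HomD[OF S'[OF that]] O.precoalg_Unit that by simp_all
    show ?thesis unfolding O.ract_def O.lact_def by auto
  qed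
  have ext: "comp2 S \<in> extensional (wpts A)" if "S \<in> wtransf O.K F G" using O.wtransf_ext[OF that] by simp
  show ?thesis
  proof
    assume D: "T2 S \<in> dual_wtransf M (T1 F) (T1 G)"
    have P: "comp2 S \<in> PiE (wpts A) (\<lambda>x. Hom M (dhom (T0 B) (pmap F x, pmap G x)) (Unit M))"
      and Q: "\<And>x y. \<lbrakk>x \<in> wpts A; y \<in> wpts A\<rbrakk> \<Longrightarrow> RUnit V (aobj (dhom (T0 A) (x, y))) \<cdot> (amap (T1 F) (x, y) \<star> comp2 S y) \<cdot> dcomul (T0 B) (pmap F x, pmap F y, pmap G y)
      = LUnit V (aobj (dhom (T0 A) (x, y))) \<cdot> (comp2 S x \<star> amap (T1 G) (x, y)) \<cdot> dcomul (T0 B) (pmap F x, pmap G x, pmap G y)"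
      using D unfolding dual_wtransf_def Let_def by (simp_all del: T0_sel(2-4) T1_sel(4) algebras_sel(4,6))
    have c: "comp2 S x \<in> Hom O.K (Unit O.K) (whom B (pmap G x, pmap F x))" if "x \<in> wpts A" for x
      using H[OF that] PiE_mem[OF P that] by blast
    show "S \<in> wtransf O.K F G"
    proof (rule O.wtransfI)
      show "O.ract (cobj (whom (dom1 F) (x, y))) (wmul (cod1 F) (pmap G x, pmap G y, pmap F y)) (amap G (x, y)) (comp2 S y)
      = O.lact (cobj (whom (dom1 F) (x, y))) (wmul (cod1 F) (pmap G x, pmap F x, pmap F y)) (comp2 S x) (amap F (x, y))"
        if "x \<in> wpts (dom1 F)" "y \<in> wpts (dom1 F)" for x y
        using iffD1[OF N[OF _ _ c] Q, of x y] that by simp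
    qed (use c P in \<open>simp_all add: PiE_iff\<close>)
  next
    assume D: "S \<in> wtransf O.K F G"
    have c: "comp2 S x \<in> Hom O.K (Unit O.K) (whom B (pmap G x, pmap F x))" if "x \<in> wpts A" for x
      using O.wtransf_Hom[OF D, of x] that by simp
    have "comp2 S \<in> PiE (wpts A) (\<lambda>x. Hom M (dhom (T0 B) (pmap F x, pmap G x)) (Unit M))"
      using c H ext[OF D] by (simp add: PiE_iff del: T0_sel(2-4) algebras_sel(4,6) coalgebras_sel)
    moreover have "RUnit V (aobj (dhom (T0 A) (x, y))) \<cdot> (amap (T1 F) (x, y) \<star> comp2 S y) \<cdot> dcomul (T0 B) (pmap F x, pmap F y, pmap G y)
      = LUnit V (aobj (dhom (T0 A) (x, y))) \<cdot> (comp2 S x \<star> amap (T1 G) (x, y)) \<cdot> dcomul (T0 B) (pmap F x, pmap G x, pmap G y)"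
      if "x \<in> wpts A" "y \<in> wpts A" for x y
      by (rule iffD2[OF N[OF that(2,1) c]]) (use O.wtransf_nat[OF D, of y x] that in simp_all)
    ultimately show "T2 S \<in> dual_wtransf M (T1 F) (T1 G)"
      unfolding dual_wtransf_def Let_def by (simp del: T0_sel(2-4) T1_sel(4) algebras_sel(4,6))
  qed
qed

lemma Dual_W_Cat_sel:
  "Cell0 (Dual_W_Cat M t) = {C. is_dual_wcat M C}"
  "Cell1 (Dual_W_Cat M t) = dual_wfunctors M"
  "Cell2 (Dual_W_Cat M t) = dual_wtransf M"
  "Id1 (Dual_W_Cat M t) = (\<lambda>C. \<lparr>dom1 = C, cod1 = C, pmap = (\<lambda>x \<in> dpts C. x),
     amap = (\<lambda>p \<in> dpts C \<times> dpts C. Idn V (aobj (dhom C p)))\<rparr>)"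
  "Comp1 (Dual_W_Cat M t) = dual_wcomp M"
  "Id2 (Dual_W_Cat M t) = (\<lambda>F. \<lparr>dom2 = F, cod2 = F, comp2 = (\<lambda>x \<in> dpts (dom1 F). dcounit (cod1 F) (pmap F x))\<rparr>)"
  "VComp (Dual_W_Cat M t) = (\<lambda>\<beta> \<alpha>. \<lparr>dom2 = dom2 \<alpha>, cod2 = cod2 \<beta>,
     comp2 = (\<lambda>x \<in> dpts (dom1 (dom2 \<alpha>)). LUnit V (Unit V) \<cdot> (comp2 \<alpha> x \<star> comp2 \<beta> x)
       \<cdot> dcomul (cod1 (dom2 \<alpha>)) (pmap (dom2 \<alpha>) x, pmap (cod2 \<alpha>) x, pmap (cod2 \<beta>) x))\<rparr>)"
  "HComp (Dual_W_Cat M t) = (\<lambda>\<alpha> \<beta>. \<lparr>dom2 = dual_wcomp M (dom2 \<beta>) (dom2 \<alpha>), cod2 = dual_wcomp M (cod2 \<beta>) (cod2 \<alpha>),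
     comp2 = (\<lambda>x \<in> dpts (dom1 (dom2 \<alpha>)). LUnit V (Unit V)
       \<cdot> (comp2 \<beta> (pmap (dom2 \<alpha>) x) \<star> (comp2 \<alpha> x \<cdot> amap (cod2 \<beta>) (pmap (dom2 \<alpha>) x, pmap (cod2 \<alpha>) x)))
       \<cdot> dcomul (cod1 (dom2 \<beta>)) (pmap (dom2 \<beta>) (pmap (dom2 \<alpha>) x), pmap (cod2 \<beta>) (pmap (dom2 \<alpha>) x),
           pmap (cod2 \<beta>) (pmap (cod2 \<alpha>) x)))\<rparr>)"
  by (simp_all add: Dual_W_Cat_def Let_def)

lemma T0_cell: "is_wcat O.K A \<Longrightarrow> is_dual_wcat M (T0 A)"
  using T0_wcat[of A] O.wcat_ext[of A] by blast

lemma T1_wcomp: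
  assumes F: "F \<in> wfunctors O.K A B" and G: "G \<in> wfunctors O.K B C"
  shows "T1 (wcomp O.K G F) = dual_wcomp M (T1 G) (T1 F)"
proof (rule one_cell.equality)
  note [simp] = O.wfun_dom_cod[OF F] O.wfun_dom_cod[OF G] O.wfun_pt[OF F]
  show "pmap (T1 (wcomp O.K G F)) = pmap (dual_wcomp M (T1 G) (T1 F))"
    by (simp add: wcomp_def dual_wcomp_def Let_def)
  show "amap (T1 (wcomp O.K G F)) = amap (dual_wcomp M (T1 G) (T1 F))"
    by (rule extensionalityI[of _ "wpts A \<times> wpts A"]) (auto simp: T1_def dual_wcomp_def Let_def)
qed (simp_all add: dual_wcomp_def Let_def)

context
  fixes t :: "'x itself"
begin

lemma T_local_iso: "local_iso (W_Cat O.K t) (Dual_W_Cat M t) T0 T1 T2"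
proof (rule local_iso.intro, unfold O.W_Cat_sel(1-3,5) Dual_W_Cat_sel(1-3,5) mem_Collect_eq)
  show "is_wcat O.K A \<Longrightarrow> is_dual_wcat M (T0 A)" for A by (rule T0_cell)
  show "bij_betw T1 (wfunctors O.K A B) (dual_wfunctors M (T0 A) (T0 B))" for A B by (rule T1_bij)
next
  fix A B :: "('x, ('o, 'a) coalg, 'a) wcat" and F G
  assume A: "is_wcat O.K A" and B: "is_wcat O.K B" and F: "F \<in> wfunctors O.K A B" and G: "G \<in> wfunctors O.K A B"
  show "T2 ` wtransf O.K F G = dual_wtransf M (T1 F) (T1 G)"
  proof (intro equalityI subsetI)
    fix S assume "S \<in> T2 ` wtransf O.K F G"
    then obtain S' where S: "S' \<in> wtransf O.K F G" "S = T2 S'" by blast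
    then show "S \<in> dual_wtransf M (T1 F) (T1 G)"
      using T2_wtransf[OF A B F G, of S'] O.wtransf_dom_cod[OF S(1)] by blast
  next
    fix S assume S: "S \<in> dual_wtransf M (T1 F) (T1 G)"
    define S' where "S' = \<lparr>dom2 = F, cod2 = G, comp2 = comp2 S\<rparr>"
    have e: "S = T2 S'"
      by (rule two_cell.equality) (use S in \<open>simp_all add: S'_def dual_wtransf_def\<close>)
    have d: "dom2 S' = F" "cod2 S' = G" by (simp_all add: S'_def)
    have "S' \<in> wtransf O.K F G" using T2_wtransf[OF A B F G d] S unfolding e by blast
    then show "S \<in> T2 ` wtransf O.K F G" using e by blast
  qed
next
  fix A B :: "('x, ('o, 'a) coalg, 'a) wcat"
  show "inj_on T2 (\<Union>F \<in> wfunctors O.K A B. \<Union>G \<in> wfunctors O.K A B. wtransf O.K F G)"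
  proof (rule inj_onI)
    fix S T assume S: "S \<in> (\<Union>F \<in> wfunctors O.K A B. \<Union>G \<in> wfunctors O.K A B. wtransf O.K F G)"
      and T: "T \<in> (\<Union>F \<in> wfunctors O.K A B. \<Union>G \<in> wfunctors O.K A B. wtransf O.K F G)" and e: "T2 S = T2 T"
    have S': "dom2 S \<in> wfunctors O.K A B" "cod2 S \<in> wfunctors O.K A B" using S O.wtransf_dom_cod by blast+
    have T': "dom2 T \<in> wfunctors O.K A B" "cod2 T \<in> wfunctors O.K A B" using T O.wtransf_dom_cod by blast+
    note inj = inj_onD[OF bij_betw_imp_inj_on[OF T1_bij]]
    show "S = T"
    proof (rule two_cell.equality)
      show "dom2 S = dom2 T" using arg_cong[OF e, of dom2] by (intro inj[OF _ S'(1) T'(1)]) simp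
      show "cod2 S = cod2 T" using arg_cong[OF e, of cod2] by (intro inj[OF _ S'(2) T'(2)]) simp
      show "comp2 S = comp2 T" using arg_cong[OF e, of comp2] by simp
    qed simp
  qed
next
  fix A :: "('x, ('o, 'a) coalg, 'a) wcat"
  show "T1 (Id1 (W_Cat O.K t) A) = Id1 (Dual_W_Cat M t) (T0 A)"
  proof (rule one_cell.equality)
    show "amap (T1 (Id1 (W_Cat O.K t) A)) = amap (Id1 (Dual_W_Cat M t) (T0 A))"
      by (rule extensionalityI[of _ "wpts A \<times> wpts A"]) (auto simp: T1_def Dual_W_Cat_sel(4))
    show "pmap (T1 (Id1 (W_Cat O.K t) A)) = pmap (Id1 (Dual_W_Cat M t) (T0 A))"
      by (simp add: Dual_W_Cat_sel(4) O.W_Cat_sel(4))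
  qed (simp_all add: Dual_W_Cat_sel(4))
next
  fix A B C :: "('x, ('o, 'a) coalg, 'a) wcat" and F G
  assume "F \<in> wfunctors O.K A B" "G \<in> wfunctors O.K B C"
  then show "T1 (wcomp O.K G F) = dual_wcomp M (T1 G) (T1 F)" by (rule T1_wcomp)
next
  fix A B :: "('x, ('o, 'a) coalg, 'a) wcat" and F assume F: "F \<in> wfunctors O.K A B"
  show "T2 (Id2 (W_Cat O.K t) F) = Id2 (Dual_W_Cat M t) (T1 F)"
    by (rule two_cell.equality) (simp_all add: Dual_W_Cat_sel(6) O.W_Cat_sel(6))
next
  fix A B :: "('x, ('o, 'a) coalg, 'a) wcat" and F G H \<alpha> \<beta>
  assume A: "is_wcat O.K A" and B: "is_wcat O.K B" and F: "F \<in> wfunctors O.K A B"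
    and G: "G \<in> wfunctors O.K A B" and H: "H \<in> wfunctors O.K A B" and \<alpha>: "\<alpha> \<in> wtransf O.K F G" and \<beta>: "\<beta> \<in> wtransf O.K G H"
  note [simp] = A B O.wfun_dom_cod[OF F] O.wfun_dom_cod[OF G] O.wfun_dom_cod[OF H]
    O.wtransf_dom_cod[OF \<alpha>] O.wtransf_dom_cod[OF \<beta>] O.wfun_pt[OF F] O.wfun_pt[OF G] O.wfun_pt[OF H]
    O.wcat_ar[OF B, simplified oprev_sel O_ar]
    O.wf2_ar(6-8)[OF O.wf2I[OF A B F G \<alpha>], simplified O.wfun_dom_cod[OF F] O.wtransf_dom_cod[OF \<alpha>] oprev_sel O_ar]
    O.wf2_ar(6-8)[OF O.wf2I[OF A B G H \<beta>], simplified O.wfun_dom_cod[OF G] O.wtransf_dom_cod[OF \<beta>] oprev_sel O_ar]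
  show "T2 (VComp (W_Cat O.K t) \<beta> \<alpha>) = VComp (Dual_W_Cat M t) (T2 \<beta>) (T2 \<alpha>)"
  proof (rule two_cell.equality)
    show "comp2 (T2 (VComp (W_Cat O.K t) \<beta> \<alpha>)) = comp2 (VComp (Dual_W_Cat M t) (T2 \<beta>) (T2 \<alpha>))"
    proof (rule extensionalityI[of _ "wpts A"])
      fix x assume [simp]: "x \<in> wpts A"
      show "comp2 (T2 (VComp (W_Cat O.K t) \<beta> \<alpha>)) x = comp2 (VComp (Dual_W_Cat M t) (T2 \<beta>) (T2 \<alpha>)) x"
        \<comment> \<open>\<open>O.lact\<close> contains the right unit isomorphism of
          \<open>V\<close>, the dual composition the left one; they agree at the unit
          object.\<close>
        by (simp add: Dual_W_Cat_sel(7) O.lact_def LUnit_Unit)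
    qed (simp_all add: Dual_W_Cat_sel(7) O.W_Cat_sel(7))
  qed (simp_all add: Dual_W_Cat_sel(7))
next
  fix A B C :: "('x, ('o, 'a) coalg, 'a) wcat" and F F' G G' \<alpha> \<beta>
  assume A: "is_wcat O.K A" and B: "is_wcat O.K B" and C: "is_wcat O.K C"
    and F: "F \<in> wfunctors O.K A B" and F': "F' \<in> wfunctors O.K A B"
    and G: "G \<in> wfunctors O.K B C" and G': "G' \<in> wfunctors O.K B C"
    and \<alpha>: "\<alpha> \<in> wtransf O.K F F'" and \<beta>: "\<beta> \<in> wtransf O.K G G'"
  note [simp] = A B C O.wfun_dom_cod[OF F] O.wfun_dom_cod[OF G] O.wfun_dom_cod[OF F'] O.wfun_dom_cod[OF G']
    O.wtransf_dom_cod[OF \<alpha>] O.wtransf_dom_cod[OF \<beta>] O.wfun_pt[OF F] O.wfun_pt[OF G] O.wfun_pt[OF F'] O.wfun_pt[OF G']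
    O.wcat_ar[OF C, simplified oprev_sel O_ar]
    O.wf1_ar(4-6)[OF O.wf1I[OF B C G'], simplified O.wfun_dom_cod[OF G'] oprev_sel O_ar]
    O.wf2_ar(6-8)[OF O.wf2I[OF A B F F' \<alpha>], simplified O.wfun_dom_cod[OF F] O.wtransf_dom_cod[OF \<alpha>] oprev_sel O_ar]
    O.wf2_ar(6-8)[OF O.wf2I[OF B C G G' \<beta>], simplified O.wfun_dom_cod[OF G] O.wtransf_dom_cod[OF \<beta>] oprev_sel O_ar]
  show "T2 (HComp (W_Cat O.K t) \<alpha> \<beta>) = HComp (Dual_W_Cat M t) (T2 \<alpha>) (T2 \<beta>)"
  proof (rule two_cell.equality)
    show "dom2 (T2 (HComp (W_Cat O.K t) \<alpha> \<beta>)) = dom2 (HComp (Dual_W_Cat M t) (T2 \<alpha>) (T2 \<beta>))"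
      using T1_wcomp[OF F G] by (simp add: Dual_W_Cat_sel(8))
    show "cod2 (T2 (HComp (W_Cat O.K t) \<alpha> \<beta>)) = cod2 (HComp (Dual_W_Cat M t) (T2 \<alpha>) (T2 \<beta>))"
      using T1_wcomp[OF F' G'] by (simp add: Dual_W_Cat_sel(8))
    show "comp2 (T2 (HComp (W_Cat O.K t) \<alpha> \<beta>)) = comp2 (HComp (Dual_W_Cat M t) (T2 \<alpha>) (T2 \<beta>))"
    proof (rule extensionalityI[of _ "wpts A"])
      fix x assume [simp]: "x \<in> wpts A"
      show "comp2 (T2 (HComp (W_Cat O.K t) \<alpha> \<beta>)) x = comp2 (HComp (Dual_W_Cat M t) (T2 \<alpha>) (T2 \<beta>)) x"
        by (simp add: Dual_W_Cat_sel(8) O.lact_def LUnit_Unit)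
    qed (simp_all add: Dual_W_Cat_sel(8) O.W_Cat_sel(8))
  qed simp
qed

text \<open>The axioms are transported from the categories enriched in
  \<open>coalgebras (oprev V)\<close>, which is possible because \<open>T0\<close> is onto.\<close>

lemma two_category_Dual_W_Cat: "two_category (Dual_W_Cat M t)"
  by (rule two_category_transport[OF O.two_category_W_Cat T_local_iso])
    (use T0_surj in \<open>auto simp: O.W_Cat_sel(1) Dual_W_Cat_sel(1)\<close>)

end

end

text \<open>A dual category is literally some \<open>T0 C\<close>, so only \<open>C\<close> has to
  be reached up to equivalence by the change of base; the second 2-functor then carries this
  equivalence to the dual side.\<close>

theorem biequivalence_W_Cat_Dual_W_Cat:
  fixes t :: "'x itself"
  assumes V: "oprev_symmon V dm cd" and F: "symfun V dm cd (oprev V) cd dm F0 F1 \<nu> \<mu> \<kappa> \<iota>"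
  shows "\<exists>P. biequivalence (W_Cat (coalgebras V) t) (Dual_W_Cat (algebras V) t) P"
proof -
  interpret F: symfun V dm cd "oprev V" cd dm F0 F1 \<nu> \<mu> \<kappa> \<iota> by (rule F)
  interpret D: oprev_symmon V dm cd by (rule V)
  note T = D.T_local_iso[of t]
  note P = local_iso_comp[OF F.Fw_local_iso[of t] T]
  have "\<exists>A \<in> Cell0 (W_Cat (coalgebras V) t). equivalent_0cells (Dual_W_Cat (algebras V) t) ((D.T0 \<circ> F.Fw0) A) Z"
    if Z: "Z \<in> Cell0 (Dual_W_Cat (algebras V) t)" for Z
  proof -
    obtain C where C: "is_wcat F.V'.K C" "D.T0 C = Z"
      using Z D.T0_surj[of Z] by (auto simp: D.Dual_W_Cat_sel(1))
    obtain A where A: "is_wcat F.V.K A" "equivalent_0cells (W_Cat F.V'.K t) (F.Fw0 A) C"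
      using F.Fw_ess_surj[OF C(1), of t] by blast
    have "equivalent_0cells (Dual_W_Cat (algebras V) t) (D.T0 (F.Fw0 A)) (D.T0 C)"
      by (rule local_iso_equivalent[OF F.V'.two_category_W_Cat T _ _ A(2)])
        (use F.Fw0_cell[OF A(1)] C(1) in \<open>simp_all add: F.V'.W_Cat_sel(1)\<close>)
    then show ?thesis using A(1) C(2) by (auto simp: F.V.W_Cat_sel(1))
  qed
  then show ?thesis
    using local_iso_biequivalence[OF F.V.two_category_W_Cat D.two_category_Dual_W_Cat P] by blast
qed

section \<open>Tensor products of modules\<close>

text \<open>Unlike \<open>mod_homs\<close>, this leaves the values off the carrier free and lets
  source and target have carriers in different types, as needed for functionals into the ring and
  for modules of functions.\<close>

definition lin :: "('r, 'e) ring_scheme \<Rightarrow> ('r, 'm) module \<Rightarrow> ('r, 'p) module \<Rightarrow> ('m \<Rightarrow> 'p) \<Rightarrow> bool" where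
  "lin R M P h \<longleftrightarrow> h \<in> carrier M \<rightarrow> carrier P \<and>
     (\<forall>x \<in> carrier M. \<forall>y \<in> carrier M. h (x \<oplus>\<^bsub>M\<^esub> y) = h x \<oplus>\<^bsub>P\<^esub> h y) \<and>
     (\<forall>r \<in> carrier R. \<forall>x \<in> carrier M. h (r \<odot>\<^bsub>M\<^esub> x) = r \<odot>\<^bsub>P\<^esub> h x)"

lemma linI:
  assumes "\<And>x. x \<in> carrier M \<Longrightarrow> h x \<in> carrier P"
    and "\<And>x y. \<lbrakk>x \<in> carrier M; y \<in> carrier M\<rbrakk> \<Longrightarrow> h (x \<oplus>\<^bsub>M\<^esub> y) = h x \<oplus>\<^bsub>P\<^esub> h y"
    and "\<And>r x. \<lbrakk>r \<in> carrier R; x \<in> carrier M\<rbrakk> \<Longrightarrow> h (r \<odot>\<^bsub>M\<^esub> x) = r \<odot>\<^bsub>P\<^esub> h x"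
  shows "lin R M P h"
  using assms by (auto simp: lin_def)

lemma linD:
  assumes "lin R M P h"
  shows lin_closed: "x \<in> carrier M \<Longrightarrow> h x \<in> carrier P"
    and lin_add: "\<lbrakk>x \<in> carrier M; y \<in> carrier M\<rbrakk> \<Longrightarrow> h (x \<oplus>\<^bsub>M\<^esub> y) = h x \<oplus>\<^bsub>P\<^esub> h y"
    and lin_smult: "\<lbrakk>r \<in> carrier R; x \<in> carrier M\<rbrakk> \<Longrightarrow> h (r \<odot>\<^bsub>M\<^esub> x) = r \<odot>\<^bsub>P\<^esub> h x"
  using assms by (auto simp: lin_def)

lemma mod_homs_iff: "h \<in> mod_homs R M N \<longleftrightarrow> lin R M N h \<and> h \<in> extensional (carrier M)"
  by (auto simp: mod_homs_def lin_def PiE_def)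

lemma lin_zero:
  assumes "module R M" "module R P" "lin R M P h"
  shows "h \<zero>\<^bsub>M\<^esub> = \<zero>\<^bsub>P\<^esub>"
proof -
  interpret M: module R M by fact
  interpret P: module R P by fact
  have "h \<zero>\<^bsub>M\<^esub> = h (\<zero>\<^bsub>R\<^esub> \<odot>\<^bsub>M\<^esub> \<zero>\<^bsub>M\<^esub>)" by simp
  also have "\<dots> = \<zero>\<^bsub>R\<^esub> \<odot>\<^bsub>P\<^esub> h \<zero>\<^bsub>M\<^esub>" by (rule lin_smult[OF assms(3)]) simp_all
  also have "\<dots> = \<zero>\<^bsub>P\<^esub>" using lin_closed[OF assms(3)] by simp
  finally show ?thesis .
qed

lemma lin_finsum:
  assumes "module R M" "module R P" "lin R M P h" "finite I" "f \<in> I \<rightarrow> carrier M"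
  shows "h (\<Oplus>\<^bsub>M\<^esub>i \<in> I. f i) = (\<Oplus>\<^bsub>P\<^esub>i \<in> I. h (f i))"
proof -
  interpret M: module R M by fact
  interpret P: module R P by fact
  from assms(4,5) show ?thesis
  proof (induction I)
    case empty then show ?case using lin_zero[OF assms(1-3)] by simp
  next
    case (insert i I)
    then have f: "f \<in> I \<rightarrow> carrier M" "f i \<in> carrier M" "(\<lambda>i. h (f i)) \<in> I \<rightarrow> carrier P" "h (f i) \<in> carrier P"
      using lin_closed[OF assms(3)] by (auto simp: Pi_iff)
    then show ?case using insert f lin_add[OF assms(3)] by (simp add: M.finsum_closed)
  qed
qed

lemma lin_comp: "\<lbrakk>lin R M N f; lin R N P g\<rbrakk> \<Longrightarrow> lin R M P (\<lambda>x. g (f x))"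
  by (auto simp: lin_def Pi_iff)

lemma lin_cong: "\<lbrakk>module R M; lin R M P f; \<And>x. x \<in> carrier M \<Longrightarrow> f x = g x\<rbrakk> \<Longrightarrow> lin R M P g"
proof -
  assume M: "module R M" and f: "lin R M P f" and eq: "\<And>x. x \<in> carrier M \<Longrightarrow> f x = g x"
  interpret M: module R M by fact
  show ?thesis
  proof (rule linI)
    show "g x \<in> carrier P" if "x \<in> carrier M" for x using linD(1)[OF f that] eq[OF that] by simp
    show "g (x \<oplus>\<^bsub>M\<^esub> y) = g x \<oplus>\<^bsub>P\<^esub> g y" if "x \<in> carrier M" "y \<in> carrier M" for x y
      using linD(2)[OF f that] eq that by simp
    show "g (r \<odot>\<^bsub>M\<^esub> x) = r \<odot>\<^bsub>P\<^esub> g x" if "r \<in> carrier R" "x \<in> carrier M" for r x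
      using linD(3)[OF f that] eq that by simp
  qed
qed

lemma module_left_commute:
  assumes "module R M" "r \<in> carrier R" "s \<in> carrier R" "x \<in> carrier M"
  shows "r \<odot>\<^bsub>M\<^esub> (s \<odot>\<^bsub>M\<^esub> x) = s \<odot>\<^bsub>M\<^esub> (r \<odot>\<^bsub>M\<^esub> x)"
proof -
  interpret M: module R M by fact
  show ?thesis using assms by (simp add: M.m_comm flip: M.smult_assoc1)
qed

lemma lin_smult_map:
  assumes "module R M" "module R P" "lin R M P h" "r \<in> carrier R"
  shows "lin R M P (\<lambda>x. r \<odot>\<^bsub>P\<^esub> h x)"
proof -
  interpret M: module R M by fact
  interpret P: module R P by fact
  show ?thesis using assms(4) linD[OF assms(3)]
    by (intro linI) (simp_all add: P.smult_r_distr module_left_commute[OF assms(2)])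
qed

lemma lin_finsum_map:
  assumes "module R M" "module R P" "finite I" "\<And>i. i \<in> I \<Longrightarrow> lin R M P (h i)"
  shows "lin R M P (\<lambda>x. \<Oplus>\<^bsub>P\<^esub>i \<in> I. h i x)"
proof -
  interpret M: module R M by fact
  interpret P: module R P by fact
  have c: "(\<lambda>i. h i x) \<in> I \<rightarrow> carrier P" if "x \<in> carrier M" for x using lin_closed[OF assms(4)] that by auto
  show ?thesis
  proof (rule linI)
    show "(\<Oplus>\<^bsub>P\<^esub>i \<in> I. h i x) \<in> carrier P" if "x \<in> carrier M" for x by (rule P.finsum_closed[OF c[OF that]])
    show "(\<Oplus>\<^bsub>P\<^esub>i \<in> I. h i (x \<oplus>\<^bsub>M\<^esub> y)) = (\<Oplus>\<^bsub>P\<^esub>i \<in> I. h i x) \<oplus>\<^bsub>P\<^esub> (\<Oplus>\<^bsub>P\<^esub>i \<in> I. h i y)"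
      if "x \<in> carrier M" "y \<in> carrier M" for x y
      unfolding P.finsum_addf[OF c[OF that(1)] c[OF that(2)], symmetric]
      by (rule P.finsum_cong') (use lin_add[OF assms(4)] that lin_closed[OF assms(4)] in auto)
    show "(\<Oplus>\<^bsub>P\<^esub>i \<in> I. h i (r \<odot>\<^bsub>M\<^esub> x)) = r \<odot>\<^bsub>P\<^esub> (\<Oplus>\<^bsub>P\<^esub>i \<in> I. h i x)"
      if "r \<in> carrier R" "x \<in> carrier M" for r x
      unfolding P.finsum_smult_ldistr[OF assms(3) that(1) c[OF that(2)]]
      by (rule P.finsum_cong') (use lin_smult[OF assms(4)] that lin_closed[OF assms(4)] in auto)
  qed
qed

definition bilin :: "('r, 'e) ring_scheme \<Rightarrow> ('r, 'm) module \<Rightarrow> ('r, 'n) module \<Rightarrow> ('r, 'p) module \<Rightarrow>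
    ('m \<Rightarrow> 'n \<Rightarrow> 'p) \<Rightarrow> bool" where
  "bilin R M N P b \<longleftrightarrow> (\<forall>n \<in> carrier N. lin R M P (\<lambda>m. b m n)) \<and> (\<forall>m \<in> carrier M. lin R N P (b m))"

lemma bilinI:
  "\<lbrakk>\<And>n. n \<in> carrier N \<Longrightarrow> lin R M P (\<lambda>m. b m n); \<And>m. m \<in> carrier M \<Longrightarrow> lin R N P (b m)\<rbrakk> \<Longrightarrow> bilin R M N P b"
  by (simp add: bilin_def)

lemma bilinD:
  assumes "bilin R M N P b"
  shows "n \<in> carrier N \<Longrightarrow> lin R M P (\<lambda>m. b m n)" "m \<in> carrier M \<Longrightarrow> lin R N P (b m)"
  using assms by (auto simp: bilin_def)

locale module_universe = cring R for R :: "('r, 'e) ring_scheme" (structure) +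
  fixes sc :: "'r \<Rightarrow> 'u" and fs :: "('u \<times> 'u) multiset \<Rightarrow> 'u"
  assumes inj_sc: "inj sc" and inj_fs: "inj fs"
begin

abbreviation T :: "('r, 'u) module \<Rightarrow> ('r, 'u) module \<Rightarrow> ('r, 'u) module" where "T \<equiv> tensor_module R fs"
abbreviation tn :: "('r, 'u) module \<Rightarrow> ('r, 'u) module \<Rightarrow> 'u \<Rightarrow> 'u \<Rightarrow> 'u" where "tn \<equiv> pure_tensor R fs"

section \<open>The tensor product as a module\<close>

context
  fixes M N :: "('r, 'u) module"
  assumes M: "module R M" and N: "module R N"
begin

interpretation M: module R M by (rule M)
interpretation N: module R N by (rule N)

abbreviation (input) step where "step \<equiv> tensor_step R M N"
abbreviation (input) eqv where "eqv \<equiv> equivclp (tensor_step R M N)"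
abbreviation (input) val where "val s \<equiv> set_mset s \<subseteq> carrier M \<times> carrier N"
abbreviation (input) cl where "cl \<equiv> tensor_class R fs M N"
abbreviation (input) sm where "sm r s \<equiv> image_mset (\<lambda>(m, n). (r \<odot>\<^bsub>M\<^esub> m, n)) s"

lemma step_add: "step s s' \<Longrightarrow> step (s + u) (s' + u)"
  by (induction rule: tensor_step.induct) (simp_all add: tensor_step.intros)

lemma step_sm: "step s s' \<Longrightarrow> r \<in> carrier R \<Longrightarrow> step (sm r s) (sm r s')"
proof (induction rule: tensor_step.induct)
  case (balanced a m n s)
  then show ?case using tensor_step.balanced[of a R "r \<odot>\<^bsub>M\<^esub> m" M n N "sm r s"]
    by (simp add: module_left_commute[OF M, of r a])
qed (simp_all add: tensor_step.intros M.smult_r_distr)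

lemma eqv_mono:
  assumes "eqv s s'" and "\<And>s s'. step s s' \<Longrightarrow> eqv (f s) (f s')"
  shows "eqv (f s) (f s')"
  using assms(1)
proof (induction rule: equivclp_induct)
  case (step y z)
  then have "eqv (f y) (f z)" using assms(2) equivclp_sym[of step "f z" "f y"] by blast
  with step.IH show ?case by (rule equivclp_trans)
qed simp

lemma eqv_add: "eqv s s' \<Longrightarrow> eqv u u' \<Longrightarrow> eqv (s + u) (s' + u')"
proof -
  assume a: "eqv s s'" and b: "eqv u u'"
  have "eqv (s + u) (s' + u)" by (rule eqv_mono[OF a]) (use step_add r_into_equivclp in blast)
  moreover have "eqv (u + s') (u' + s')" by (rule eqv_mono[OF b]) (use step_add r_into_equivclp in blast)
  then have "eqv (s' + u) (s' + u')" by (simp add: add.commute)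
  ultimately show ?thesis by (rule equivclp_trans)
qed

lemma eqv_sm: "eqv s s' \<Longrightarrow> r \<in> carrier R \<Longrightarrow> eqv (sm r s) (sm r s')"
  by (erule eqv_mono) (use step_sm r_into_equivclp in blast)

text \<open>Congruent sums have the same congruence class, hence the same chosen member. Conversely
  a chosen member is congruent to the sum it stands for, and \<open>fs\<close> is injective.\<close>

lemma cl_eq: "cl s = cl s' \<longleftrightarrow> eqv s s'"
proof
  have e: "eqv s (SOME t. eqv s t)" for s by (rule someI[of _ s]) simp
  assume "cl s = cl s'"
  then have "(SOME t. eqv s t) = (SOME t. eqv s' t)" using inj_fs by (simp add: tensor_class_def inj_eq)
  with e[of s] have "eqv s (SOME t. eqv s' t)" by simp
  then show "eqv s s'" by (rule equivclp_trans[OF _ equivclp_sym[OF e[of s']]])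
next
  assume a: "eqv s s'"
  have "eqv s = eqv s'"
    by (intro ext iffI) (rule equivclp_trans[OF equivclp_sym[OF a]], assumption, rule equivclp_trans[OF a], assumption)
  then show "cl s = cl s'" by (simp add: tensor_class_def)
qed

lemma cl_rep: "eqv s (inv_into UNIV fs (cl s))"
proof -
  have "eqv s (SOME t. eqv s t)" by (rule someI[of _ s]) simp
  then show ?thesis using inj_fs by (simp add: tensor_class_def)
qed

lemma T_carrier: "x \<in> carrier (T M N) \<longleftrightarrow> (\<exists>s. val s \<and> x = cl s)"
  by (auto simp: tensor_module_def)

lemma T_cases:
  assumes "x \<in> carrier (T M N)"
  obtains s where "val s" "x = cl s"
  using assms by (auto simp: tensor_module_def)

lemma T_zero: "\<zero>\<^bsub>T M N\<^esub> = cl {#}"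
  by (simp add: tensor_module_def)

lemma T_add: "cl s \<oplus>\<^bsub>T M N\<^esub> cl u = cl (s + u)"
  using iffD2[OF cl_eq eqv_add[OF cl_rep[of s] cl_rep[of u]]] by (simp add: tensor_module_def)

lemma T_smult: "r \<in> carrier R \<Longrightarrow> r \<odot>\<^bsub>T M N\<^esub> cl s = cl (sm r s)"
  using iffD2[OF cl_eq eqv_sm[OF cl_rep[of s]]] by (simp add: tensor_module_def)

lemma step_eqv: "step s s' \<Longrightarrow> eqv s s'"
  by (rule r_into_equivclp)

lemma val_sm: "val s \<Longrightarrow> r \<in> carrier R \<Longrightarrow> val (sm r s)"
  by fastforce

text \<open>Formal sums have no negatives. Together with \<open>eqv_sm_zero\<close> this makes the
  class of the sum scaled by \<open>\<ominus> \<one>\<close> an additive inverse.\<close>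

lemma eqv_sm_add: "val s \<Longrightarrow> a \<in> carrier R \<Longrightarrow> b \<in> carrier R \<Longrightarrow> eqv (sm (a \<oplus> b) s) (sm a s + sm b s)"
proof (induction s)
  case (add p s)
  obtain m n where p: "p = (m, n)" "m \<in> carrier M" "n \<in> carrier N" using add.prems by (cases p) auto
  have "eqv {#((a \<oplus> b) \<odot>\<^bsub>M\<^esub> m, n)#} {#(a \<odot>\<^bsub>M\<^esub> m, n), (b \<odot>\<^bsub>M\<^esub> m, n)#}"
    using tensor_step.add_left[of "a \<odot>\<^bsub>M\<^esub> m" M "b \<odot>\<^bsub>M\<^esub> m" n N R "{#}"] p add.prems
    by (intro step_eqv) (simp add: M.smult_l_distr)
  from eqv_add[OF this add.IH] show ?case using add.prems p by (simp add: add_mset_commute)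
qed simp

lemma eqv_sm_zero: "val s \<Longrightarrow> eqv (sm \<zero> s) {#}"
proof (induction s)
  case (add p s)
  obtain m n where p: "p = (m, n)" "m \<in> carrier M" "n \<in> carrier N" using add.prems by (cases p) auto
  have "eqv {#(\<zero>\<^bsub>M\<^esub>, n)#} {#}" using tensor_step.zero_left[of n N R M "{#}"] p by (intro step_eqv)
  from eqv_add[OF this add.IH] show ?case using add.prems p by simp
qed simp

lemma sm_one: "val s \<Longrightarrow> sm \<one> s = s"
proof -
  assume "val s"
  then have "sm \<one> s = image_mset (\<lambda>p. p) s" by (intro image_mset_cong) auto
  then show ?thesis by simp
qed

lemma T_module: "module R (T M N)"
proof (rule moduleI)
  show "cring R" by unfold_locales
  show "abelian_group (T M N)"
  proof (rule abelian_groupI)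
    fix x y z assume "x \<in> carrier (T M N)" "y \<in> carrier (T M N)" "z \<in> carrier (T M N)"
    then obtain s u v where s: "val s" "x = cl s" and u: "val u" "y = cl u" and v: "val v" "z = cl v"
      by (auto simp: T_carrier)
    show "x \<oplus>\<^bsub>T M N\<^esub> y \<oplus>\<^bsub>T M N\<^esub> z = x \<oplus>\<^bsub>T M N\<^esub> (y \<oplus>\<^bsub>T M N\<^esub> z)"
      by (simp add: s u v T_add add.assoc)
  next
    fix x y assume "x \<in> carrier (T M N)" "y \<in> carrier (T M N)"
    then obtain s u where s: "val s" "x = cl s" and u: "val u" "y = cl u" by (auto simp: T_carrier)
    show "x \<oplus>\<^bsub>T M N\<^esub> y \<in> carrier (T M N)"
      unfolding s u T_add T_carrier by (rule exI[of _ "s + u"]) (use s u in auto)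
    show "x \<oplus>\<^bsub>T M N\<^esub> y = y \<oplus>\<^bsub>T M N\<^esub> x" by (simp add: s u T_add add.commute)
  next
    show "\<zero>\<^bsub>T M N\<^esub> \<in> carrier (T M N)" unfolding T_zero T_carrier by (rule exI[of _ "{#}"]) simp
  next
    fix x assume "x \<in> carrier (T M N)"
    then obtain s where s: "val s" "x = cl s" by (auto simp: T_carrier)
    show "\<zero>\<^bsub>T M N\<^esub> \<oplus>\<^bsub>T M N\<^esub> x = x" by (simp add: s T_add T_zero)
    have "eqv (sm (\<ominus> \<one>) s + sm \<one> s) {#}"
      using equivclp_trans[OF equivclp_sym[OF eqv_sm_add[OF s(1), of "\<ominus> \<one>" \<one>]], of "{#}"] eqv_sm_zero[OF s(1)]
      by (simp add: l_neg)
    then have "cl (sm (\<ominus> \<one>) s) \<oplus>\<^bsub>T M N\<^esub> x = \<zero>\<^bsub>T M N\<^esub>" using cl_eq by (simp add: s T_add T_zero sm_one)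
    moreover have "cl (sm (\<ominus> \<one>) s) \<in> carrier (T M N)" unfolding T_carrier using val_sm[OF s(1), of "\<ominus> \<one>"] by blast
    ultimately show "\<exists>y \<in> carrier (T M N). y \<oplus>\<^bsub>T M N\<^esub> x = \<zero>\<^bsub>T M N\<^esub>" by blast
  qed
next
  fix a x assume a: "a \<in> carrier R" and "x \<in> carrier (T M N)"
  then obtain s where s: "val s" "x = cl s" by (auto simp: T_carrier)
  show "a \<odot>\<^bsub>T M N\<^esub> x \<in> carrier (T M N)" unfolding s T_smult[OF a] T_carrier using val_sm[OF s(1) a] by blast
next
  fix a b x assume a: "a \<in> carrier R" "b \<in> carrier R" and "x \<in> carrier (T M N)"
  then obtain s where s: "val s" "x = cl s" by (auto simp: T_carrier)
  show "(a \<oplus> b) \<odot>\<^bsub>T M N\<^esub> x = a \<odot>\<^bsub>T M N\<^esub> x \<oplus>\<^bsub>T M N\<^esub> b \<odot>\<^bsub>T M N\<^esub> x"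
    using a eqv_sm_add[OF s(1)] cl_eq by (simp add: s T_smult T_add)
  have "sm (a \<otimes> b) s = sm a (sm b s)"
    unfolding multiset.map_comp by (rule image_mset_cong) (use s a in \<open>auto simp: M.smult_assoc1\<close>)
  then show "a \<otimes> b \<odot>\<^bsub>T M N\<^esub> x = a \<odot>\<^bsub>T M N\<^esub> (b \<odot>\<^bsub>T M N\<^esub> x)" using a by (simp add: s T_smult)
next
  fix a x y assume a: "a \<in> carrier R" and "x \<in> carrier (T M N)" "y \<in> carrier (T M N)"
  then obtain s u where s: "val s" "x = cl s" and u: "val u" "y = cl u" by (auto simp: T_carrier)
  show "a \<odot>\<^bsub>T M N\<^esub> (x \<oplus>\<^bsub>T M N\<^esub> y) = a \<odot>\<^bsub>T M N\<^esub> x \<oplus>\<^bsub>T M N\<^esub> a \<odot>\<^bsub>T M N\<^esub> y"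
    using a by (simp add: s u T_smult T_add)
next
  fix x assume "x \<in> carrier (T M N)"
  then obtain s where s: "val s" "x = cl s" by (auto simp: T_carrier)
  show "\<one> \<odot>\<^bsub>T M N\<^esub> x = x" by (simp add: s T_smult sm_one)
qed

lemma tn_bilin: "bilin R M N (T M N) (tn M N)"
proof (rule bilinI)
  have cl1: "cl {#(m, n)#} \<in> carrier (T M N)" if "m \<in> carrier M" "n \<in> carrier N" for m n
    unfolding T_carrier by (rule exI[of _ "{#(m, n)#}"]) (use that in simp)
  fix n assume n: "n \<in> carrier N"
  show "lin R M (T M N) (\<lambda>m. tn M N m n)" unfolding pure_tensor_def
  proof (rule linI)
    fix m m' assume m: "m \<in> carrier M" "m' \<in> carrier M"
    show "cl {#(m \<oplus>\<^bsub>M\<^esub> m', n)#} = cl {#(m, n)#} \<oplus>\<^bsub>T M N\<^esub> cl {#(m', n)#}"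
      unfolding T_add cl_eq using tensor_step.add_left[OF m n, of R "{#}"] by (intro step_eqv) (simp add: add_mset_commute)
  qed (use n in \<open>simp_all add: cl1 T_smult\<close>)
next
  have cl1: "cl {#(m, n)#} \<in> carrier (T M N)" if "m \<in> carrier M" "n \<in> carrier N" for m n
    unfolding T_carrier by (rule exI[of _ "{#(m, n)#}"]) (use that in simp)
  fix m assume m: "m \<in> carrier M"
  show "lin R N (T M N) (tn M N m)" unfolding pure_tensor_def
  proof (rule linI)
    fix n n' assume n: "n \<in> carrier N" "n' \<in> carrier N"
    show "cl {#(m, n \<oplus>\<^bsub>N\<^esub> n')#} = cl {#(m, n)#} \<oplus>\<^bsub>T M N\<^esub> cl {#(m, n')#}"
      unfolding T_add cl_eq using tensor_step.add_right[OF m n, of R "{#}"] by (intro step_eqv) (simp add: add_mset_commute)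
  next
    fix r n assume n: "r \<in> carrier R" "n \<in> carrier N"
    have "cl {#(r \<odot>\<^bsub>M\<^esub> m, n)#} = cl {#(m, r \<odot>\<^bsub>N\<^esub> n)#}"
      unfolding cl_eq using tensor_step.balanced[OF n(1) m n(2), of "{#}"] by (intro step_eqv) simp
    then show "cl {#(m, r \<odot>\<^bsub>N\<^esub> n)#} = r \<odot>\<^bsub>T M N\<^esub> cl {#(m, n)#}" using n by (simp add: T_smult)
  qed (use m in \<open>simp_all add: cl1\<close>)
qed

text \<open>The empty formal sum represents the pure tensor of two zeros, and scalars can be
  absorbed into one factor; so every tensor is a nonempty sum of pure tensors.\<close>

lemma tensor_induct [consumes 1, case_names pure add]:
  assumes "x \<in> carrier (T M N)"
    and pure: "\<And>m n. \<lbrakk>m \<in> carrier M; n \<in> carrier N\<rbrakk> \<Longrightarrow> P (tn M N m n)"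
    and add: "\<And>x y. \<lbrakk>x \<in> carrier (T M N); y \<in> carrier (T M N); P x; P y\<rbrakk> \<Longrightarrow> P (x \<oplus>\<^bsub>T M N\<^esub> y)"
  shows "P x"
proof -
  obtain s where s: "val s" "x = cl s" using assms(1) by (auto simp: T_carrier)
  have "P (cl s)" using s(1)
  proof (induction s)
    case empty
    have "cl {#(\<zero>\<^bsub>M\<^esub>, \<zero>\<^bsub>N\<^esub>)#} = cl {#}"
      unfolding cl_eq by (rule step_eqv, rule tensor_step.zero_left) simp
    then show ?case using pure[of "\<zero>\<^bsub>M\<^esub>" "\<zero>\<^bsub>N\<^esub>"] by (simp add: pure_tensor_def)
  next
    case (add p s)
    obtain m n where p: "p = (m, n)" "m \<in> carrier M" "n \<in> carrier N" using add.prems by (cases p) auto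
    have "cl {#p#} \<in> carrier (T M N)" "cl s \<in> carrier (T M N)" using add.prems unfolding T_carrier
      by (metis p(1) p(2,3) SigmaI empty_subsetI insert_subset set_mset_single, auto)
    then have "P (cl {#p#} \<oplus>\<^bsub>T M N\<^esub> cl s)"
      using assms(3) pure[OF p(2,3)] add by (simp add: pure_tensor_def p)
    then show ?case by (simp add: T_add)
  qed
  then show ?thesis using s by simp
qed

section \<open>The universal property of the tensor product\<close>

context
  fixes P :: "('r, 'p) module" and b
  assumes P: "module R P" and b: "bilin R M N P b"
begin

interpretation P: module R P by (rule P)

text \<open>The conditions make the folded function left-commutative on the whole type.\<close>

definition msum :: "('u \<times> 'u) multiset \<Rightarrow> 'p" where
  "msum = fold_mset (\<lambda>p z. if p \<in> carrier M \<times> carrier N \<and> z \<in> carrier P then b (fst p) (snd p) \<oplus>\<^bsub>P\<^esub> z else z) \<zero>\<^bsub>P\<^esub>"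

lemma b_closed: "\<lbrakk>m \<in> carrier M; n \<in> carrier N\<rbrakk> \<Longrightarrow> b m n \<in> carrier P"
  using bilinD(2)[OF b] lin_closed by metis

lemma msum_add: "msum (add_mset p s)
    = (if p \<in> carrier M \<times> carrier N \<and> msum s \<in> carrier P then b (fst p) (snd p) \<oplus>\<^bsub>P\<^esub> msum s else msum s)"
proof -
  interpret comp_fun_commute "\<lambda>p z. if p \<in> carrier M \<times> carrier N \<and> z \<in> carrier P then b (fst p) (snd p) \<oplus>\<^bsub>P\<^esub> z else z"
    by unfold_locales (auto simp: fun_eq_iff b_closed P.a_lcomm)
  show ?thesis by (simp add: msum_def)
qed

lemma msum_empty [simp]: "msum {#} = \<zero>\<^bsub>P\<^esub>"
  by (simp add: msum_def)

lemma msum_closed [simp]: "msum s \<in> carrier P"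
  by (induction s) (auto simp: msum_add b_closed)

lemma msum_pair [simp]: "\<lbrakk>m \<in> carrier M; n \<in> carrier N\<rbrakk> \<Longrightarrow> msum (add_mset (m, n) s) = b m n \<oplus>\<^bsub>P\<^esub> msum s"
  by (simp add: msum_add)

lemma msum_union: "msum (s + u) = msum s \<oplus>\<^bsub>P\<^esub> msum u"
  by (induction s) (auto simp: msum_add b_closed P.a_assoc)

lemma msum_sm: "val s \<Longrightarrow> r \<in> carrier R \<Longrightarrow> msum (sm r s) = r \<odot>\<^bsub>P\<^esub> msum s"
proof (induction s)
  case (add p s)
  obtain m n where p: "p = (m, n)" "m \<in> carrier M" "n \<in> carrier N" using add.prems by (cases p) auto
  then show ?case using add lin_smult[OF bilinD(1)[OF b p(3)] _ p(2)] by (simp add: P.smult_r_distr b_closed)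
qed simp

lemma msum_step: "step s s' \<Longrightarrow> msum s = msum s'"
proof (induction rule: tensor_step.induct)
  case (add_left m m' n s)
  then show ?case using lin_add[OF bilinD(1)[OF b]] by (simp add: b_closed P.a_assoc)
next
  case (add_right m n n' s)
  then show ?case using lin_add[OF bilinD(2)[OF b]] by (simp add: b_closed P.a_assoc)
next
  case (balanced r m n s)
  then show ?case using lin_smult[OF bilinD(2)[OF b]] lin_smult[OF bilinD(1)[OF b]] by simp
next
  case (zero_left n s)
  then show ?case using lin_zero[OF M P bilinD(1)[OF b]] by simp
qed

lemma msum_eqv: "eqv s s' \<Longrightarrow> msum s = msum s'"
proof (induction rule: equivclp_induct)
  case (step y z) then show ?case using msum_step[of y z] msum_step[of z y] by auto
qed simp

text \<open>\<open>msum\<close> is constant on congruence classes, so it may be evaluated at the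
  chosen member, which is recovered from its code by inverting \<open>fs\<close>.\<close>

lemma tensor_lift_exists: "\<exists>h. lin R (T M N) P h \<and> h \<in> extensional (carrier (T M N)) \<and>
    (\<forall>m \<in> carrier M. \<forall>n \<in> carrier N. h (tn M N m n) = b m n)"
proof -
  define h where "h = (\<lambda>x \<in> carrier (T M N). msum (inv_into UNIV fs x))"
  have c: "val s \<Longrightarrow> cl s \<in> carrier (T M N)" for s unfolding T_carrier by blast
  have h: "h (cl s) = msum s" if "val s" for s
    using msum_eqv[OF cl_rep[of s]] c[OF that] by (simp add: h_def)
  have "lin R (T M N) P h"
  proof (rule linI)
    show "h x \<in> carrier P" if "x \<in> carrier (T M N)" for x using that by (simp add: h_def)
    show "h (x \<oplus>\<^bsub>T M N\<^esub> y) = h x \<oplus>\<^bsub>P\<^esub> h y" if xy: "x \<in> carrier (T M N)" "y \<in> carrier (T M N)" for x y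
    proof -
      obtain s where s: "val s" "x = cl s" by (rule T_cases[OF xy(1)])
      obtain u where u: "val u" "y = cl u" by (rule T_cases[OF xy(2)])
      have "val (s + u)" using s(1) u(1) by simp
      then have "h (cl (s + u)) = h (cl s) \<oplus>\<^bsub>P\<^esub> h (cl u)" by (simp only: h[OF s(1)] h[OF u(1)] h msum_union)
      then show ?thesis by (simp only: s(2) u(2) T_add)
    qed
    show "h (r \<odot>\<^bsub>T M N\<^esub> x) = r \<odot>\<^bsub>P\<^esub> h x" if rx: "r \<in> carrier R" "x \<in> carrier (T M N)" for r x
    proof -
      obtain s where s: "val s" "x = cl s" by (rule T_cases[OF rx(2)])
      show ?thesis unfolding s(2) T_smult[OF rx(1)] h[OF s(1)] h[OF val_sm[OF s(1) rx(1)]]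
        by (rule msum_sm[OF s(1) rx(1)])
    qed
  qed
  moreover have "h (tn M N m n) = b m n" if "m \<in> carrier M" "n \<in> carrier N" for m n
    using h[of "{#(m, n)#}"] that by (simp add: pure_tensor_def b_closed)
  ultimately show ?thesis by (intro exI[of _ h]) (simp add: h_def)
qed

end

lemma tensor_lin_eq:
  assumes P: "module R P" and f: "lin R (T M N) P f" and g: "lin R (T M N) P g"
    and eq: "\<And>m n. \<lbrakk>m \<in> carrier M; n \<in> carrier N\<rbrakk> \<Longrightarrow> f (tn M N m n) = g (tn M N m n)"
    and x: "x \<in> carrier (T M N)"
  shows "f x = g x"
  using x by (induction rule: tensor_induct) (simp_all add: eq lin_add[OF f] lin_add[OF g])

text \<open>The conditions that determine arrows in \<open>fgp_modules\<close> are not all stated on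
  pure tensors of two factors: unit isomorphisms use scalars and associators use triples.
  \<open>Q\<close> stands for any condition equivalent to the one on pure tensors.\<close>

lemma tensor_the:
  assumes P: "module R (P :: ('r, 'u) module)" and b: "bilin R M N P b"
    and Q: "\<And>h. h \<in> mod_homs R (T M N) P \<Longrightarrow> Q h \<longleftrightarrow> (\<forall>m \<in> carrier M. \<forall>n \<in> carrier N. h (tn M N m n) = b m n)"
  shows "(THE h. h \<in> mod_homs R (T M N) P \<and> Q h) \<in> mod_homs R (T M N) P"
    "\<lbrakk>m \<in> carrier M; n \<in> carrier N\<rbrakk> \<Longrightarrow> (THE h. h \<in> mod_homs R (T M N) P \<and> Q h) (tn M N m n) = b m n"
proof -
  obtain h where h: "h \<in> mod_homs R (T M N) P" "\<forall>m \<in> carrier M. \<forall>n \<in> carrier N. h (tn M N m n) = b m n"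
    using tensor_lift_exists[OF P b] by (auto simp: mod_homs_iff)
  have "(THE h. h \<in> mod_homs R (T M N) P \<and> Q h) = h"
  proof (rule the_equality)
    show "h \<in> mod_homs R (T M N) P \<and> Q h" using h Q by blast
    fix g assume g: "g \<in> mod_homs R (T M N) P \<and> Q g"
    show "g = h"
    proof (rule extensionalityI[of _ "carrier (T M N)"])
      show "g x = h x" if "x \<in> carrier (T M N)" for x
        by (rule tensor_lin_eq[OF P _ _ _ that]) (use g h Q in \<open>auto simp: mod_homs_iff\<close>)
    qed (use g h in \<open>auto simp: mod_homs_iff\<close>)
  qed
  then show "(THE h. h \<in> mod_homs R (T M N) P \<and> Q h) \<in> mod_homs R (T M N) P"
    "\<lbrakk>m \<in> carrier M; n \<in> carrier N\<rbrakk> \<Longrightarrow> (THE h. h \<in> mod_homs R (T M N) P \<and> Q h) (tn M N m n) = b m n"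
    using h by simp_all
qed

end

end

section \<open>Dual bases\<close>

text \<open>The ring as a module on its own type \<open>'r\<close>, in contrast to
  \<open>scalar_module\<close>, so that functionals take uncoded values.\<close>

definition reg :: "('r, 'e) ring_scheme \<Rightarrow> ('r, 'r) module" where
  "reg R = \<lparr>carrier = carrier R, monoid.mult = undefined, one = undefined,
     zero = \<zero>\<^bsub>R\<^esub>, add = add R, smult = monoid.mult R\<rparr>"

lemma reg_sel [simp]: "carrier (reg R) = carrier R" "\<zero>\<^bsub>reg R\<^esub> = \<zero>\<^bsub>R\<^esub>" "x \<oplus>\<^bsub>reg R\<^esub> y = x \<oplus>\<^bsub>R\<^esub> y"
  "r \<odot>\<^bsub>reg R\<^esub> x = r \<otimes>\<^bsub>R\<^esub> x"
  by (simp_all add: reg_def)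

lemma reg_module: "cring R \<Longrightarrow> module R (reg R)"
proof -
  assume "cring R"
  then interpret cring R .
  show ?thesis
  proof (rule moduleI)
    show "abelian_group (reg R)"
      by (rule abelian_groupI) (auto simp: a_ac intro: l_neg)
  qed (simp_all add: l_distr r_distr m_assoc, unfold_locales)
qed

text \<open>The operations of \<open>N\<close> are compared only at images \<open>h x\<close>, which
  is where operations defined by decoding can be computed.\<close>

lemma module_iso:
  assumes M: "module R M" and bij: "bij_betw h (carrier M) (carrier N)"
    and zero: "h \<zero>\<^bsub>M\<^esub> = \<zero>\<^bsub>N\<^esub>"
    and add: "\<And>x y. \<lbrakk>x \<in> carrier M; y \<in> carrier M\<rbrakk> \<Longrightarrow> h x \<oplus>\<^bsub>N\<^esub> h y = h (x \<oplus>\<^bsub>M\<^esub> y)"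
    and smult: "\<And>r x. \<lbrakk>r \<in> carrier R; x \<in> carrier M\<rbrakk> \<Longrightarrow> r \<odot>\<^bsub>N\<^esub> h x = h (r \<odot>\<^bsub>M\<^esub> x)"
  shows "module R N"
proof -
  interpret M: module R M by fact
  have N: "carrier N = h ` carrier M" using bij by (simp add: bij_betw_def)
  show ?thesis
  proof (rule moduleI)
    show "cring R" by unfold_locales
    show "abelian_group N"
    proof (rule abelian_groupI)
      fix x assume "x \<in> carrier N"
      then obtain x' where x': "x' \<in> carrier M" "x = h x'" unfolding N by blast
      then have "h (\<ominus>\<^bsub>M\<^esub> x') \<oplus>\<^bsub>N\<^esub> x = \<zero>\<^bsub>N\<^esub>" by (simp add: add zero M.l_neg)
      then show "\<exists>y \<in> carrier N. y \<oplus>\<^bsub>N\<^esub> x = \<zero>\<^bsub>N\<^esub>" using x' N by blast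
    qed (auto simp: N add M.a_ac zero[symmetric])
  qed (auto simp: N add smult M.smult_l_distr M.smult_r_distr M.smult_assoc1)
qed

text \<open>The notion of the dual basis lemma: generators together with linear coordinate
  functionals, not necessarily independent. The family is indexed because repetitions may occur, for
  instance among tensors of generators.\<close>

definition dbasis :: "('r, 'e) ring_scheme \<Rightarrow> ('r, 'm) module \<Rightarrow> 'i set \<Rightarrow> ('i \<Rightarrow> 'm) \<Rightarrow> ('i \<Rightarrow> 'm \<Rightarrow> 'r) \<Rightarrow> bool" where
  "dbasis R M I e \<phi> \<longleftrightarrow> finite I \<and> e \<in> I \<rightarrow> carrier M \<and> (\<forall>i \<in> I. lin R M (reg R) (\<phi> i)) \<and>
     (\<forall>x \<in> carrier M. x = (\<Oplus>\<^bsub>M\<^esub>i \<in> I. \<phi> i x \<odot>\<^bsub>M\<^esub> e i))"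

lemma dbasisI:
  "\<lbrakk>finite I; \<And>i. i \<in> I \<Longrightarrow> e i \<in> carrier M; \<And>i. i \<in> I \<Longrightarrow> lin R M (reg R) (\<phi> i);
    \<And>x. x \<in> carrier M \<Longrightarrow> (\<Oplus>\<^bsub>M\<^esub>i \<in> I. \<phi> i x \<odot>\<^bsub>M\<^esub> e i) = x\<rbrakk> \<Longrightarrow> dbasis R M I e \<phi>"
  by (simp add: dbasis_def Pi_iff)

lemma dbasisD:
  assumes "dbasis R M I e \<phi>"
  shows "finite I" "i \<in> I \<Longrightarrow> e i \<in> carrier M" "i \<in> I \<Longrightarrow> lin R M (reg R) (\<phi> i)"
    "x \<in> carrier M \<Longrightarrow> (\<Oplus>\<^bsub>M\<^esub>i \<in> I. \<phi> i x \<odot>\<^bsub>M\<^esub> e i) = x"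
  using assms by (auto simp: dbasis_def)

lemma dbasis_coeff: "\<lbrakk>dbasis R M I e \<phi>; i \<in> I; x \<in> carrier M\<rbrakk> \<Longrightarrow> \<phi> i x \<in> carrier R"
  using lin_closed[OF dbasisD(3)] by fastforce

lemma lin_scale:
  assumes "module R M" "module R P" "lin R M (reg R) \<phi>" "c \<in> carrier P"
  shows "lin R M P (\<lambda>x. \<phi> x \<odot>\<^bsub>P\<^esub> c)"
proof -
  interpret P: module R P by fact
  show ?thesis using linD[OF assms(3)] assms(4) by (intro linI) (simp_all add: P.smult_l_distr P.smult_assoc1)
qed

text \<open>Since generators may repeat, the coefficients of all indices with the same
  \<open>e i\<close> have to be added up; hence the induction on the index set.\<close>

lemma finitely_generatedI:
  assumes M: "module R (M :: ('r, 'u) module)" and e: "dbasis R M I e \<phi>"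
  shows "finitely_generated R M"
  unfolding finitely_generated_def
proof (intro exI conjI ballI)
  interpret M: module R M by fact
  define S where "S = e ` I"
  show S: "finite (e ` I)" "e ` I \<subseteq> carrier M" using dbasisD(1,2)[OF e] by auto
  note S = S[folded S_def]
  have comb: "\<exists>a \<in> S \<rightarrow> carrier R. (\<Oplus>\<^bsub>M\<^esub>i \<in> J. c i \<odot>\<^bsub>M\<^esub> e i) = (\<Oplus>\<^bsub>M\<^esub>s \<in> S. a s \<odot>\<^bsub>M\<^esub> s)"
    if "finite J" "J \<subseteq> I" "c \<in> J \<rightarrow> carrier R" for J c
    using that
  proof (induction J)
    case empty
    have "(\<Oplus>\<^bsub>M\<^esub>s \<in> S. \<zero>\<^bsub>R\<^esub> \<odot>\<^bsub>M\<^esub> s) = (\<Oplus>\<^bsub>M\<^esub>s \<in> S. \<zero>\<^bsub>M\<^esub>)"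
      by (rule M.finsum_cong') (use S in auto)
    then show ?case by (intro bexI[of _ "\<lambda>_. \<zero>\<^bsub>R\<^esub>"]) simp_all
  next
    case (insert j J)
    then have cl: "c j \<in> carrier R" "e j \<in> carrier M" "e j \<in> S" "(\<lambda>i. c i \<odot>\<^bsub>M\<^esub> e i) \<in> J \<rightarrow> carrier M"
      using dbasisD(2)[OF e] by (auto simp: S_def Pi_iff)
    obtain a where a: "a \<in> S \<rightarrow> carrier R" "(\<Oplus>\<^bsub>M\<^esub>i \<in> J. c i \<odot>\<^bsub>M\<^esub> e i) = (\<Oplus>\<^bsub>M\<^esub>s \<in> S. a s \<odot>\<^bsub>M\<^esub> s)"
      using insert by auto
    have 1: "(\<lambda>s. if e j = s then c j \<odot>\<^bsub>M\<^esub> s else \<zero>\<^bsub>M\<^esub>) \<in> S \<rightarrow> carrier M" "(\<lambda>s. a s \<odot>\<^bsub>M\<^esub> s) \<in> S \<rightarrow> carrier M"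
      using cl a(1) S(2) by (auto simp: Pi_iff)
    have "(\<Oplus>\<^bsub>M\<^esub>i \<in> insert j J. c i \<odot>\<^bsub>M\<^esub> e i) = c j \<odot>\<^bsub>M\<^esub> e j \<oplus>\<^bsub>M\<^esub> (\<Oplus>\<^bsub>M\<^esub>s \<in> S. a s \<odot>\<^bsub>M\<^esub> s)"
      using insert cl a(2) by simp
    \<comment> \<open>The new term is written as a sum over \<open>S\<close> concentrated at
      \<open>e j\<close>, so that it can be added to the coefficients termwise.\<close>
    also have "c j \<odot>\<^bsub>M\<^esub> e j = (\<Oplus>\<^bsub>M\<^esub>s \<in> S. if e j = s then c j \<odot>\<^bsub>M\<^esub> s else \<zero>\<^bsub>M\<^esub>)"
      by (rule M.finsum_singleton[OF cl(3) S(1), symmetric]) (use cl S(2) in auto)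
    also have "\<dots> \<oplus>\<^bsub>M\<^esub> (\<Oplus>\<^bsub>M\<^esub>s \<in> S. a s \<odot>\<^bsub>M\<^esub> s)
        = (\<Oplus>\<^bsub>M\<^esub>s \<in> S. (if e j = s then c j \<odot>\<^bsub>M\<^esub> s else \<zero>\<^bsub>M\<^esub>) \<oplus>\<^bsub>M\<^esub> a s \<odot>\<^bsub>M\<^esub> s)"
      by (rule M.finsum_addf[OF 1, symmetric])
    also have "\<dots> = (\<Oplus>\<^bsub>M\<^esub>s \<in> S. ((if e j = s then c j else \<zero>\<^bsub>R\<^esub>) \<oplus>\<^bsub>R\<^esub> a s) \<odot>\<^bsub>M\<^esub> s)"
      by (rule M.finsum_cong') (use a(1) cl S(2) in \<open>auto simp: Pi_iff M.smult_l_distr\<close>)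
    finally show ?case
      by (intro bexI[of _ "\<lambda>s. (if e j = s then c j else \<zero>\<^bsub>R\<^esub>) \<oplus>\<^bsub>R\<^esub> a s"]) (use a(1) cl in \<open>auto simp: Pi_iff\<close>)
  qed
  fix x assume x: "x \<in> carrier M"
  have "\<exists>a \<in> S \<rightarrow> carrier R. (\<Oplus>\<^bsub>M\<^esub>i \<in> I. \<phi> i x \<odot>\<^bsub>M\<^esub> e i) = (\<Oplus>\<^bsub>M\<^esub>s \<in> S. a s \<odot>\<^bsub>M\<^esub> s)"
    by (rule comb) (use dbasisD(1)[OF e] dbasis_coeff[OF e _ x] in auto)
  then show "\<exists>a \<in> e ` I \<rightarrow> carrier R. x = (\<Oplus>\<^bsub>M\<^esub>s \<in> e ` I. a s \<odot>\<^bsub>M\<^esub> s)"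
    unfolding dbasisD(4)[OF e x] S_def by blast
qed

text \<open>Choose preimages \<open>n i\<close> of \<open>f (e i)\<close> under \<open>p\<close> and
  send \<open>x\<close> to the combination of the \<open>n i\<close> with the coordinates of
  \<open>x\<close>; linearity of the coordinates makes this a linear map.\<close>

lemma projectiveI:
  assumes M: "module R (M :: ('r, 'u) module)" and e: "dbasis R M I e \<phi>"
  shows "projective R M"
  unfolding projective_def
proof (intro allI impI)
  fix N L :: "('r, 'u) module" and p f
  assume N: "module R N" and L: "module R L" and p: "p \<in> mod_homs R N L" and sur: "p ` carrier N = carrier L"
    and f: "f \<in> mod_homs R M L"
  interpret M: module R M by fact
  interpret N: module R N by fact
  interpret L: module R L by fact
  have lp: "lin R N L p" and lf: "lin R M L f" using p f by (auto simp: mod_homs_iff)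
  have "\<forall>i \<in> I. \<exists>y \<in> carrier N. p y = f (e i)"
    using sur lin_closed[OF lf dbasisD(2)[OF e]] by (metis imageE)
  then obtain n where n: "\<And>i. i \<in> I \<Longrightarrow> n i \<in> carrier N" "\<And>i. i \<in> I \<Longrightarrow> p (n i) = f (e i)" by metis
  define h where "h = (\<lambda>x. \<Oplus>\<^bsub>N\<^esub>i \<in> I. \<phi> i x \<odot>\<^bsub>N\<^esub> n i)"
  have h: "lin R M N h" unfolding h_def
    by (intro lin_finsum_map M N dbasisD(1)[OF e] lin_scale dbasisD(3)[OF e] n)
  have "p (h x) = f x" if x: "x \<in> carrier M" for x
  proof -
    have "p (h x) = (\<Oplus>\<^bsub>L\<^esub>i \<in> I. p (\<phi> i x \<odot>\<^bsub>N\<^esub> n i))" unfolding h_def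
      by (rule lin_finsum[OF N L lp]) (use n(1) dbasisD(1)[OF e] dbasis_coeff[OF e _ x] in auto)
    also have "\<dots> = (\<Oplus>\<^bsub>L\<^esub>i \<in> I. f (\<phi> i x \<odot>\<^bsub>M\<^esub> e i))"
      by (rule L.finsum_cong')
        (use n dbasis_coeff[OF e _ x] dbasisD(2)[OF e] lin_smult[OF lp] lin_smult[OF lf] lin_closed[OF lf] in auto)
    also have "\<dots> = f (\<Oplus>\<^bsub>M\<^esub>i \<in> I. \<phi> i x \<odot>\<^bsub>M\<^esub> e i)"
      by (rule lin_finsum[OF M L lf, symmetric]) (use dbasisD(1,2)[OF e] dbasis_coeff[OF e _ x] in auto)
    also have "\<dots> = f x" using dbasisD(4)[OF e x] by simp
    finally show ?thesis .
  qed
  moreover have "restrict h (carrier M) \<in> mod_homs R M N"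
    using lin_cong[OF M h, of "restrict h (carrier M)"] by (simp add: mod_homs_iff)
  ultimately show "\<exists>h \<in> mod_homs R M N. \<forall>x \<in> carrier M. p (h x) = f x"
    by (intro bexI[of _ "restrict h (carrier M)"]) simp_all
qed

lemma bilin_finsum:
  assumes M: "module R M" and N: "module R N" and P: "module R P" and b: "bilin R M N P b"
    and I: "finite I" "finite J" and f: "f \<in> I \<rightarrow> carrier M" and g: "g \<in> J \<rightarrow> carrier N"
  shows "b (\<Oplus>\<^bsub>M\<^esub>i \<in> I. f i) (\<Oplus>\<^bsub>N\<^esub>j \<in> J. g j) = (\<Oplus>\<^bsub>P\<^esub>p \<in> I \<times> J. b (f (fst p)) (g (snd p)))"
proof -
  interpret M: module R M by fact
  interpret N: module R N by fact
  interpret P: module R P by fact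
  let ?y = "\<Oplus>\<^bsub>N\<^esub>j \<in> J. g j"
  have y: "?y \<in> carrier N" by (rule N.finsum_closed[OF g])
  have c: "b m n \<in> carrier P" if "m \<in> carrier M" "n \<in> carrier N" for m n
    using lin_closed[OF bilinD(2)[OF b]] that by blast
  show ?thesis using I(1) f
  proof (induction I)
    case empty then show ?case using lin_zero[OF M P bilinD(1)[OF b y]] by simp
  next
    case (insert i I)
    have fi: "f i \<in> carrier M" and fI: "f \<in> I \<rightarrow> carrier M" using insert.prems by (auto simp: Pi_iff)
    have "b (\<Oplus>\<^bsub>M\<^esub>i \<in> insert i I. f i) ?y = b (f i) ?y \<oplus>\<^bsub>P\<^esub> b (\<Oplus>\<^bsub>M\<^esub>i \<in> I. f i) ?y"
      using insert.hyps fi fI lin_add[OF bilinD(1)[OF b y]] by (simp add: M.finsum_closed)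
    also have "b (f i) ?y = (\<Oplus>\<^bsub>P\<^esub>j \<in> J. b (f i) (g j))"
      by (rule lin_finsum[OF N P bilinD(2)[OF b fi] I(2) g])
    also have "\<dots> = (\<Oplus>\<^bsub>P\<^esub>p \<in> Pair i ` J. b (f (fst p)) (g (snd p)))"
      by (subst P.finsum_reindex) (use c fi g in \<open>auto simp: Pi_iff inj_on_def\<close>)
    also have "b (\<Oplus>\<^bsub>M\<^esub>i \<in> I. f i) ?y = (\<Oplus>\<^bsub>P\<^esub>p \<in> I \<times> J. b (f (fst p)) (g (snd p)))" by (rule insert.IH[OF fI])
    also have "(\<Oplus>\<^bsub>P\<^esub>p \<in> Pair i ` J. b (f (fst p)) (g (snd p))) \<oplus>\<^bsub>P\<^esub> \<dots>
        = (\<Oplus>\<^bsub>P\<^esub>p \<in> Pair i ` J \<union> I \<times> J. b (f (fst p)) (g (snd p)))"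
      by (rule P.finsum_Un_disjoint[symmetric]) (use insert.hyps I(2) c fi fI g in \<open>auto simp: Pi_iff\<close>)
    also have "Pair i ` J \<union> I \<times> J = insert i I \<times> J" by auto
    finally show ?case .
  qed
qed

text \<open>The set \<open>A\<close> is a parameter because there are two uses: all functions on a
  finite set give a free module, the functionals on a module give its dual.\<close>

definition fun_module :: "('r, 'e) ring_scheme \<Rightarrow> 'x set \<Rightarrow> ('x \<Rightarrow> 'r) set \<Rightarrow> ('r, 'x \<Rightarrow> 'r) module" where
  "fun_module R X A = \<lparr>carrier = A, monoid.mult = undefined, one = undefined, zero = (\<lambda>x \<in> X. \<zero>\<^bsub>R\<^esub>),
     add = (\<lambda>f g. \<lambda>x \<in> X. f x \<oplus>\<^bsub>R\<^esub> g x), smult = (\<lambda>r f. \<lambda>x \<in> X. r \<otimes>\<^bsub>R\<^esub> f x)\<rparr>"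

lemma fun_module:
  assumes "cring R" and A: "A \<subseteq> X \<rightarrow>\<^sub>E carrier R" "(\<lambda>x \<in> X. \<zero>\<^bsub>R\<^esub>) \<in> A"
    and add: "\<And>f g. \<lbrakk>f \<in> A; g \<in> A\<rbrakk> \<Longrightarrow> (\<lambda>x \<in> X. f x \<oplus>\<^bsub>R\<^esub> g x) \<in> A"
    and smult: "\<And>r f. \<lbrakk>r \<in> carrier R; f \<in> A\<rbrakk> \<Longrightarrow> (\<lambda>x \<in> X. r \<otimes>\<^bsub>R\<^esub> f x) \<in> A"
  shows "module R (fun_module R X A)" "x \<in> X \<Longrightarrow> lin R (fun_module R X A) (reg R) (\<lambda>f. f x)"
proof -
  interpret cring R by fact
  have cl[simp]: "f x \<in> carrier R" if "f \<in> A" "x \<in> X" for f x using that A(1) by (auto simp: PiE_iff)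
  have eq: "f = (\<lambda>x \<in> X. g x)" if "f \<in> A" "\<And>x. x \<in> X \<Longrightarrow> f x = g x" for f g
    using that A(1) by (intro extensionalityI[of _ X]) (auto simp: PiE_iff)
  show "module R (fun_module R X A)"
  proof (rule moduleI)
    show "abelian_group (fun_module R X A)"
    proof (rule abelian_groupI)
      fix f assume f: "f \<in> carrier (fun_module R X A)"
      have "(\<lambda>x \<in> X. (\<lambda>x \<in> X. \<ominus>\<^bsub>R\<^esub> \<one>\<^bsub>R\<^esub> \<otimes>\<^bsub>R\<^esub> f x) x \<oplus>\<^bsub>R\<^esub> f x) = (\<lambda>x \<in> X. \<zero>\<^bsub>R\<^esub>)"
        by (rule restrict_ext) (use f in \<open>simp add: fun_module_def l_minus l_neg\<close>)
      then show "\<exists>g \<in> carrier (fun_module R X A). g \<oplus>\<^bsub>fun_module R X A\<^esub> f = \<zero>\<^bsub>fun_module R X A\<^esub>"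
        using f smult[of "\<ominus>\<^bsub>R\<^esub> \<one>\<^bsub>R\<^esub>" f] by (intro bexI[of _ "\<lambda>x \<in> X. \<ominus>\<^bsub>R\<^esub> \<one>\<^bsub>R\<^esub> \<otimes>\<^bsub>R\<^esub> f x"]) (simp_all add: fun_module_def)
    qed (auto simp: fun_module_def A add a_ac intro!: eq[symmetric] restrict_ext)
  qed (unfold_locales, auto simp: fun_module_def smult l_distr r_distr m_assoc intro!: eq[symmetric] restrict_ext)
  show "lin R (fun_module R X A) (reg R) (\<lambda>f. f x)" if "x \<in> X"
    by (rule linI) (use that in \<open>auto simp: fun_module_def\<close>)
qed

definition coded_module :: "('m \<Rightarrow> 'n) \<Rightarrow> ('r, 'm) module \<Rightarrow> ('r, 'n) module" where
  "coded_module e M = \<lparr>carrier = e ` carrier M, monoid.mult = undefined, one = undefined, zero = e \<zero>\<^bsub>M\<^esub>,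
     add = (\<lambda>u v. e (inv_into (carrier M) e u \<oplus>\<^bsub>M\<^esub> inv_into (carrier M) e v)),
     smult = (\<lambda>r u. e (r \<odot>\<^bsub>M\<^esub> inv_into (carrier M) e u))\<rparr>"

lemma coded_module:
  assumes M: "module R M" and e: "inj_on e (carrier M)"
  shows "module R (coded_module e M)" "lin R M (coded_module e M) e"
    "lin R (coded_module e M) M (inv_into (carrier M) e)"
proof -
  interpret M: module R M by fact
  show "module R (coded_module e M)"
    by (rule module_iso[OF M, of e]) (use e in \<open>simp_all add: coded_module_def bij_betw_def\<close>)
  show "lin R M (coded_module e M) e" by (rule linI) (use e in \<open>simp_all add: coded_module_def\<close>)
  show "lin R (coded_module e M) M (inv_into (carrier M) e)"
    by (rule linI) (use e in \<open>auto simp: coded_module_def\<close>)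
qed

section \<open>Free modules inside the universe and the dual basis lemma\<close>

context module_universe
begin

abbreviation fgp :: "('r, 'u) module \<Rightarrow> bool" where
  "fgp M \<equiv> module R M \<and> finitely_generated R M \<and> projective R M"

abbreviation K :: "('r, 'u) module" where "K \<equiv> scalar_module R sc"

text \<open>A function on a finite set is written as the formal sum of the pairs of an argument and
  its coded value. This is how modules of functions obtain carriers in \<open>'u\<close>.\<close>

definition enc :: "'u set \<Rightarrow> ('u \<Rightarrow> 'r) \<Rightarrow> 'u" where
  "enc S a = fs (image_mset (\<lambda>s. (s, sc (a s))) (mset_set S))"

lemma enc_cong: "(\<And>s. s \<in> S \<Longrightarrow> a s = b s) \<Longrightarrow> enc S a = enc S b"
  unfolding enc_def by (cases "finite S") (auto intro!: arg_cong[of _ _ fs] image_mset_cong)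

text \<open>The pairs form the graph of the function, so the value at \<open>s\<close> can be read
  off from the one pair with first component \<open>s\<close>.\<close>

lemma enc_inj:
  assumes "finite S" "enc S a = enc S b" "s \<in> S"
  shows "a s = b s"
proof -
  have "image_mset (\<lambda>s. (s, sc (a s))) (mset_set S) = image_mset (\<lambda>s. (s, sc (b s))) (mset_set S)"
    using assms(2) inj_fs by (simp add: enc_def inj_eq)
  from arg_cong[OF this, of set_mset] have "(\<lambda>s. (s, sc (a s))) ` S = (\<lambda>s. (s, sc (b s))) ` S"
    using assms(1) by simp
  then have "(s, sc (a s)) \<in> (\<lambda>s. (s, sc (b s))) ` S" using assms(3) by blast
  then show ?thesis using inj_sc by (auto simp: inj_eq)
qed

lemma fgpI: "\<lbrakk>module R (M :: ('r, 'u) module); dbasis R M I e \<phi>\<rbrakk> \<Longrightarrow> fgp M"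
  using finitely_generatedI projectiveI by blast

text \<open>The converse of \<open>fgpI\<close>, which completes the dual basis lemma. The free
  module on the generators has to be coded into \<open>'u\<close>, because \<open>projective\<close>
  tests lifting only against modules with carrier in this type.\<close>

lemma fgp_dbasis:
  assumes "fgp M"
  shows "\<exists>S \<phi>. S \<subseteq> carrier M \<and> dbasis R M S (\<lambda>s. s) \<phi>"
proof -
  interpret M: module R M using assms by blast
  have M: "module R M" by unfold_locales
  obtain S where S: "finite S" "S \<subseteq> carrier M"
    and gen: "\<And>x. x \<in> carrier M \<Longrightarrow> \<exists>a \<in> S \<rightarrow> carrier R. x = (\<Oplus>\<^bsub>M\<^esub>s \<in> S. a s \<odot>\<^bsub>M\<^esub> s)"
    using assms unfolding finitely_generated_def by auto
  \<comment> \<open>A splitting of the surjection from the free module on \<open>S\<close> has the coordinate functionals as components.\<close>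
  define A where "A = S \<rightarrow>\<^sub>E carrier R"
  define F where "F = coded_module (enc S) (fun_module R S A)"
  define dec where "dec = inv_into A (enc S)"
  have "cring R" by unfold_locales
  note fm = fun_module[OF this, of A S]
  have fmod: "module R (fun_module R S A)" and ev: "\<And>s. s \<in> S \<Longrightarrow> lin R (fun_module R S A) (reg R) (\<lambda>f. f s)"
    by (rule fm(1); auto simp: A_def)(rule fm(2); auto simp: A_def)
  have carr: "carrier (fun_module R S A) = A" by (simp add: fun_module_def)
  have inj: "inj_on (enc S) A"
    by (rule inj_onI, rule extensionalityI[of _ S]) (use enc_inj[OF S(1)] in \<open>auto simp: A_def PiE_iff\<close>)
  have F: "module R F" and dec: "lin R F (fun_module R S A) dec"
    using coded_module[OF fmod, of "enc S"] inj by (simp_all add: F_def dec_def carr)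
  have decs: "lin R F (reg R) (\<lambda>u. dec u s)" if "s \<in> S" for s using lin_comp[OF dec ev[OF that]] .
  define p where "p = (\<lambda>u. \<Oplus>\<^bsub>M\<^esub>s \<in> S. dec u s \<odot>\<^bsub>M\<^esub> s)"
  have p: "lin R F M p" unfolding p_def
    by (intro lin_finsum_map F M S(1) lin_scale decs) (use S(2) in auto)
  have surj: "restrict p (carrier F) ` carrier F = carrier M"
  proof (intro equalityI subsetI)
    fix x assume "x \<in> carrier M"
    then obtain a where a: "a \<in> S \<rightarrow> carrier R" "x = (\<Oplus>\<^bsub>M\<^esub>s \<in> S. a s \<odot>\<^bsub>M\<^esub> s)" using gen by blast
    have aA: "restrict a S \<in> A" using a(1) by (auto simp: A_def)
    then have F1: "enc S (restrict a S) \<in> carrier F" by (simp add: F_def coded_module_def carr)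
    have "p (enc S (restrict a S)) = (\<Oplus>\<^bsub>M\<^esub>s \<in> S. a s \<odot>\<^bsub>M\<^esub> s)"
      unfolding p_def dec_def inv_into_f_f[OF inj aA] by (rule M.finsum_cong') (use a(1) S(2) in auto)
    then show "x \<in> restrict p (carrier F) ` carrier F" using F1 a(2) by (auto intro!: image_eqI[OF _ F1])
  qed (use lin_closed[OF p] in auto)
  have pF: "restrict p (carrier F) \<in> mod_homs R F M"
    using lin_cong[OF F p, of "restrict p (carrier F)"] by (auto simp: mod_homs_iff)
  have idM: "(\<lambda>x \<in> carrier M. x) \<in> mod_homs R M M" by (auto simp: mod_homs_iff lin_def)
  have "projective R M" using assms by blast
  \<comment> \<open>Lifting the identity of \<open>M\<close> along the surjection \<open>p\<close>
    gives the splitting \<open>h\<close>.\<close>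
  from this[unfolded projective_def, rule_format, OF F M pF surj idM]
  obtain h where h: "h \<in> mod_homs R M F" "\<And>x. x \<in> carrier M \<Longrightarrow> restrict p (carrier F) (h x) = x"
    by auto
  then have hl: "lin R M F h" by (simp add: mod_homs_iff)
  have "dbasis R M S (\<lambda>s. s) (\<lambda>s x. dec (h x) s)"
  proof (rule dbasisI)
    show "(\<Oplus>\<^bsub>M\<^esub>s \<in> S. dec (h x) s \<odot>\<^bsub>M\<^esub> s) = x" if "x \<in> carrier M" for x
      using h(2)[OF that] lin_closed[OF hl that] by (simp add: p_def)
  qed (use S lin_comp[OF hl decs] in auto)
  then show ?thesis using S(2) by blast
qed

lemma K_carrier: "carrier K = sc ` carrier R"
  by (simp add: scalar_module_def)

lemma K_module: "module R K" and sc_lin: "lin R (reg R) K sc" and unsc_lin: "lin R K (reg R) (inv_into UNIV sc)"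
proof -
  show "module R K" by (rule module_iso[OF reg_module, of _ sc])
    (use inj_sc in \<open>auto simp: scalar_module_def bij_betw_def inj_on_def, unfold_locales\<close>)
  show "lin R (reg R) K sc" by (rule linI) (use inj_sc in \<open>simp_all add: scalar_module_def\<close>)
  show "lin R K (reg R) (inv_into UNIV sc)" by (rule linI) (use inj_sc in \<open>auto simp: scalar_module_def\<close>)
qed

lemma sc_simps:
  "inv_into UNIV sc (sc r) = r" "r \<in> carrier R \<Longrightarrow> sc r \<in> carrier K"
  "\<lbrakk>r \<in> carrier R; s \<in> carrier R\<rbrakk> \<Longrightarrow> r \<odot>\<^bsub>K\<^esub> sc s = sc (r \<otimes> s)"
  using inj_sc by (simp_all add: scalar_module_def)

lemma K_fgp: "fgp K"
proof (rule fgpI[OF K_module])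
  interpret K: module R K by (rule K_module)
  show "dbasis R K {()} (\<lambda>_. sc \<one>) (\<lambda>_. inv_into UNIV sc)"
    by (rule dbasisI) (use unsc_lin in \<open>auto simp: sc_simps K_carrier\<close>)
qed

lemma mult_bilin:
  assumes "module R M" "module R N" "lin R M (reg R) f" "lin R N (reg R) g"
  shows "bilin R M N (reg R) (\<lambda>m n. f m \<otimes> g n)"
proof (rule bilinI; rule linI)
qed (use linD[OF assms(3)] linD[OF assms(4)] in \<open>simp_all add: l_distr r_distr m_assoc m_lcomm\<close>)

text \<open>Both sides of the expansion are linear in the tensor, so they are compared on pure
  tensors, where the double sum splits into the expansions of the two factors. The functionals
  \<open>f\<close> are given only by their values on pure tensors.\<close>

lemma tensor_dbasis:
  assumes M: "module R M" and N: "module R N" and e: "dbasis R M I e \<phi>" and e': "dbasis R N J e' \<phi>'"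
    and f: "\<And>i j. \<lbrakk>i \<in> I; j \<in> J\<rbrakk> \<Longrightarrow> lin R (T M N) (reg R) (f i j)"
    "\<And>i j m n. \<lbrakk>i \<in> I; j \<in> J; m \<in> carrier M; n \<in> carrier N\<rbrakk> \<Longrightarrow> f i j (tn M N m n) = \<phi> i m \<otimes> \<phi>' j n"
  shows "dbasis R (T M N) (I \<times> J) (\<lambda>p. tn M N (e (fst p)) (e' (snd p))) (\<lambda>p. f (fst p) (snd p))"
proof (rule dbasisI)
  note TM = T_module[OF M N] and b = tn_bilin[OF M N]
  interpret M: module R M by fact
  interpret N: module R N by fact
  interpret TM: module R "T M N" by (rule TM)
  have tc: "tn M N m n \<in> carrier (T M N)" if "m \<in> carrier M" "n \<in> carrier N" for m n
    using lin_closed[OF bilinD(2)[OF b]] that by blast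
  show fin: "finite (I \<times> J)" using dbasisD(1)[OF e] dbasisD(1)[OF e'] by blast
  show "tn M N (e (fst p)) (e' (snd p)) \<in> carrier (T M N)" if "p \<in> I \<times> J" for p
    using that dbasisD(2)[OF e] dbasisD(2)[OF e'] tc by auto
  show "lin R (T M N) (reg R) (f (fst p) (snd p))" if "p \<in> I \<times> J" for p using that f(1) by auto
  fix x assume x: "x \<in> carrier (T M N)"
  show "(\<Oplus>\<^bsub>T M N\<^esub>p \<in> I \<times> J. f (fst p) (snd p) x \<odot>\<^bsub>T M N\<^esub> tn M N (e (fst p)) (e' (snd p))) = x" (is "?h x = x")
  proof (rule tensor_lin_eq[OF M N TM _ _ _ x])
    show "lin R (T M N) (T M N) ?h"
      by (intro lin_finsum_map lin_scale TM fin) (use f(1) dbasisD(2)[OF e] dbasisD(2)[OF e'] tc in auto)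
    show "lin R (T M N) (T M N) (\<lambda>x. x)" by (rule linI) auto
    fix m n assume mn: "m \<in> carrier M" "n \<in> carrier N"
    have "tn M N m n = tn M N (\<Oplus>\<^bsub>M\<^esub>i \<in> I. \<phi> i m \<odot>\<^bsub>M\<^esub> e i) (\<Oplus>\<^bsub>N\<^esub>j \<in> J. \<phi>' j n \<odot>\<^bsub>N\<^esub> e' j)"
      using dbasisD(4)[OF e mn(1)] dbasisD(4)[OF e' mn(2)] by simp
    also have "\<dots> = (\<Oplus>\<^bsub>T M N\<^esub>p \<in> I \<times> J. tn M N (\<phi> (fst p) m \<odot>\<^bsub>M\<^esub> e (fst p)) (\<phi>' (snd p) n \<odot>\<^bsub>N\<^esub> e' (snd p)))"
      by (rule bilin_finsum[OF M N TM b dbasisD(1)[OF e] dbasisD(1)[OF e']])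
        (use dbasisD(2)[OF e] dbasisD(2)[OF e'] dbasis_coeff[OF e _ mn(1)] dbasis_coeff[OF e' _ mn(2)] in auto)
    also have "\<dots> = ?h (tn M N m n)"
    proof (rule TM.finsum_cong')
      fix p assume p: "p \<in> I \<times> J"
      have c: "e (fst p) \<in> carrier M" "e' (snd p) \<in> carrier N" "\<phi> (fst p) m \<in> carrier R" "\<phi>' (snd p) n \<in> carrier R"
        "fst p \<in> I" "snd p \<in> J"
        using p dbasisD(2)[OF e] dbasisD(2)[OF e'] dbasis_coeff[OF e _ mn(1)] dbasis_coeff[OF e' _ mn(2)] by auto
      show "tn M N (\<phi> (fst p) m \<odot>\<^bsub>M\<^esub> e (fst p)) (\<phi>' (snd p) n \<odot>\<^bsub>N\<^esub> e' (snd p))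
        = f (fst p) (snd p) (tn M N m n) \<odot>\<^bsub>T M N\<^esub> tn M N (e (fst p)) (e' (snd p))"
        using c mn f(2)[OF c(5,6) mn] lin_smult[OF bilinD(1)[OF b]] lin_smult[OF bilinD(2)[OF b]] tc
        by (simp add: TM.smult_assoc1 module_left_commute[OF TM])
    qed (use mn f(1) linD(1)[OF f(1)] tc dbasisD(2)[OF e] dbasisD(2)[OF e'] in \<open>fastforce+\<close>)
    finally show "?h (tn M N m n) = tn M N m n" by simp
  qed
qed

text \<open>The target may have its carrier in any type, in particular it may be
  \<open>reg R\<close>; on the carrier the value is determined by \<open>b\<close>.\<close>

definition lift :: "('r, 'u) module \<Rightarrow> ('r, 'u) module \<Rightarrow> ('r, 'p) module \<Rightarrow> ('u \<Rightarrow> 'u \<Rightarrow> 'p) \<Rightarrow> 'u \<Rightarrow> 'p" where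
  "lift M N P b = (SOME h. lin R (T M N) P h \<and> (\<forall>m \<in> carrier M. \<forall>n \<in> carrier N. h (tn M N m n) = b m n))"

lemma lift:
  assumes "module R M" "module R N" "module R P" "bilin R M N P b"
  shows "lin R (T M N) P (lift M N P b)"
    "\<lbrakk>m \<in> carrier M; n \<in> carrier N\<rbrakk> \<Longrightarrow> lift M N P b (tn M N m n) = b m n"
proof -
  have "\<exists>h. lin R (T M N) P h \<and> (\<forall>m \<in> carrier M. \<forall>n \<in> carrier N. h (tn M N m n) = b m n)"
    using tensor_lift_exists[OF assms] by blast
  from someI_ex[OF this] show "lin R (T M N) P (lift M N P b)"
    "\<lbrakk>m \<in> carrier M; n \<in> carrier N\<rbrakk> \<Longrightarrow> lift M N P b (tn M N m n) = b m n"
    unfolding lift_def by blast+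
qed

lemma T_fgp:
  assumes "fgp M" "fgp N"
  shows "fgp (T M N)"
proof -
  have MN: "module R M" "module R N" "module R (reg R)" using assms reg_module is_cring by auto
  obtain S \<phi> where S: "dbasis R M S (\<lambda>s. s) \<phi>" using fgp_dbasis[OF assms(1)] by blast
  obtain S' \<phi>' where S': "dbasis R N S' (\<lambda>s. s) \<phi>'" using fgp_dbasis[OF assms(2)] by blast
  note b = mult_bilin[OF MN(1,2) dbasisD(3)[OF S] dbasisD(3)[OF S']]
  show ?thesis
    by (rule fgpI[OF T_module[OF MN(1,2)] tensor_dbasis[OF MN(1,2) S S' lift[OF MN b]]])
qed

section \<open>The category of finitely generated projective modules\<close>

lemma tn_closed: "\<lbrakk>module R M; module R N; m \<in> carrier M; n \<in> carrier N\<rbrakk> \<Longrightarrow> tn M N m n \<in> carrier (T M N)"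
  using lin_closed[OF bilinD(2)[OF tn_bilin]] by blast

lemma lin_add_map:
  assumes "module R M" "module R P" "lin R M P f" "lin R M P g"
  shows "lin R M P (\<lambda>x. f x \<oplus>\<^bsub>P\<^esub> g x)"
proof -
  interpret M: module R M by fact
  interpret P: module R P by fact
  show ?thesis using linD[OF assms(3)] linD[OF assms(4)]
    by (intro linI) (simp_all add: P.smult_r_distr P.a_ac)
qed

text \<open>Lifting in two of three variables preserves linearity in the third, by induction on the
  tensor. So a map out of a triple tensor product is obtained by lifting twice, as for the
  associators.\<close>

lemma trilin_lift_left:
  assumes M: "module R M" and N: "module R N" and P: "module R P" and X: "module R X"
    and b: "\<And>p. p \<in> carrier P \<Longrightarrow> bilin R M N X (\<lambda>m n. t m n p)"
    and l: "\<And>m n. \<lbrakk>m \<in> carrier M; n \<in> carrier N\<rbrakk> \<Longrightarrow> lin R P X (t m n)"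
  shows "bilin R (T M N) P X (\<lambda>z p. lift M N X (\<lambda>m n. t m n p) z)"
proof (rule bilinI)
  note L = lift[OF M N X b]
  show "lin R (T M N) X (\<lambda>z. lift M N X (\<lambda>m n. t m n p) z)" if "p \<in> carrier P" for p by (rule L(1)[OF that])
  fix z assume "z \<in> carrier (T M N)"
  then show "lin R P X (\<lambda>p. lift M N X (\<lambda>m n. t m n p) z)"
  proof (induction rule: tensor_induct[OF M N, consumes 1, case_names pure add])
    case (pure m n)
    show ?case by (rule lin_cong[OF P l[OF pure]]) (simp add: L(2) pure)
  next
    case (add x y)
    show ?case by (rule lin_cong[OF P lin_add_map[OF P X add(3,4)]]) (simp add: lin_add[OF L(1)] add)
  qed
qed

lemma trilin_lift_right:
  assumes M: "module R M" and N: "module R N" and P: "module R P" and X: "module R X"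
    and b: "\<And>p. p \<in> carrier P \<Longrightarrow> bilin R M N X (\<lambda>m n. t p m n)"
    and l: "\<And>m n. \<lbrakk>m \<in> carrier M; n \<in> carrier N\<rbrakk> \<Longrightarrow> lin R P X (\<lambda>p. t p m n)"
  shows "bilin R P (T M N) X (\<lambda>p z. lift M N X (t p) z)"
  using trilin_lift_left[OF M N P X, of "\<lambda>m n p. t p m n", OF b l] by (auto simp: bilin_def)

abbreviation V :: "(('r, 'u) module, ('r, 'u) mod_arrow) sym_mon_cat" where "V \<equiv> fgp_modules R sc fs"

lemma V_Obj: "A \<in> Obj V \<longleftrightarrow> fgp A"
  unfolding fgp_modules_def Let_def by simp

lemma V_sel [simp]:
  "Unit V = K" "A \<boxtimes>\<^bsub>V\<^esub> B = T A B"
  "mdom (Idn V A) = A" "mcod (Idn V A) = A"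
  "mdom (g \<cdot>\<^bsub>V\<^esub> f) = mdom f" "mcod (g \<cdot>\<^bsub>V\<^esub> f) = mcod g"
  "mdom (f \<star>\<^bsub>V\<^esub> g) = T (mdom f) (mdom g)" "mcod (f \<star>\<^bsub>V\<^esub> g) = T (mcod f) (mcod g)"
  "mdom (Assoc V A B C) = T (T A B) C" "mcod (Assoc V A B C) = T A (T B C)"
  "mdom (AssocInv V A B C) = T A (T B C)" "mcod (AssocInv V A B C) = T (T A B) C"
  "mdom (LUnit V A) = T K A" "mcod (LUnit V A) = A" "mdom (LUnitInv V A) = A" "mcod (LUnitInv V A) = T K A"
  "mdom (RUnit V A) = T A K" "mcod (RUnit V A) = A" "mdom (RUnitInv V A) = A" "mcod (RUnitInv V A) = T A K"
  "mdom (Braid V A B) = T A B" "mcod (Braid V A B) = T B A"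
  unfolding fgp_modules_def Let_def by simp_all

lemma V_Obj_module [simp]: "A \<in> Obj V \<Longrightarrow> module R A"
  and V_Obj_K [simp]: "K \<in> Obj V"
  and V_Obj_T [simp]: "\<lbrakk>A \<in> Obj V; B \<in> Obj V\<rbrakk> \<Longrightarrow> T A B \<in> Obj V"
  using K_fgp T_fgp by (auto simp: V_Obj)

text \<open>The counterpart of \<open>ar\<close>, for computing typings of module maps before
  \<open>V\<close> is known to satisfy \<open>symmon\<close>.\<close>

definition arr :: "('r, 'u) mod_arrow \<Rightarrow> bool" where
  "arr f \<longleftrightarrow> mdom f \<in> Obj V \<and> mcod f \<in> Obj V \<and> mfun f \<in> mod_homs R (mdom f) (mcod f)"

lemma V_Hom: "f \<in> Hom V A B \<longleftrightarrow> mdom f = A \<and> mcod f = B \<and> mfun f \<in> mod_homs R A B"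
  unfolding fgp_modules_def Let_def by simp

lemma V_Hom_iff: "\<lbrakk>A \<in> Obj V; B \<in> Obj V\<rbrakk> \<Longrightarrow> f \<in> Hom V A B \<longleftrightarrow> arr f \<and> mdom f = A \<and> mcod f = B"
  unfolding V_Hom arr_def by blast

lemma arrD:
  assumes "arr f"
  shows arr_Obj [simp]: "mdom f \<in> Obj V" "mcod f \<in> Obj V" and arr_lin: "lin R (mdom f) (mcod f) (mfun f)"
    and arr_ext: "mfun f \<in> extensional (carrier (mdom f))"
  using assms by (auto simp: arr_def mod_homs_iff)

lemma mfun_closed [simp]: "\<lbrakk>arr f; mcod f = B; x \<in> carrier (mdom f)\<rbrakk> \<Longrightarrow> mfun f x \<in> carrier B"
  using lin_closed[OF arr_lin] by blast

lemma V_tn_closed [simp]: "\<lbrakk>A \<in> Obj V; B \<in> Obj V; a \<in> carrier A; b \<in> carrier B\<rbrakk> \<Longrightarrow> tn A B a b \<in> carrier (T A B)"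
  by (simp add: tn_closed)

lemma K_closed [simp]: "r \<in> carrier R \<Longrightarrow> sc r \<in> carrier K"
  by (rule sc_simps)

lemma V_Idn [simp]:
  shows "A \<in> Obj V \<Longrightarrow> arr (Idn V A)" "x \<in> carrier A \<Longrightarrow> mfun (Idn V A) x = x"
proof -
  show "x \<in> carrier A \<Longrightarrow> mfun (Idn V A) x = x" unfolding fgp_modules_def Let_def by simp
  assume A: "A \<in> Obj V"
  then interpret module R A by simp
  have "mfun (Idn V A) \<in> mod_homs R A A" unfolding fgp_modules_def Let_def by (simp add: mod_homs_iff lin_def)
  then show "arr (Idn V A)" using A unfolding arr_def by simp
qed

lemma V_Comp [simp]:
  assumes "arr f" "arr g" "mdom g = mcod f"
  shows "arr (g \<cdot>\<^bsub>V\<^esub> f)" "x \<in> carrier (mdom f) \<Longrightarrow> mfun (g \<cdot>\<^bsub>V\<^esub> f) x = mfun g (mfun f x)"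
proof -
  have e: "mfun (g \<cdot>\<^bsub>V\<^esub> f) = restrict (\<lambda>x. mfun g (mfun f x)) (carrier (mdom f))"
    unfolding fgp_modules_def Let_def by (simp add: compose_def)
  then show "x \<in> carrier (mdom f) \<Longrightarrow> mfun (g \<cdot>\<^bsub>V\<^esub> f) x = mfun g (mfun f x)" by simp
  have "lin R (mdom f) (mcod g) (\<lambda>x. mfun g (mfun f x))"
    using lin_comp[OF arr_lin[OF assms(1)], of "mcod g" "mfun g"] arr_lin[OF assms(2)] assms(3) by simp
  then have "lin R (mdom f) (mcod g) (mfun (g \<cdot>\<^bsub>V\<^esub> f))"
    by (rule lin_cong[rotated]) (use assms in \<open>simp_all add: e\<close>)
  then show "arr (g \<cdot>\<^bsub>V\<^esub> f)" using assms unfolding arr_def[of "g \<cdot>\<^bsub>V\<^esub> f"] by (simp add: mod_homs_iff e)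
qed

lemma V_TenA [simp]:
  assumes f: "arr f" and g: "arr g"
  shows "arr (f \<star>\<^bsub>V\<^esub> g)"
    "\<lbrakk>A = mdom f; B = mdom g; a \<in> carrier A; b \<in> carrier B\<rbrakk> \<Longrightarrow>
      mfun (f \<star>\<^bsub>V\<^esub> g) (tn A B a b) = tn (mcod f) (mcod g) (mfun f a) (mfun g b)"
proof -
  let ?b = "\<lambda>a b. tn (mcod f) (mcod g) (mfun f a) (mfun g b)"
  have m: "module R (mdom f)" "module R (mdom g)" "module R (mcod f)" "module R (mcod g)" using assms by simp_all
  note t = tn_bilin[OF m(3,4)]
  have b: "bilin R (mdom f) (mdom g) (T (mcod f) (mcod g)) ?b"
    by (rule bilinI; rule linI)
      (use bilinD[OF t] linD[OF arr_lin[OF f]] linD[OF arr_lin[OF g]] in \<open>simp_all add: lin_def Pi_iff\<close>)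
  have e: "mfun (f \<star>\<^bsub>V\<^esub> g) = (THE h. h \<in> mod_homs R (T (mdom f) (mdom g)) (T (mcod f) (mcod g)) \<and>
      (\<forall>m \<in> carrier (mdom f). \<forall>n \<in> carrier (mdom g). h (tn (mdom f) (mdom g) m n) = ?b m n))"
    unfolding fgp_modules_def Let_def by simp
  note the = tensor_the[OF m(1,2) T_module[OF m(3,4)] b, of "\<lambda>h. \<forall>m \<in> carrier (mdom f). \<forall>n \<in> carrier (mdom g). h (tn (mdom f) (mdom g) m n) = ?b m n", OF refl]
  show "arr (f \<star>\<^bsub>V\<^esub> g)" using the(1) assms unfolding arr_def by (simp add: e)
  show "\<lbrakk>A = mdom f; B = mdom g; a \<in> carrier A; b \<in> carrier B\<rbrakk> \<Longrightarrow>
      mfun (f \<star>\<^bsub>V\<^esub> g) (tn A B a b) = tn (mcod f) (mcod g) (mfun f a) (mfun g b)"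
    using the(2) by (simp add: e)
qed

lemma V_Braid [simp]:
  assumes A: "A \<in> Obj V" and B: "B \<in> Obj V"
  shows "arr (Braid V A B)" "\<lbrakk>a \<in> carrier A; b \<in> carrier B\<rbrakk> \<Longrightarrow> mfun (Braid V A B) (tn A B a b) = tn B A b a"
proof -
  have m: "module R A" "module R B" using assms by simp_all
  have b: "bilin R A B (T B A) (\<lambda>a b. tn B A b a)" using tn_bilin[OF m(2,1)] by (simp add: bilin_def)
  have e: "mfun (Braid V A B) = (THE h. h \<in> mod_homs R (T A B) (T B A) \<and>
      (\<forall>m \<in> carrier A. \<forall>n \<in> carrier B. h (tn A B m n) = tn B A n m))"
    unfolding fgp_modules_def Let_def by simp
  note the = tensor_the[OF m T_module[OF m(2,1)] b, of "\<lambda>h. \<forall>m \<in> carrier A. \<forall>n \<in> carrier B. h (tn A B m n) = tn B A n m", OF refl]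
  show "arr (Braid V A B)" using the(1) assms unfolding arr_def by (simp add: e)
  show "\<lbrakk>a \<in> carrier A; b \<in> carrier B\<rbrakk> \<Longrightarrow> mfun (Braid V A B) (tn A B a b) = tn B A b a"
    using the(2) by (simp add: e)
qed

lemma V_LUnit [simp]:
  assumes A: "A \<in> Obj V"
  shows "arr (LUnit V A)" "\<lbrakk>r \<in> carrier R; a \<in> carrier A\<rbrakk> \<Longrightarrow> mfun (LUnit V A) (tn K A (sc r) a) = r \<odot>\<^bsub>A\<^esub> a"
    "arr (LUnitInv V A)" "a \<in> carrier A \<Longrightarrow> mfun (LUnitInv V A) a = tn K A (sc \<one>) a"
    "arr (RUnit V A)" "\<lbrakk>r \<in> carrier R; a \<in> carrier A\<rbrakk> \<Longrightarrow> mfun (RUnit V A) (tn A K a (sc r)) = r \<odot>\<^bsub>A\<^esub> a"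
    "arr (RUnitInv V A)" "a \<in> carrier A \<Longrightarrow> mfun (RUnitInv V A) a = tn A K a (sc \<one>)"
proof -
  have m: "module R A" using assms by simp
  then interpret A: module R A .
  have l: "lin R K A (\<lambda>r. inv_into UNIV sc r \<odot>\<^bsub>A\<^esub> a)" if "a \<in> carrier A" for a
    by (rule lin_scale[OF K_module m unsc_lin that])
  have l': "lin R A A (\<lambda>a. inv_into UNIV sc r \<odot>\<^bsub>A\<^esub> a)" if "r \<in> carrier K" for r
    using lin_smult_map[OF m m, of "\<lambda>x. x" "inv_into UNIV sc r"] lin_closed[OF unsc_lin that] by (simp add: lin_def)
  have b: "bilin R K A A (\<lambda>r a. inv_into UNIV sc r \<odot>\<^bsub>A\<^esub> a)" "bilin R A K A (\<lambda>a r. inv_into UNIV sc r \<odot>\<^bsub>A\<^esub> a)"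
    using l l' by (simp_all add: bilin_def)
  have e: "mfun (LUnit V A) = (THE h. h \<in> mod_homs R (T K A) A \<and>
      (\<forall>r \<in> carrier R. \<forall>a \<in> carrier A. h (tn K A (sc r) a) = r \<odot>\<^bsub>A\<^esub> a))"
    "mfun (RUnit V A) = (THE h. h \<in> mod_homs R (T A K) A \<and>
      (\<forall>r \<in> carrier R. \<forall>a \<in> carrier A. h (tn A K a (sc r)) = r \<odot>\<^bsub>A\<^esub> a))"
    "mfun (LUnitInv V A) = (\<lambda>a \<in> carrier A. tn K A (sc \<one>) a)"
    "mfun (RUnitInv V A) = (\<lambda>a \<in> carrier A. tn A K a (sc \<one>))"
    unfolding fgp_modules_def Let_def by simp_all
  have "\<And>h. h \<in> mod_homs R (T K A) A \<Longrightarrow> (\<forall>r \<in> carrier R. \<forall>a \<in> carrier A. h (tn K A (sc r) a) = r \<odot>\<^bsub>A\<^esub> a)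
      \<longleftrightarrow> (\<forall>r \<in> carrier K. \<forall>a \<in> carrier A. h (tn K A r a) = inv_into UNIV sc r \<odot>\<^bsub>A\<^esub> a)"
    by (auto simp: K_carrier sc_simps)
  note L = tensor_the[OF K_module m m b(1), of "\<lambda>h. \<forall>r \<in> carrier R. \<forall>a \<in> carrier A. h (tn K A (sc r) a) = r \<odot>\<^bsub>A\<^esub> a", OF this]
  have "\<And>h. h \<in> mod_homs R (T A K) A \<Longrightarrow> (\<forall>r \<in> carrier R. \<forall>a \<in> carrier A. h (tn A K a (sc r)) = r \<odot>\<^bsub>A\<^esub> a)
      \<longleftrightarrow> (\<forall>a \<in> carrier A. \<forall>r \<in> carrier K. h (tn A K a r) = inv_into UNIV sc r \<odot>\<^bsub>A\<^esub> a)"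
    by (auto simp: K_carrier sc_simps)
  note R = tensor_the[OF m K_module m b(2), of "\<lambda>h. \<forall>r \<in> carrier R. \<forall>a \<in> carrier A. h (tn A K a (sc r)) = r \<odot>\<^bsub>A\<^esub> a", OF this]
  show "arr (LUnit V A)" "arr (RUnit V A)" using L(1) R(1) assms unfolding arr_def by (simp_all add: e)
  show "\<lbrakk>r \<in> carrier R; a \<in> carrier A\<rbrakk> \<Longrightarrow> mfun (LUnit V A) (tn K A (sc r) a) = r \<odot>\<^bsub>A\<^esub> a"
    using L(2)[of "sc r" a] by (simp add: e sc_simps)
  show "\<lbrakk>r \<in> carrier R; a \<in> carrier A\<rbrakk> \<Longrightarrow> mfun (RUnit V A) (tn A K a (sc r)) = r \<odot>\<^bsub>A\<^esub> a"
    using R(2)[of a "sc r"] by (simp add: e sc_simps)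
  show "a \<in> carrier A \<Longrightarrow> mfun (LUnitInv V A) a = tn K A (sc \<one>) a"
    "a \<in> carrier A \<Longrightarrow> mfun (RUnitInv V A) a = tn A K a (sc \<one>)" by (simp_all add: e)
  have "lin R A (T K A) (tn K A (sc \<one>))" "lin R A (T A K) (\<lambda>a. tn A K a (sc \<one>))"
    using bilinD(2)[OF tn_bilin[OF K_module m]] bilinD(1)[OF tn_bilin[OF m K_module]] by simp_all
  then have "lin R A (T K A) (mfun (LUnitInv V A))" "lin R A (T A K) (mfun (RUnitInv V A))"
    by (auto simp: e intro: lin_cong[OF m])
  then show "arr (LUnitInv V A)" "arr (RUnitInv V A)" using assms unfolding arr_def by (simp_all add: mod_homs_iff e)
qed

lemma V_Assoc [simp]:
  assumes A: "A \<in> Obj V" and B: "B \<in> Obj V" and C: "C \<in> Obj V"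
  shows "arr (Assoc V A B C)" "arr (AssocInv V A B C)"
    "\<lbrakk>a \<in> carrier A; b \<in> carrier B; c \<in> carrier C\<rbrakk> \<Longrightarrow>
      mfun (Assoc V A B C) (tn (T A B) C (tn A B a b) c) = tn A (T B C) a (tn B C b c)"
    "\<lbrakk>a \<in> carrier A; b \<in> carrier B; c \<in> carrier C\<rbrakk> \<Longrightarrow>
      mfun (AssocInv V A B C) (tn A (T B C) a (tn B C b c)) = tn (T A B) C (tn A B a b) c"
proof -
  have m: "module R A" "module R B" "module R C" using assms by simp_all
  note AB = T_module[OF m(1,2)] and BC = T_module[OF m(2,3)]
  note X = T_module[OF m(1) BC] and Y = T_module[OF AB m(3)]
  note t = tn_bilin[OF m(1) BC] tn_bilin[OF m(2,3)] tn_bilin[OF AB m(3)] tn_bilin[OF m(1,2)]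
  let ?t = "\<lambda>a b c. tn A (T B C) a (tn B C b c)" and ?s = "\<lambda>a b c. tn (T A B) C (tn A B a b) c"
  note ll = lin_comp[OF bilinD(2)[OF t(2)] bilinD(2)[OF t(1)]] lin_comp[OF bilinD(1)[OF t(2)] bilinD(2)[OF t(1)]]
    lin_comp[OF bilinD(2)[OF t(4)] bilinD(1)[OF t(3)]] lin_comp[OF bilinD(1)[OF t(4)] bilinD(1)[OF t(3)]]
  have bt: "bilin R A B (T A (T B C)) (\<lambda>a b. ?t a b c)" if "c \<in> carrier C" for c
    by (rule bilinI) (use that bilinD(1)[OF t(1)] ll tn_closed m in auto)
  have bs: "bilin R B C (T (T A B) C) (\<lambda>b c. ?s a b c)" if "a \<in> carrier A" for a
    by (rule bilinI) (use that bilinD(2)[OF t(3)] ll tn_closed m in auto)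
  have lt: "lin R C (T A (T B C)) (?t a b)" if "a \<in> carrier A" "b \<in> carrier B" for a b using ll that by auto
  have ls: "lin R A (T (T A B) C) (\<lambda>a. ?s a b c)" if "b \<in> carrier B" "c \<in> carrier C" for b c using ll that by auto
  have e: "mfun (Assoc V A B C) = (THE h. h \<in> mod_homs R (T (T A B) C) (T A (T B C)) \<and>
      (\<forall>a \<in> carrier A. \<forall>b \<in> carrier B. \<forall>c \<in> carrier C. h (?s a b c) = ?t a b c))"
    "mfun (AssocInv V A B C) = (THE h. h \<in> mod_homs R (T A (T B C)) (T (T A B) C) \<and>
      (\<forall>a \<in> carrier A. \<forall>b \<in> carrier B. \<forall>c \<in> carrier C. h (?t a b c) = ?s a b c))"
    unfolding fgp_modules_def Let_def by simp_all
  note Lt = lift[OF m(1,2) X bt] and Ls = lift[OF m(2,3) Y bs]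
  have bf: "bilin R (T A B) C (T A (T B C)) (\<lambda>z c. lift A B (T A (T B C)) (\<lambda>a b. ?t a b c) z)"
    by (rule trilin_lift_left[OF m X bt lt])
  have bg: "bilin R A (T B C) (T (T A B) C) (\<lambda>a z. lift B C (T (T A B) C) (?s a) z)"
    by (rule trilin_lift_right[OF m(2,3,1) Y bs ls])
  \<comment> \<open>The condition on triples that defines the associator is brought into the form
    expected by \<open>tensor_the\<close>, a condition on pairs from \<open>T A B\<close> and
    \<open>C\<close>.\<close>
  have "(\<forall>a \<in> carrier A. \<forall>b \<in> carrier B. \<forall>c \<in> carrier C. h (?s a b c) = ?t a b c)
    \<longleftrightarrow> (\<forall>z \<in> carrier (T A B). \<forall>c \<in> carrier C. h (tn (T A B) C z c) = lift A B (T A (T B C)) (\<lambda>a b. ?t a b c) z)"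
    if "h \<in> mod_homs R (T (T A B) C) (T A (T B C))" for h
  proof (intro iffI ballI)
    fix z c assume *: "\<forall>a \<in> carrier A. \<forall>b \<in> carrier B. \<forall>c \<in> carrier C. h (?s a b c) = ?t a b c"
      and z: "z \<in> carrier (T A B)" and c: "c \<in> carrier C"
    show "h (tn (T A B) C z c) = lift A B (T A (T B C)) (\<lambda>a b. ?t a b c) z"
      by (rule tensor_lin_eq[OF m(1,2) X lin_comp[OF bilinD(1)[OF t(3) c]] Lt(1)[OF c] _ z])
        (use that * c in \<open>simp_all add: mod_homs_iff Lt(2)\<close>)
  qed (simp add: Lt(2) tn_closed m)
  note F = tensor_the[OF AB m(3) X bf,
      of "\<lambda>h. \<forall>a \<in> carrier A. \<forall>b \<in> carrier B. \<forall>c \<in> carrier C. h (?s a b c) = ?t a b c", OF this]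
  have "(\<forall>a \<in> carrier A. \<forall>b \<in> carrier B. \<forall>c \<in> carrier C. h (?t a b c) = ?s a b c)
    \<longleftrightarrow> (\<forall>a \<in> carrier A. \<forall>z \<in> carrier (T B C). h (tn A (T B C) a z) = lift B C (T (T A B) C) (?s a) z)"
    if "h \<in> mod_homs R (T A (T B C)) (T (T A B) C)" for h
  proof (intro iffI ballI)
    fix a z assume *: "\<forall>a \<in> carrier A. \<forall>b \<in> carrier B. \<forall>c \<in> carrier C. h (?t a b c) = ?s a b c"
      and z: "z \<in> carrier (T B C)" and a: "a \<in> carrier A"
    show "h (tn A (T B C) a z) = lift B C (T (T A B) C) (?s a) z"
      by (rule tensor_lin_eq[OF m(2,3) Y lin_comp[OF bilinD(2)[OF t(1) a]] Ls(1)[OF a] _ z])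
        (use that * a in \<open>simp_all add: mod_homs_iff Ls(2)\<close>)
  qed (simp add: Ls(2) tn_closed m)
  note G = tensor_the[OF m(1) BC Y bg,
      of "\<lambda>h. \<forall>a \<in> carrier A. \<forall>b \<in> carrier B. \<forall>c \<in> carrier C. h (?t a b c) = ?s a b c", OF this]
  show "arr (Assoc V A B C)" "arr (AssocInv V A B C)" using F(1) G(1) assms unfolding arr_def by (simp_all add: e)
  show "mfun (Assoc V A B C) (?s a b c) = ?t a b c" if "a \<in> carrier A" "b \<in> carrier B" "c \<in> carrier C"
    unfolding e using F(2)[of "tn A B a b" c] that by (simp add: Lt(2) tn_closed m)
  show "mfun (AssocInv V A B C) (?t a b c) = ?s a b c" if "a \<in> carrier A" "b \<in> carrier B" "c \<in> carrier C"
    unfolding e using G(2)[of a "tn B C b c"] that by (simp add: Ls(2) tn_closed m)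
qed

end

text \<open>Generation by sums alone, in the form of an induction principle. Linear maps are
  determined on such a set, and for iterated tensor products it may consist of pure tensors of pure
  tensors.\<close>

definition spans :: "('r, 'm) module \<Rightarrow> 'm set \<Rightarrow> bool" where
  "spans M S \<longleftrightarrow> S \<subseteq> carrier M \<and> (\<forall>Q. (\<forall>s \<in> S. Q s) \<longrightarrow>
     (\<forall>x \<in> carrier M. \<forall>y \<in> carrier M. Q x \<longrightarrow> Q y \<longrightarrow> Q (x \<oplus>\<^bsub>M\<^esub> y)) \<longrightarrow> (\<forall>x \<in> carrier M. Q x))"

lemma spans_carrier: "spans M (carrier M)"
  by (simp add: spans_def)

lemma spans_induct:
  assumes "spans M S" "x \<in> carrier M" "\<And>s. s \<in> S \<Longrightarrow> Q s"
    "\<And>x y. \<lbrakk>x \<in> carrier M; y \<in> carrier M; Q x; Q y\<rbrakk> \<Longrightarrow> Q (x \<oplus>\<^bsub>M\<^esub> y)"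
  shows "Q x"
  using assms(1)[unfolded spans_def, THEN conjunct2, rule_format, of Q x] assms(2-4) by blast

lemma spans_lin_eq:
  assumes "spans M S" "lin R M P f" "lin R M P g" "\<And>s. s \<in> S \<Longrightarrow> f s = g s" "x \<in> carrier M"
  shows "f x = g x"
  using assms(1,5) by (rule spans_induct) (simp_all add: assms(4) lin_add[OF assms(2)] lin_add[OF assms(3)])

context module_universe
begin

text \<open>Additivity in one factor at a time extends \<open>Q\<close> from tensors of generators
  to all pure tensors, and \<open>tensor_induct\<close> does the rest.\<close>

lemma spans_T:
  assumes M: "module R M" and N: "module R N" and S: "spans M S" and S': "spans N S'"
  shows "spans (T M N) {tn M N s s' | s s'. s \<in> S \<and> s' \<in> S'}" (is "spans _ ?G")
  unfolding spans_def
proof (intro conjI allI impI ballI)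
  have SS: "S \<subseteq> carrier M" "S' \<subseteq> carrier N" using S S' by (simp_all add: spans_def)
  then show "?G \<subseteq> carrier (T M N)" using tn_closed[OF M N] by blast
  fix Q x
  assume Q: "\<forall>s \<in> ?G. Q s" and add: "\<forall>x \<in> carrier (T M N). \<forall>y \<in> carrier (T M N). Q x \<longrightarrow> Q y \<longrightarrow> Q (x \<oplus>\<^bsub>T M N\<^esub> y)"
    and x: "x \<in> carrier (T M N)"
  have 1: "Q (tn M N m s')" if "m \<in> carrier M" "s' \<in> S'" for m s'
    using S that(1)
  proof (rule spans_induct)
    fix x y assume "x \<in> carrier M" "y \<in> carrier M" "Q (tn M N x s')" "Q (tn M N y s')"
    then show "Q (tn M N (x \<oplus>\<^bsub>M\<^esub> y) s')"
      using add lin_add[OF bilinD(1)[OF tn_bilin[OF M N]]] that(2) SS(2) tn_closed[OF M N] by auto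
  qed (use Q that in blast)
  have 2: "Q (tn M N m n)" if "m \<in> carrier M" "n \<in> carrier N" for m n
    using S' that(2)
  proof (rule spans_induct)
    fix x y assume "x \<in> carrier N" "y \<in> carrier N" "Q (tn M N m x)" "Q (tn M N m y)"
    then show "Q (tn M N m (x \<oplus>\<^bsub>N\<^esub> y))"
      using add lin_add[OF bilinD(2)[OF tn_bilin[OF M N]]] that(1) tn_closed[OF M N] by auto
  qed (use 1 that in blast)
  show "Q x" using x by (induction rule: tensor_induct[OF M N, consumes 1, case_names pure add]) (use 2 add in auto)
qed

text \<open>In this form an element of \<open>K\<close> comes with a scalar, which can then be moved
  across tensor factors.\<close>

lemma spans_K: "spans K (sc ` carrier R)"
  using spans_carrier[of K] by (simp add: K_carrier)

lemma arr_eqI: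
  assumes "arr f" "arr g" "mdom f = A" "mdom g = A" "mcod f = mcod g" "spans A S"
    and "\<And>s. s \<in> S \<Longrightarrow> mfun f s = mfun g s"
  shows "f = g"
proof (rule mod_arrow.equality)
  show "mfun f = mfun g"
  proof (rule extensionalityI[of _ "carrier A"])
    show "mfun f x = mfun g x" if "x \<in> carrier A" for x
      by (rule spans_lin_eq[OF assms(6) _ _ assms(7) that])
        (use assms(3-5) arr_lin[OF assms(1)] arr_lin[OF assms(2)] in auto)
  qed (use arr_ext[OF assms(1)] arr_ext[OF assms(2)] assms(3,4) in auto)
qed (use assms in simp_all)

lemma arr_eq1:
  assumes "arr f" "arr g" "mdom f = A" "mdom g = A" "mcod f = mcod g" "A \<in> Obj V"
    "\<And>a. a \<in> carrier A \<Longrightarrow> mfun f a = mfun g a"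
  shows "f = g"
  using assms(1-5) spans_carrier assms(7) by (rule arr_eqI)

lemma arr_eq2:
  assumes "arr f" "arr g" "mdom f = T A B" "mdom g = T A B" "mcod f = mcod g" "A \<in> Obj V" "B \<in> Obj V"
    "\<And>a b. \<lbrakk>a \<in> carrier A; b \<in> carrier B\<rbrakk> \<Longrightarrow> mfun f (tn A B a b) = mfun g (tn A B a b)"
  shows "f = g"
  by (rule arr_eqI[OF assms(1-5) spans_T[OF _ _ spans_carrier spans_carrier]]) (use assms in auto)

lemma arr_eq3:
  assumes "arr f" "arr g" "mdom f = T (T A B) C" "mdom g = T (T A B) C" "mcod f = mcod g"
    "A \<in> Obj V" "B \<in> Obj V" "C \<in> Obj V"
    "\<And>a b c. \<lbrakk>a \<in> carrier A; b \<in> carrier B; c \<in> carrier C\<rbrakk> \<Longrightarrow>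
      mfun f (tn (T A B) C (tn A B a b) c) = mfun g (tn (T A B) C (tn A B a b) c)"
  shows "f = g"
  by (rule arr_eqI[OF assms(1-5) spans_T[OF _ _ spans_T[OF _ _ spans_carrier spans_carrier] spans_carrier]])
    (use assms in auto)

lemma arr_eq4:
  assumes "arr f" "arr g" "mdom f = T (T A B) (T C D)" "mdom g = T (T A B) (T C D)" "mcod f = mcod g"
    "A \<in> Obj V" "B \<in> Obj V" "C \<in> Obj V" "D \<in> Obj V"
    "\<And>a b c d. \<lbrakk>a \<in> carrier A; b \<in> carrier B; c \<in> carrier C; d \<in> carrier D\<rbrakk> \<Longrightarrow>
      mfun f (tn (T A B) (T C D) (tn A B a b) (tn C D c d)) = mfun g (tn (T A B) (T C D) (tn A B a b) (tn C D c d))"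
  shows "f = g"
  by (rule arr_eqI[OF assms(1-5) spans_T[OF _ _ spans_T[OF _ _ spans_carrier spans_carrier]
        spans_T[OF _ _ spans_carrier spans_carrier]]]) (use assms in auto)

lemma tn_smult:
  assumes "module R M" "module R N" "r \<in> carrier R" "m \<in> carrier M" "n \<in> carrier N"
  shows "tn M N (r \<odot>\<^bsub>M\<^esub> m) n = r \<odot>\<^bsub>T M N\<^esub> tn M N m n" "tn M N m (r \<odot>\<^bsub>N\<^esub> n) = r \<odot>\<^bsub>T M N\<^esub> tn M N m n"
  using lin_smult[OF bilinD(1)[OF tn_bilin[OF assms(1,2)] assms(5)] assms(3,4)]
    lin_smult[OF bilinD(2)[OF tn_bilin[OF assms(1,2)] assms(4)] assms(3,5)] by simp_all

lemma V_mid4 [simp]: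
  assumes "A \<in> Obj V" "B \<in> Obj V" "C \<in> Obj V" "D \<in> Obj V"
  shows "arr (mid4 V A B C D)" "mdom (mid4 V A B C D) = T (T A B) (T C D)" "mcod (mid4 V A B C D) = T (T A C) (T B D)"
    "\<lbrakk>a \<in> carrier A; b \<in> carrier B; c \<in> carrier C; d \<in> carrier D\<rbrakk> \<Longrightarrow>
      mfun (mid4 V A B C D) (tn (T A B) (T C D) (tn A B a b) (tn C D c d)) = tn (T A C) (T B D) (tn A C a c) (tn B D b d)"
  unfolding mid4_def using assms by simp_all

lemma V_category: "category V"
proof
  fix A B C D f g h
  assume o: "A \<in> Obj V" "B \<in> Obj V" "C \<in> Obj V" "D \<in> Obj V"
    and fgh: "f \<in> Hom V A B" "g \<in> Hom V B C" "h \<in> Hom V C D"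
  show "(h \<cdot>\<^bsub>V\<^esub> g) \<cdot>\<^bsub>V\<^esub> f = h \<cdot>\<^bsub>V\<^esub> (g \<cdot>\<^bsub>V\<^esub> f)"
    by (rule arr_eq1[of _ _ A]) (use o fgh in \<open>auto simp: V_Hom_iff\<close>)
next
  fix A B f assume "A \<in> Obj V" "B \<in> Obj V" "f \<in> Hom V A B"
  then show "f \<cdot>\<^bsub>V\<^esub> Idn V A = f" "Idn V B \<cdot>\<^bsub>V\<^esub> f = f"
    by (auto simp: V_Hom_iff intro!: arr_eq1[of _ _ A])
qed (auto simp: V_Hom_iff)

text \<open>Each equation between arrows is an equation of linear maps and is compared on elements
  or pure tensors, where the rewrite rules compute both sides. If unit factors are involved, scalars
  have to be moved between the factors in addition.\<close>

lemma V_symmon: "symmon V mdom mcod"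
proof (rule symmon.intro[OF V_category], rule symmon_axioms.intro, unfold V_sel)
  fix A A' A'' B B' B'' f f' g g'
  assume "A \<in> Obj V" "A' \<in> Obj V" "A'' \<in> Obj V" "B \<in> Obj V" "B' \<in> Obj V" "B'' \<in> Obj V"
    "f \<in> Hom V A A'" "f' \<in> Hom V A' A''" "g \<in> Hom V B B'" "g' \<in> Hom V B' B''"
  then show "(f' \<star>\<^bsub>V\<^esub> g') \<cdot>\<^bsub>V\<^esub> (f \<star>\<^bsub>V\<^esub> g) = (f' \<cdot>\<^bsub>V\<^esub> f) \<star>\<^bsub>V\<^esub> (g' \<cdot>\<^bsub>V\<^esub> g)"
    by (intro arr_eq2[of _ _ A B]) (auto simp: V_Hom_iff)
next
  fix A B assume "A \<in> Obj V" "B \<in> Obj V"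
  then show "Idn V A \<star>\<^bsub>V\<^esub> Idn V B = Idn V (T A B)" by (intro arr_eq2[of _ _ A B]) auto
next
  fix A A' B B' C C' f g h
  assume "A \<in> Obj V" "A' \<in> Obj V" "B \<in> Obj V" "B' \<in> Obj V" "C \<in> Obj V" "C' \<in> Obj V"
    "f \<in> Hom V A A'" "g \<in> Hom V B B'" "h \<in> Hom V C C'"
  then show "Assoc V A' B' C' \<cdot>\<^bsub>V\<^esub> ((f \<star>\<^bsub>V\<^esub> g) \<star>\<^bsub>V\<^esub> h) = (f \<star>\<^bsub>V\<^esub> (g \<star>\<^bsub>V\<^esub> h)) \<cdot>\<^bsub>V\<^esub> Assoc V A B C"
    by (intro arr_eq3[of _ _ A B C]) (auto simp: V_Hom_iff)
next
  fix A A' B B' C C' D D' f g h k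
  assume "A \<in> Obj V" "A' \<in> Obj V" "B \<in> Obj V" "B' \<in> Obj V" "C \<in> Obj V" "C' \<in> Obj V" "D \<in> Obj V" "D' \<in> Obj V"
    "f \<in> Hom V A A'" "g \<in> Hom V B B'" "h \<in> Hom V C C'" "k \<in> Hom V D D'"
  then show "mid4 V A' B' C' D' \<cdot>\<^bsub>V\<^esub> ((f \<star>\<^bsub>V\<^esub> g) \<star>\<^bsub>V\<^esub> (h \<star>\<^bsub>V\<^esub> k)) = ((f \<star>\<^bsub>V\<^esub> h) \<star>\<^bsub>V\<^esub> (g \<star>\<^bsub>V\<^esub> k)) \<cdot>\<^bsub>V\<^esub> mid4 V A B C D"
    by (intro arr_eq4[of _ _ A B C D]) (auto simp: V_Hom_iff)
next
  \<comment> \<open>Every element of \<open>K\<close> is a multiple of \<open>sc \<one>\<close>.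
    After the scalars are pulled out, all four factors are equal and exchanging two of them changes
    nothing.\<close>
  have e: "sc r = r \<odot>\<^bsub>K\<^esub> sc \<one>" if "r \<in> carrier R" for r using that by (simp add: sc_simps)
  interpret K: module R K by (rule K_module)
  interpret KK: module R "T K K" by (rule T_module[OF K_module K_module])
  interpret KKKK: module R "T (T K K) (T K K)" by (rule T_module[OF KK.module_axioms KK.module_axioms])
  show "mid4 V K K K K = Idn V (T (T K K) (T K K))"
  proof (rule arr_eqI[OF _ _ _ _ _ spans_T[OF _ _ spans_T[OF _ _ spans_K spans_K] spans_T[OF _ _ spans_K spans_K]]])
    fix s assume "s \<in> {tn (T K K) (T K K) s s' |s s'. s \<in> {tn K K s s' |s s'. s \<in> sc ` carrier R \<and> s' \<in> sc ` carrier R} \<and>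
      s' \<in> {tn K K s s' |s s'. s \<in> sc ` carrier R \<and> s' \<in> sc ` carrier R}}"
    then obtain a b c d where s: "s = tn (T K K) (T K K) (tn K K (sc a) (sc b)) (tn K K (sc c) (sc d))"
      and [simp]: "a \<in> carrier R" "b \<in> carrier R" "c \<in> carrier R" "d \<in> carrier R" by blast
    have "tn (T K K) (T K K) (tn K K (sc a) (sc b)) (tn K K (sc c) (sc d)) = tn (T K K) (T K K) (tn K K (sc a) (sc c)) (tn K K (sc b) (sc d))"
      unfolding e[OF \<open>a \<in> carrier R\<close>] e[OF \<open>b \<in> carrier R\<close>] e[OF \<open>c \<in> carrier R\<close>] e[OF \<open>d \<in> carrier R\<close>]
      by (simp add: tn_smult module_left_commute[OF KKKK.module_axioms])
    then show "mfun (mid4 V K K K K) s = mfun (Idn V (T (T K K) (T K K))) s" by (simp add: s)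
  qed simp_all
next
  fix A assume A: "A \<in> Obj V"
  have e: "sc r = r \<odot>\<^bsub>K\<^esub> sc \<one>" if "r \<in> carrier R" for r using that by (simp add: sc_simps)
  interpret A: module R A using A by simp
  show "LUnit V A \<cdot>\<^bsub>V\<^esub> LUnitInv V A = Idn V A" "RUnit V A \<cdot>\<^bsub>V\<^esub> RUnitInv V A = Idn V A"
    by (rule arr_eq1[of _ _ A]; use A in simp)+
  show "Assoc V K K A \<cdot>\<^bsub>V\<^esub> (LUnitInv V K \<star>\<^bsub>V\<^esub> Idn V A) = Idn V K \<star>\<^bsub>V\<^esub> LUnitInv V A"
  proof (rule arr_eqI[OF _ _ _ _ _ spans_T[OF _ _ spans_K spans_carrier]])
    fix s assume "s \<in> {tn K A s s' |s s'. s \<in> sc ` carrier R \<and> s' \<in> carrier A}"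
    then obtain r a where s: "s = tn K A (sc r) a" and [simp]: "r \<in> carrier R" "a \<in> carrier A" by blast
    have "tn K (T K A) (sc \<one>) (tn K A (sc r) a) = tn K (T K A) (sc r) (tn K A (sc \<one>) a)"
      unfolding e[OF \<open>r \<in> carrier R\<close>] using A by (simp add: tn_smult)
    then show "mfun (Assoc V K K A \<cdot>\<^bsub>V\<^esub> (LUnitInv V K \<star>\<^bsub>V\<^esub> Idn V A)) s = mfun (Idn V K \<star>\<^bsub>V\<^esub> LUnitInv V A) s"
      using A by (simp add: s)
  qed (use A in simp_all)
  show "Assoc V A K K \<cdot>\<^bsub>V\<^esub> (RUnitInv V A \<star>\<^bsub>V\<^esub> Idn V K) = Idn V A \<star>\<^bsub>V\<^esub> LUnitInv V K"
    by (rule arr_eq2[of _ _ A K]) (use A in auto)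
  show "Assoc V K A K \<cdot>\<^bsub>V\<^esub> (LUnitInv V A \<star>\<^bsub>V\<^esub> Idn V K) \<cdot>\<^bsub>V\<^esub> RUnitInv V A = (Idn V K \<star>\<^bsub>V\<^esub> RUnitInv V A) \<cdot>\<^bsub>V\<^esub> LUnitInv V A"
    by (rule arr_eq1[of _ _ A]) (use A in auto)
  show "LUnitInv V A \<cdot>\<^bsub>V\<^esub> LUnit V A = Idn V (T K A)"
  proof (rule arr_eqI[OF _ _ _ _ _ spans_T[OF _ _ spans_K spans_carrier]])
    fix s assume "s \<in> {tn K A s s' |s s'. s \<in> sc ` carrier R \<and> s' \<in> carrier A}"
    then obtain r a where s: "s = tn K A (sc r) a" and [simp]: "r \<in> carrier R" "a \<in> carrier A" by blast
    have "tn K A (sc r) a = tn K A (sc \<one>) (r \<odot>\<^bsub>A\<^esub> a)" unfolding e[OF \<open>r \<in> carrier R\<close>] using A by (simp add: tn_smult)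
    then show "mfun (LUnitInv V A \<cdot>\<^bsub>V\<^esub> LUnit V A) s = mfun (Idn V (T K A)) s" using A by (simp add: s)
  qed (use A in simp_all)
  show "RUnitInv V A \<cdot>\<^bsub>V\<^esub> RUnit V A = Idn V (T A K)"
  proof (rule arr_eqI[OF _ _ _ _ _ spans_T[OF _ _ spans_carrier spans_K]])
    fix s assume "s \<in> {tn A K s s' |s s'. s \<in> carrier A \<and> s' \<in> sc ` carrier R}"
    then obtain r a where s: "s = tn A K a (sc r)" and [simp]: "r \<in> carrier R" "a \<in> carrier A" by blast
    have "tn A K a (sc r) = tn A K (r \<odot>\<^bsub>A\<^esub> a) (sc \<one>)" unfolding e[OF \<open>r \<in> carrier R\<close>] using A by (simp add: tn_smult)
    then show "mfun (RUnitInv V A \<cdot>\<^bsub>V\<^esub> RUnit V A) s = mfun (Idn V (T A K)) s" using A by (simp add: s)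
  qed (use A in simp_all)
next
  fix A B f assume o: "A \<in> Obj V" "B \<in> Obj V" "f \<in> Hom V A B"
  then have [simp]: "A \<in> Obj V" "B \<in> Obj V" "arr f" "mdom f = A" "mcod f = B" by (auto simp: V_Hom_iff)
  have l: "mfun f (r \<odot>\<^bsub>A\<^esub> a) = r \<odot>\<^bsub>B\<^esub> mfun f a" if "r \<in> carrier R" "a \<in> carrier A" for r a
    using lin_smult[OF arr_lin[of f]] that by simp
  interpret A: module R A by simp
  show "LUnit V B \<cdot>\<^bsub>V\<^esub> (Idn V K \<star>\<^bsub>V\<^esub> f) = f \<cdot>\<^bsub>V\<^esub> LUnit V A"
    by (rule arr_eqI[OF _ _ _ _ _ spans_T[OF _ _ spans_K spans_carrier], of _ _ A]) (auto simp: l)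
  show "RUnit V B \<cdot>\<^bsub>V\<^esub> (f \<star>\<^bsub>V\<^esub> Idn V K) = f \<cdot>\<^bsub>V\<^esub> RUnit V A"
    by (rule arr_eqI[OF _ _ _ _ _ spans_T[OF _ _ spans_carrier spans_K], of _ _ A]) (auto simp: l)
next
  show "RUnitInv V K = LUnitInv V K"
  proof (rule arr_eqI[OF _ _ _ _ _ spans_K])
    have e: "sc r = r \<odot>\<^bsub>K\<^esub> sc \<one>" if "r \<in> carrier R" for r using that by (simp add: sc_simps)
    fix s assume "s \<in> sc ` carrier R"
    then obtain r where s: "s = sc r" and [simp]: "r \<in> carrier R" by blast
    have "tn K K (sc r) (sc \<one>) = tn K K (sc \<one>) (sc r)"
      unfolding e[OF \<open>r \<in> carrier R\<close>] by (simp add: tn_smult)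
    then show "mfun (RUnitInv V K) s = mfun (LUnitInv V K) s" by (simp add: s)
  qed simp_all
next
  show "f \<in> Hom V A B \<Longrightarrow> mdom f = A \<and> mcod f = B" for f A B by (simp add: V_Hom)
qed (auto simp: V_Hom_iff)

lemma V_oprev_symmon: "oprev_symmon V mdom mcod"
proof (rule oprev_symmon.intro[OF V_symmon], rule oprev_symmon_axioms.intro)
  fix A B C D assume o: "A \<in> Obj V" "B \<in> Obj V" "C \<in> Obj V" "D \<in> Obj V"
  show "mid4 (oprev V) A B C D = mid4 V D B C A"
    by (rule arr_eq4[of _ _ D B C A]) (use o in \<open>simp_all add: mid4_def[of "oprev V"]\<close>)
qed

section \<open>Dual modules\<close>

text \<open>One dual basis per module, chosen once and for all, so that the codes of functionals
  depend on the module alone.\<close>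

definition cbasis :: "('r, 'u) module \<Rightarrow> 'u set \<times> ('u \<Rightarrow> 'u \<Rightarrow> 'r)" where
  "cbasis M = (SOME (S, \<phi>). S \<subseteq> carrier M \<and> dbasis R M S (\<lambda>s. s) \<phi>)"

definition bas :: "('r, 'u) module \<Rightarrow> 'u set" where "bas M = fst (cbasis M)"
definition cf :: "('r, 'u) module \<Rightarrow> 'u \<Rightarrow> 'u \<Rightarrow> 'r" where "cf M = snd (cbasis M)"

text \<open>
  The carrier of the dual has to be in the type \<open>'u\<close>, so a functional is coded by its values on the
  generators \<open>bas M\<close>, which determine it.
\<close>

definition functionals :: "('r, 'u) module \<Rightarrow> ('u \<Rightarrow> 'r) set" where
  "functionals M = {\<phi>. lin R M (reg R) \<phi> \<and> \<phi> \<in> extensional (carrier M)}"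

definition code :: "('r, 'u) module \<Rightarrow> ('u \<Rightarrow> 'r) \<Rightarrow> 'u" where "code M = enc (bas M)"
text \<open>Decoding of functionals: \<open>ev M u x\<close> is the pairing of an element
  \<open>u\<close> of the dual with an element \<open>x\<close> of \<open>M\<close>.\<close>

definition ev :: "('r, 'u) module \<Rightarrow> 'u \<Rightarrow> 'u \<Rightarrow> 'r" where "ev M = inv_into (functionals M) (code M)"

definition dual :: "('r, 'u) module \<Rightarrow> ('r, 'u) module" where
  "dual M = coded_module (code M) (fun_module R (carrier M) (functionals M))"

lemma reg_mod [simp]: "module R (reg R)"
  by (rule reg_module[OF is_cring])

lemma bas:
  assumes "A \<in> Obj V"
  shows "bas A \<subseteq> carrier A" "dbasis R A (bas A) (\<lambda>s. s) (cf A)"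
proof -
  have "\<exists>p. case p of (S, \<phi>) \<Rightarrow> S \<subseteq> carrier A \<and> dbasis R A S (\<lambda>s. s) \<phi>"
    using fgp_dbasis[of A] assms by (auto simp: V_Obj)
  from someI_ex[OF this] show "bas A \<subseteq> carrier A" "dbasis R A (bas A) (\<lambda>s. s) (cf A)"
    by (simp_all add: bas_def cf_def cbasis_def case_prod_unfold)
qed

lemma bas_simps [simp]:
  assumes "A \<in> Obj V"
  shows "finite (bas A)" "s \<in> bas A \<Longrightarrow> s \<in> carrier A" "s \<in> bas A \<Longrightarrow> lin R A (reg R) (cf A s)"
    "\<lbrakk>s \<in> bas A; x \<in> carrier A\<rbrakk> \<Longrightarrow> cf A s x \<in> carrier R"
  using dbasisD(1,3)[OF bas(2)[OF assms]] dbasis_coeff[OF bas(2)[OF assms]] bas(1)[OF assms] by auto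

lemma bas_sum: "\<lbrakk>A \<in> Obj V; x \<in> carrier A\<rbrakk> \<Longrightarrow> (\<Oplus>\<^bsub>A\<^esub>s \<in> bas A. cf A s x \<odot>\<^bsub>A\<^esub> s) = x"
  using dbasisD(4)[OF bas(2)] by simp

text \<open>The dual basis expansion of \<open>x\<close> gives \<open>\<phi> x\<close> as the sum of
  the products \<open>cf A s x \<otimes> \<phi> s\<close>. This is why the coding of functionals by
  their values on \<open>bas A\<close> is injective.\<close>

lemma functional_eq:
  assumes A: "A \<in> Obj V" and \<phi>: "lin R A (reg R) \<phi>" and \<psi>: "lin R A (reg R) \<psi>"
    and eq: "\<And>s. s \<in> bas A \<Longrightarrow> \<phi> s = \<psi> s" and x: "x \<in> carrier A"
  shows "\<phi> x = \<psi> x"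
proof -
  have m: "module R A" using A by simp
  interpret A: module R A by (rule m)
  interpret G: module R "reg R" by simp
  have "\<chi> x = (\<Oplus>\<^bsub>reg R\<^esub>s \<in> bas A. cf A s x \<otimes> \<chi> s)" if \<chi>: "lin R A (reg R) \<chi>" for \<chi>
  proof -
    have "\<chi> x = \<chi> (\<Oplus>\<^bsub>A\<^esub>s \<in> bas A. cf A s x \<odot>\<^bsub>A\<^esub> s)" using bas_sum[OF A x] by simp
    also have "\<dots> = (\<Oplus>\<^bsub>reg R\<^esub>s \<in> bas A. \<chi> (cf A s x \<odot>\<^bsub>A\<^esub> s))"
      by (rule lin_finsum[OF m _ \<chi>]) (use A x in auto)
    also have "\<dots> = (\<Oplus>\<^bsub>reg R\<^esub>s \<in> bas A. cf A s x \<otimes> \<chi> s)"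
      by (rule G.finsum_cong') (use A x lin_smult[OF \<chi>] lin_closed[OF \<chi>] in auto)
    finally show ?thesis .
  qed
  note e = this
  have "(\<Oplus>\<^bsub>reg R\<^esub>s \<in> bas A. cf A s x \<otimes> \<phi> s) = (\<Oplus>\<^bsub>reg R\<^esub>s \<in> bas A. cf A s x \<otimes> \<psi> s)"
    by (rule G.finsum_cong') (use A x eq lin_closed[OF \<psi>] in auto)
  then show ?thesis using e[OF \<phi>] e[OF \<psi>] by simp
qed

lemma code_inj: "A \<in> Obj V \<Longrightarrow> inj_on (code A) (functionals A)"
proof (rule inj_onI)
  fix \<phi> \<psi> assume A: "A \<in> Obj V" and f: "\<phi> \<in> functionals A" "\<psi> \<in> functionals A" and e: "code A \<phi> = code A \<psi>"
  show "\<phi> = \<psi>"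
  proof (rule extensionalityI[of _ "carrier A"])
    show "\<phi> x = \<psi> x" if "x \<in> carrier A" for x
      by (rule functional_eq[OF A _ _ _ that])
        (use f enc_inj[OF bas_simps(1)[OF A]] e in \<open>auto simp: functionals_def code_def\<close>)
  qed (use f in \<open>auto simp: functionals_def\<close>)
qed

lemma functionals_module:
  assumes "A \<in> Obj V"
  shows "module R (fun_module R (carrier A) (functionals A))"
    "x \<in> carrier A \<Longrightarrow> lin R (fun_module R (carrier A) (functionals A)) (reg R) (\<lambda>f. f x)"
proof -
  have m: "module R A" using assms by simp
  interpret A: module R A by (rule m)
  have r: "lin R A (reg R) f \<Longrightarrow> restrict f (carrier A) \<in> functionals A" for f
    using lin_cong[OF m, of "reg R" f "restrict f (carrier A)"] by (simp add: functionals_def)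
  have 0: "lin R A (reg R) (\<lambda>x. \<zero>)" by (rule linI) simp_all
  have cl: "functionals A \<subseteq> carrier A \<rightarrow>\<^sub>E carrier R" by (auto simp: functionals_def lin_def PiE_def)
  have ad: "(\<lambda>x \<in> carrier A. f x \<oplus> g x) \<in> functionals A" if "f \<in> functionals A" "g \<in> functionals A" for f g
    using r[OF lin_add_map[OF m reg_mod, of f g]] that by (simp add: functionals_def)
  have sm: "(\<lambda>x \<in> carrier A. c \<otimes> f x) \<in> functionals A" if "c \<in> carrier R" "f \<in> functionals A" for f c
    using r[OF lin_smult_map[OF m reg_mod, of f c]] that by (simp add: functionals_def)
  note F = fun_module[OF is_cring cl r[OF 0] ad sm]
  show "module R (fun_module R (carrier A) (functionals A))" by (rule F(1))
  show "x \<in> carrier A \<Longrightarrow> lin R (fun_module R (carrier A) (functionals A)) (reg R) (\<lambda>f. f x)" by (rule F(2))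
qed

lemma dual_carrier: "carrier (dual A) = code A ` functionals A"
  by (simp add: dual_def coded_module_def fun_module_def)

lemma code_restrict: "A \<in> Obj V \<Longrightarrow> code A (restrict \<phi> (carrier A)) = code A \<phi>"
  unfolding code_def by (rule enc_cong) simp

lemma functionals_restrict: "\<lbrakk>A \<in> Obj V; lin R A (reg R) \<phi>\<rbrakk> \<Longrightarrow> restrict \<phi> (carrier A) \<in> functionals A"
  using lin_cong[of R A "reg R" \<phi> "restrict \<phi> (carrier A)"] by (simp add: functionals_def)

lemma ev_code [simp]:
  assumes "A \<in> Obj V" "lin R A (reg R) \<phi>"
  shows "code A \<phi> \<in> carrier (dual A)" "x \<in> carrier A \<Longrightarrow> ev A (code A \<phi>) x = \<phi> x"
proof -
  note f = functionals_restrict[OF assms]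
  show "code A \<phi> \<in> carrier (dual A)"
    unfolding dual_carrier code_restrict[OF assms(1), of \<phi>, symmetric] using f by blast
  have "ev A (code A \<phi>) = restrict \<phi> (carrier A)"
    unfolding ev_def code_restrict[OF assms(1), of \<phi>, symmetric] by (rule inv_into_f_f[OF code_inj[OF assms(1)] f])
  then show "x \<in> carrier A \<Longrightarrow> ev A (code A \<phi>) x = \<phi> x" by simp
qed

lemma ev_lin:
  assumes A: "A \<in> Obj V"
  shows "u \<in> carrier (dual A) \<Longrightarrow> lin R A (reg R) (ev A u)"
    "x \<in> carrier A \<Longrightarrow> lin R (dual A) (reg R) (\<lambda>u. ev A u x)"
proof -
  have c: "carrier (fun_module R (carrier A) (functionals A)) = functionals A" by (simp add: fun_module_def)
  show "lin R A (reg R) (ev A u)" if "u \<in> carrier (dual A)"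
    using inv_into_into[of u "code A" "functionals A"] that by (simp add: dual_carrier ev_def functionals_def)
  have "lin R (dual A) (fun_module R (carrier A) (functionals A)) (ev A)"
    unfolding dual_def ev_def using coded_module(3)[OF functionals_module(1)[OF A], of "code A"] code_inj[OF A] by (simp add: c)
  from lin_comp[OF this functionals_module(2)[OF A]]
  show "lin R (dual A) (reg R) (\<lambda>u. ev A u x)" if "x \<in> carrier A" using that .
qed

lemma ev_closed [simp]: "\<lbrakk>A \<in> Obj V; u \<in> carrier (dual A); x \<in> carrier A\<rbrakk> \<Longrightarrow> ev A u x \<in> carrier R"
  using lin_closed[OF ev_lin(1)] by fastforce

lemma code_ev: "\<lbrakk>A \<in> Obj V; u \<in> carrier (dual A)\<rbrakk> \<Longrightarrow> code A (ev A u) = u"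
  using f_inv_into_f[of u "code A" "functionals A"] by (simp add: ev_def dual_carrier)

lemma dual_eqI:
  assumes "A \<in> Obj V" "u \<in> carrier (dual A)" "v \<in> carrier (dual A)" "spans A S" "\<And>x. x \<in> S \<Longrightarrow> ev A u x = ev A v x"
  shows "u = v"
proof -
  have "ev A u x = ev A v x" if "x \<in> carrier A" for x
    by (rule spans_lin_eq[OF assms(4) ev_lin(1)[OF assms(1,2)] ev_lin(1)[OF assms(1,3)] assms(5) that])
  then have "code A (ev A u) = code A (ev A v)" unfolding code_def by (intro enc_cong) (use assms(1) in simp)
  then show ?thesis using code_ev assms by simp
qed

lemma dual_module: "A \<in> Obj V \<Longrightarrow> module R (dual A)"
  unfolding dual_def by (rule coded_module(1)[OF functionals_module(1)]) (simp_all add: fun_module_def code_inj)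

text \<open>A functional is the combination of the coordinate functionals with its own values on the
  generators as coefficients: the dual basis of \<open>A\<close> with its two families interchanged.
  It shows that duals are again objects of \<open>V\<close>.\<close>

lemma dual_dbasis:
  assumes A: "A \<in> Obj V"
  shows "dbasis R (dual A) (bas A) (\<lambda>s. code A (cf A s)) (\<lambda>s u. ev A u s)"
proof (rule dbasisI)
  interpret A: module R A using A by simp
  interpret D: module R "dual A" by (rule dual_module[OF A])
  interpret G: module R "reg R" by simp
  fix u assume u: "u \<in> carrier (dual A)"
  have f: "(\<lambda>s. ev A u s \<odot>\<^bsub>dual A\<^esub> code A (cf A s)) \<in> bas A \<rightarrow> carrier (dual A)" using A u by auto
  show "(\<Oplus>\<^bsub>dual A\<^esub>s \<in> bas A. ev A u s \<odot>\<^bsub>dual A\<^esub> code A (cf A s)) = u"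
  proof (rule dual_eqI[OF A D.finsum_closed[OF f] u spans_carrier])
    fix x assume x: "x \<in> carrier A"
    have "ev A (\<Oplus>\<^bsub>dual A\<^esub>s \<in> bas A. ev A u s \<odot>\<^bsub>dual A\<^esub> code A (cf A s)) x
        = (\<Oplus>\<^bsub>reg R\<^esub>s \<in> bas A. ev A (ev A u s \<odot>\<^bsub>dual A\<^esub> code A (cf A s)) x)"
      by (rule lin_finsum[OF dual_module[OF A] _ ev_lin(2)[OF A x] _ f]) (use A in simp_all)
    also have "\<dots> = (\<Oplus>\<^bsub>reg R\<^esub>s \<in> bas A. ev A u (cf A s x \<odot>\<^bsub>A\<^esub> s))"
      by (rule G.finsum_cong')
        (use A u x lin_smult[OF ev_lin(2)[OF A x]] lin_smult[OF ev_lin(1)[OF A u]] in \<open>auto simp: m_comm\<close>)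
    also have "\<dots> = ev A u (\<Oplus>\<^bsub>A\<^esub>s \<in> bas A. cf A s x \<odot>\<^bsub>A\<^esub> s)"
      by (rule lin_finsum[OF _ _ ev_lin(1)[OF A u], symmetric]) (use A x in auto)
    finally show "ev A (\<Oplus>\<^bsub>dual A\<^esub>s \<in> bas A. ev A u s \<odot>\<^bsub>dual A\<^esub> code A (cf A s)) x = ev A u x"
      by (simp add: bas_sum[OF A x])
  qed
qed (use A ev_lin(2)[OF A] in simp_all)

lemma dual_Obj [simp]: "A \<in> Obj V \<Longrightarrow> dual A \<in> Obj V"
  using fgpI[OF dual_module dual_dbasis] by (simp add: V_Obj)

text \<open>A bilinear form is the same as a linear map into the dual of its second argument.
  Transposes, \<open>kappa\<close>, \<open>nu\<close> and the map to the double dual are typed with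
  this.\<close>

lemma lin_code_map:
  assumes A: "A \<in> Obj V" and M: "module R M" and b: "bilin R M A (reg R) b"
  shows "lin R M (dual A) (\<lambda>m. code A (b m))"
proof (rule linI)
  interpret M: module R M by (rule M)
  interpret D: module R "dual A" by (rule dual_module[OF A])
  note b1 = bilinD(1)[OF b] and b2 = bilinD(2)[OF b]
  show "code A (b m) \<in> carrier (dual A)" if "m \<in> carrier M" for m using A b2[OF that] by simp
  show "code A (b (m \<oplus>\<^bsub>M\<^esub> n)) = code A (b m) \<oplus>\<^bsub>dual A\<^esub> code A (b n)" if "m \<in> carrier M" "n \<in> carrier M" for m n
    by (rule dual_eqI[OF A _ _ spans_carrier])
      (use A that b2 lin_add[OF b1] lin_add[OF ev_lin(2)[OF A]] in simp_all)
  show "code A (b (r \<odot>\<^bsub>M\<^esub> m)) = r \<odot>\<^bsub>dual A\<^esub> code A (b m)" if "r \<in> carrier R" "m \<in> carrier M" for r m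
    by (rule dual_eqI[OF A _ _ spans_carrier])
      (use A that b2 lin_smult[OF b1] lin_smult[OF ev_lin(2)[OF A]] in simp_all)
qed

text \<open>A point is recovered from its coordinates, and these are values of the functionals
  \<open>cf A s\<close>.\<close>

lemma separated:
  assumes A: "A \<in> Obj V" and x: "x \<in> carrier A" and y: "y \<in> carrier A"
    and eq: "\<And>u. u \<in> carrier (dual A) \<Longrightarrow> ev A u x = ev A u y"
  shows "x = y"
proof -
  interpret A: module R A using A by simp
  have "cf A s x = cf A s y" if "s \<in> bas A" for s using eq[of "code A (cf A s)"] A x y that by simp
  then have "(\<Oplus>\<^bsub>A\<^esub>s \<in> bas A. cf A s x \<odot>\<^bsub>A\<^esub> s) = (\<Oplus>\<^bsub>A\<^esub>s \<in> bas A. cf A s y \<odot>\<^bsub>A\<^esub> s)"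
    by (intro A.finsum_cong') (use A y in auto)
  then show ?thesis by (simp add: bas_sum A x y)
qed

section \<open>Transposition as a full and faithful contravariant functor\<close>

definition mk :: "('r, 'u) module \<Rightarrow> ('r, 'u) module \<Rightarrow> ('u \<Rightarrow> 'u) \<Rightarrow> ('r, 'u) mod_arrow" where
  "mk A B h = \<lparr>mdom = A, mcod = B, mfun = restrict h (carrier A)\<rparr>"

lemma mk_sel [simp]: "mdom (mk A B h) = A" "mcod (mk A B h) = B" "x \<in> carrier A \<Longrightarrow> mfun (mk A B h) x = h x"
  by (simp_all add: mk_def)

lemma arr_mk: "\<lbrakk>A \<in> Obj V; B \<in> Obj V; lin R A B h\<rbrakk> \<Longrightarrow> arr (mk A B h)"
  using lin_cong[of R A B h "restrict h (carrier A)"] unfolding arr_def mk_def by (simp add: mod_homs_iff)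

definition D1 :: "('r, 'u) mod_arrow \<Rightarrow> ('r, 'u) mod_arrow" where
  "D1 f = mk (dual (mcod f)) (dual (mdom f)) (\<lambda>u. code (mdom f) (\<lambda>x. ev (mcod f) u (mfun f x)))"

lemma D1_sel [simp]: "mdom (D1 f) = dual (mcod f)" "mcod (D1 f) = dual (mdom f)"
  by (simp_all add: D1_def)

lemma D1 [simp]:
  assumes f: "arr f"
  shows "arr (D1 f)" "\<lbrakk>A = mdom f; x \<in> carrier A; u \<in> carrier (dual (mcod f))\<rbrakk> \<Longrightarrow>
      ev A (mfun (D1 f) u) x = ev (mcod f) u (mfun f x)"
proof -
  have o: "mdom f \<in> Obj V" "mcod f \<in> Obj V" using f by simp_all
  have b: "bilin R (dual (mcod f)) (mdom f) (reg R) (\<lambda>u x. ev (mcod f) u (mfun f x))"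
    by (rule bilinI) (use lin_comp[OF arr_lin[OF f] ev_lin(1)[OF o(2)]] ev_lin(2)[OF o(2)] f in auto)
  show "arr (D1 f)" unfolding D1_def by (rule arr_mk) (use o lin_code_map[OF o(1) _ b] in \<open>simp_all add: dual_module\<close>)
  show "\<lbrakk>A = mdom f; x \<in> carrier A; u \<in> carrier (dual (mcod f))\<rbrakk> \<Longrightarrow> ev A (mfun (D1 f) u) x = ev (mcod f) u (mfun f x)"
    using o bilinD(2)[OF b] by (simp add: D1_def)
qed

lemma D1_inj:
  assumes f: "arr f" "arr g" "mdom f = mdom g" "mcod f = mcod g" and e: "D1 f = D1 g"
  shows "f = g"
proof (rule arr_eq1[OF f(1,2) refl f(3)[symmetric] f(4)])
  fix x assume x: "x \<in> carrier (mdom f)"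
  show "mfun f x = mfun g x"
  proof (rule separated[of "mcod f"])
    fix u assume u: "u \<in> carrier (dual (mcod f))"
    have "ev (mdom f) (mfun (D1 f) u) x = ev (mdom f) (mfun (D1 g) u) x" using e by simp
    then show "ev (mcod f) u (mfun f x) = ev (mcod f) u (mfun g x)" using f x u by simp
  qed (use f x in simp_all)
qed (use f in simp)

text \<open>If \<open>h\<close> is to be the transpose of \<open>f\<close>, a coordinate of
  \<open>f x\<close> must be the value at \<open>x\<close> of \<open>h\<close> applied to the
  coordinate functional. This dictates \<open>f\<close>; expanding \<open>u\<close> in the dual
  basis of \<open>dual B\<close> shows that its transpose is \<open>h\<close>.\<close>

lemma D1_surj:
  assumes A: "A \<in> Obj V" and B: "B \<in> Obj V" and h: "arr h" "mdom h = dual B" "mcod h = dual A"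
  shows "\<exists>f. arr f \<and> mdom f = A \<and> mcod f = B \<and> D1 f = h"
proof -
  interpret A: module R A using A by simp
  interpret B: module R B using B by simp
  interpret G: module R "reg R" by simp
  have hl: "lin R (dual B) (dual A) (mfun h)" using arr_lin[OF h(1)] h by simp
  let ?c = "\<lambda>s. code B (cf B s)"
  have hc: "mfun h u \<in> carrier (dual A)" if "u \<in> carrier (dual B)" for u using h that by simp
  define f where "f = mk A B (\<lambda>x. \<Oplus>\<^bsub>B\<^esub>s \<in> bas B. ev A (mfun h (?c s)) x \<odot>\<^bsub>B\<^esub> s)"
  have f: "arr f" unfolding f_def
    by (intro arr_mk A B lin_finsum_map lin_scale ev_lin hc) (use A B in simp_all)
  have [simp]: "mdom f = A" "mcod f = B" by (simp_all add: f_def)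
  have "D1 f = h"
  proof (rule arr_eq1[of _ _ "dual B"])
    fix u assume u: "u \<in> carrier (dual B)"
    show "mfun (D1 f) u = mfun h u"
    proof (rule dual_eqI[OF A _ _ spans_carrier])
      fix x assume x: "x \<in> carrier A"
      interpret DB: module R "dual B" by (rule dual_module[OF B])
      have "ev A (mfun (D1 f) u) x = ev B u (\<Oplus>\<^bsub>B\<^esub>s \<in> bas B. ev A (mfun h (?c s)) x \<odot>\<^bsub>B\<^esub> s)"
        using f x u by (simp add: f_def)
      also have "\<dots> = (\<Oplus>\<^bsub>reg R\<^esub>s \<in> bas B. ev B u (ev A (mfun h (?c s)) x \<odot>\<^bsub>B\<^esub> s))"
        by (rule lin_finsum[OF _ _ ev_lin(1)[OF B u]]) (use A B x h in auto)
      also have "\<dots> = (\<Oplus>\<^bsub>reg R\<^esub>s \<in> bas B. ev A (mfun h (ev B u s \<odot>\<^bsub>dual B\<^esub> ?c s)) x)"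
        by (rule G.finsum_cong')
          (use A B x u h lin_smult[OF ev_lin(1)[OF B u]] lin_smult[OF hl] lin_smult[OF ev_lin(2)[OF A x]] in \<open>auto simp: m_comm\<close>)
      also have "\<dots> = ev A (mfun h (\<Oplus>\<^bsub>dual B\<^esub>s \<in> bas B. ev B u s \<odot>\<^bsub>dual B\<^esub> ?c s)) x"
        by (rule lin_finsum[OF _ _ lin_comp[OF hl ev_lin(2)[OF A x]], symmetric]) (use A B u in auto)
      also have "\<dots> = ev A (mfun h u) x" using dbasisD(4)[OF dual_dbasis[OF B] u] by simp
      finally show "ev A (mfun (D1 f) u) x = ev A (mfun h u) x" .
    qed (use f h u in simp_all)
  qed (use f h B in simp_all)
  then show ?thesis using f by auto
qed

section \<open>Compatibility of duals with tensor products and the unit object\<close>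

lemma tensor_functional:
  assumes A: "A \<in> Obj V" and B: "B \<in> Obj V" and u: "lin R A (reg R) u" and v: "lin R B (reg R) v"
  shows "lin R (T A B) (reg R) (lift A B (reg R) (\<lambda>a b. u a \<otimes> v b))"
    "\<lbrakk>a \<in> carrier A; b \<in> carrier B\<rbrakk> \<Longrightarrow> lift A B (reg R) (\<lambda>a b. u a \<otimes> v b) (tn A B a b) = u a \<otimes> v b"
  using lift[OF _ _ reg_mod mult_bilin[OF _ _ u v]] A B by simp_all

text \<open>An arrow in \<open>V\<close> from \<open>dual B \<boxtimes> dual A\<close> to \<open>dual (A \<boxtimes> B)\<close>, hence from \<open>dual (A \<boxtimes> B)\<close> to
  \<open>dual A \<boxtimes> dual B\<close> in \<open>oprev V\<close>.\<close>

definition nu :: "('r, 'u) module \<Rightarrow> ('r, 'u) module \<Rightarrow> ('r, 'u) mod_arrow" where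
  "nu A B = mk (T (dual B) (dual A)) (dual (T A B))
     (lift (dual B) (dual A) (dual (T A B)) (\<lambda>v u. code (T A B) (lift A B (reg R) (\<lambda>a b. ev A u a \<otimes> ev B v b))))"

text \<open>The inverse of \<open>nu\<close>: a functional on the tensor product is expanded in
  tensors of coordinate functionals, and its values on tensors of generators are the
  coefficients.\<close>

definition mu :: "('r, 'u) module \<Rightarrow> ('r, 'u) module \<Rightarrow> ('r, 'u) mod_arrow" where
  "mu A B = mk (dual (T A B)) (T (dual B) (dual A))
     (\<lambda>w. \<Oplus>\<^bsub>T (dual B) (dual A)\<^esub>p \<in> bas A \<times> bas B. ev (T A B) w (tn A B (fst p) (snd p))
        \<odot>\<^bsub>T (dual B) (dual A)\<^esub> tn (dual B) (dual A) (code B (cf B (snd p))) (code A (cf A (fst p))))"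

lemma nu_sel [simp]: "mdom (nu A B) = T (dual B) (dual A)" "mcod (nu A B) = dual (T A B)"
  "mdom (mu A B) = dual (T A B)" "mcod (mu A B) = T (dual B) (dual A)"
  by (simp_all add: nu_def mu_def)

lemma mfun_mu: "w \<in> carrier (dual (T A B)) \<Longrightarrow> mfun (mu A B) w
    = (\<Oplus>\<^bsub>T (dual B) (dual A)\<^esub>p \<in> bas A \<times> bas B. ev (T A B) w (tn A B (fst p) (snd p))
        \<odot>\<^bsub>T (dual B) (dual A)\<^esub> tn (dual B) (dual A) (code B (cf B (snd p))) (code A (cf A (fst p))))"
  by (simp add: mu_def)

lemma nu [simp]:
  assumes A: "A \<in> Obj V" and B: "B \<in> Obj V"
  shows "arr (nu A B)"
    "\<lbrakk>u \<in> carrier (dual A); v \<in> carrier (dual B); a \<in> carrier A; b \<in> carrier B\<rbrakk> \<Longrightarrow>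
      ev (T A B) (mfun (nu A B) (tn (dual B) (dual A) v u)) (tn A B a b) = ev A u a \<otimes> ev B v b"
proof -
  let ?t = "\<lambda>u v. lift A B (reg R) (\<lambda>a b. ev A u a \<otimes> ev B v b)"
  have m: "module R A" "module R B" "module R (dual A)" "module R (dual B)" and o: "T A B \<in> Obj V"
    using A B by simp_all
  have s: "lin R (dual A) (reg R) (\<lambda>u. ev A u a \<otimes> r)" "lin R (dual B) (reg R) (\<lambda>v. r \<otimes> ev B v b)"
    if "r \<in> carrier R" "a \<in> carrier A" "b \<in> carrier B" for a b r
    using lin_smult_map[OF m(3) reg_mod ev_lin(2)[OF A that(2)] that(1)] A B that
      lin_smult_map[OF m(4) reg_mod ev_lin(2)[OF B that(3)] that(1)]
    by (auto intro: lin_cong[OF m(3)] simp: m_comm)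
  \<comment> \<open>For a fixed second functional, the product form extended to \<open>T A B\<close>
    stays linear in the first one; this and \<open>bt'\<close> make the pairing of functionals
    bilinear into the dual.\<close>
  have bt: "bilin R (dual A) (T A B) (reg R) (\<lambda>u z. ?t u v z)" if v: "v \<in> carrier (dual B)" for v
    by (rule trilin_lift_right[OF m(1,2,3) reg_mod mult_bilin[OF m(1,2) ev_lin(1)[OF A] ev_lin(1)[OF B v]] s(1)])
      (use B v in simp_all)
  have bt': "bilin R (dual B) (T A B) (reg R) (\<lambda>v z. ?t u v z)" if u: "u \<in> carrier (dual A)" for u
    by (rule trilin_lift_right[OF m(1,2,4) reg_mod mult_bilin[OF m(1,2) ev_lin(1)[OF A u] ev_lin(1)[OF B]] s(2)])
      (use A u in simp_all)
  have b: "bilin R (dual B) (dual A) (dual (T A B)) (\<lambda>v u. code (T A B) (?t u v))"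
    by (rule bilinI) (use lin_code_map[OF o m(4) bt'] lin_code_map[OF o m(3) bt] in auto)
  note L = lift[OF m(4,3) dual_module[OF o] b]
  show "arr (nu A B)" unfolding nu_def by (rule arr_mk) (use A B L(1) in simp_all)
  show "ev (T A B) (mfun (nu A B) (tn (dual B) (dual A) v u)) (tn A B a b) = ev A u a \<otimes> ev B v b"
    if "u \<in> carrier (dual A)" "v \<in> carrier (dual B)" "a \<in> carrier A" "b \<in> carrier B"
    using that A B L(2)[OF that(2,1)] tensor_functional[OF A B ev_lin(1)[OF A that(1)] ev_lin(1)[OF B that(2)]]
    by (simp add: nu_def)
qed

lemma mu_arr [simp]:
  assumes A: "A \<in> Obj V" and B: "B \<in> Obj V"
  shows "arr (mu A B)"
  unfolding mu_def
  by (intro arr_mk lin_finsum_map lin_scale ev_lin) (use A B in auto)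

text \<open>Either composite becomes a double sum over the two bases, which
  \<open>bilin_finsum\<close> factors into the dual basis expansions of two arguments. On
  \<open>dual (T A B)\<close> it is enough to evaluate at pure tensors.\<close>

lemma nu_mu_inverse:
  assumes A: "A \<in> Obj V" and B: "B \<in> Obj V"
  shows "mu A B \<cdot>\<^bsub>V\<^esub> nu A B = Idn V (T (dual B) (dual A))" "nu A B \<cdot>\<^bsub>V\<^esub> mu A B = Idn V (dual (T A B))"
proof -
  let ?X = "T (dual B) (dual A)" and ?I = "bas A \<times> bas B"
  have m: "module R A" "module R B" "module R (dual A)" "module R (dual B)" and o: "T A B \<in> Obj V" "?X \<in> Obj V"
    using A B by simp_all
  then have mX: "module R ?X" by simp
  interpret X: module R ?X by (rule mX)
  interpret G: module R "reg R" by simp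
  interpret A: module R A by (rule m)
  interpret B: module R B by (rule m)
  interpret DA: module R "dual A" by (rule m)
  interpret DB: module R "dual B" by (rule m)
  interpret AB: module R "T A B" using o by simp
  let ?c = "\<lambda>p. tn (dual B) (dual A) (code B (cf B (snd p))) (code A (cf A (fst p)))"
  show "mu A B \<cdot>\<^bsub>V\<^esub> nu A B = Idn V ?X"
  proof (rule arr_eq2[of _ _ "dual B" "dual A"])
    fix v u assume v: "v \<in> carrier (dual B)" and u: "u \<in> carrier (dual A)"
    have "mfun (mu A B \<cdot>\<^bsub>V\<^esub> nu A B) (tn (dual B) (dual A) v u)
      = (\<Oplus>\<^bsub>?X\<^esub>p \<in> ?I. ev (T A B) (mfun (nu A B) (tn (dual B) (dual A) v u)) (tn A B (fst p) (snd p)) \<odot>\<^bsub>?X\<^esub> ?c p)"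
      using A B u v by (simp add: mfun_mu)
    also have "\<dots> = (\<Oplus>\<^bsub>?X\<^esub>p \<in> ?I. tn (dual B) (dual A) (ev B v (snd p) \<odot>\<^bsub>dual B\<^esub> code B (cf B (snd p)))
        (ev A u (fst p) \<odot>\<^bsub>dual A\<^esub> code A (cf A (fst p))))"
      by (rule X.finsum_cong') (use A B u v in \<open>auto simp: tn_smult X.smult_assoc1\<close>)
    also have "\<dots> = tn (dual B) (dual A) (\<Oplus>\<^bsub>dual B\<^esub>s \<in> bas B. ev B v s \<odot>\<^bsub>dual B\<^esub> code B (cf B s))
        (\<Oplus>\<^bsub>dual A\<^esub>s \<in> bas A. ev A u s \<odot>\<^bsub>dual A\<^esub> code A (cf A s))"
      by (rule bilin_finsum[OF m(3,4) mX, of "\<lambda>u v. tn (dual B) (dual A) v u", symmetric])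
        (use tn_bilin[OF m(4,3)] A B u v in \<open>auto simp: bilin_def\<close>)
    also have "\<dots> = tn (dual B) (dual A) v u"
      using dbasisD(4)[OF dual_dbasis[OF A] u] dbasisD(4)[OF dual_dbasis[OF B] v] by simp
    finally show "mfun (mu A B \<cdot>\<^bsub>V\<^esub> nu A B) (tn (dual B) (dual A) v u) = mfun (Idn V ?X) (tn (dual B) (dual A) v u)"
      using A B u v by simp
  qed (use A B in simp_all)
  show "nu A B \<cdot>\<^bsub>V\<^esub> mu A B = Idn V (dual (T A B))"
  proof (rule arr_eq1[of _ _ "dual (T A B)"])
    fix w assume w: "w \<in> carrier (dual (T A B))"
    have "mfun (nu A B \<cdot>\<^bsub>V\<^esub> mu A B) w = w"
    proof (rule dual_eqI[OF o(1) _ w spans_T[OF m(1,2) spans_carrier spans_carrier]])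
      show "mfun (nu A B \<cdot>\<^bsub>V\<^esub> mu A B) w \<in> carrier (dual (T A B))" using A B w by simp
      fix z assume "z \<in> {tn A B a b |a b. a \<in> carrier A \<and> b \<in> carrier B}"
      then obtain a b where z: "z = tn A B a b" and ab: "a \<in> carrier A" "b \<in> carrier B" by blast
      have zc: "z \<in> carrier (T A B)" using z ab A B by simp
      have nl: "lin R ?X (reg R) (\<lambda>t. ev (T A B) (mfun (nu A B) t) z)"
        using lin_comp[OF arr_lin[OF nu(1)[OF A B]]] ev_lin(2)[OF o(1) zc] by simp
      have "ev (T A B) (mfun (nu A B \<cdot>\<^bsub>V\<^esub> mu A B) w) z
        = ev (T A B) (mfun (nu A B) (\<Oplus>\<^bsub>?X\<^esub>p \<in> ?I. ev (T A B) w (tn A B (fst p) (snd p)) \<odot>\<^bsub>?X\<^esub> ?c p)) z"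
        using A B w by (simp add: mfun_mu)
      also have "\<dots> = (\<Oplus>\<^bsub>reg R\<^esub>p \<in> ?I. ev (T A B) (mfun (nu A B) (ev (T A B) w (tn A B (fst p) (snd p)) \<odot>\<^bsub>?X\<^esub> ?c p)) z)"
        by (rule lin_finsum[OF mX reg_mod nl]) (use A B w in auto)
      \<comment> \<open>\<open>nu\<close> is evaluated on the tensors of coordinate functionals, and
        the resulting coordinates of \<open>a\<close> and \<open>b\<close> are moved into the
        argument of \<open>w\<close>.\<close>
      also have "\<dots> = (\<Oplus>\<^bsub>reg R\<^esub>p \<in> ?I. ev (T A B) w (tn A B (cf A (fst p) a \<odot>\<^bsub>A\<^esub> fst p) (cf B (snd p) b \<odot>\<^bsub>B\<^esub> snd p)))"
        by (rule G.finsum_cong')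
          (use A B w ab lin_smult[OF nl] lin_smult[OF ev_lin(1)[OF o(1) w]] in \<open>auto simp: z tn_smult m_ac\<close>)
      also have "\<dots> = ev (T A B) w (tn A B (\<Oplus>\<^bsub>A\<^esub>s \<in> bas A. cf A s a \<odot>\<^bsub>A\<^esub> s) (\<Oplus>\<^bsub>B\<^esub>s \<in> bas B. cf B s b \<odot>\<^bsub>B\<^esub> s))"
      proof (rule bilin_finsum[OF m(1,2) reg_mod, of "\<lambda>a b. ev (T A B) w (tn A B a b)", symmetric])
        show "bilin R A B (reg R) (\<lambda>a b. ev (T A B) w (tn A B a b))"
          by (rule bilinI) (rule lin_comp[OF bilinD(1)[OF tn_bilin[OF m(1,2)]] ev_lin(1)[OF o(1) w]], assumption,
            rule lin_comp[OF bilinD(2)[OF tn_bilin[OF m(1,2)]] ev_lin(1)[OF o(1) w]])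
      qed (use A B ab in auto)
      finally show "ev (T A B) (mfun (nu A B \<cdot>\<^bsub>V\<^esub> mu A B) w) z = ev (T A B) w z"
        by (simp add: bas_sum A B ab z)
    qed
    then show "mfun (nu A B \<cdot>\<^bsub>V\<^esub> mu A B) w = mfun (Idn V (dual (T A B))) w" using w by simp
  qed (use A B in simp_all)
qed

text \<open>\<open>kappa\<close> sends a scalar to the multiplication by it, and \<open>iota\<close>
  sends a functional to its value at one. As arrows of \<open>oprev V\<close> both point the other
  way, as required of \<open>\<kappa>\<close> and \<open>\<iota>\<close> in
  \<open>symfun\<close>.\<close>

definition kappa :: "('r, 'u) mod_arrow" where
  "kappa = mk K (dual K) (\<lambda>r. code K (\<lambda>x. inv_into UNIV sc r \<otimes> inv_into UNIV sc x))"

definition iota :: "('r, 'u) mod_arrow" where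
  "iota = mk (dual K) K (\<lambda>u. sc (ev K u (sc \<one>)))"

lemma kappa_iota [simp]:
  shows "mdom kappa = K" "mcod kappa = dual K" "mdom iota = dual K" "mcod iota = K" "arr kappa" "arr iota"
    "\<lbrakk>r \<in> carrier R; s \<in> carrier R\<rbrakk> \<Longrightarrow> ev K (mfun kappa (sc r)) (sc s) = r \<otimes> s"
    "u \<in> carrier (dual K) \<Longrightarrow> mfun iota u = sc (ev K u (sc \<one>))"
proof -
  have b: "bilin R K K (reg R) (\<lambda>r s. inv_into UNIV sc r \<otimes> inv_into UNIV sc s)"
    by (rule mult_bilin[OF K_module K_module unsc_lin unsc_lin])
  show "arr kappa" unfolding kappa_def
    by (rule arr_mk[OF _ _ lin_code_map[OF _ K_module b]]) simp_all
  have "lin R (dual K) K (\<lambda>u. sc (ev K u (sc \<one>)))" by (rule lin_comp[OF ev_lin(2) sc_lin]) simp_all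
  then show "arr iota" unfolding iota_def by (intro arr_mk) simp_all
  show "\<lbrakk>r \<in> carrier R; s \<in> carrier R\<rbrakk> \<Longrightarrow> ev K (mfun kappa (sc r)) (sc s) = r \<otimes> s"
    using bilinD(2)[OF b, of "sc r"] by (simp add: kappa_def sc_simps)
qed (simp_all add: kappa_def iota_def)

text \<open>Evaluation \<open>e\<close> goes from \<open>Z\<close> to its double dual in
  \<open>V\<close>, hence from \<open>dual (dual Z)\<close> to \<open>Z\<close> in
  \<open>oprev V\<close>. Its inverse \<open>g\<close> recombines the generators of \<open>Z\<close>
  with the values of \<open>w\<close> on the coordinate functionals.\<close>

lemma double_dual:
  assumes Z: "Z \<in> Obj V"
  shows "\<exists>e. iso_arrow (oprev V) (dual (dual Z)) Z e"
proof -
  have mZ: "module R Z" "module R (dual Z)" using Z by simp_all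
  interpret Z: module R Z by (rule mZ)
  interpret G: module R "reg R" by simp
  have b: "bilin R Z (dual Z) (reg R) (\<lambda>z u. ev Z u z)"
    by (rule bilinI) (use ev_lin[OF Z] in simp_all)
  define e where "e = mk Z (dual (dual Z)) (\<lambda>z. code (dual Z) (\<lambda>u. ev Z u z))"
  define g where "g = mk (dual (dual Z)) Z (\<lambda>w. \<Oplus>\<^bsub>Z\<^esub>s \<in> bas Z. ev (dual Z) w (code Z (cf Z s)) \<odot>\<^bsub>Z\<^esub> s)"
  have e: "arr e" unfolding e_def by (rule arr_mk) (use Z lin_code_map[OF _ mZ(1) b] in simp_all)
  have g: "arr g" unfolding g_def
    by (intro arr_mk lin_finsum_map lin_scale ev_lin(2)) (use Z in simp_all)
  have [simp]: "mdom e = Z" "mcod e = dual (dual Z)" "mdom g = dual (dual Z)" "mcod g = Z" by (simp_all add: e_def g_def)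
  have ev: "ev (dual Z) (mfun e z) u = ev Z u z" if "z \<in> carrier Z" "u \<in> carrier (dual Z)" for z u
    using that Z bilinD(2)[OF b that(1)] by (simp add: e_def)
  have gw: "mfun g w = (\<Oplus>\<^bsub>Z\<^esub>s \<in> bas Z. ev (dual Z) w (code Z (cf Z s)) \<odot>\<^bsub>Z\<^esub> s)" if "w \<in> carrier (dual (dual Z))" for w
    using that by (simp add: g_def)
  have 1: "g \<cdot>\<^bsub>V\<^esub> e = Idn V Z"
  proof (rule arr_eq1[of _ _ Z])
    fix z assume z: "z \<in> carrier Z"
    have "mfun (g \<cdot>\<^bsub>V\<^esub> e) z = (\<Oplus>\<^bsub>Z\<^esub>s \<in> bas Z. ev (dual Z) (mfun e z) (code Z (cf Z s)) \<odot>\<^bsub>Z\<^esub> s)"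
      using e g z by (simp add: gw)
    also have "\<dots> = (\<Oplus>\<^bsub>Z\<^esub>s \<in> bas Z. cf Z s z \<odot>\<^bsub>Z\<^esub> s)"
      by (rule Z.finsum_cong') (use Z z in \<open>auto simp: ev\<close>)
    finally show "mfun (g \<cdot>\<^bsub>V\<^esub> e) z = mfun (Idn V Z) z" using Z z by (simp add: bas_sum)
  qed (use Z e g in simp_all)
  have 2: "e \<cdot>\<^bsub>V\<^esub> g = Idn V (dual (dual Z))"
  proof (rule arr_eq1[of _ _ "dual (dual Z)"])
    fix w assume w: "w \<in> carrier (dual (dual Z))"
    have "mfun (e \<cdot>\<^bsub>V\<^esub> g) w = w"
    proof (rule dual_eqI[OF dual_Obj[OF Z] _ w spans_carrier])
      fix u assume u: "u \<in> carrier (dual Z)"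
      have "ev (dual Z) (mfun (e \<cdot>\<^bsub>V\<^esub> g) w) u = ev Z u (\<Oplus>\<^bsub>Z\<^esub>s \<in> bas Z. ev (dual Z) w (code Z (cf Z s)) \<odot>\<^bsub>Z\<^esub> s)"
        using e g w u ev[of "mfun g w" u] by (simp flip: gw)
      also have "\<dots> = (\<Oplus>\<^bsub>reg R\<^esub>s \<in> bas Z. ev Z u (ev (dual Z) w (code Z (cf Z s)) \<odot>\<^bsub>Z\<^esub> s))"
        by (rule lin_finsum[OF _ _ ev_lin(1)[OF Z u]]) (use Z w in auto)
      also have "\<dots> = (\<Oplus>\<^bsub>reg R\<^esub>s \<in> bas Z. ev (dual Z) w (ev Z u s \<odot>\<^bsub>dual Z\<^esub> code Z (cf Z s)))"
        by (rule G.finsum_cong') (use Z u w lin_smult[OF ev_lin(1)[OF Z u]] lin_smult[OF ev_lin(1)[OF dual_Obj[OF Z] w]] in \<open>auto simp: m_comm\<close>)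
      also have "\<dots> = ev (dual Z) w (\<Oplus>\<^bsub>dual Z\<^esub>s \<in> bas Z. ev Z u s \<odot>\<^bsub>dual Z\<^esub> code Z (cf Z s))"
      proof (rule lin_finsum[OF mZ(2) _ ev_lin(1)[OF dual_Obj[OF Z] w], symmetric])
        interpret DZ: module R "dual Z" by (rule mZ)
        show "(\<lambda>s. ev Z u s \<odot>\<^bsub>dual Z\<^esub> code Z (cf Z s)) \<in> bas Z \<rightarrow> carrier (dual Z)" using Z u by auto
      qed (use Z in simp_all)
      also have "\<dots> = ev (dual Z) w u" using dbasisD(4)[OF dual_dbasis[OF Z] u] by simp
      finally show "ev (dual Z) (mfun (e \<cdot>\<^bsub>V\<^esub> g) w) u = ev (dual Z) w u" .
    qed (use Z e g w in simp)
    then show "mfun (e \<cdot>\<^bsub>V\<^esub> g) w = mfun (Idn V (dual (dual Z))) w" using w by simp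
  qed (use Z e g in simp_all)
  have "iso_arrow (oprev V) (dual (dual Z)) Z e"
    unfolding iso_arrow_def oprev_sel using 1 2 e g Z by (intro conjI bexI[of _ g]) (simp_all add: V_Hom_iff)
  then show ?thesis ..
qed

text \<open>Essential surjectivity is the double dual isomorphism. The compatibility laws equate
  arrows into duals, so they are tested twice: on functionals or their pure tensors, and then by
  evaluating the resulting functionals on elements or pure tensors, where they become identities in
  the commutative ring.\<close>

lemma V_symfun: "symfun V mdom mcod (oprev V) mcod mdom dual D1 nu mu kappa iota"
proof -
  interpret O: oprev_symmon V mdom mcod by (rule V_oprev_symmon)
  note spansT = spans_T[OF V_Obj_module V_Obj_module spans_carrier spans_carrier]
  show ?thesis
  proof (rule symfun.intro[OF V_symmon O.O.symmon_axioms], rule symfun_axioms.intro, unfold oprev_sel V_sel)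
    fix A B assume o: "A \<in> Obj V" "B \<in> Obj V"
    show "bij_betw D1 (Hom V A B) (Hom V (dual B) (dual A))"
      unfolding bij_betw_def
    proof (intro conjI inj_onI equalityI subsetI)
      show "f = g" if "f \<in> Hom V A B" "g \<in> Hom V A B" "D1 f = D1 g" for f g
        by (rule D1_inj) (use that o in \<open>auto simp: V_Hom_iff\<close>)
      show "h \<in> Hom V (dual B) (dual A)" if "h \<in> D1 ` Hom V A B" for h
        using that o by (auto simp: V_Hom_iff)
      show "h \<in> D1 ` Hom V A B" if "h \<in> Hom V (dual B) (dual A)" for h
        using D1_surj[OF o, of h] that o by (auto simp: V_Hom_iff)
    qed
    show "mu A B \<cdot>\<^bsub>V\<^esub> nu A B = Idn V (T (dual B) (dual A))" "nu A B \<cdot>\<^bsub>V\<^esub> mu A B = Idn V (dual (T A B))"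
      by (rule nu_mu_inverse[OF o])+
  next
    fix A assume o: "A \<in> Obj V"
    show "D1 (Idn V A) = Idn V (dual A)"
    proof (rule arr_eq1[of _ _ "dual A"])
      fix u assume "u \<in> carrier (dual A)"
      then show "mfun (D1 (Idn V A)) u = mfun (Idn V (dual A)) u"
        by (intro dual_eqI[OF o _ _ spans_carrier]) (use o in simp_all)
    qed (use o in simp_all)
    show "(nu K A \<cdot>\<^bsub>V\<^esub> (Idn V (dual A) \<star>\<^bsub>V\<^esub> kappa)) \<cdot>\<^bsub>V\<^esub> RUnitInv V (dual A) = D1 (LUnit V A)"
    proof (rule arr_eq1[of _ _ "dual A"])
      fix u assume "u \<in> carrier (dual A)"
      then show "mfun ((nu K A \<cdot>\<^bsub>V\<^esub> (Idn V (dual A) \<star>\<^bsub>V\<^esub> kappa)) \<cdot>\<^bsub>V\<^esub> RUnitInv V (dual A)) u = mfun (D1 (LUnit V A)) u"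
        by (intro dual_eqI[OF _ _ _ spans_T[OF _ _ spans_K spans_carrier[of A]]])
          (use o lin_smult[OF ev_lin(1)[OF o]] in auto)
    qed (use o in simp_all)
    show "(nu A K \<cdot>\<^bsub>V\<^esub> (kappa \<star>\<^bsub>V\<^esub> Idn V (dual A))) \<cdot>\<^bsub>V\<^esub> LUnitInv V (dual A) = D1 (RUnit V A)"
    proof (rule arr_eq1[of _ _ "dual A"])
      fix u assume "u \<in> carrier (dual A)"
      then show "mfun ((nu A K \<cdot>\<^bsub>V\<^esub> (kappa \<star>\<^bsub>V\<^esub> Idn V (dual A))) \<cdot>\<^bsub>V\<^esub> LUnitInv V (dual A)) u = mfun (D1 (RUnit V A)) u"
        by (intro dual_eqI[OF _ _ _ spans_T[OF _ _ spans_carrier[of A] spans_K]])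
          (use o lin_smult[OF ev_lin(1)[OF o]] in \<open>auto simp: m_comm\<close>)
    qed (use o in simp_all)
  next
    fix A B C f g assume o: "A \<in> Obj V" "B \<in> Obj V" "C \<in> Obj V" "f \<in> Hom V A B" "g \<in> Hom V B C"
    then have fg: "arr f" "arr g" "mdom f = A" "mcod f = B" "mdom g = B" "mcod g = C" by (auto simp: V_Hom_iff)
    show "D1 (g \<cdot>\<^bsub>V\<^esub> f) = D1 f \<cdot>\<^bsub>V\<^esub> D1 g"
    proof (rule arr_eq1[of _ _ "dual C"])
      fix u assume "u \<in> carrier (dual C)"
      then show "mfun (D1 (g \<cdot>\<^bsub>V\<^esub> f)) u = mfun (D1 f \<cdot>\<^bsub>V\<^esub> D1 g) u"
        by (intro dual_eqI[OF o(1) _ _ spans_carrier]) (use o fg in simp_all)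
    qed (use o fg in simp_all)
  next
    fix A A' B B' f g
    assume "A \<in> Obj V" "A' \<in> Obj V" "B \<in> Obj V" "B' \<in> Obj V" "f \<in> Hom V A A'" "g \<in> Hom V B B'"
    then have o: "A \<in> Obj V" "A' \<in> Obj V" "B \<in> Obj V" "B' \<in> Obj V" "arr f" "arr g"
      "mdom f = A" "mcod f = A'" "mdom g = B" "mcod g = B'" by (auto simp: V_Hom_iff)
    show "D1 (f \<star>\<^bsub>V\<^esub> g) \<cdot>\<^bsub>V\<^esub> nu A' B' = nu A B \<cdot>\<^bsub>V\<^esub> (D1 g \<star>\<^bsub>V\<^esub> D1 f)"
    proof (rule arr_eq2[of _ _ "dual B'" "dual A'"])
      fix v u assume "v \<in> carrier (dual B')" "u \<in> carrier (dual A')"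
      then show "mfun (D1 (f \<star>\<^bsub>V\<^esub> g) \<cdot>\<^bsub>V\<^esub> nu A' B') (tn (dual B') (dual A') v u)
        = mfun (nu A B \<cdot>\<^bsub>V\<^esub> (D1 g \<star>\<^bsub>V\<^esub> D1 f)) (tn (dual B') (dual A') v u)"
        by (intro dual_eqI[OF _ _ _ spansT[of A B]]) (use o in auto)
    qed (use o in simp_all)
  next
    fix A B C assume o: "A \<in> Obj V" "B \<in> Obj V" "C \<in> Obj V"
    show "(nu (T A B) C \<cdot>\<^bsub>V\<^esub> (Idn V (dual C) \<star>\<^bsub>V\<^esub> nu A B)) \<cdot>\<^bsub>V\<^esub> Assoc V (dual C) (dual B) (dual A)
      = (D1 (Assoc V A B C) \<cdot>\<^bsub>V\<^esub> nu A (T B C)) \<cdot>\<^bsub>V\<^esub> (nu B C \<star>\<^bsub>V\<^esub> Idn V (dual A))"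
    proof (rule arr_eq3[of _ _ "dual C" "dual B" "dual A"])
      fix w v u assume "w \<in> carrier (dual C)" "v \<in> carrier (dual B)" "u \<in> carrier (dual A)"
      then show "mfun ((nu (T A B) C \<cdot>\<^bsub>V\<^esub> (Idn V (dual C) \<star>\<^bsub>V\<^esub> nu A B)) \<cdot>\<^bsub>V\<^esub> Assoc V (dual C) (dual B) (dual A))
          (tn (T (dual C) (dual B)) (dual A) (tn (dual C) (dual B) w v) u)
        = mfun ((D1 (Assoc V A B C) \<cdot>\<^bsub>V\<^esub> nu A (T B C)) \<cdot>\<^bsub>V\<^esub> (nu B C \<star>\<^bsub>V\<^esub> Idn V (dual A)))
          (tn (T (dual C) (dual B)) (dual A) (tn (dual C) (dual B) w v) u)"
        by (intro dual_eqI[OF _ _ _ spans_T[OF _ _ spansT[of A B] spans_carrier[of C]]]) (use o in \<open>auto simp: m_assoc\<close>)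
    qed (use o in simp_all)
  next
    fix A B C D assume o: "A \<in> Obj V" "B \<in> Obj V" "C \<in> Obj V" "D \<in> Obj V"
    show "(nu (T A B) (T C D) \<cdot>\<^bsub>V\<^esub> (nu C D \<star>\<^bsub>V\<^esub> nu A B)) \<cdot>\<^bsub>V\<^esub> mid4 (oprev V) (dual A) (dual B) (dual C) (dual D)
      = (D1 (mid4 V A B C D) \<cdot>\<^bsub>V\<^esub> nu (T A C) (T B D)) \<cdot>\<^bsub>V\<^esub> (nu B D \<star>\<^bsub>V\<^esub> nu A C)"
    proof (rule arr_eq4[of _ _ "dual D" "dual B" "dual C" "dual A"])
      fix z v w u assume "z \<in> carrier (dual D)" "v \<in> carrier (dual B)" "w \<in> carrier (dual C)" "u \<in> carrier (dual A)"
      then show "mfun ((nu (T A B) (T C D) \<cdot>\<^bsub>V\<^esub> (nu C D \<star>\<^bsub>V\<^esub> nu A B)) \<cdot>\<^bsub>V\<^esub> mid4 (oprev V) (dual A) (dual B) (dual C) (dual D))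
          (tn (T (dual D) (dual B)) (T (dual C) (dual A)) (tn (dual D) (dual B) z v) (tn (dual C) (dual A) w u))
        = mfun ((D1 (mid4 V A B C D) \<cdot>\<^bsub>V\<^esub> nu (T A C) (T B D)) \<cdot>\<^bsub>V\<^esub> (nu B D \<star>\<^bsub>V\<^esub> nu A C))
          (tn (T (dual D) (dual B)) (T (dual C) (dual A)) (tn (dual D) (dual B) z v) (tn (dual C) (dual A) w u))"
        by (intro dual_eqI[OF _ _ _ spans_T[OF _ _ spansT[of A B] spansT[of C D]]]) (use o in \<open>auto simp: O.mid4_oprev m_ac\<close>)
    qed (use o in \<open>simp_all add: O.mid4_oprev\<close>)
  next
    show "iota \<cdot>\<^bsub>V\<^esub> kappa = Idn V K"
      by (rule arr_eqI[OF _ _ _ _ _ spans_K]) auto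
    show "kappa \<cdot>\<^bsub>V\<^esub> iota = Idn V (dual K)"
    proof (rule arr_eq1[of _ _ "dual K"])
      fix u assume u: "u \<in> carrier (dual K)"
      have "mfun (kappa \<cdot>\<^bsub>V\<^esub> iota) u = u"
      proof (rule dual_eqI[OF V_Obj_K _ u spans_K])
        fix s assume "s \<in> sc ` carrier R"
        then obtain r where r: "s = sc r" "r \<in> carrier R" by blast
        have "ev K u (r \<odot>\<^bsub>K\<^esub> sc \<one>) = r \<otimes> ev K u (sc \<one>)"
          using lin_smult[OF ev_lin(1)[OF V_Obj_K u]] r by simp
        then show "ev K (mfun (kappa \<cdot>\<^bsub>V\<^esub> iota) u) s = ev K u s" using u r by (simp add: sc_simps(3) m_comm)
      qed (use u in simp)
      then show "mfun (kappa \<cdot>\<^bsub>V\<^esub> iota) u = mfun (Idn V (dual K)) u" using u by simp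
    qed simp_all
  next
    fix Z assume "Z \<in> Obj V"
    then show "\<exists>A \<in> Obj V. \<exists>e. iso_arrow (oprev V) (dual A) Z e" using double_dual[of Z] by (intro bexI[of _ "dual Z"]) simp_all
  qed (auto simp: V_Hom_iff)
qed

end

theorem theorem4p5:
  fixes R :: "('r, 'e) ring_scheme"
    and sc :: "'r \<Rightarrow> 'u"
    and fs :: "('u \<times> 'u) multiset \<Rightarrow> 'u"
  assumes commutative_ring: "cring R"
    and universe: "inj sc" "inj fs"
  shows "\<exists>F. biequivalence
           (W_Cat (coalgebras (fgp_modules R sc fs)) TYPE('x))
           (Dual_W_Cat (algebras (fgp_modules R sc fs)) TYPE('x)) F"
proof -
  interpret module_universe R sc fs
    by (rule module_universe.intro[OF commutative_ring]) (unfold_locales, rule universe(1), rule universe(2))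
  show ?thesis by (rule biequivalence_W_Cat_Dual_W_Cat[OF V_oprev_symmon V_symfun])
qed

end
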